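(* Let $\ell>0$ and let $u_0\in\dot H^1(\mathbb{R})\cap L^\infty(\mathbb{R})$. If there exists a Lipschitz function $\phi:\mathbb{R}\to\mathbb{R}$ such that $\phi'\in L^1(\mathbb{R})$ and $u_0-\phi\in H^1(\mathbb{R})$, then there exists a global conservative solution $u$ of the regularised Burgers equation $u_t+u\,u_x+\ell^2P_x=0$ with $u(0,\cdot)=u_0$, such that $u(t,\cdot)-\phi\in H^1(\mathbb{R})$ for all $t>0$. In addition, for all $T>0$, $$\lim_{t\uparrow T}\ \inf_{x\in\mathbb{R}}u_x(t,x)=-\infty\quad\Longrightarrow\quad\lim_{t\downarrow T}\ \sup_{x\in\mathbb{R}}u_x(t,x)=+\infty,$$ and if $u_0\in H^1(\mathbb{R})$, then for almost all $t>0$ $$\int_{\mathbb{R}}\left[u(t,x)^2+\ell^2u_x(t,x)^2\right]\mathrm{d}x=\int_{\mathbb{R}}\left[u_0(x)^2+\ell^2u_0'(x)^2\right]\mathrm{d}x.$$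
   Context: $\dot H^1(\mathbb{R})=\{f:\|f'\|_{L^2}<+\infty\}$. $P=\mathfrak{G}\ast\tfrac12u_x^2$ (convolution in $x$), with $\mathfrak{G}(x)=(2\ell)^{-1}\exp(-|x|/\ell)$. Definition. A function $u$ is called a (global) conservative solution of $u_t+uu_x+\ell^2P_x=0$ with initial datum $u_0$ if: (i) $u\in\mathrm{Lip}([0,T],L^2_{\rm loc}(\mathbb{R}))$ and $u_x\in L^\infty([0,T],L^2_{\rm loc}(\mathbb{R}))$ for all $T>0$; (ii) $u$ satisfies $u_t+uu_x+\ell^2P_x=0$ (in the weak sense), with $u(0,x)=u_0(x)$; (iii) $u$ satisfies, in the sense of distributions, $$\left[\tfrac12u^2+\tfrac12\ell^2u_x^2\right]_t+\left[\tfrac13u^3+\ell^2uP+\tfrac12\ell^2u\,u_x^2\right]_x=0.$$ Since $u_x(t,\cdot)$ is defined only almost everywhere, $\inf_x$ and $\sup_x$ of $u_x(t,\cdot)$ are essential infimum and supremum. *)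

theory Defs
  imports "HOL-Probability.Essential_Supremum"
begin

section \<open>Test functions and weak derivatives\<close>

primrec Ck :: "nat \<Rightarrow> ('a::euclidean_space \<Rightarrow> real) \<Rightarrow> bool" where
  "Ck 0 f \<longleftrightarrow> continuous_on UNIV f"
| "Ck (Suc n) f \<longleftrightarrow> (\<forall>x. f differentiable (at x)) \<and> (\<forall>v. Ck n (\<lambda>x. frechet_derivative f (at x) v))"

definition test_functions :: "'a::euclidean_space set \<Rightarrow> ('a \<Rightarrow> real) set" where
  "test_functions U =
     {\<psi>. (\<forall>n. Ck n \<psi>) \<and> compact (closure {x. \<psi> x \<noteq> 0}) \<and> closure {x. \<psi> x \<noteq> 0} \<subseteq> U}"

definition locally_integrable_on :: "('a::euclidean_space \<Rightarrow> real) \<Rightarrow> 'a set \<Rightarrow> bool"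
    (infix "locally'_integrable'_on" 50) where
  "f locally_integrable_on U \<longleftrightarrow> (\<forall>K. compact K \<and> K \<subseteq> U \<longrightarrow> f absolutely_integrable_on K)"

definition has_weak_deriv :: "(real \<Rightarrow> real) \<Rightarrow> (real \<Rightarrow> real) \<Rightarrow> bool" where
  "has_weak_deriv f g \<longleftrightarrow>
     f locally_integrable_on UNIV \<and> g locally_integrable_on UNIV \<and>
     (\<forall>\<psi>\<in>test_functions UNIV.
        (LINT x|lebesgue. f x * deriv \<psi> x) = - (LINT x|lebesgue. g x * \<psi> x))"

text \<open>A weak derivative is unique only almost everywhere, so \<open>weak_deriv f\<close> is an unspecified
  representative; it is used below only in integrals and essential bounds.\<close>

definition weak_deriv :: "(real \<Rightarrow> real) \<Rightarrow> real \<Rightarrow> real" where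
  "weak_deriv f = (SOME g. has_weak_deriv f g)"

section \<open>Function spaces on the real line\<close>

definition L2 :: "(real \<Rightarrow> real) set" where
  "L2 = {f. f \<in> borel_measurable lebesgue \<and> integrable lebesgue (\<lambda>x. (f x)\<^sup>2)}"

definition L2_loc :: "(real \<Rightarrow> real) set" where
  "L2_loc = {f. f \<in> borel_measurable lebesgue \<and> (\<lambda>x. (f x)\<^sup>2) locally_integrable_on UNIV}"

definition L2_norm_on :: "real set \<Rightarrow> (real \<Rightarrow> real) \<Rightarrow> real" where
  "L2_norm_on K f = sqrt (LINT x:K|lebesgue. (f x)\<^sup>2)"

definition Linf :: "(real \<Rightarrow> real) set" where
  "Linf = {f. f \<in> borel_measurable lebesgue \<and> esssup lebesgue (\<lambda>x. ereal \<bar>f x\<bar>) < \<infinity>}"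

definition H1_dot :: "(real \<Rightarrow> real) set" where
  "H1_dot = {f. (\<exists>g. has_weak_deriv f g) \<and> weak_deriv f \<in> L2}"

definition H1 :: "(real \<Rightarrow> real) set" where
  "H1 = L2 \<inter> H1_dot"

definition essinf :: "'a measure \<Rightarrow> ('a \<Rightarrow> ereal) \<Rightarrow> ereal" where
  "essinf M f = - esssup M (\<lambda>x. - f x)"

section \<open>Functions of time and space\<close>

text \<open>The argument order is \<open>u t x\<close>. Since \<open>L2_loc\<close> is a Frechet space with seminorms indexed by
  the compact sets, Lipschitz continuity and boundedness mean that each seminorm has its own
  constant.\<close>

definition Lip_L2_loc :: "real \<Rightarrow> (real \<Rightarrow> real \<Rightarrow> real) set" where
  "Lip_L2_loc T = {u. (\<forall>t\<in>{0..T}. u t \<in> L2_loc) \<and>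
     (\<forall>K. compact K \<longrightarrow> (\<exists>C. \<forall>s\<in>{0..T}. \<forall>t\<in>{0..T}.
        L2_norm_on K (\<lambda>x. u t x - u s x) \<le> C * \<bar>t - s\<bar>))}"

text \<open>Joint measurability on the strip expresses strong measurability of the map from \<open>t\<close> to
  \<open>v t\<close> (up to the choice of representatives).\<close>

definition Linf_L2_loc :: "real \<Rightarrow> (real \<Rightarrow> real \<Rightarrow> real) set" where
  "Linf_L2_loc T = {v. (\<lambda>(t, x). v t x) \<in> borel_measurable (lebesgue_on ({0..T} \<times> UNIV)) \<and>
     (AE t in lebesgue. t \<in> {0..T} \<longrightarrow> v t \<in> L2_loc) \<and>
     (\<forall>K. compact K \<longrightarrow> (\<exists>C. AE t in lebesgue. t \<in> {0..T} \<longrightarrow> L2_norm_on K (v t) \<le> C))}"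

text \<open>\<open>A\<^sub>t + B + C\<^sub>x = 0\<close> in the sense of distributions on the open half plane \<open>t > 0\<close>; the integrands
  vanish outside it.\<close>

definition weak_balance_law ::
    "(real \<Rightarrow> real \<Rightarrow> real) \<Rightarrow> (real \<Rightarrow> real \<Rightarrow> real) \<Rightarrow> (real \<Rightarrow> real \<Rightarrow> real) \<Rightarrow> bool" where
  "weak_balance_law A B C \<longleftrightarrow>
     (\<lambda>(t, x). A t x) locally_integrable_on ({0<..} \<times> UNIV) \<and>
     (\<lambda>(t, x). B t x) locally_integrable_on ({0<..} \<times> UNIV) \<and>
     (\<lambda>(t, x). C t x) locally_integrable_on ({0<..} \<times> UNIV) \<and>
     (\<forall>\<psi>\<in>test_functions ({0<..} \<times> UNIV).
        (LINT (t, x)|lebesgue.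
            A t x * deriv (\<lambda>s. \<psi> (s, x)) t - B t x * \<psi> (t, x) + C t x * deriv (\<lambda>y. \<psi> (t, y)) x) = 0)"

section \<open>The regularised Burgers equation\<close>

definition conv_integrable :: "(real \<Rightarrow> real) \<Rightarrow> (real \<Rightarrow> real) \<Rightarrow> real \<Rightarrow> bool" where
  "conv_integrable f g x \<longleftrightarrow> integrable lebesgue (\<lambda>y. f (x - y) * g y)"

definition convolution :: "(real \<Rightarrow> real) \<Rightarrow> (real \<Rightarrow> real) \<Rightarrow> real \<Rightarrow> real" where
  "convolution f g x = (LINT y|lebesgue. f (x - y) * g y)"

definition \<GG> :: "real \<Rightarrow> real \<Rightarrow> real" where
  "\<GG> l x = exp (- \<bar>x\<bar> / l) / (2 * l)"

definition burgers_P :: "real \<Rightarrow> (real \<Rightarrow> real \<Rightarrow> real) \<Rightarrow> real \<Rightarrow> real \<Rightarrow> real" where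
  "burgers_P l ux t = convolution (\<GG> l) (\<lambda>y. 1/2 * (ux t y)\<^sup>2)"

text \<open>\<open>ux\<close> is a jointly measurable representative of the spatial derivative \<open>u\<^sub>x\<close>. The condition
  \<open>conv_integrable\<close> says that \<open>burgers_P\<close> is well defined, which \<open>Linf_L2_loc\<close> alone does not guarantee.\<close>

definition conservative_solution ::
    "real \<Rightarrow> (real \<Rightarrow> real) \<Rightarrow> (real \<Rightarrow> real \<Rightarrow> real) \<Rightarrow> bool" where
  "conservative_solution l u0 u \<longleftrightarrow>
     (\<forall>T>0. u \<in> Lip_L2_loc T) \<and> u 0 = u0 \<and>
     (\<exists>ux. (AE t in lebesgue. t > 0 \<longrightarrow> has_weak_deriv (u t) (ux t)) \<and>
        (\<forall>T>0. ux \<in> Linf_L2_loc T) \<and>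
        (AE t in lebesgue. t > 0 \<longrightarrow> (\<forall>x. conv_integrable (\<GG> l) (\<lambda>y. 1/2 * (ux t y)\<^sup>2) x)) \<and>
        weak_balance_law u (\<lambda>t x. u t x * ux t x) (\<lambda>t x. l\<^sup>2 * burgers_P l ux t x) \<and>
        weak_balance_law
          (\<lambda>t x. 1/2 * (u t x)\<^sup>2 + 1/2 * l\<^sup>2 * (ux t x)\<^sup>2)
          (\<lambda>t x. 0)
          (\<lambda>t x. 1/3 * (u t x)^3 + l\<^sup>2 * u t x * burgers_P l ux t x + 1/2 * l\<^sup>2 * u t x * (ux t x)\<^sup>2))"

end

theory Submission imports Defs
begin

text \<open>The equation is solved along characteristics \<open>y(t,\<xi>)\<close> with \<open>y\<^sub>t = U = u(t,y)\<close>, following Bressan and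
  Constantin. Put \<open>p\<^sup>2 = y\<^sub>\<xi>\<close> and \<open>r = p u\<^sub>x\<close>, so that \<open>r\<^sup>2\<close> is the density of \<open>u\<^sub>x\<^sup>2\<close> in the labels \<open>\<xi>\<close>. Then
  \<open>p\<^sub>t = r/2\<close> and \<open>r\<^sub>t = -P p\<close>, where \<open>P\<close> is a Lipschitz functional of \<open>(p, r)\<close>: an ordinary differential equation
  which does not notice the blow-up of \<open>u\<^sub>x = r/p\<close> at the zeros of \<open>p\<close>. Picard iteration solves a clipped version,
  and an energy estimate relative to a moving average of the datum shows that the clipping is never active.
  Since \<open>(p, r)\<close> never vanishes, the zeros of \<open>p\<close> on a characteristic are isolated in time; hence \<open>p \<noteq> 0\<close> almost
  everywhere at almost every time, and for such times the conservation laws, and for data in \<open>H\<^sup>1\<close> the energy identity,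
  pass from labels to positions. Where \<open>r/p\<close> is very negative shortly before time \<open>T\<close>, \<open>p\<close> changes sign and \<open>r/p\<close>
  is very positive shortly after.\<close>

section \<open>Absolutely continuous functions\<close>

text \<open>Taking \<open>p^2\<close>, \<open>p r\<close>, \<open>r^2\<close> for
  \<open>y_\<xi>\<close>, \<open>U_\<xi>\<close> and the energy density builds in the constraint
  that \<open>U_\<xi>^2\<close> is the product of the other two. In the angle variable
  \<open>v = 2 arctan u_x\<close> of Bressan and Constantin, with their density \<open>q\<close>,
  \<open>p\<close> and \<open>r\<close> are \<open>sqrt q\<close> times cosine and sine of
  \<open>v/2\<close>. The obstacle lies at infinity. The velocity need not decay, and before the
  energy estimate \<open>r\<close> is only bounded by a multiple of a weight
  \<open>w \<ge> 1\<close>. So \<open>P\<close> is controlled only if distant labels have distant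
  positions, which is why the kernel is clipped as well as \<open>P\<close>, and the energy carries
  a spatial weight \<open>rho \<epsilon>\<close>. The bounds from Picard iteration depend on the
  clipping levels, but enter the energy estimate only through \<open>Wmax\<close>, always multiplied
  by \<epsilon>. The limit \<epsilon> -> 0 leaves a bound for \<open>P\<close> by the datum and the
  time alone; bounds for \<open>Q\<close>, \<open>U\<close>, \<open>y\<close> follow by integration
  in time. The moving average is a suitable profile since the integral of \<open>g^2\<close> over a
  unit window dominates the squares of its derivative and of its distance to the datum, and is
  itself integrable.\<close>

abbreviation (input) borel_plane :: "('a::topological_space \<times> 'b::topological_space \<Rightarrow> 'c::topological_space) set" where
  "borel_plane \<equiv> borel_measurable (borel \<Otimes>\<^sub>M borel)"

text \<open>Local absolute continuity is encoded by the fundamental theorem on compact intervals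
  with a chosen Borel density. The density takes the part of the almost everywhere derivative, and
  the rules of calculus become statements about pairs of a function and an explicit density.\<close>

definition ac :: "(real \<Rightarrow> real) \<Rightarrow> (real \<Rightarrow> real) \<Rightarrow> bool" where
  "ac F f \<longleftrightarrow> f \<in> borel_measurable borel \<and>
     (\<forall>a b. a \<le> b \<longrightarrow> set_integrable lborel {a..b} f \<and> (LBINT x:{a..b}. f x) = F b - F a)"

lemma acI:
  assumes "f \<in> borel_measurable borel"
    and "\<And>a b. a \<le> b \<Longrightarrow> set_integrable lborel {a..b} f"
    and "\<And>a b. a \<le> b \<Longrightarrow> (f has_integral F b - F a) {a..b}"
  shows "ac F f"
  unfolding ac_def
proof (intro conjI allI impI)
  fix a b :: real assume ab: "a \<le> b"
  show "set_integrable lborel {a..b} f" by (rule assms(2)[OF ab])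
  show "(LBINT x:{a..b}. f x) = F b - F a"
    using set_borel_integral_eq_integral(2)[OF assms(2)[OF ab]] assms(3)[OF ab] by (simp add: integral_unique)
qed (rule assms)

lemma ac_measurable: "ac F f \<Longrightarrow> f \<in> borel_measurable borel"
  by (simp add: ac_def)

lemma ac_set_integrable: "ac F f \<Longrightarrow> set_integrable lborel {a..b} f"
  by (cases "a \<le> b") (auto simp: ac_def set_integrable_def)

lemma ac_integral: "ac F f \<Longrightarrow> a \<le> b \<Longrightarrow> (LBINT x:{a..b}. f x) = F b - F a"
  by (simp add: ac_def)

lemma ac_has_integral: "ac F f \<Longrightarrow> a \<le> b \<Longrightarrow> (f has_integral F b - F a) {a..b}"
  using set_borel_integral_eq_integral[OF ac_set_integrable[of F f a b]] ac_integral[of F f a b]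
  by (metis integrable_integral)

lemma ac_continuous:
  assumes "ac F f" shows "continuous_on UNIV F"
proof -
  have "continuous_on {a<..<b} F" if "a \<le> b" for a b :: real
  proof -
    have "continuous_on {a..b} (\<lambda>x. F a + integral {a..x} f)"
      by (intro continuous_intros indefinite_integral_continuous_1)
        (use ac_has_integral[OF assms that] in blast)
    then have "continuous_on {a..b} F"
      by (rule continuous_on_eq) (use integral_unique[OF ac_has_integral[OF assms]] in auto)
    then show ?thesis by (rule continuous_on_subset) auto
  qed
  then have "isCont F x" for x
    using continuous_on_eq_continuous_at[of "{x-1<..<x+1}" F] by (simp add: order_less_imp_le)
  then show ?thesis by (simp add: continuous_at_imp_continuous_on)
qed

lemma ac_borel: "ac F f \<Longrightarrow> F \<in> borel_measurable borel"
  by (rule borel_measurable_continuous_onI) (rule ac_continuous)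

lemma set_integrable_bounded_mult:
  fixes f h :: "real \<Rightarrow> real"
  assumes "set_integrable lborel {a..b} f" "f \<in> borel_measurable borel" "continuous_on UNIV h"
  shows "set_integrable lborel {a..b} (\<lambda>x. h x * f x)"
proof -
  have "bounded (h ` {a..b})"
    by (meson assms(3) compact_Icc compact_continuous_image compact_imp_bounded continuous_on_subset subset_UNIV)
  then obtain C where C: "\<And>x. x \<in> {a..b} \<Longrightarrow> \<bar>h x\<bar> \<le> C" unfolding bounded_iff by fastforce
  have [measurable]: "h \<in> borel_measurable borel" "f \<in> borel_measurable borel"
    using assms by (auto intro: borel_measurable_continuous_onI)
  have "set_integrable lborel {a..b} (\<lambda>x. C * f x)" using assms(1) by simp
  then show ?thesis unfolding set_integrable_def
  proof (rule Bochner_Integration.integrable_bound)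
    show "AE x in lborel. norm (indicator {a..b} x *\<^sub>R (h x * f x)) \<le> norm (indicator {a..b} x *\<^sub>R (C * f x))"
    proof (intro AE_I2)
      fix x show "norm (indicator {a..b} x *\<^sub>R (h x * f x)) \<le> norm (indicator {a..b} x *\<^sub>R (C * f x))"
        using C[of x] by (auto simp: indicator_def abs_mult intro!: mult_right_mono)
    qed
  qed simp
qed

text \<open>Differences of \<open>\<Psi> \<circ> F\<close> and of the indefinite integral of \<open>(\<psi> \<circ> F) f\<close> agree up to \<open>\<epsilon> \<integral>\<bar>f\<bar>\<close>
  on small intervals; both are additive, so they agree up to \<open>\<epsilon> \<integral>\<bar>f\<bar>\<close> on every interval.\<close>

lemma ac_chain:
  assumes F: "ac F f" and \<Psi>: "\<And>x. (\<Psi> has_real_derivative \<psi> x) (at x)" and \<psi>: "continuous_on UNIV \<psi>"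
  shows "ac (\<lambda>x. \<Psi> (F x)) (\<lambda>x. \<psi> (F x) * f x)"
proof (rule acI)
  have contF: "continuous_on UNIV F" by (rule ac_continuous[OF F])
  have cont: "continuous_on UNIV (\<lambda>x. \<psi> (F x))"
    by (rule continuous_on_compose2[OF \<psi> contF]) auto
  have [measurable]: "f \<in> borel_measurable borel" "(\<lambda>x. \<psi> (F x)) \<in> borel_measurable borel"
    using ac_measurable[OF F] cont by (auto intro: borel_measurable_continuous_onI)
  show "(\<lambda>x. \<psi> (F x) * f x) \<in> borel_measurable borel" by measurable
  show int: "set_integrable lborel {a..b} (\<lambda>x. \<psi> (F x) * f x)" for a b
    by (rule set_integrable_bounded_mult[OF ac_set_integrable[OF F]]) (use cont in auto)
  have inta: "set_integrable lborel {a..b} (\<lambda>x. \<bar>f x\<bar>)" for a b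
    by (rule set_integrable_abs[OF ac_set_integrable[OF F]])
  define I where "I a b = integral {a..b} (\<lambda>x. \<psi> (F x) * f x)" for a b
  define N where "N a b = integral {a..b} (\<lambda>x. \<bar>f x\<bar>)" for a b
  have hI: "((\<lambda>x. \<psi> (F x) * f x) has_integral I a b) {a..b}" for a b
    unfolding I_def using set_borel_integral_eq_integral(1)[OF int] by (rule integrable_integral)
  have hN: "((\<lambda>x. \<bar>f x\<bar>) has_integral N a b) {a..b}" for a b
    unfolding N_def using set_borel_integral_eq_integral(1)[OF inta] by (rule integrable_integral)
  have hf: "a \<le> b \<Longrightarrow> (f has_integral F b - F a) {a..b}" for a b by (rule ac_has_integral[OF F])
  have "\<bar>\<Psi> (F b) - \<Psi> (F a) - I a b\<bar> \<le> 2 * e * N a b" if "a \<le> b" "e > 0" for a b e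
    using \<open>a \<le> b\<close>
  proof (induction rule: Bolzano[where P="\<lambda>a b. \<bar>\<Psi> (F b) - \<Psi> (F a) - I a b\<bar> \<le> 2 * e * N a b"])
    case (trans a b c)
    have "I a c = I a b + I b c" "N a c = N a b + N b c"
      using has_integral_combine[OF trans(3,4) hI hI] has_integral_combine[OF trans(3,4) hN hN]
        has_integral_unique[OF hI] has_integral_unique[OF hN] by metis+
    then show ?case using trans(1,2) by (simp add: algebra_simps)
  next
    case (local x)
    have "isCont (\<lambda>x. \<psi> (F x)) x" using cont by (simp add: continuous_on_eq_continuous_at)
    then obtain d where d: "d > 0" "\<And>z. \<bar>z - x\<bar> < d \<Longrightarrow> \<bar>\<psi> (F z) - \<psi> (F x)\<bar> < e"
      using \<open>e > 0\<close> by (auto simp: continuous_at_eps_delta dist_real_def)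
    have "\<bar>\<Psi> (F v) - \<Psi> (F u) - I u v\<bar> \<le> 2 * e * N u v" if uv: "u \<le> x" "x \<le> v" "v - u < d" for u v
    proof -
      have uv': "u \<le> v" using uv by simp
      have cl: "\<bar>\<psi> (F z) - \<psi> (F x)\<bar> < e" if "z \<in> {u..v}" for z
        using d(2)[of z] that uv by auto
      have FN: "\<bar>F v - F u\<bar> \<le> N u v"
        using has_integral_norm_bound_integral_component hf[OF uv'] hN
        by (metis (no_types, lifting) integral_norm_bound_integral has_integral_integrable integral_unique order_refl real_norm_def)
      \<comment> \<open>The mean value theorem for \<Psi> gives a value between \<open>F u\<close>
        and \<open>F v\<close>; continuity of \<open>F\<close> attains it inside the interval, where
        \<psi> after \<open>F\<close> is within \<open>e\<close> of its value at
        \<open>x\<close>.\<close>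
      have "\<exists>z\<in>{u..v}. \<Psi> (F v) - \<Psi> (F u) = \<psi> (F z) * (F v - F u)"
      proof -
        have *: "\<exists>z\<in>{u..v}. F z = k" if "min (F u) (F v) \<le> k" "k \<le> max (F u) (F v)" for k
        proof (cases "F u \<le> F v")
          case True
          then show ?thesis using IVT'[of F u k v] that uv' continuous_on_subset[OF contF] by fastforce
        next
          case False
          then show ?thesis using IVT2'[of F v k u] that uv' continuous_on_subset[OF contF] by fastforce
        qed
        consider "F u = F v" | "F u < F v" | "F v < F u" by linarith
        then show ?thesis
        proof cases
          case 1 then show ?thesis using uv' by auto
        next
          case 2
          obtain k where k: "F u < k" "k < F v" "\<Psi> (F v) - \<Psi> (F u) = (F v - F u) * \<psi> k"
            using MVT2[OF 2, of \<Psi> \<psi>] \<Psi> by blast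
          then show ?thesis using *[of k] by auto
        next
          case 3
          obtain k where k: "F v < k" "k < F u" "\<Psi> (F u) - \<Psi> (F v) = (F u - F v) * \<psi> k"
            using MVT2[OF 3, of \<Psi> \<psi>] \<Psi> by blast
          obtain z where "z \<in> {u..v}" "F z = k" using *[of k] k by auto
          then show ?thesis using k by (intro bexI[of _ z]) (auto simp: algebra_simps)
        qed
      qed
      then obtain z where z: "z \<in> {u..v}" "\<Psi> (F v) - \<Psi> (F u) = \<psi> (F z) * (F v - F u)" by blast
      have A: "\<bar>\<Psi> (F v) - \<Psi> (F u) - \<psi> (F x) * (F v - F u)\<bar> \<le> e * N u v"
      proof -
        have "\<bar>\<Psi> (F v) - \<Psi> (F u) - \<psi> (F x) * (F v - F u)\<bar> = \<bar>\<psi> (F z) - \<psi> (F x)\<bar> * \<bar>F v - F u\<bar>"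
          unfolding z(2) by (simp add: abs_mult[symmetric] algebra_simps)
        also have "\<dots> \<le> e * N u v" using cl[OF z(1)] FN by (intro mult_mono) auto
        finally show ?thesis .
      qed
      have d1: "((\<lambda>s. \<psi> (F x) * f s - \<psi> (F s) * f s) has_integral \<psi> (F x) * (F v - F u) - I u v) {u..v}"
        by (intro has_integral_diff has_integral_mult_right hI hf uv')
      have d2: "((\<lambda>s. e * \<bar>f s\<bar>) has_integral e * N u v) {u..v}"
        by (intro has_integral_mult_right hN)
      have B: "\<bar>\<psi> (F x) * (F v - F u) - I u v\<bar> \<le> e * N u v"
      proof -
        have "norm (integral {u..v} (\<lambda>s. \<psi> (F x) * f s - \<psi> (F s) * f s)) \<le> integral {u..v} (\<lambda>s. e * \<bar>f s\<bar>)"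
        proof (rule integral_norm_bound_integral)
          fix s assume "s \<in> {u..v}"
          from cl[OF this] show "norm (\<psi> (F x) * f s - \<psi> (F s) * f s) \<le> e * \<bar>f s\<bar>"
            by (simp add: left_diff_distrib[symmetric] abs_mult mult_right_mono abs_minus_commute)
        qed (use d1 d2 in blast)+
        then show ?thesis
          using integral_unique[OF d1] by (simp add: N_def)
      qed
      show ?thesis using A B by linarith
    qed
    then show ?case using d(1) by auto
  qed
  then have le: "\<bar>\<Psi> (F b) - \<Psi> (F a) - I a b\<bar> \<le> 2 * e * N a b" if "a \<le> b" "e > 0" for a b e using that by blast
  show "((\<lambda>x. \<psi> (F x) * f x) has_integral \<Psi> (F b) - \<Psi> (F a)) {a..b}" if "a \<le> b" for a b
  proof -
    have "N a b \<ge> 0" using hN by (rule has_integral_nonneg) auto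
    have "\<bar>\<Psi> (F b) - \<Psi> (F a) - I a b\<bar> \<le> 0 + e" if "e > 0" for e
    proof -
      have "\<bar>\<Psi> (F b) - \<Psi> (F a) - I a b\<bar> \<le> 2 * (e / (2 * (N a b + 1))) * N a b"
        using le[OF \<open>a \<le> b\<close>, of "e / (2 * (N a b + 1))"] that \<open>N a b \<ge> 0\<close> by simp
      also have "\<dots> = e * (N a b / (N a b + 1))" using \<open>N a b \<ge> 0\<close> by (simp add: field_simps)
      also have "\<dots> \<le> e * 1" using \<open>N a b \<ge> 0\<close> that by (intro mult_left_mono) (auto simp: field_simps)
      finally show ?thesis by simp
    qed
    then have "\<bar>\<Psi> (F b) - \<Psi> (F a) - I a b\<bar> \<le> 0" by (rule field_le_epsilon)
    then show ?thesis using hI[of a b] by simp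
  qed
qed

lemma ac_add: "ac F f \<Longrightarrow> ac G g \<Longrightarrow> ac (\<lambda>x. F x + G x) (\<lambda>x. f x + g x)"
  unfolding ac_def by (auto simp: set_integral_add)

lemma ac_cmult: "ac F f \<Longrightarrow> ac (\<lambda>x. c * F x) (\<lambda>x. c * f x)"
  unfolding ac_def by (auto simp: right_diff_distrib)

lemma ac_diff: "ac F f \<Longrightarrow> ac G g \<Longrightarrow> ac (\<lambda>x. F x - G x) (\<lambda>x. f x - g x)"
  using ac_add[of F f "\<lambda>x. (-1) * G x" "\<lambda>x. (-1) * g x"] ac_cmult[of G g "-1"] by simp

lemma ac_of_C1:
  assumes "\<And>x. (\<Psi> has_real_derivative \<psi> x) (at x)" "continuous_on UNIV \<psi>"
  shows "ac \<Psi> \<psi>"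
proof (rule acI)
  show "set_integrable lborel {a..b} \<psi>" for a b
    by (rule borel_integrable_atLeastAtMost') (use assms(2) continuous_on_subset in blast)
  show "(\<psi> has_integral \<Psi> b - \<Psi> a) {a..b}" if "a \<le> b" for a b
    using fundamental_theorem_of_calculus[OF that, of \<Psi> \<psi>] assms(1)
    by (meson has_real_derivative_iff_has_vector_derivative has_vector_derivative_at_within)
qed (use assms in \<open>auto intro: borel_measurable_continuous_onI\<close>)

lemma ac_const: "ac (\<lambda>x. c) (\<lambda>x. 0)"
  by (rule ac_of_C1) auto

lemma ac_id: "ac (\<lambda>x. x) (\<lambda>x. 1)"
  by (rule ac_of_C1) auto

text \<open>Polarisation: the product is half of the square of the sum minus both squares, and
  squares are covered by the chain rule.\<close>

lemma ac_mult:
  assumes "ac F f" "ac G g"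
  shows "ac (\<lambda>x. F x * G x) (\<lambda>x. F x * g x + f x * G x)"
proof -
  have sq: "ac (\<lambda>x. (H x)\<^sup>2) (\<lambda>x. 2 * H x * h x)" if "ac H h" for H h
    using that by (rule ac_chain[where \<Psi>="\<lambda>x. x\<^sup>2" and \<psi>="\<lambda>x. 2 * x"])
      (auto intro!: derivative_eq_intros continuous_intros)
  have "ac (\<lambda>x. (1/2) * ((F x + G x)\<^sup>2 - (F x)\<^sup>2 - (G x)\<^sup>2))
     (\<lambda>x. (1/2) * (2 * (F x + G x) * (f x + g x) - 2 * F x * f x - 2 * G x * g x))"
    by (intro ac_cmult ac_diff sq ac_add assms)
  then show ?thesis by (simp add: power2_eq_square algebra_simps)
qed

lemma ac_cong: "ac F f \<Longrightarrow> (\<And>x. F x = G x) \<Longrightarrow> (\<And>x. f x = g x) \<Longrightarrow> ac G g"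
  by (simp add: ext[of F G] ext[of f g])

lemma tendsto_integral_Icc_at_top:
  fixes f :: "real \<Rightarrow> real"
  assumes "integrable lborel f"
  shows "((\<lambda>R. LBINT x:{-R..R}. f x) \<longlongrightarrow> (LBINT x. f x)) at_top"
  unfolding set_lebesgue_integral_def
proof (rule integral_dominated_convergence_at_top[where w="\<lambda>x. \<bar>f x\<bar>"])
  show "integrable lborel (\<lambda>x. \<bar>f x\<bar>)" using assms by simp
  show "AE x in lborel. ((\<lambda>R. indicator {-R..R} x *\<^sub>R f x) \<longlongrightarrow> f x) at_top"
  proof (intro AE_I2 tendsto_eventually)
    fix x
    show "eventually (\<lambda>R. indicator {-R..R} x *\<^sub>R f x = f x) at_top"
      using eventually_ge_at_top[of "\<bar>x\<bar>"] by eventually_elim (auto simp: indicator_def)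
  qed
qed (use assms in \<open>auto simp: indicator_def borel_measurable_integrable\<close>)

text \<open>Fluxes leave the integral balances through this fact.\<close>

lemma ac_integral_zero:
  assumes "ac F f" "integrable lborel f" "(F \<longlongrightarrow> 0) at_top" "(F \<longlongrightarrow> 0) at_bot"
  shows "(LBINT x. f x) = 0"
proof -
  have "((\<lambda>R. F R - F (-R)) \<longlongrightarrow> 0 - 0) at_top"
    using assms(3,4) by (intro tendsto_diff) (auto simp: filterlim_at_bot_mirror)
  moreover have "eventually (\<lambda>R. F R - F (-R) = (LBINT x:{-R..R}. f x)) at_top"
    using eventually_ge_at_top[of 0] by eventually_elim (use ac_integral[OF assms(1)] in auto)
  ultimately have "((\<lambda>R. LBINT x:{-R..R}. f x) \<longlongrightarrow> 0) at_top"
    by (simp add: tendsto_cong)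
  then show ?thesis
    using tendsto_integral_Icc_at_top[OF assms(2)] tendsto_unique trivial_limit_at_top_linorder by blast
qed

text \<open>The integral from \<open>0\<close> to \<open>x\<close>, with the usual sign for \<open>x < 0\<close>.\<close>

definition sint :: "(real \<Rightarrow> real) \<Rightarrow> real \<Rightarrow> real" where
  "sint f x = (LBINT s. (indicator {0..x} s - indicator {x..0} s) * f s)"

lemma sint_diff:
  assumes f: "\<And>a b. set_integrable lborel {a..b} f" and "a \<le> b"
  shows "sint f b - sint f a = (LBINT x:{a..b}. f x)"
proof -
  have i: "integrable lborel (\<lambda>s. (indicator {0..x} s - indicator {x..0} s) * f s)" for x
    using f[of 0 x] f[of x 0] unfolding set_integrable_def
    by (simp add: left_diff_distrib)
  have "sint f b - sint f a
      = (LBINT s. (indicator {0..b} s - indicator {b..0} s) * f s - (indicator {0..a} s - indicator {a..0} s) * f s)"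
    unfolding sint_def by (rule Bochner_Integration.integral_diff[symmetric, OF i i])
  also have "\<dots> = (LBINT s. indicator {a..b} s * f s)"
  proof (rule integral_cong_AE)
    \<comment> \<open>The closed intervals overlap at their end points, so the indicators combine
      correctly only away from 0, \<open>a\<close> and \<open>b\<close>.\<close>
    have *: "AE s in lborel. s \<noteq> 0 \<and> s \<noteq> a \<and> s \<noteq> b"
      by (intro AE_conjI AE_lborel_singleton)
    show "AE s in lborel. (indicator {0..b} s - indicator {b..0} s) * f s - (indicator {0..a} s - indicator {a..0} s) * f s
        = indicator {a..b} s * f s"
      using * by eventually_elim (use \<open>a \<le> b\<close> in \<open>auto simp: indicator_def\<close>)
  qed (use i[of a] i[of b] f[of a b] in \<open>auto simp: set_integrable_def intro: borel_measurable_integrable\<close>)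
  finally show ?thesis by (simp add: set_lebesgue_integral_def)
qed

lemma ac_sint:
  assumes "f \<in> borel_measurable borel" "\<And>a b. set_integrable lborel {a..b} f"
  shows "ac (sint f) f"
  unfolding ac_def using assms sint_diff[OF assms(2)] by auto

lemma ac_has_real_derivative:
  assumes "ac F f" "continuous_on UNIV f"
  shows "(F has_real_derivative f x) (at x)"
proof -
  have "((\<lambda>y. integral {x-1..y} f) has_real_derivative f x) (at x within {x-1..x+1})"
    by (rule integral_has_real_derivative) (use assms(2) continuous_on_subset in auto)
  then have "((\<lambda>y. F (x-1) + integral {x-1..y} f) has_real_derivative f x) (at x within {x-1..x+1})"
    by (auto intro!: derivative_eq_intros)
  then have "(F has_real_derivative f x) (at x within {x-1..x+1})"
  proof (rule has_field_derivative_transform_within[of _ _ _ _ 1])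
    fix y assume "y \<in> {x-1..x+1}"
    then show "F (x-1) + integral {x-1..y} f = F y"
      using integral_unique[OF ac_has_integral[OF assms(1), of "x-1" y]] by simp
  qed auto
  then show ?thesis by (simp add: at_within_Icc_at)
qed

section \<open>Change of variables along nondecreasing maps\<close>

lemma ac_mono:
  assumes "ac F f" "\<And>x. f x \<ge> 0" "x \<le> y"
  shows "F x \<le> F y"
  using has_integral_nonneg[OF ac_has_integral[OF assms(1,3)]] assms(2) by simp

lemma ac_surj:
  assumes "ac Y a" "filterlim Y at_top at_top" "filterlim Y at_bot at_bot"
  shows "\<exists>\<xi>. Y \<xi> = x"
proof -
  obtain p where p: "Y p \<le> x"
    using assms(3)[unfolded filterlim_at_bot, rule_format, of x] by (auto simp: eventually_at_bot_linorder)
  obtain N where N: "\<And>q. q \<ge> N \<Longrightarrow> x \<le> Y q"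
    using assms(2)[unfolded filterlim_at_top, rule_format, of x] by (auto simp: eventually_at_top_linorder)
  show ?thesis
    using IVT'[of Y p x "max p N"] p N continuous_on_subset[OF ac_continuous[OF assms(1)]] by auto
qed

text \<open>The preimage of an open interval under the monotone map \<open>Y\<close> is an open
  interval, over which \<open>a\<close> integrates to the increment of \<open>Y\<close>. Plateaus
  carry no mass, so injectivity plays no part; this matters because many labels may share one
  position.\<close>

lemma distr_density_ac:
  assumes ac: "ac Y a" and a: "\<And>x. a x \<ge> 0"
    and top: "filterlim Y at_top at_top" and bot: "filterlim Y at_bot at_bot"
  shows "distr (density lborel (\<lambda>x. ennreal (a x))) borel Y = lborel"
proof (rule lborel_eqI[symmetric])
  have [measurable]: "a \<in> borel_measurable borel" "Y \<in> borel_measurable borel"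
    using ac_measurable[OF ac] ac_borel[OF ac] by auto
  have cont: "continuous_on UNIV Y" by (rule ac_continuous[OF ac])
  have mono: "x \<le> y \<Longrightarrow> Y x \<le> Y y" for x y by (rule ac_mono[OF ac a])
  fix l u :: real
  assume "\<And>b. b \<in> Basis \<Longrightarrow> l \<bullet> b \<le> u \<bullet> b"
  then have lu: "l \<le> u" by simp
  have "emeasure (distr (density lborel (\<lambda>x. ennreal (a x))) borel Y) {l<..<u} = ennreal (u - l)"
  proof (cases "l = u")
    case False
    then have "l < u" using lu by simp
    \<comment> \<open>\<open>\<alpha>\<close> is the right end of the plateau at height
      \<open>l\<close> and \<open>\<beta>\<close> the left end of the plateau at height
      \<open>u\<close>, so the preimage of the open interval is exactly what lies between
      them.\<close>
    define \<alpha> where "\<alpha> = Sup {x. Y x \<le> l}"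
    define \<beta> where "\<beta> = Inf {x. Y x \<ge> u}"
    obtain x0 where x0: "Y x0 = l" using ac_surj[OF ac top bot] by blast
    obtain x1 where x1: "Y x1 = u" using ac_surj[OF ac top bot] by blast
    have cl: "closed {x. Y x \<le> l}" "closed {x. Y x \<ge> u}"
      by (intro closed_Collect_le cont continuous_on_const)+
    have bdd: "bdd_above {x. Y x \<le> l}" "bdd_below {x. Y x \<ge> u}"
    proof -
      show "bdd_above {x. Y x \<le> l}"
      proof (rule bdd_aboveI[of _ x1])
        fix x assume "x \<in> {x. Y x \<le> l}"
        then show "x \<le> x1" using mono[of x1 x] x1 \<open>l < u\<close> by (cases "x \<le> x1") auto
      qed
      show "bdd_below {x. Y x \<ge> u}"
      proof (rule bdd_belowI[of _ x0])
        fix x assume "x \<in> {x. Y x \<ge> u}"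
        then show "x0 \<le> x" using mono[of x x0] x0 \<open>l < u\<close> by (cases "x0 \<le> x") auto
      qed
    qed
    have \<alpha>in: "Y \<alpha> \<le> l" using closed_contains_Sup[OF _ bdd(1) cl(1)] x0 unfolding \<alpha>_def by auto
    have \<beta>in: "Y \<beta> \<ge> u" using closed_contains_Inf[OF _ bdd(2) cl(2)] x1 unfolding \<beta>_def by auto
    have "x0 \<le> \<alpha>" unfolding \<alpha>_def using x0 bdd(1) by (auto intro: cSup_upper)
    then have Y\<alpha>: "Y \<alpha> = l" using mono[of x0 \<alpha>] x0 \<alpha>in by simp
    have "\<beta> \<le> x1" unfolding \<beta>_def using x1 bdd(2) by (auto intro: cInf_lower)
    then have Y\<beta>: "Y \<beta> = u" using mono[of \<beta> x1] x1 \<beta>in by simp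
    have "\<alpha> \<le> \<beta>" using mono[of \<beta> \<alpha>] Y\<alpha> Y\<beta> \<open>l < u\<close> by linarith
    have "x > \<alpha> \<longleftrightarrow> Y x > l" for x
    proof
      assume "x > \<alpha>"
      then show "Y x > l" using cSup_upper[OF _ bdd(1), of x] unfolding \<alpha>_def[symmetric] by force
    next
      assume "Y x > l" then show "x > \<alpha>" using mono[of x \<alpha>] Y\<alpha> by linarith
    qed
    moreover have "x < \<beta> \<longleftrightarrow> Y x < u" for x
    proof
      assume "x < \<beta>"
      then show "Y x < u" using cInf_lower[OF _ bdd(2), of x] unfolding \<beta>_def[symmetric] by force
    next
      assume "Y x < u" then show "x < \<beta>" using mono[of \<beta> x] Y\<beta> by linarith
    qed
    ultimately have "Y -` {l<..<u} = {\<alpha><..<\<beta>}" by auto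
    then have "emeasure (distr (density lborel (\<lambda>x. ennreal (a x))) borel Y) {l<..<u}
        = (\<integral>\<^sup>+x. ennreal (a x) * indicator {\<alpha><..<\<beta>} x \<partial>lborel)"
      by (simp add: emeasure_distr emeasure_density)
    also have "\<dots> = (\<integral>\<^sup>+x. ennreal (indicator {\<alpha>..\<beta>} x * a x) \<partial>lborel)"
    proof (rule nn_integral_cong_AE)
      have "AE x in lborel. x \<noteq> \<alpha> \<and> x \<noteq> \<beta>" by (intro AE_conjI AE_lborel_singleton)
      then show "AE x in lborel. ennreal (a x) * indicator {\<alpha><..<\<beta>} x = ennreal (indicator {\<alpha>..\<beta>} x * a x)"
        by eventually_elim (auto simp: indicator_def)
    qed
    also have "\<dots> = ennreal (LBINT x:{\<alpha>..\<beta>}. a x)"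
      unfolding set_lebesgue_integral_def
      using ac_set_integrable[OF ac, of \<alpha> \<beta>] a
      by (subst nn_integral_eq_integral) (auto simp: set_integrable_def)
    also have "\<dots> = ennreal (u - l)" using ac_integral[OF ac \<open>\<alpha> \<le> \<beta>\<close>] Y\<alpha> Y\<beta> by simp
    finally show ?thesis .
  qed simp
  then show "emeasure (distr (density lborel (\<lambda>x. ennreal (a x))) borel Y) (box l u)
      = (\<Prod>b\<in>Basis. (u - l) \<bullet> b)" by (simp add: box_real)
qed simp

lemma
  assumes ac: "ac Y a" and a: "\<And>x. a x \<ge> 0"
    and top: "filterlim Y at_top at_top" and bot: "filterlim Y at_bot at_bot"
    and f [measurable]: "f \<in> borel_measurable borel"
  shows nn_integral_ac_subst: "(\<integral>\<^sup>+x. ennreal (f x) \<partial>lborel) = (\<integral>\<^sup>+\<xi>. ennreal (a \<xi> * f (Y \<xi>)) \<partial>lborel)"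
    and integral_ac_subst: "(LBINT x. f x) = (LBINT \<xi>. a \<xi> * f (Y \<xi>))"
    and integrable_ac_subst: "integrable lborel f \<longleftrightarrow> integrable lborel (\<lambda>\<xi>. a \<xi> * f (Y \<xi>))"
proof -
  have [measurable]: "a \<in> borel_measurable borel" "Y \<in> borel_measurable borel"
    using ac_measurable[OF ac] ac_borel[OF ac] by auto
  note eq = distr_density_ac[OF ac a top bot]
  show "(\<integral>\<^sup>+x. ennreal (f x) \<partial>lborel) = (\<integral>\<^sup>+\<xi>. ennreal (a \<xi> * f (Y \<xi>)) \<partial>lborel)"
    by (subst eq[symmetric]) (simp add: nn_integral_distr nn_integral_density ennreal_mult' a)
  show "(LBINT x. f x) = (LBINT \<xi>. a \<xi> * f (Y \<xi>))"
    by (subst eq[symmetric]) (simp add: integral_distr integral_density a)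
  show "integrable lborel f \<longleftrightarrow> integrable lborel (\<lambda>\<xi>. a \<xi> * f (Y \<xi>))"
    by (subst eq[symmetric]) (simp add: integrable_distr_eq integrable_density a)
qed

lemma AE_ac_subst:
  assumes ac: "ac Y a" and a: "\<And>x. a x \<ge> 0"
    and top: "filterlim Y at_top at_top" and bot: "filterlim Y at_bot at_bot"
    and [measurable]: "Measurable.pred borel Q"
  shows "(AE x in lborel. Q x) \<longleftrightarrow> (AE \<xi> in lborel. a \<xi> > 0 \<longrightarrow> Q (Y \<xi>))"
proof -
  have [measurable]: "a \<in> borel_measurable borel" "Y \<in> borel_measurable borel"
    using ac_measurable[OF ac] ac_borel[OF ac] by auto
  show ?thesis
    by (subst distr_density_ac[OF ac a top bot, symmetric]) (simp add: AE_distr_iff AE_density)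
qed

text \<open>Integrals over intervals determine the density, by comparing the finite measures with densities
  \<open>f\<^sup>+\<close> and \<open>f\<^sup>-\<close> on bounded intervals.\<close>

lemma AE_zero_if_interval_integrals_zero:
  fixes f :: "real \<Rightarrow> real"
  assumes [measurable]: "f \<in> borel_measurable borel"
    and int: "\<And>a b. set_integrable lborel {a..b} f"
    and zero: "\<And>a b. a \<le> b \<Longrightarrow> (LBINT x:{a..b}. f x) = 0"
  shows "AE x in lborel. f x = 0"
proof -
  have "AE x in lborel. x \<in> {-real n..real n} \<longrightarrow> f x = 0" for n
  proof -
    define F where "F x = indicator {-real n..real n} x * f x" for x
    have F_eq: "F = (\<lambda>x. indicator {-real n..real n} x * f x)" unfolding F_def ..
    have iF: "integrable lborel F" using int[of "-n" n] by (simp add: F_eq set_integrable_def)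
    have [measurable]: "F \<in> borel_measurable borel" unfolding F_def by measurable
    have ip: "integrable lborel (\<lambda>x. indicator A x * max 0 (F x))"
      "integrable lborel (\<lambda>x. indicator A x * max 0 (- F x))" if "A \<in> sets borel" for A
      by (rule Bochner_Integration.integrable_bound[OF iF]; use that in \<open>auto simp: indicator_def\<close>)+
    have em: "emeasure (density lborel (\<lambda>x. ennreal (max 0 (F x)))) A = ennreal (LBINT x. indicator A x * max 0 (F x))"
      "emeasure (density lborel (\<lambda>x. ennreal (max 0 (- F x)))) A = ennreal (LBINT x. indicator A x * max 0 (- F x))"
      if "A \<in> sets borel" for A
      using that ip[OF that]
      by (auto simp: emeasure_density nn_integral_eq_integral[symmetric] intro!: nn_integral_cong split: split_indicator)
    have "density lborel (\<lambda>x. ennreal (max 0 (F x))) = density lborel (\<lambda>x. ennreal (max 0 (- F x)))"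
    proof (rule measure_eqI_lessThan)
      fix x :: real
      have "(LBINT s. indicator {x<..} s * max 0 (F s)) - (LBINT s. indicator {x<..} s * max 0 (- F s))
          = (LBINT s. indicator {x<..} s * max 0 (F s) - indicator {x<..} s * max 0 (- F s))"
        by (rule Bochner_Integration.integral_diff[symmetric]) (auto intro: ip)
      also have "\<dots> = (LBINT s:{max x (-n)..n}. f s)"
        unfolding set_lebesgue_integral_def
      proof (rule integral_cong_AE)
        have "AE s in lborel. s \<noteq> x" by (rule AE_lborel_singleton)
        then show "AE s in lborel. indicator {x<..} s * max 0 (F s) - indicator {x<..} s * max 0 (- F s)
            = indicator {max x (-n)..n} s *\<^sub>R f s"
          by eventually_elim (auto simp: F_def indicator_def)
      qed auto
      also have "\<dots> = 0"
      proof (cases "max x (-n) \<le> n")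
        case False
        then have "{max x (-real n)..real n} = {}" by auto
        then show ?thesis by (simp add: set_lebesgue_integral_def)
      qed (rule zero)
      finally show "emeasure (density lborel (\<lambda>x. ennreal (max 0 (F x)))) {x<..}
         = emeasure (density lborel (\<lambda>x. ennreal (max 0 (- F x)))) {x<..}"
        by (simp add: em)
    qed (auto simp: em)
    then have "AE x in lborel. ennreal (max 0 (F x)) = ennreal (max 0 (- F x))"
      using sigma_finite_measure.density_unique_iff[OF sigma_finite_lborel, of "\<lambda>x. ennreal (max 0 (F x))" "\<lambda>x. ennreal (max 0 (- F x))"] by simp
    then show ?thesis
      by eventually_elim (auto simp: F_def max_def split: if_splits)
  qed
  then have "AE x in lborel. \<forall>n. x \<in> {-real n..real n} \<longrightarrow> f x = 0" by (subst AE_all_countable) blast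
  then show ?thesis
  proof eventually_elim
    case (elim x)
    obtain n :: nat where "\<bar>x\<bar> \<le> real n" using real_arch_simple by blast
    then show ?case using elim by (auto simp: abs_le_iff)
  qed
qed

section \<open>Test functions and weak derivatives\<close>

lemma frechet_derivative_real:
  assumes "(f has_real_derivative d) (at x)"
  shows "frechet_derivative f (at x) v = d * v"
  using frechet_derivative_at[of f "\<lambda>v. d * v" x] assms unfolding has_field_derivative_def by metis

lemma Ck_cmult: "Ck n f \<Longrightarrow> Ck n (\<lambda>x. c * f x)" for f :: "real \<Rightarrow> real"
proof (induction n arbitrary: f)
  case (Suc n)
  have "frechet_derivative (\<lambda>x. c * f x) (at x) v = c * frechet_derivative f (at x) v" for x v
  proof -
    have "(f has_derivative frechet_derivative f (at x)) (at x)"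
      using Suc.prems frechet_derivative_works by auto
    then have "((\<lambda>x. c * f x) has_derivative (\<lambda>v. c * frechet_derivative f (at x) v)) (at x)"
      by (rule has_derivative_mult_right)
    from frechet_derivative_at[OF this] show ?thesis by metis
  qed
  then show ?case using Suc by (auto intro!: differentiable_mult)
qed (auto intro: continuous_intros)

lemma Ck_add: "Ck n f \<Longrightarrow> Ck n g \<Longrightarrow> Ck n (\<lambda>x. f x + g x)" for f :: "real \<Rightarrow> real"
proof (induction n arbitrary: f g)
  case (Suc n)
  have "frechet_derivative (\<lambda>x. f x + g x) (at x) v = frechet_derivative f (at x) v + frechet_derivative g (at x) v" for x v
  proof -
    have "(f has_derivative frechet_derivative f (at x)) (at x)" "(g has_derivative frechet_derivative g (at x)) (at x)"
      using Suc.prems by (auto simp flip: frechet_derivative_works)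
    from has_derivative_add[OF this]
    have "((\<lambda>x. f x + g x) has_derivative (\<lambda>v. frechet_derivative f (at x) v + frechet_derivative g (at x) v)) (at x)" .
    from frechet_derivative_at[OF this] show ?thesis by metis
  qed
  then show ?case using Suc by (auto intro!: differentiable_add)
qed (auto intro: continuous_intros)

lemma Ck_SucI:
  fixes f :: "real \<Rightarrow> real"
  assumes "\<And>x. (f has_real_derivative f' x) (at x)" "Ck n f'"
  shows "Ck (Suc n) f"
proof -
  have "frechet_derivative f (at x) v = v * f' x" for x v
    using frechet_derivative_real[OF assms(1)] by (simp add: mult.commute)
  then show ?thesis using assms by (auto intro: Ck_cmult simp: real_differentiable_def)
qed

lemma test_function_C1:
  fixes \<psi> :: "real \<Rightarrow> real"
  assumes "\<psi> \<in> test_functions UNIV"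
  shows "(\<psi> has_real_derivative deriv \<psi> x) (at x)" and "continuous_on UNIV (deriv \<psi>)"
proof -
  have C: "Ck (Suc 0) \<psi>" using assms unfolding test_functions_def by blast
  show d: "(\<psi> has_real_derivative deriv \<psi> x) (at x)" for x
    using C by (auto simp: DERIV_deriv_iff_real_differentiable)
  have "frechet_derivative \<psi> (at x) 1 = deriv \<psi> x" for x
    using frechet_derivative_real[OF d, of x 1] by simp
  then show "continuous_on UNIV (deriv \<psi>)" using C by (auto dest: spec[of _ 1])
qed

lemma test_function_zero_outside:
  fixes \<psi> :: "real \<Rightarrow> real"
  assumes "\<psi> \<in> test_functions UNIV"
  obtains X where "X > 0" "\<And>x. \<bar>x\<bar> \<ge> X \<Longrightarrow> \<psi> x = 0" "\<And>x. \<bar>x\<bar> \<ge> X \<Longrightarrow> deriv \<psi> x = 0"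
proof -
  have "bounded (closure {x. \<psi> x \<noteq> 0})" using assms by (auto simp: test_functions_def compact_imp_bounded)
  then obtain B where "\<And>x. x \<in> closure {x. \<psi> x \<noteq> 0} \<Longrightarrow> \<bar>x\<bar> \<le> B"
    unfolding bounded_iff real_norm_def by blast
  then have B: "\<psi> x \<noteq> 0 \<Longrightarrow> \<bar>x\<bar> \<le> B" for x
    using subsetD[OF closure_subset, of x "{x. \<psi> x \<noteq> 0}"] by simp
  have "deriv \<psi> x = 0" if "\<bar>x\<bar> > B" for x
  proof -
    have "eventually (\<lambda>y. \<psi> y = 0) (nhds x)"
    proof (rule eventually_nhds[THEN iffD2], intro exI conjI ballI)
      show "open {y. B < \<bar>y\<bar>}" by (intro open_Collect_less continuous_intros)
    qed (use B that in force)+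
    then have "deriv \<psi> x = deriv (\<lambda>_. 0) x" by (rule deriv_cong_ev) simp
    then show ?thesis by simp
  qed
  then show ?thesis using B by (intro that[of "\<bar>B\<bar> + 1"]) force+
qed

lemma test_functionI:
  fixes \<psi> :: "real \<Rightarrow> real"
  assumes "\<And>n. Ck n \<psi>" "\<And>x. \<psi> x \<noteq> 0 \<Longrightarrow> x \<in> {a..b}"
  shows "\<psi> \<in> test_functions UNIV"
proof -
  have "closure {x. \<psi> x \<noteq> 0} \<subseteq> {a..b}" by (rule closure_minimal) (use assms(2) in auto)
  then have "compact (closure {x. \<psi> x \<noteq> 0})" 
    by (metis bounded_closed_interval bounded_subset closed_closure compact_eq_bounded_closed)
  then show ?thesis using assms(1) by (simp add: test_functions_def)
qed

text \<open>The functions \<open>v \<mapsto> v\<^sup>-\<^sup>n exp(-c/v)\<close>, extended by \<open>0\<close> to \<open>v \<le> 0\<close>: a family whose span is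
  closed under differentiation.\<close>

definition flat :: "real \<Rightarrow> nat \<Rightarrow> real \<Rightarrow> real" where
  "flat c n v = (if v > 0 then exp (- c / v) / v ^ n else 0)"

text \<open>From the right, the substitution \<open>s = c / v\<close> reduces the claim to
  \<open>s^n exp (- s) -> 0\<close> at infinity; from the left the function vanishes.\<close>

lemma flat_tendsto_0:
  assumes "c > 0"
  shows "(flat c n \<longlongrightarrow> 0) (at 0)"
proof -
  have "filterlim (\<lambda>v. c / v) at_top (at_right (0::real))"
    unfolding divide_inverse
    by (rule filterlim_tendsto_pos_mult_at_top[OF tendsto_const assms filterlim_inverse_at_top_right])
  with tendsto_power_div_exp_0[of n]
  have "((\<lambda>v. (c / v) ^ n / exp (c / v)) \<longlongrightarrow> 0) (at_right 0)"
    by (rule filterlim_compose)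
  then have "((\<lambda>v. (1 / c ^ n) * ((c / v) ^ n / exp (c / v))) \<longlongrightarrow> (1 / c ^ n) * 0) (at_right 0)"
    by (rule tendsto_mult_left)
  moreover have "eventually (\<lambda>v. (1 / c ^ n) * ((c / v) ^ n / exp (c / v)) = flat c n v) (at_right 0)"
    using eventually_at_right_less[of 0]
    by eventually_elim (use assms in \<open>simp add: flat_def power_divide exp_minus field_simps\<close>)
  ultimately have "(flat c n \<longlongrightarrow> 0) (at_right 0)" by (simp add: tendsto_cong)
  moreover have "(flat c n \<longlongrightarrow> 0) (at_left 0)"
    by (rule tendsto_eventually) (use eventually_at_left_real[of "-1" 0] in \<open>auto elim!: eventually_mono simp: flat_def\<close>)
  ultimately show ?thesis by (simp add: filterlim_at_split)
qed

text \<open>The only delicate point is 0, where the difference quotient of \<open>flat c n\<close>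
  is \<open>flat c (n+1)\<close> itself.\<close>

lemma flat_has_derivative:
  assumes "c > 0"
  shows "(flat c n has_real_derivative c * flat c (n+2) v - n * flat c (n+1) v) (at v)"
proof -
  consider "v > 0" | "v < 0" | "v = 0" by linarith
  then show ?thesis
  proof cases
    case 1
    have "((\<lambda>v. exp (- c / v) / v ^ n) has_real_derivative
        (exp (- c / v) * (c / v\<^sup>2) * v ^ n - exp (- c / v) * (n * v ^ (n - 1))) / (v ^ n * v ^ n)) (at v)"
      using 1 by (auto intro!: derivative_eq_intros simp: power2_eq_square)
    also have "(exp (- c / v) * (c / v\<^sup>2) * v ^ n - exp (- c / v) * (n * v ^ (n - 1))) / (v ^ n * v ^ n)
        = c * flat c (n+2) v - n * flat c (n+1) v"
      using 1 by (cases n) (auto simp: flat_def field_simps power2_eq_square)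
    finally have "((\<lambda>v. exp (- c / v) / v ^ n) has_real_derivative c * flat c (n+2) v - n * flat c (n+1) v) (at v)" .
    then show ?thesis
      by (rule has_field_derivative_transform_within_open[of _ _ _ "{0<..}"]) (use 1 in \<open>auto simp: flat_def\<close>)
  next
    case 2
    have "((\<lambda>v. 0) has_real_derivative c * flat c (n+2) v - n * flat c (n+1) v) (at v)"
      using 2 by (simp add: flat_def)
    then show ?thesis
      by (rule has_field_derivative_transform_within_open[of _ _ _ "{..<0}"]) (use 2 in \<open>auto simp: flat_def\<close>)
  next
    case 3
    have "(\<lambda>h. (flat c n (0 + h) - flat c n 0) / h) = flat c (n+1)"
      by (auto simp: flat_def)
    then show ?thesis using flat_tendsto_0[OF assms, of "n+1"] 3 by (simp add: DERIV_def flat_def[of _ _ 0])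
  qed
qed

text \<open>The polynomial factor \<open>R\<close> and the exponent \<open>n\<close> are generalised
  so that the derivative is a sum of functions of the same shape and the induction on
  \<open>k\<close> closes.\<close>

lemma Ck_poly_flat:
  fixes v :: "real poly"
  assumes "c > 0"
  shows "Ck k (\<lambda>x. poly R x * flat c n (poly v x))"
proof (induction k arbitrary: R n)
  case 0
  have "isCont (\<lambda>x. flat c n (poly v x)) x" for x
    by (rule isCont_o2[OF poly_isCont]) (rule DERIV_isCont[OF flat_has_derivative[OF assms]])
  then show ?case by (auto intro!: continuous_intros continuous_at_imp_continuous_on)
next
  case (Suc k)
  show ?case
  proof (rule Ck_SucI)
    fix x
    show "((\<lambda>x. poly R x * flat c n (poly v x)) has_real_derivative
        poly (pderiv R) x * flat c n (poly v x) + (poly (smult c (R * pderiv v)) x * flat c (n+2) (poly v x)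
         + poly (smult (- real n) (R * pderiv v)) x * flat c (n+1) (poly v x))) (at x)"
      by (auto intro!: derivative_eq_intros DERIV_chain2[OF flat_has_derivative[OF assms]] simp: algebra_simps)
  qed (intro Ck_add Suc)
qed

text \<open>The quadratic is positive exactly inside the interval. The parameter \<open>c\<close>
  controls the steepness: as \<open>c\<close> tends to 0 the bumps tend to the indicator of the open
  interval while staying below 1.\<close>

definition bump :: "real \<Rightarrow> real \<Rightarrow> real \<Rightarrow> real \<Rightarrow> real" where
  "bump c a b x = flat c 0 ((x - a) * (b - x))"

lemma bump_pos_iff: "a < b \<Longrightarrow> bump c a b x > 0 \<longleftrightarrow> x \<in> {a<..<b}"
  by (auto simp: bump_def flat_def zero_less_mult_iff)

lemma bump_zero: "a < b \<Longrightarrow> x \<notin> {a<..<b} \<Longrightarrow> bump c a b x = 0"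
  using bump_pos_iff[of a b c x] by (auto simp: bump_def flat_def split: if_splits)

lemma bump_bounds: "c > 0 \<Longrightarrow> 0 \<le> bump c a b x" "c > 0 \<Longrightarrow> bump c a b x \<le> 1"
  by (auto simp: bump_def flat_def)

lemma Ck_bump: "c > 0 \<Longrightarrow> Ck k (bump c a b)"
proof -
  assume c: "c > 0"
  have "(\<lambda>x. poly 1 x * flat c 0 (poly ([:-a, 1:] * [:b, -1:]) x)) = bump c a b"
    by (simp add: bump_def fun_eq_iff algebra_simps)
  then show ?thesis using Ck_poly_flat[OF c, of k 1 0 "[:-a, 1:] * [:b, -1:]"] by metis
qed

lemma continuous_bump: "c > 0 \<Longrightarrow> continuous_on UNIV (bump c a b)"
  using Ck_bump[of c 0] by simp

lemma bump_test: "c > 0 \<Longrightarrow> a < b \<Longrightarrow> bump c a b \<in> test_functions UNIV"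
proof (rule test_functionI[of _ a b])
  fix x assume "a < b" "bump c a b x \<noteq> 0"
  then have "x \<in> {a<..<b}" using bump_zero by blast
  then show "x \<in> {a..b}" by simp
qed (rule Ck_bump)

lemma bump_tendsto:
  assumes "a < b"
  shows "(\<lambda>k. bump (1 / real (Suc k)) a b x) \<longlonglongrightarrow> indicator {a<..<b} x"
proof (cases "x \<in> {a<..<b}")
  case True
  then have p: "(x - a) * (b - x) > 0" by simp
  have "(\<lambda>k. exp (- (1 / real (Suc k)) / ((x - a) * (b - x)))) \<longlonglongrightarrow> exp (- 0 / ((x - a) * (b - x)))"
    using p by (intro tendsto_intros LIMSEQ_Suc[OF lim_1_over_n]) auto
  then show ?thesis using p True by (simp add: bump_def flat_def)
qed (use assms in \<open>simp add: bump_zero\<close>)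

text \<open>Letting the steepness parameter tend to 0 under dominated convergence turns bump
  integrals into interval integrals.\<close>

lemma AE_zero_if_bump_integrals_zero:
  fixes f :: "real \<Rightarrow> real"
  assumes [measurable]: "f \<in> borel_measurable borel"
    and int: "\<And>a b. set_integrable lborel {a..b} f"
    and zero: "\<And>a b c. a < b \<Longrightarrow> c > 0 \<Longrightarrow> (LBINT x. f x * bump c a b x) = 0"
  shows "AE x in lborel. f x = 0"
proof (rule AE_zero_if_interval_integrals_zero[OF assms(1) int])
  fix a b :: real assume ab: "a \<le> b"
  show "(LBINT x:{a..b}. f x) = 0"
  proof (cases "a = b")
    case True
    have "AE x in lborel. indicator {a..b} x *\<^sub>R f x = 0"
      using AE_lborel_singleton[of a] by eventually_elim (use True in auto)
    then show ?thesis unfolding set_lebesgue_integral_def by (rule integral_eq_zero_AE)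
  next
    case False
    then have "a < b" using ab by simp
    have [measurable]: "bump (1 / real (Suc k)) a b \<in> borel_measurable borel" for k
      by (intro borel_measurable_continuous_onI continuous_bump) simp
    have "(\<lambda>k. LBINT x. f x * bump (1 / real (Suc k)) a b x) \<longlonglongrightarrow> (LBINT x. f x * indicator {a<..<b} x)"
    proof (rule integral_dominated_convergence[where w="\<lambda>x. indicator {a..b} x * \<bar>f x\<bar>"])
      show "integrable lborel (\<lambda>x. indicator {a..b} x * \<bar>f x\<bar>)"
        using set_integrable_abs[OF int[of a b]] by (simp add: set_integrable_def)
      show "AE x in lborel. (\<lambda>k. f x * bump (1 / real (Suc k)) a b x) \<longlonglongrightarrow> f x * indicator {a<..<b} x"
        by (intro AE_I2 tendsto_mult_left bump_tendsto \<open>a < b\<close>)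
      show "AE x in lborel. norm (f x * bump (1 / real (Suc k)) a b x) \<le> indicator {a..b} x * \<bar>f x\<bar>" for k
      proof (intro AE_I2)
        fix x
        show "norm (f x * bump (1 / real (Suc k)) a b x) \<le> indicator {a..b} x * \<bar>f x\<bar>"
          using bump_zero[OF \<open>a < b\<close>, of x "1 / real (Suc k)"] bump_bounds[of "1 / real (Suc k)" a b x]
          by (auto simp: indicator_def abs_mult intro!: mult_left_le)
      qed
    qed measurable
    then have "(LBINT x. f x * indicator {a<..<b} x) = 0"
      using zero[OF \<open>a < b\<close>] by (simp add: LIMSEQ_const_iff)
    also have "(LBINT x. f x * indicator {a<..<b} x) = (LBINT x:{a..b}. f x)"
      unfolding set_lebesgue_integral_def
    proof (rule integral_cong_AE)
      have "AE x in lborel. x \<noteq> a \<and> x \<noteq> b" by (intro AE_conjI AE_lborel_singleton)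
      then show "AE x in lborel. f x * indicator {a<..<b} x = indicator {a..b} x *\<^sub>R f x"
        by eventually_elim (auto simp: indicator_def)
    qed measurable
    finally show ?thesis .
  qed
qed

lemma integrable_mult_cont_compact:
  fixes f \<psi> :: "real \<Rightarrow> real"
  assumes "f \<in> borel_measurable borel" "\<And>a b. set_integrable lborel {a..b} f"
    and "continuous_on UNIV \<psi>" "\<And>x. \<bar>x\<bar> \<ge> X \<Longrightarrow> \<psi> x = 0"
  shows "integrable lborel (\<lambda>x. f x * \<psi> x)"
proof -
  have "set_integrable lborel {-X..X} (\<lambda>x. \<psi> x * f x)"
    by (rule set_integrable_bounded_mult[OF assms(2,1,3)])
  then show ?thesis unfolding set_integrable_def
  proof (rule Bochner_Integration.integrable_cong[THEN iffD1, rotated -1])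
    fix x show "indicator {-X..X} x *\<^sub>R (\<psi> x * f x) = f x * \<psi> x"
      using assms(4)[of x] by (cases "\<bar>x\<bar> \<ge> X") (auto simp: indicator_def not_le abs_less_iff)
  qed simp
qed

text \<open>The lemma of du Bois-Reymond: \<open>\<beta> - (\<integral>\<beta> / \<integral>\<eta>) \<eta>\<close> is the derivative of a test function,
  for any two bumps \<open>\<beta>\<close> and \<open>\<eta>\<close>.\<close>

lemma AE_const_if_deriv_integrals_zero:
  fixes f :: "real \<Rightarrow> real"
  assumes f [measurable]: "f \<in> borel_measurable borel"
    and int: "\<And>a b. set_integrable lborel {a..b} f"
    and zero: "\<And>\<psi>. \<psi> \<in> test_functions UNIV \<Longrightarrow> (LBINT x. f x * deriv \<psi> x) = 0"
  shows "\<exists>k. AE x in lborel. f x = k"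
proof -
  let ?\<eta> = "bump 1 0 1"
  define m where "m = (LBINT x. ?\<eta> x)"
  define k where "k = (LBINT x. f x * ?\<eta> x) / m"
  have bi: "integrable lborel (\<lambda>x. h x * bump c a b x)"
    if "h \<in> borel_measurable borel" "\<And>a b. set_integrable lborel {a..b} h" "a < b" "c > 0" for h :: "real \<Rightarrow> real" and a b c
    by (rule integrable_mult_cont_compact[OF that(1,2) continuous_bump[OF \<open>c > 0\<close>], of "max \<bar>a\<bar> \<bar>b\<bar>"])
       (rule bump_zero[OF \<open>a < b\<close>], auto)
  have one: "set_integrable lborel {a..b} (\<lambda>x. d)" for a b d :: real
    by (rule borel_integrable_atLeastAtMost') simp
  have bi1: "integrable lborel (bump c a b)" if "a < b" "c > 0" for a b c
    using bi[OF _ one[where d=1] that] by simp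
  have "m > 0"
  proof -
    have "m \<noteq> 0"
    proof
      assume "m = 0"
      then have "AE x in lborel. ?\<eta> x = 0"
        unfolding m_def using integral_nonneg_eq_0_iff_AE[OF bi1[of 0 1 1]] bump_bounds(1)[of 1 0 1] by simp
      then have "AE x in lborel. x \<notin> {0<..<1::real}"
      proof eventually_elim
        case (elim x)
        then show ?case using bump_pos_iff[of 0 1 1 x] by simp
      qed
      then have "emeasure lborel {x \<in> space lborel. \<not> x \<notin> {0<..<1::real}} = 0" by (subst (asm) AE_iff_null) (auto simp: null_sets_def)
      moreover have "{x \<in> space lborel. \<not> x \<notin> {0<..<1::real}} = {0<..<1}" by auto
      ultimately have "emeasure lborel {0<..<1::real} = 0" by simp
      then show False by simp
    qed
    moreover have "m \<ge> 0" unfolding m_def using bump_bounds(1)[of 1 0 1] by (intro integral_nonneg_AE) auto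
    ultimately show ?thesis by simp
  qed
  have [measurable]: "bump c a b \<in> borel_measurable borel" if "c > 0" for a b c
    using that by (intro borel_measurable_continuous_onI continuous_bump)
  have "(LBINT x. (f x - k) * bump c a b x) = 0" if ab: "a < b" and c: "c > 0" for a b c
  proof -
    define \<mu> where "\<mu> = (LBINT x. bump c a b x) / m"
    define \<psi> where "\<psi> x = bump c a b x + (- \<mu>) * ?\<eta> x" for x
    have Ck: "Ck n \<psi>" for n
      unfolding \<psi>_def[abs_def] by (intro Ck_add Ck_cmult Ck_bump c) simp
    have cont: "continuous_on UNIV \<psi>" using Ck[of 0] by simp
    define X where "X = max \<bar>a\<bar> \<bar>b\<bar> + 1"
    have X: "X > 0" "\<psi> x = 0" if "\<bar>x\<bar> \<ge> X" for x
    proof -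
      have "x \<notin> {a<..<b}" "x \<notin> {0<..<1}" using that by (auto simp: X_def)
      then show "\<psi> x = 0" by (simp add: \<psi>_def bump_zero ab)
    qed (auto simp: X_def)
    have "X > 0" by (auto simp: X_def)
    have s\<psi>: "set_integrable lborel {u..v} \<psi>" for u v
      by (rule borel_integrable_atLeastAtMost') (use cont continuous_on_subset in blast)
    have ac\<psi>: "ac (sint \<psi>) \<psi>"
      by (rule ac_sint[OF borel_measurable_continuous_onI[OF cont] s\<psi>])
    \<comment> \<open>The primitive started at \<open>-X\<close> vanishes left of the support, and
      right of it because \<open>\<psi>\<close> has total integral zero; hence it has compact
      support.\<close>
    define \<Psi> where "\<Psi> x = sint \<psi> x - sint \<psi> (- X)" for x
    have D: "(\<Psi> has_real_derivative \<psi> x) (at x)" for x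
      unfolding \<Psi>_def[abs_def] using ac_has_real_derivative[OF ac\<psi> cont, of x] by (auto intro!: derivative_eq_intros)
    have int0: "(LBINT x. \<psi> x) = 0"
      unfolding \<psi>_def using bi1[OF ab c] bi1[of 0 1 1] \<open>m > 0\<close> by (simp add: m_def[symmetric] \<mu>_def)
    have out: "\<Psi> x = 0" if "\<bar>x\<bar> \<ge> X" for x
    proof (cases "x \<ge> 0")
      case True
      have "\<Psi> x = (LBINT s:{-X..x}. \<psi> s)"
        using ac_integral[OF ac\<psi>, of "-X" x] True that \<open>X > 0\<close> by (simp add: \<Psi>_def)
      also have "\<dots> = (LBINT s. \<psi> s)"
        unfolding set_lebesgue_integral_def
      proof (rule Bochner_Integration.integral_cong)
        fix s show "indicator {-X..x} s *\<^sub>R \<psi> s = \<psi> s"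
          using X(2)[of s] that True by (cases "\<bar>s\<bar> \<ge> X") (auto simp: indicator_def not_le abs_less_iff)
      qed simp
      finally show ?thesis using int0 by simp
    next
      case False
      have "- \<Psi> x = (LBINT s:{x..-X}. \<psi> s)"
        using ac_integral[OF ac\<psi>, of x "-X"] False that by (simp add: \<Psi>_def)
      also have "\<dots> = (LBINT s::real. 0)"
        unfolding set_lebesgue_integral_def
      proof (rule Bochner_Integration.integral_cong)
        fix s show "indicator {x..-X} s *\<^sub>R \<psi> s = 0"
          using X(2)[of s] \<open>X > 0\<close> by (auto simp: indicator_def)
      qed simp
      finally show ?thesis by simp
    qed
    have "Ck n \<Psi>" for n
    proof (cases n)
      case 0
      then show ?thesis using D by (auto intro!: continuous_at_imp_continuous_on DERIV_isCont)
    qed (use Ck_SucI[OF D Ck] in auto)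
    then have "\<Psi> \<in> test_functions UNIV"
      by (rule test_functionI[of _ "-X" X]) (use out in force)
    from zero[OF this] have "(LBINT x. f x * \<psi> x) = 0"
      by (simp add: DERIV_imp_deriv[OF D])
    moreover have "(LBINT x. f x * \<psi> x) = (LBINT x. f x * bump c a b x) - \<mu> * (LBINT x. f x * ?\<eta> x)"
      using bi[OF f int ab c] bi[OF f int, of 0 1 1] by (simp add: \<psi>_def algebra_simps)
    ultimately have "(LBINT x. f x * bump c a b x) = k * (LBINT x. bump c a b x)"
      using \<open>m > 0\<close> by (simp add: \<mu>_def k_def)
    then show ?thesis
      using bi[OF f int ab c] bi1[OF ab c] by (simp add: left_diff_distrib)
  qed
  then have "AE x in lborel. f x - k = 0"
    by (intro AE_zero_if_bump_integrals_zero) (auto intro!: int one set_integral_diff)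
  then show ?thesis by (intro exI[of _ k]) auto
qed

section \<open>Weak derivatives and absolutely continuous representatives\<close>

lemma has_bochner_lebesgue_lborel:
  fixes f :: "'a::euclidean_space \<Rightarrow> real"
  assumes "f \<in> borel_measurable borel"
  shows "(LINT x|lebesgue. f x) = (LBINT x. f x)"
    and "integrable lebesgue f \<longleftrightarrow> integrable lborel f"
  using assms by (auto simp: integral_completion integrable_completion)

lemma locally_integrable_onI:
  fixes f :: "real \<Rightarrow> real"
  assumes "f \<in> borel_measurable borel" "\<And>a b. set_integrable lborel {a..b} f"
  shows "f locally_integrable_on UNIV"
  unfolding locally_integrable_on_def
proof (intro allI impI)
  fix K :: "real set" assume "compact K \<and> K \<subseteq> UNIV"
  then have K: "compact K" by simp
  then obtain B where "\<And>x. x \<in> K \<Longrightarrow> \<bar>x\<bar> \<le> B"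
    using compact_imp_bounded[OF K] unfolding bounded_iff real_norm_def by blast
  then have sub: "K \<subseteq> {-B..B}" by (auto simp: abs_le_iff) (metis abs_le_iff minus_le_iff)
  have "set_integrable lborel K f"
    by (rule set_integrable_subset[OF assms(2) _ sub]) (use K in \<open>auto intro: borel_compact\<close>)
  then show "f absolutely_integrable_on K"
    using assms(1) K unfolding set_integrable_def
    by (subst has_bochner_lebesgue_lborel(2)) (auto intro: borel_compact)
qed

lemma locally_integrable_on_measurable:
  fixes f :: "real \<Rightarrow> real"
  assumes "f locally_integrable_on UNIV"
  shows "f \<in> borel_measurable lebesgue"
proof (rule borel_measurable_LIMSEQ_real)
  show "(\<lambda>x. indicator {-real n..real n} x *\<^sub>R f x) \<in> borel_measurable lebesgue" for n
    using assms unfolding locally_integrable_on_def set_integrable_def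
    by (intro borel_measurable_integrable) auto
  fix x
  obtain N :: nat where N: "\<bar>x\<bar> \<le> real N" using real_arch_simple by blast
  have "eventually (\<lambda>n. indicator {-real n..real n} x *\<^sub>R f x = f x) sequentially"
    using eventually_ge_at_top[of N]
  proof eventually_elim
    case (elim n)
    then have "\<bar>x\<bar> \<le> real n" using N by linarith
    then show ?case by (auto simp: indicator_def abs_le_iff)
  qed
  then show "(\<lambda>n. indicator {-real n..real n} x *\<^sub>R f x) \<longlonglongrightarrow> f x" by (rule tendsto_eventually)
qed

lemma locally_integrable_borel_version:
  fixes f :: "real \<Rightarrow> real"
  assumes "f locally_integrable_on UNIV"
  obtains f' where "f' \<in> borel_measurable borel" "AE x in lebesgue. f x = f' x"
    "\<And>a b. set_integrable lborel {a..b} f'"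
proof -
  obtain f' where f': "f' \<in> borel_measurable lborel" "AE x in lborel. f x = f' x"
    using completion_ex_borel_measurable_real[OF locally_integrable_on_measurable[OF assms]] by blast
  have AE: "AE x in lebesgue. f x = f' x" by (rule AE_completion[OF f'(2)])
  have "set_integrable lborel {a..b} f'" for a b
  proof -
    have "integrable lebesgue (\<lambda>x. indicator {a..b} x *\<^sub>R f x)"
      using assms unfolding locally_integrable_on_def set_integrable_def by auto
    then have "integrable lebesgue (\<lambda>x. indicator {a..b} x *\<^sub>R f' x)"
    proof (rule integrable_cong_AE_imp)
      show "(\<lambda>x. indicator {a..b} x *\<^sub>R f' x) \<in> borel_measurable lebesgue"
        using f'(1) by (intro measurable_completion) auto
      show "AE x in lebesgue. indicator {a..b} x *\<^sub>R f x = indicator {a..b} x *\<^sub>R f' x"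
        using AE by eventually_elim simp
    qed
    then show ?thesis unfolding set_integrable_def
      using f'(1) by (subst (asm) has_bochner_lebesgue_lborel(2)) auto
  qed
  then show ?thesis using that[of f'] f'(1) AE by simp
qed

text \<open>Integration by parts: the product with a test function is absolutely continuous and
  vanishes near infinity.\<close>

lemma ac_imp_has_weak_deriv:
  assumes "ac F f"
  shows "has_weak_deriv F f"
  unfolding has_weak_deriv_def
proof (intro conjI ballI)
  have F [measurable]: "F \<in> borel_measurable borel" and f [measurable]: "f \<in> borel_measurable borel"
    using ac_borel[OF assms] ac_measurable[OF assms] by auto
  have iF: "set_integrable lborel {a..b} F" for a b
    by (rule borel_integrable_atLeastAtMost') (use ac_continuous[OF assms] continuous_on_subset in blast)
  have if': "set_integrable lborel {a..b} f" for a b by (rule ac_set_integrable[OF assms])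
  show "F locally_integrable_on UNIV" by (rule locally_integrable_onI[OF F iF])
  show "f locally_integrable_on UNIV" by (rule locally_integrable_onI[OF f if'])
  fix \<psi> :: "real \<Rightarrow> real" assume \<psi>: "\<psi> \<in> test_functions UNIV"
  obtain X where X: "X > 0" "\<And>x. \<bar>x\<bar> \<ge> X \<Longrightarrow> \<psi> x = 0" "\<And>x. \<bar>x\<bar> \<ge> X \<Longrightarrow> deriv \<psi> x = 0"
    using test_function_zero_outside[OF \<psi>] by blast
  note D = test_function_C1[OF \<psi>]
  have c\<psi>: "continuous_on UNIV \<psi>" using D(1) by (auto intro!: continuous_at_imp_continuous_on DERIV_isCont)
  have [measurable]: "\<psi> \<in> borel_measurable borel" "deriv \<psi> \<in> borel_measurable borel"
    using c\<psi> D(2) by (auto intro: borel_measurable_continuous_onI)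
  have i: "integrable lborel (\<lambda>x. F x * deriv \<psi> x)" "integrable lborel (\<lambda>x. f x * \<psi> x)"
    by (rule integrable_mult_cont_compact[OF F iF D(2) X(3)] integrable_mult_cont_compact[OF f if' c\<psi> X(2)], simp)+
  have "(LBINT x. F x * deriv \<psi> x + f x * \<psi> x) = 0"
  proof (rule ac_integral_zero[OF ac_mult[OF assms ac_of_C1[OF D]]])
    show "integrable lborel (\<lambda>x. F x * deriv \<psi> x + f x * \<psi> x)" using i by simp
    show "((\<lambda>x. F x * \<psi> x) \<longlongrightarrow> 0) at_top"
      by (intro tendsto_eventually eventually_at_top_linorderI[of X]) (simp add: X(2))
    show "((\<lambda>x. F x * \<psi> x) \<longlongrightarrow> 0) at_bot"
      by (intro tendsto_eventually eventually_at_bot_linorderI[of "-X"]) (simp add: X(2))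
  qed
  then show "(LINT x|lebesgue. F x * deriv \<psi> x) = - (LINT x|lebesgue. f x * \<psi> x)"
    using i by (simp add: has_bochner_lebesgue_lborel)
qed

lemma LINT_lebesgue_AE_eq_lborel:
  fixes f f' \<psi> :: "real \<Rightarrow> real"
  assumes "f \<in> borel_measurable lebesgue" "f' \<in> borel_measurable borel" "\<psi> \<in> borel_measurable borel"
    and "AE x in lebesgue. f x = f' x"
  shows "(LINT x|lebesgue. f x * \<psi> x) = (LBINT x. f' x * \<psi> x)"
proof -
  have \<psi>: "\<psi> \<in> borel_measurable lebesgue" and f': "f' \<in> borel_measurable lebesgue"
    using assms(2,3) by (auto intro!: measurable_completion)
  have "(LINT x|lebesgue. f x * \<psi> x) = (LINT x|lebesgue. f' x * \<psi> x)"
    by (rule integral_cong_AE) (use assms(1,4) \<psi> f' in \<open>auto elim!: eventually_mono intro: borel_measurable_times\<close>)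
  also have "\<dots> = (LBINT x. f' x * \<psi> x)"
    by (rule has_bochner_lebesgue_lborel) (use assms(2,3) in auto)
  finally show ?thesis .
qed

lemma has_weak_deriv_AE_unique:
  assumes g: "has_weak_deriv f g" and h: "has_weak_deriv f h"
  shows "AE x in lebesgue. g x = h x"
proof -
  have lg: "g locally_integrable_on UNIV" and lh: "h locally_integrable_on UNIV"
    using g h by (auto simp: has_weak_deriv_def)
  obtain g' where g': "g' \<in> borel_measurable borel" "AE x in lebesgue. g x = g' x" "\<And>a b. set_integrable lborel {a..b} g'"
    using locally_integrable_borel_version[OF lg] by blast
  obtain h' where h': "h' \<in> borel_measurable borel" "AE x in lebesgue. h x = h' x" "\<And>a b. set_integrable lborel {a..b} h'"
    using locally_integrable_borel_version[OF lh] by blast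
  have "AE x in lborel. g' x - h' x = 0"
  proof (rule AE_zero_if_bump_integrals_zero)
    show "(\<lambda>x. g' x - h' x) \<in> borel_measurable borel" using g'(1) h'(1) by auto
    show "set_integrable lborel {a..b} (\<lambda>x. g' x - h' x)" for a b
      by (rule set_integral_diff(1)[OF g'(3) h'(3)])
    fix a b c :: real assume ab: "a < b" and c: "c > 0"
    have t: "bump c a b \<in> test_functions UNIV" by (rule bump_test[OF c ab])
    have m: "bump c a b \<in> borel_measurable borel" by (rule borel_measurable_continuous_onI[OF continuous_bump[OF c]])
    have "(LINT x|lebesgue. g x * bump c a b x) = (LINT x|lebesgue. h x * bump c a b x)"
    proof -
      have "- (LINT x|lebesgue. g x * bump c a b x) = - (LINT x|lebesgue. h x * bump c a b x)"
        using g[unfolded has_weak_deriv_def, THEN conjunct2, THEN conjunct2, rule_format, OF t]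
          h[unfolded has_weak_deriv_def, THEN conjunct2, THEN conjunct2, rule_format, OF t] by (rule trans[OF sym])
      then show ?thesis by simp
    qed
    then have "(LBINT x. g' x * bump c a b x) = (LBINT x. h' x * bump c a b x)"
      using LINT_lebesgue_AE_eq_lborel[OF locally_integrable_on_measurable[OF lg] g'(1) m g'(2)]
        LINT_lebesgue_AE_eq_lborel[OF locally_integrable_on_measurable[OF lh] h'(1) m h'(2)] by simp
    moreover have "integrable lborel (\<lambda>x. w x * bump c a b x)"
      if "w \<in> borel_measurable borel" "\<And>a b. set_integrable lborel {a..b} w" for w
      by (rule integrable_mult_cont_compact[OF that continuous_bump[OF c], of "max \<bar>a\<bar> \<bar>b\<bar>"])
       (rule bump_zero[OF \<open>a < b\<close>], auto)
    ultimately show "(LBINT x. (g' x - h' x) * bump c a b x) = 0"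
      using g'(1,3) h'(1,3) by (simp add: left_diff_distrib)
  qed
  then have "AE x in lebesgue. g' x - h' x = 0" by (rule AE_completion)
  then show ?thesis using g'(2) h'(2) by eventually_elim simp
qed

text \<open>The function and the primitive of a Borel version of its weak derivative have the same
  weak derivative, so they differ by a constant almost everywhere.\<close>

lemma has_weak_deriv_imp_ac:
  assumes "has_weak_deriv f g"
  obtains F g' where "ac F g'" "AE x in lebesgue. f x = F x" "AE x in lebesgue. g x = g' x"
proof -
  have lf: "f locally_integrable_on UNIV" and lg: "g locally_integrable_on UNIV"
    using assms by (auto simp: has_weak_deriv_def)
  obtain f' where f': "f' \<in> borel_measurable borel" "AE x in lebesgue. f x = f' x" "\<And>a b. set_integrable lborel {a..b} f'"
    using locally_integrable_borel_version[OF lf] by blast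
  obtain g' where g': "g' \<in> borel_measurable borel" "AE x in lebesgue. g x = g' x" "\<And>a b. set_integrable lborel {a..b} g'"
    using locally_integrable_borel_version[OF lg] by blast
  have ac: "ac (sint g') g'" by (rule ac_sint[OF g'(1,3)])
  note G = ac_imp_has_weak_deriv[OF ac]
  have sG: "set_integrable lborel {a..b} (sint g')" for a b
    by (rule borel_integrable_atLeastAtMost') (use ac_continuous[OF ac] continuous_on_subset in blast)
  have mG: "sint g' \<in> borel_measurable borel" by (rule ac_borel[OF ac])
  have "\<exists>k. AE x in lborel. f' x - sint g' x = k"
  proof (rule AE_const_if_deriv_integrals_zero)
    show "(\<lambda>x. f' x - sint g' x) \<in> borel_measurable borel" using f'(1) mG by auto
    show "set_integrable lborel {a..b} (\<lambda>x. f' x - sint g' x)" for a b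
      by (rule set_integral_diff(1)[OF f'(3) sG])
    fix \<psi> :: "real \<Rightarrow> real" assume \<psi>: "\<psi> \<in> test_functions UNIV"
    obtain X where X: "X > 0" "\<And>x. \<bar>x\<bar> \<ge> X \<Longrightarrow> \<psi> x = 0" "\<And>x. \<bar>x\<bar> \<ge> X \<Longrightarrow> deriv \<psi> x = 0"
      using test_function_zero_outside[OF \<psi>] by blast
    note D = test_function_C1[OF \<psi>]
    have c\<psi>: "continuous_on UNIV \<psi>" using D(1) by (auto intro!: continuous_at_imp_continuous_on DERIV_isCont)
    have m: "\<psi> \<in> borel_measurable borel" "deriv \<psi> \<in> borel_measurable borel"
      using c\<psi> D(2) by (auto intro: borel_measurable_continuous_onI)
    have "(LBINT x. f' x * deriv \<psi> x) = (LINT x|lebesgue. f x * deriv \<psi> x)"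
      by (rule LINT_lebesgue_AE_eq_lborel[OF locally_integrable_on_measurable[OF lf] f'(1) m(2) f'(2), symmetric])
    also have "\<dots> = - (LINT x|lebesgue. g x * \<psi> x)" using assms \<psi> by (simp add: has_weak_deriv_def)
    also have "\<dots> = - (LBINT x. g' x * \<psi> x)"
      by (simp add: LINT_lebesgue_AE_eq_lborel[OF locally_integrable_on_measurable[OF lg] g'(1) m(1) g'(2)])
    also have "\<dots> = - (LINT x|lebesgue. g' x * \<psi> x)"
      using g'(1) m(1) by (simp add: has_bochner_lebesgue_lborel)
    also have "\<dots> = (LINT x|lebesgue. sint g' x * deriv \<psi> x)" using G \<psi> by (simp add: has_weak_deriv_def)
    also have "\<dots> = (LBINT x. sint g' x * deriv \<psi> x)"
      using mG m(2) by (simp add: has_bochner_lebesgue_lborel)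
    finally show "(LBINT x. (f' x - sint g' x) * deriv \<psi> x) = 0"
      using integrable_mult_cont_compact[OF f'(1,3) D(2) X(3)] integrable_mult_cont_compact[OF mG sG D(2) X(3)]
      by (simp add: left_diff_distrib)
  qed
  then obtain k where "AE x in lborel. f' x - sint g' x = k" by blast
  then have k: "AE x in lebesgue. f' x - sint g' x = k" by (rule AE_completion)
  show ?thesis
  proof (rule that[of "\<lambda>x. sint g' x + k" g'])
    show "ac (\<lambda>x. sint g' x + k) g'" using ac_add[OF ac ac_const[of k]] by simp
    show "AE x in lebesgue. f x = sint g' x + k" using k f'(2) by eventually_elim simp
  qed (rule g'(2))
qed

lemma weak_deriv_AE:
  assumes "has_weak_deriv f g"
  shows "AE x in lebesgue. weak_deriv f x = g x" and "has_weak_deriv f (weak_deriv f)"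
proof -
  show "has_weak_deriv f (weak_deriv f)" unfolding weak_deriv_def by (rule someI[of "has_weak_deriv f", OF assms])
  then show "AE x in lebesgue. weak_deriv f x = g x" using assms by (rule has_weak_deriv_AE_unique)
qed

lemma has_weak_deriv_measurable: "has_weak_deriv f g \<Longrightarrow> g \<in> borel_measurable lebesgue"
  by (auto simp: has_weak_deriv_def intro: locally_integrable_on_measurable)

section \<open>The weighted exponential kernel\<close>

text \<open>Integrability of \<open>f\<close> is not assumed: the integral of a non-integrable
  function is 0 by convention, and the right side is nonnegative.\<close>

lemma LINT_norm_le:
  fixes f :: "'a \<Rightarrow> 'b::{banach, second_countable_topology}" and h :: "'a \<Rightarrow> real"
  assumes "integrable M h" "\<And>x. x \<in> space M \<Longrightarrow> norm (f x) \<le> h x"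
  shows "norm (LINT x|M. f x) \<le> (LINT x|M. h x)"
proof (cases "integrable M f")
  case True
  have "norm (LINT x|M. f x) \<le> (LINT x|M. norm (f x))" by simp
  also have "\<dots> \<le> (LINT x|M. h x)" using True assms by (intro integral_mono) auto
  finally show ?thesis .
next
  case False
  have "(LINT x|M. h x) \<ge> 0"
    using assms(2) by (intro integral_nonneg_AE AE_I2) (meson norm_ge_zero order_trans)
  then show ?thesis using False by (simp add: not_integrable_integral_eq)
qed

lemma LINT_abs_le:
  fixes f h :: "'a \<Rightarrow> real"
  assumes "integrable M h" "\<And>x. x \<in> space M \<Longrightarrow> \<bar>f x\<bar> \<le> h x"
  shows "\<bar>LINT x|M. f x\<bar> \<le> (LINT x|M. h x)"
  using LINT_norm_le[of M h f] assms by simp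

lemma measurable_Pair_apply:
  fixes f :: "'a::topological_space \<Rightarrow> 'b::topological_space \<Rightarrow> 'c::topological_space"
  assumes "case_prod f \<in> borel_plane" "X \<in> borel_measurable N" "Y \<in> borel_measurable N"
  shows "(\<lambda>x. f (X x) (Y x)) \<in> borel_measurable N"
proof -
  have "(\<lambda>x. case_prod f (X x, Y x)) \<in> borel_measurable N"
    by (rule measurable_compose[OF _ assms(1)]) (use assms(2,3) in measurable)
  then show ?thesis by simp
qed

lemma measurable_sint:
  assumes "case_prod f \<in> borel_plane"
  shows "(\<lambda>(t, \<xi>). sint (f t) \<xi>) \<in> borel_plane"
proof -
  have [measurable]: "(\<lambda>x. f (fst (fst x)) (snd x)) \<in> borel_measurable ((borel \<Otimes>\<^sub>M borel) \<Otimes>\<^sub>M lborel)"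
    by (rule measurable_Pair_apply[OF assms]) auto
  have "(\<lambda>x. LBINT s. (indicator {0..snd x} s - indicator {snd x..0} s) * f (fst x) s)
      \<in> borel_plane"
    unfolding indicator_def by (rule lborel.borel_measurable_lebesgue_integral) (simp add: case_prod_beta')
  then show ?thesis by (simp add: sint_def case_prod_beta')
qed

lemma integrable_exp_abs:
  fixes c \<xi> :: real
  assumes "c > 0"
  shows "integrable lborel (\<lambda>\<eta>. exp (- \<bar>\<xi> - \<eta>\<bar> / c))"
    and "(LBINT \<eta>. exp (- \<bar>\<xi> - \<eta>\<bar> / c)) = (LBINT \<eta>. exp (- \<bar>\<eta>\<bar> / c))"
proof -
  have "(\<lambda>x. exp (- (1/c) * x)) integrable_on {0..}"
    using assms by (intro integrable_on_exp_minus_to_infinity) auto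
  then have "(\<lambda>x. exp (- (1/c) * x)) absolutely_integrable_on {0..}"
    by (rule nonnegative_absolutely_integrable_1) auto
  then have 1: "integrable lborel (\<lambda>x. indicator {0..} x * exp (- x / c))"
    unfolding set_integrable_def by (subst (asm) has_bochner_lebesgue_lborel(2)) auto
  have "integrable lborel (\<lambda>x. indicator {0..} (0 + (-1) * x) * exp (- (0 + (-1) * x) / c))"
    by (rule lborel_integrable_real_affine[OF 1]) simp
  from Bochner_Integration.integrable_add[OF 1 this]
  have i0: "integrable lborel (\<lambda>x. exp (- \<bar>x\<bar> / c))"
    by (rule Bochner_Integration.integrable_bound) (auto simp: indicator_def)
  show "integrable lborel (\<lambda>\<eta>. exp (- \<bar>\<xi> - \<eta>\<bar> / c))"
    using lborel_integrable_real_affine[OF i0, of "-1" \<xi>] by simp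
  show "(LBINT \<eta>. exp (- \<bar>\<xi> - \<eta>\<bar> / c)) = (LBINT \<eta>. exp (- \<bar>\<eta>\<bar> / c))"
    using lborel_integral_real_affine[of "-1" "\<lambda>x. exp (- \<bar>x\<bar> / c)" \<xi>] by simp
qed

text \<open>The distance of two positions is replaced by its a priori lower bound \<open>\<bar>\<xi> - \<eta>\<bar>/2 - D\<close> where it is smaller. This
  keeps the kernel integrable in \<open>\<eta>\<close> for every \<open>p\<close>.\<close>

definition ker :: "real \<Rightarrow> real \<Rightarrow> (real \<Rightarrow> real) \<Rightarrow> real \<Rightarrow> real \<Rightarrow> real" where
  "ker l D p \<xi> \<eta> = exp (- max \<bar>sint (\<lambda>s. (p s)\<^sup>2) \<xi> - sint (\<lambda>s. (p s)\<^sup>2) \<eta>\<bar> (\<bar>\<xi> - \<eta>\<bar> / 2 - D) / l)"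

text \<open>The factor \<open>\<sigma>\<close> is 1 for the pressure and the sign of
  \<open>\<xi> - \<eta>\<close> for its derivative, so that bounds and Lipschitz estimates are
  proved once for both.\<close>

definition kerint :: "(real \<Rightarrow> real \<Rightarrow> real) \<Rightarrow> real \<Rightarrow> real \<Rightarrow> (real \<Rightarrow> real) \<Rightarrow> (real \<Rightarrow> real) \<Rightarrow> real \<Rightarrow> real" where
  "kerint \<sigma> l D p r \<xi> = (LBINT \<eta>. \<sigma> \<xi> \<eta> * ker l D p \<xi> \<eta> * (r \<eta>)\<^sup>2)"

lemma measurable_ker:
  assumes "case_prod p \<in> borel_plane" "D \<in> borel_measurable borel"
  shows "(\<lambda>((t, \<xi>), \<eta>). ker l (D t) (p t) \<xi> \<eta>) \<in> borel_measurable ((borel \<Otimes>\<^sub>M borel) \<Otimes>\<^sub>M borel)"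
proof -
  have "case_prod (\<lambda>t s. (p t s)\<^sup>2) = (\<lambda>x. (case_prod p x)\<^sup>2)" by auto
  then have "case_prod (\<lambda>t s. (p t s)\<^sup>2) \<in> borel_plane"
    using assms(1) by simp
  note S = measurable_sint[OF this]
  have [measurable]: "(\<lambda>x. sint (\<lambda>s. (p (fst (fst x)) s)\<^sup>2) (snd (fst x))) \<in> borel_measurable ((borel \<Otimes>\<^sub>M borel) \<Otimes>\<^sub>M borel)"
    "(\<lambda>x. sint (\<lambda>s. (p (fst (fst x)) s)\<^sup>2) (snd x)) \<in> borel_measurable ((borel \<Otimes>\<^sub>M borel) \<Otimes>\<^sub>M borel)"
    by (rule measurable_Pair_apply[OF S]; simp)+
  note assms(2)[measurable]
  show ?thesis unfolding ker_def case_prod_beta' by measurable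
qed

lemma measurable_kerint:
  assumes p: "case_prod p \<in> borel_plane" and r: "case_prod r \<in> borel_plane"
    and D: "D \<in> borel_measurable borel" and \<sigma>: "case_prod \<sigma> \<in> borel_plane"
  shows "(\<lambda>(t, \<xi>). kerint \<sigma> l (D t) (p t) (r t) \<xi>) \<in> borel_plane"
proof -
  have [measurable]: "(\<lambda>x. ker l (D (fst (fst x))) (p (fst (fst x))) (snd (fst x)) (snd x)) \<in> borel_measurable ((borel \<Otimes>\<^sub>M borel) \<Otimes>\<^sub>M lborel)"
    using measurable_ker[OF p D, of l] by (simp add: case_prod_beta')
  have [measurable]: "(\<lambda>x. \<sigma> (snd (fst x)) (snd x)) \<in> borel_measurable ((borel \<Otimes>\<^sub>M borel) \<Otimes>\<^sub>M lborel)"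
    "(\<lambda>x. r (fst (fst x)) (snd x)) \<in> borel_measurable ((borel \<Otimes>\<^sub>M borel) \<Otimes>\<^sub>M lborel)"
    by (rule measurable_Pair_apply[OF \<sigma>] measurable_Pair_apply[OF r]; simp)+
  have "(\<lambda>x. LBINT \<eta>. \<sigma> (snd x) \<eta> * ker l (D (fst x)) (p (fst x)) (snd x) \<eta> * (r (fst x) \<eta>)\<^sup>2)
      \<in> borel_plane"
    by (rule lborel.borel_measurable_lebesgue_integral) (simp add: case_prod_beta')
  then show ?thesis by (simp add: kerint_def case_prod_beta')
qed

lemma measurable_ker1:
  assumes "p \<in> borel_measurable borel"
  shows "ker l D p \<xi> \<in> borel_measurable borel"
proof -
  have "case_prod (\<lambda>_::real. p) \<in> borel_plane" "(\<lambda>_::real. D) \<in> borel_measurable borel"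
    using assms by (simp_all add: case_prod_beta')
  from measurable_ker[OF this, of l] have "(\<lambda>x::(real \<times> real) \<times> real. ker l D p (snd (fst x)) (snd x)) \<in> borel_measurable ((borel \<Otimes>\<^sub>M borel) \<Otimes>\<^sub>M borel)"
    by (simp add: case_prod_beta')
  from measurable_compose[OF _ this, of "\<lambda>\<eta>. ((0::real, \<xi>), \<eta>)" borel] show ?thesis by simp
qed

lemma exp_diff_le:
  fixes a b c :: real
  assumes "c \<le> a" "c \<le> b"
  shows "\<bar>exp (- a) - exp (- b)\<bar> \<le> \<bar>a - b\<bar> * exp (- c)"
proof -
  have *: "\<bar>exp (- a) - exp (- b)\<bar> \<le> \<bar>a - b\<bar> * exp (- c)" if "a \<le> b" "c \<le> a" for a b
  proof -
    have "exp (- a) - exp (- b) = exp (- a) * (1 - exp (- (b - a)))"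
      by (simp add: algebra_simps exp_add[symmetric])
    also have "\<dots> \<le> exp (- a) * (b - a)"
    proof (rule mult_left_mono)
      show "1 - exp (- (b - a)) \<le> b - a" using exp_ge_add_one_self[of "- (b - a)"] by linarith
    qed simp
    also have "\<dots> \<le> exp (- c) * (b - a)" using that by (intro mult_right_mono) auto
    finally show ?thesis using that by (simp add: algebra_simps)
  qed
  show ?thesis using *[of a b] *[of b a] assms by (cases "a \<le> b") (auto simp: abs_minus_commute)
qed

text \<open>The weight \<open>w\<close> with \<open>w\<^sup>2 = 1 + g\<^sup>2\<close> bounds the initial data \<open>(1, g)\<close> of the characteristic system.\<close>

locale label_weight =
  fixes l :: real and g :: "real \<Rightarrow> real"
  assumes l_pos: "l > 0" and g_measurable [measurable]: "g \<in> borel_measurable borel"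
    and g_square_integrable: "integrable lborel (\<lambda>\<xi>. (g \<xi>)\<^sup>2)"
begin

definition G :: real where "G = (LBINT \<xi>. (g \<xi>)\<^sup>2)"

definition w :: "real \<Rightarrow> real" where "w \<xi> = sqrt (1 + (g \<xi>)\<^sup>2)"

lemma w_square: "(w \<xi>)\<^sup>2 = 1 + (g \<xi>)\<^sup>2"
  by (simp add: w_def)

lemma w_ge_1: "w \<xi> \<ge> 1"
  by (simp add: w_def)

lemma G_nonneg: "G \<ge> 0"
  unfolding G_def by (rule integral_nonneg_AE) simp

lemma w_exp:
  assumes "c > 0"
  shows "integrable lborel (\<lambda>\<eta>. exp (- \<bar>\<xi> - \<eta>\<bar> / c) * (w \<eta>)\<^sup>2)"
    and "(LBINT \<eta>. exp (- \<bar>\<xi> - \<eta>\<bar> / c) * (w \<eta>)\<^sup>2) \<le> (LBINT \<eta>. exp (- \<bar>\<eta>\<bar> / c)) + G"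
proof -
  have i: "integrable lborel (\<lambda>\<eta>. exp (- \<bar>\<xi> - \<eta>\<bar> / c) * (g \<eta>)\<^sup>2)"
    by (rule Bochner_Integration.integrable_bound[OF g_square_integrable])
       (use assms in \<open>auto simp: mult_left_le_one_le\<close>)
  show "integrable lborel (\<lambda>\<eta>. exp (- \<bar>\<xi> - \<eta>\<bar> / c) * (w \<eta>)\<^sup>2)"
    using i integrable_exp_abs(1)[OF assms, of \<xi>] by (simp add: w_square distrib_left)
  have "(LBINT \<eta>. exp (- \<bar>\<xi> - \<eta>\<bar> / c) * (w \<eta>)\<^sup>2)
      = (LBINT \<eta>. exp (- \<bar>\<xi> - \<eta>\<bar> / c)) + (LBINT \<eta>. exp (- \<bar>\<xi> - \<eta>\<bar> / c) * (g \<eta>)\<^sup>2)"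
    using i integrable_exp_abs(1)[OF assms, of \<xi>] by (simp add: w_square distrib_left)
  also have "(LBINT \<eta>. exp (- \<bar>\<xi> - \<eta>\<bar> / c) * (g \<eta>)\<^sup>2) \<le> G"
    unfolding G_def by (rule integral_mono[OF i g_square_integrable]) (use assms in \<open>auto simp: mult_left_le_one_le\<close>)
  finally show "(LBINT \<eta>. exp (- \<bar>\<xi> - \<eta>\<bar> / c) * (w \<eta>)\<^sup>2) \<le> (LBINT \<eta>. exp (- \<bar>\<eta>\<bar> / c)) + G"
    using integrable_exp_abs(2)[OF assms, of \<xi>] by simp
qed

lemma w_interval:
  shows "set_integrable lborel {a..b} (\<lambda>\<eta>. (w \<eta>)\<^sup>2)"
    and "a \<le> b \<Longrightarrow> (LBINT \<eta>:{a..b}. (w \<eta>)\<^sup>2) \<le> (b - a) + G"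
proof -
  have 1: "set_integrable lborel {a..b} (\<lambda>\<eta>. (1::real))"
    by (rule borel_integrable_atLeastAtMost') simp
  have 2: "set_integrable lborel {a..b} (\<lambda>\<eta>. (g \<eta>)\<^sup>2)"
    unfolding set_integrable_def
    by (rule Bochner_Integration.integrable_bound[OF g_square_integrable]) (auto simp: indicator_def)
  show "set_integrable lborel {a..b} (\<lambda>\<eta>. (w \<eta>)\<^sup>2)"
    using set_integral_add(1)[OF 1 2] by (simp add: w_square)
  assume "a \<le> b"
  have "(LBINT \<eta>:{a..b}. (g \<eta>)\<^sup>2) \<le> G"
    unfolding G_def set_lebesgue_integral_def
    by (rule integral_mono[OF 2[unfolded set_integrable_def] g_square_integrable]) (auto simp: indicator_def)
  moreover have "(LBINT \<eta>:{a..b}. (1::real)) = b - a"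
    using \<open>a \<le> b\<close> by (simp add: set_lebesgue_integral_def)
  ultimately show "(LBINT \<eta>:{a..b}. (w \<eta>)\<^sup>2) \<le> (b - a) + G"
    using set_integral_add(2)[OF 1 2] by (simp add: w_square)
qed

lemma weighted_square_interval:
  assumes "p \<in> borel_measurable borel" "\<And>\<eta>. \<bar>p \<eta>\<bar> \<le> C * (w \<eta>)\<^sup>2"
  shows "set_integrable lborel {a..b} p"
    and "a \<le> b \<Longrightarrow> \<bar>LBINT \<eta>:{a..b}. p \<eta>\<bar> \<le> C * ((b - a) + G)"
proof -
  have "\<bar>p 0\<bar> \<le> C * (w 0)\<^sup>2" by (rule assms)
  then have "0 \<le> C * (w 0)\<^sup>2" by linarith
  then have C: "C \<ge> 0" using w_ge_1[of 0] by (simp add: zero_le_mult_iff)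
  have iw: "integrable lborel (\<lambda>\<eta>. indicator {a..b} \<eta> * (C * (w \<eta>)\<^sup>2))"
    using set_integrable_mult_right[where a=C, OF w_interval(1)[of a b]] by (simp add: set_integrable_def)
  show ip: "set_integrable lborel {a..b} p"
    unfolding set_integrable_def
    by (rule Bochner_Integration.integrable_bound[OF iw])
       (use assms C in \<open>auto simp: indicator_def abs_mult intro!: AE_I2\<close>)
  assume ab: "a \<le> b"
  have "\<bar>LBINT \<eta>:{a..b}. p \<eta>\<bar> \<le> (LBINT \<eta>. indicator {a..b} \<eta> * (C * (w \<eta>)\<^sup>2))"
    unfolding set_lebesgue_integral_def
    by (rule LINT_abs_le[OF iw])
       (use assms in \<open>auto simp: indicator_def\<close>)
  also have "\<dots> = C * (LBINT \<eta>:{a..b}. (w \<eta>)\<^sup>2)"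
    by (simp add: set_lebesgue_integral_def mult.left_commute[of _ C])
  also have "\<dots> \<le> C * ((b - a) + G)" using w_interval(2)[OF ab] C by (intro mult_left_mono)
  finally show "\<bar>LBINT \<eta>:{a..b}. p \<eta>\<bar> \<le> C * ((b - a) + G)" .
qed

lemma square_le_w:
  assumes "\<bar>p\<bar> \<le> R * w \<eta>"
  shows "p\<^sup>2 \<le> R\<^sup>2 * (w \<eta>)\<^sup>2"
  using power_mono[OF assms, of 2] by (simp add: power_mult_distrib)

lemma ac_sint_square:
  assumes "p \<in> borel_measurable borel" "\<And>\<eta>. \<bar>p \<eta>\<bar> \<le> R * w \<eta>"
  shows "ac (sint (\<lambda>s. (p s)\<^sup>2)) (\<lambda>s. (p s)\<^sup>2)"
  by (intro ac_sint weighted_square_interval(1)[where C="R\<^sup>2"]) (use assms in \<open>auto intro: square_le_w\<close>)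

text \<open>The second entry of the maximum alone gives a majorant free of \<open>p\<close>.\<close>

lemma ker_le: "ker l D p \<xi> \<eta> \<le> exp (D / l) * exp (- \<bar>\<xi> - \<eta>\<bar> / (2 * l))"
proof -
  have "- max \<bar>sint (\<lambda>s. (p s)\<^sup>2) \<xi> - sint (\<lambda>s. (p s)\<^sup>2) \<eta>\<bar> (\<bar>\<xi> - \<eta>\<bar> / 2 - D) / l \<le> D / l + - \<bar>\<xi> - \<eta>\<bar> / (2 * l)"
    using l_pos max.cobounded2[of "\<bar>\<xi> - \<eta>\<bar> / 2 - D" "\<bar>sint (\<lambda>s. (p s)\<^sup>2) \<xi> - sint (\<lambda>s. (p s)\<^sup>2) \<eta>\<bar>"]
    by (simp add: field_simps del: max.cobounded2)
  then show ?thesis unfolding ker_def exp_add[symmetric] by (rule exp_le_cancel_iff[THEN iffD2])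
qed

lemma ker_pos: "ker l D p \<xi> \<eta> > 0"
  by (simp add: ker_def)

definition kerint_const :: real where
  "kerint_const = (LBINT \<eta>. exp (- \<bar>\<eta>\<bar> / (2 * l))) + G"

lemma kerint_bound:
  assumes [measurable]: "p \<in> borel_measurable borel" "r \<in> borel_measurable borel" "\<sigma> \<xi> \<in> borel_measurable borel"
    and r: "\<And>\<eta>. \<bar>r \<eta>\<bar> \<le> R * w \<eta>" and \<sigma>: "\<And>\<eta>. \<bar>\<sigma> \<xi> \<eta>\<bar> \<le> 1"
  shows "integrable lborel (\<lambda>\<eta>. \<sigma> \<xi> \<eta> * ker l D p \<xi> \<eta> * (r \<eta>)\<^sup>2)"
    and "\<bar>kerint \<sigma> l D p r \<xi>\<bar> \<le> R\<^sup>2 * exp (D / l) * kerint_const"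
proof -
  have l2: "2 * l > 0" using l_pos by simp
  have [measurable]: "ker l D p \<xi> \<in> borel_measurable borel" by (rule measurable_ker1) simp
  have i: "integrable lborel (\<lambda>\<eta>. R\<^sup>2 * exp (D / l) * (exp (- \<bar>\<xi> - \<eta>\<bar> / (2 * l)) * (w \<eta>)\<^sup>2))"
    by (intro integrable_mult_right w_exp l2)
  have le: "\<bar>\<sigma> \<xi> \<eta> * ker l D p \<xi> \<eta> * (r \<eta>)\<^sup>2\<bar> \<le> R\<^sup>2 * exp (D / l) * (exp (- \<bar>\<xi> - \<eta>\<bar> / (2 * l)) * (w \<eta>)\<^sup>2)" for \<eta>
  proof -
    have "\<bar>\<sigma> \<xi> \<eta> * ker l D p \<xi> \<eta> * (r \<eta>)\<^sup>2\<bar> = \<bar>\<sigma> \<xi> \<eta>\<bar> * ker l D p \<xi> \<eta> * (r \<eta>)\<^sup>2"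
      using ker_pos[of D p \<xi> \<eta>] by (simp add: abs_mult)
    also have "\<dots> \<le> 1 * (exp (D / l) * exp (- \<bar>\<xi> - \<eta>\<bar> / (2 * l))) * (R\<^sup>2 * (w \<eta>)\<^sup>2)"
      using ker_pos[of D p \<xi> \<eta>] by (intro mult_mono \<sigma> ker_le square_le_w r mult_nonneg_nonneg) auto
    finally show ?thesis by (simp add: mult_ac)
  qed
  show ii: "integrable lborel (\<lambda>\<eta>. \<sigma> \<xi> \<eta> * ker l D p \<xi> \<eta> * (r \<eta>)\<^sup>2)"
    by (rule Bochner_Integration.integrable_bound[OF i]) (use le in \<open>auto intro: order_trans[OF _ abs_ge_self]\<close>)
  have "\<bar>kerint \<sigma> l D p r \<xi>\<bar> \<le> (LBINT \<eta>. R\<^sup>2 * exp (D / l) * (exp (- \<bar>\<xi> - \<eta>\<bar> / (2 * l)) * (w \<eta>)\<^sup>2))"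
    unfolding kerint_def
    by (rule LINT_abs_le[OF i]) (use le in auto)
  also have "\<dots> \<le> R\<^sup>2 * exp (D / l) * kerint_const"
    using w_exp(2)[OF l2, of \<xi>] by (auto simp: kerint_const_def intro!: mult_left_mono)
  finally show "\<bar>kerint \<sigma> l D p r \<xi>\<bar> \<le> R\<^sup>2 * exp (D / l) * kerint_const" .
qed

text \<open>The first summand in the bracket comes from varying the kernel, the second from varying
  \<open>r^2\<close>. The decay length is \<open>4 * l\<close>, twice that of \<open>ker_le\<close>,
  because half of the exponential decay is spent on the growth of position differences.\<close>

definition lip_const :: "real \<Rightarrow> real \<Rightarrow> real" where
  "lip_const R D = (2 * R * (4 * l + G) / l * R\<^sup>2 + 2 * R) * exp (D / l) * ((LBINT \<eta>. exp (- \<bar>\<eta>\<bar> / (4 * l))) + G)"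

text \<open>A change of \<open>p\<close> by \<open>\<delta> * w\<close> moves the distance of the
  positions of \<xi> and \<eta> by a quantity that grows linearly in the distance of the labels. The
  lower bound inside \<open>ker\<close> supplies enough exponential decay to absorb this growth, and
  taking the maximum does not increase differences.\<close>

lemma kerint_Lipschitz:
  assumes [measurable]: "p \<in> borel_measurable borel" "r \<in> borel_measurable borel" "p' \<in> borel_measurable borel"
     "r' \<in> borel_measurable borel" "\<sigma> \<xi> \<in> borel_measurable borel"
    and p: "\<And>\<eta>. \<bar>p \<eta>\<bar> \<le> R * w \<eta>" and r: "\<And>\<eta>. \<bar>r \<eta>\<bar> \<le> R * w \<eta>"
    and p': "\<And>\<eta>. \<bar>p' \<eta>\<bar> \<le> R * w \<eta>" and r': "\<And>\<eta>. \<bar>r' \<eta>\<bar> \<le> R * w \<eta>"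
    and \<sigma>: "\<And>\<eta>. \<bar>\<sigma> \<xi> \<eta>\<bar> \<le> 1"
    and dp: "\<And>\<eta>. \<bar>p \<eta> - p' \<eta>\<bar> \<le> \<delta> * w \<eta>" and dr: "\<And>\<eta>. \<bar>r \<eta> - r' \<eta>\<bar> \<le> \<delta> * w \<eta>"
  shows "\<bar>kerint \<sigma> l D p r \<xi> - kerint \<sigma> l D p' r' \<xi>\<bar> \<le> lip_const R D * \<delta>"
proof -
  have l4: "4 * l > 0" using l_pos by simp
  have "0 \<le> R * w 0" "0 \<le> \<delta> * w 0" using p[of 0] dp[of 0] by linarith+
  then have R0: "R \<ge> 0" and \<delta>0: "\<delta> \<ge> 0" using w_ge_1[of 0] by (simp_all add: zero_le_mult_iff)
  have [measurable]: "ker l D p \<xi> \<in> borel_measurable borel" "ker l D p' \<xi> \<in> borel_measurable borel"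
    by (rule measurable_ker1; simp)+
  have sq: "\<bar>a\<^sup>2 - b\<^sup>2\<bar> \<le> 2 * R * \<delta> * (w \<eta>)\<^sup>2" if "\<bar>a\<bar> \<le> R * w \<eta>" "\<bar>b\<bar> \<le> R * w \<eta>" "\<bar>a - b\<bar> \<le> \<delta> * w \<eta>" for a b \<eta>
  proof -
    have "\<bar>a\<^sup>2 - b\<^sup>2\<bar> = \<bar>a + b\<bar> * \<bar>a - b\<bar>" by (simp add: power2_eq_square square_diff_square_factored abs_mult)
    also have "\<dots> \<le> (2 * (R * w \<eta>)) * (\<delta> * w \<eta>)" by (rule mult_mono) (use that in auto)
    finally show ?thesis by (simp add: power2_eq_square mult_ac)
  qed
  define S where "S q \<eta> = sint (\<lambda>s. (q s)\<^sup>2) \<eta>" for q \<eta>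
  have acp: "ac (S p) (\<lambda>s. (p s)\<^sup>2)" and acp': "ac (S p') (\<lambda>s. (p' s)\<^sup>2)"
    unfolding S_def[abs_def] by (rule ac_sint_square[where R=R]; use p p' in simp)+
  note ac = ac_diff[OF acp acp']
  have *: "\<bar>(S p b - S p' b) - (S p a - S p' a)\<bar> \<le> 2 * R * \<delta> * ((b - a) + G)" if "a \<le> b" for a b
    using weighted_square_interval(2)[of "\<lambda>s. (p s)\<^sup>2 - (p' s)\<^sup>2" "2 * R * \<delta>" a b] ac_integral[OF ac that] that sq p p' dp
    by simp
  have dS: "\<bar>(S p \<xi> - S p \<eta>) - (S p' \<xi> - S p' \<eta>)\<bar> \<le> 2 * R * \<delta> * (\<bar>\<xi> - \<eta>\<bar> + G)" for \<eta>
    using *[of \<xi> \<eta>] *[of \<eta> \<xi>] by (cases "\<xi> \<le> \<eta>") (auto simp: abs_if split: if_splits)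
  let ?E = "\<lambda>\<eta>. exp (- \<bar>\<xi> - \<eta>\<bar> / (4 * l))"
  have dker: "\<bar>ker l D p \<xi> \<eta> - ker l D p' \<xi> \<eta>\<bar> \<le> 2 * R * (4 * l + G) / l * \<delta> * exp (D / l) * ?E \<eta>" for \<eta>
  proof -
    define a where "a = max \<bar>S p \<xi> - S p \<eta>\<bar> (\<bar>\<xi> - \<eta>\<bar> / 2 - D)"
    define b where "b = max \<bar>S p' \<xi> - S p' \<eta>\<bar> (\<bar>\<xi> - \<eta>\<bar> / 2 - D)"
    have ab: "\<bar>a - b\<bar> \<le> 2 * R * \<delta> * (\<bar>\<xi> - \<eta>\<bar> + G)"
      using dS[of \<eta>] unfolding a_def b_def by linarith
    have "\<bar>exp (- (a / l)) - exp (- (b / l))\<bar> \<le> \<bar>a / l - b / l\<bar> * exp (- ((\<bar>\<xi> - \<eta>\<bar> / 2 - D) / l))"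
      by (rule exp_diff_le) (use l_pos in \<open>auto simp: a_def b_def intro: divide_right_mono\<close>)
    also have "\<bar>a / l - b / l\<bar> = \<bar>a - b\<bar> / l" using l_pos by (simp add: diff_divide_distrib[symmetric])
    also have "exp (- ((\<bar>\<xi> - \<eta>\<bar> / 2 - D) / l)) = exp (D / l) * (?E \<eta> * ?E \<eta>)"
      using l_pos by (simp add: exp_add[symmetric] field_simps)
    finally have "\<bar>exp (- (a / l)) - exp (- (b / l))\<bar> \<le> \<bar>a - b\<bar> / l * (exp (D / l) * (?E \<eta> * ?E \<eta>))" .
    also have "\<dots> \<le> (2 * R * \<delta> * (\<bar>\<xi> - \<eta>\<bar> + G)) / l * (exp (D / l) * (?E \<eta> * ?E \<eta>))"
      using l_pos by (intro mult_right_mono divide_right_mono ab) auto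
    also have "\<dots> = 2 * R * \<delta> / l * exp (D / l) * ?E \<eta> * ((\<bar>\<xi> - \<eta>\<bar> + G) * ?E \<eta>)"
      by (simp add: field_simps)
    \<comment> \<open>One of the two factors \<open>?E\<close> absorbs the linear growth, by
      \<open>s \<le> exp s\<close> with \<open>s = \<bar>\<xi> - \<eta>\<bar> / (4 * l)\<close>; the
      other keeps the integral over \<eta> finite.\<close>
    also have "(\<bar>\<xi> - \<eta>\<bar> + G) * ?E \<eta> \<le> 4 * l + G"
    proof -
      have "\<bar>\<xi> - \<eta>\<bar> / (4 * l) \<le> exp (\<bar>\<xi> - \<eta>\<bar> / (4 * l))" using exp_ge_add_one_self[of "\<bar>\<xi> - \<eta>\<bar> / (4 * l)"] by linarith
      then have "\<bar>\<xi> - \<eta>\<bar> \<le> 4 * l * exp (\<bar>\<xi> - \<eta>\<bar> / (4 * l))" using l_pos by (simp add: field_simps)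
      then have "\<bar>\<xi> - \<eta>\<bar> * ?E \<eta> \<le> 4 * l * exp (\<bar>\<xi> - \<eta>\<bar> / (4 * l)) * ?E \<eta>"
        by (rule mult_right_mono) simp
      also have "\<dots> = 4 * l" by (simp add: mult.assoc exp_add[symmetric])
      finally have "\<bar>\<xi> - \<eta>\<bar> * ?E \<eta> \<le> 4 * l" .
      moreover have "G * ?E \<eta> \<le> G * 1" using l_pos G_nonneg by (intro mult_left_mono) auto
      ultimately show ?thesis by (simp add: distrib_right)
    qed
    then have "2 * R * \<delta> / l * exp (D / l) * ?E \<eta> * ((\<bar>\<xi> - \<eta>\<bar> + G) * ?E \<eta>)
        \<le> 2 * R * \<delta> / l * exp (D / l) * ?E \<eta> * (4 * l + G)"
      using R0 \<delta>0 l_pos by (intro mult_left_mono) auto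
    finally show ?thesis unfolding ker_def S_def[symmetric] a_def[symmetric] b_def[symmetric]
      by (simp add: field_simps)
  qed
  define C where "C = (2 * R * (4 * l + G) / l * R\<^sup>2 + 2 * R) * exp (D / l)"
  have le: "\<bar>\<sigma> \<xi> \<eta> * ker l D p \<xi> \<eta> * (r \<eta>)\<^sup>2 - \<sigma> \<xi> \<eta> * ker l D p' \<xi> \<eta> * (r' \<eta>)\<^sup>2\<bar> \<le> C * \<delta> * (?E \<eta> * (w \<eta>)\<^sup>2)" for \<eta>
  proof -
    have "\<bar>\<sigma> \<xi> \<eta> * ker l D p \<xi> \<eta> * (r \<eta>)\<^sup>2 - \<sigma> \<xi> \<eta> * ker l D p' \<xi> \<eta> * (r' \<eta>)\<^sup>2\<bar>
       = \<bar>\<sigma> \<xi> \<eta>\<bar> * \<bar>(ker l D p \<xi> \<eta> - ker l D p' \<xi> \<eta>) * (r \<eta>)\<^sup>2 + ker l D p' \<xi> \<eta> * ((r \<eta>)\<^sup>2 - (r' \<eta>)\<^sup>2)\<bar>"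
      by (simp add: abs_mult[symmetric] algebra_simps)
    also have "\<dots> \<le> 1 * (\<bar>(ker l D p \<xi> \<eta> - ker l D p' \<xi> \<eta>) * (r \<eta>)\<^sup>2\<bar> + \<bar>ker l D p' \<xi> \<eta> * ((r \<eta>)\<^sup>2 - (r' \<eta>)\<^sup>2)\<bar>)"
      by (intro mult_mono \<sigma>) auto
    also have "\<bar>(ker l D p \<xi> \<eta> - ker l D p' \<xi> \<eta>) * (r \<eta>)\<^sup>2\<bar> \<le> (2 * R * (4 * l + G) / l * \<delta> * exp (D / l) * ?E \<eta>) * (R\<^sup>2 * (w \<eta>)\<^sup>2)"
      unfolding abs_mult abs_power2
      by (intro mult_mono dker square_le_w r) (use R0 \<delta>0 l_pos G_nonneg in auto)
    also have "\<bar>ker l D p' \<xi> \<eta> * ((r \<eta>)\<^sup>2 - (r' \<eta>)\<^sup>2)\<bar> \<le> (exp (D / l) * ?E \<eta>) * (2 * R * \<delta> * (w \<eta>)\<^sup>2)"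
    proof -
      have "exp (- \<bar>\<xi> - \<eta>\<bar> / (2 * l)) \<le> ?E \<eta>" using l_pos by (simp add: field_simps)
      then have "ker l D p' \<xi> \<eta> \<le> exp (D / l) * ?E \<eta>"
        using ker_le[of D p' \<xi> \<eta>] by (meson exp_ge_zero mult_left_mono order_trans)
      then show ?thesis unfolding abs_mult[of "ker l D p' \<xi> \<eta>"] using ker_pos[of D p' \<xi> \<eta>] R0 \<delta>0
        by (intro mult_mono sq r r' dr) auto
    qed
    finally show ?thesis by (simp add: C_def algebra_simps)
  qed
  have i: "integrable lborel (\<lambda>\<eta>. C * \<delta> * (?E \<eta> * (w \<eta>)\<^sup>2))"
    by (intro integrable_mult_right w_exp l4)
  have i1: "integrable lborel (\<lambda>\<eta>. \<sigma> \<xi> \<eta> * ker l D p \<xi> \<eta> * (r \<eta>)\<^sup>2)"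
    and i2: "integrable lborel (\<lambda>\<eta>. \<sigma> \<xi> \<eta> * ker l D p' \<xi> \<eta> * (r' \<eta>)\<^sup>2)"
    by (rule kerint_bound(1)[where R=R]; use r r' \<sigma> in simp)+
  have "\<bar>kerint \<sigma> l D p r \<xi> - kerint \<sigma> l D p' r' \<xi>\<bar>
      = \<bar>LBINT \<eta>. \<sigma> \<xi> \<eta> * ker l D p \<xi> \<eta> * (r \<eta>)\<^sup>2 - \<sigma> \<xi> \<eta> * ker l D p' \<xi> \<eta> * (r' \<eta>)\<^sup>2\<bar>"
    unfolding kerint_def by (simp add: Bochner_Integration.integral_diff[OF i1 i2])
  also have "\<dots> \<le> (LBINT \<eta>. C * \<delta> * (?E \<eta> * (w \<eta>)\<^sup>2))"
    by (rule LINT_abs_le[OF i]) (use le in auto)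
  also have "\<dots> = C * \<delta> * (LBINT \<eta>. ?E \<eta> * (w \<eta>)\<^sup>2)" by simp
  also have "\<dots> \<le> C * \<delta> * ((LBINT \<eta>. exp (- \<bar>\<eta>\<bar> / (4 * l))) + G)"
    by (intro mult_left_mono w_exp l4) (use R0 \<delta>0 l_pos G_nonneg in \<open>auto simp: C_def\<close>)
  finally show ?thesis by (simp add: lip_const_def C_def mult_ac)
qed

end

section \<open>Picard iteration\<close>

lemma set_integrable_bounded_Icc:
  fixes f :: "real \<Rightarrow> 'b::{banach, second_countable_topology}"
  assumes "f \<in> borel_measurable borel" "\<And>s. s \<in> {a..b} \<Longrightarrow> norm (f s) \<le> B"
  shows "set_integrable lborel {a..b} f"
  unfolding set_integrable_def
proof (rule Bochner_Integration.integrable_bound)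
  show "integrable lborel (\<lambda>s. indicator {a..b} s * B)"
    using borel_integrable_atLeastAtMost'[of a b "\<lambda>_. B"] by (simp add: set_integrable_def)
  show "(\<lambda>x. indicator {a..b} x *\<^sub>R f x) \<in> borel_measurable lborel"
    using assms(1) by simp
  show "AE x in lborel. norm (indicator {a..b} x *\<^sub>R f x) \<le> norm (indicator {a..b} x * B)"
    using assms(2) by (auto simp: indicator_def intro: order_trans[OF _ abs_ge_self])
qed

text \<open>The majorant is the derivative of \<open>B * exp (c * s)\<close>. The subtracted 1
  matters: it leaves room for the initial value when the iterates are bounded.\<close>

lemma integral_exp_bound:
  fixes f :: "real \<Rightarrow> 'b::{banach, second_countable_topology}"
  assumes "\<And>s. s \<in> {0..t} \<Longrightarrow> norm (f s) \<le> B * c * exp (c * s)" "t \<ge> 0"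
  shows "norm (LBINT s:{0..t}. f s) \<le> B * (exp (c * t) - 1)"
proof -
  have ac: "ac (\<lambda>s. B * exp (c * s)) (\<lambda>s. B * c * exp (c * s))"
    by (rule ac_of_C1) (auto intro!: derivative_eq_intros continuous_intros)
  have "norm (LBINT s:{0..t}. f s) \<le> (LBINT s:{0..t}. B * c * exp (c * s))"
    unfolding set_lebesgue_integral_def
    by (rule LINT_norm_le) (use assms(1) ac_set_integrable[OF ac, of 0 t] in \<open>auto simp: indicator_def set_integrable_def\<close>)
  also have "\<dots> = B * exp (c * t) - B * exp (c * 0)" by (rule ac_integral[OF ac assms(2)])
  finally show ?thesis by (simp add: algebra_simps)
qed

lemma geometric_convergence:
  fixes x :: "nat \<Rightarrow> complex"
  assumes "\<And>n. cmod (x (Suc n) - x n) \<le> C / 2 ^ n"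
  shows "x \<longlonglongrightarrow> lim x" and "cmod (lim x - x n) \<le> 2 * C / 2 ^ n"
proof -
  have *: "cmod (x (n + k) - x n) \<le> 2 * C / 2 ^ n - 2 * C / 2 ^ (n + k)" for n k
  proof (induction k)
    case (Suc k)
    have "cmod (x (n + Suc k) - x n) \<le> cmod (x (n + Suc k) - x (n + k)) + cmod (x (n + k) - x n)"
      using norm_triangle_ineq[of "x (n + Suc k) - x (n + k)" "x (n + k) - x n"] by simp
    also have "\<dots> \<le> C / 2 ^ (n + k) + (2 * C / 2 ^ n - 2 * C / 2 ^ (n + k))"
      using assms[of "n + k"] Suc by (intro add_mono) simp_all
    also have "\<dots> = 2 * C / 2 ^ n - 2 * C / 2 ^ (n + Suc k)" by (simp add: field_simps)
    finally show ?case .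
  qed simp
  have C: "C \<ge> 0" using assms[of 0] norm_ge_zero[of "x (Suc 0) - x 0"] by (simp del: norm_ge_zero)
  have **: "cmod (x (n + k) - x n) \<le> 2 * C / 2 ^ n" for n k
  proof -
    have "0 \<le> 2 * C / 2 ^ (n + k)" using C by simp
    then show ?thesis using *[of n k] by linarith
  qed
  have t0: "(\<lambda>n. 2 * C / 2 ^ n) \<longlonglongrightarrow> 0"
    using tendsto_mult_right_zero[OF LIMSEQ_power_zero[of "1/2 :: real"], of "2 * C"] by (simp add: power_divide)
  have "Cauchy x"
  proof (rule metric_CauchyI)
    fix e :: real assume "e > 0"
    then obtain N where N: "2 * C / 2 ^ N < e / 2"
      using order_tendstoD(2)[OF t0, of "e/2"] by (auto simp: eventually_sequentially)
    have "dist (x n) (x N) < e / 2" if "n \<ge> N" for n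
      using **[of N "n - N"] N that by (simp add: dist_norm)
    then have "dist (x m) (x n) < e" if "m \<ge> N" "n \<ge> N" for m n
      using dist_triangle_half_l that by blast
    then show "\<exists>M. \<forall>m\<ge>M. \<forall>n\<ge>M. dist (x m) (x n) < e" by blast
  qed
  then show L: "x \<longlonglongrightarrow> lim x" using Cauchy_convergent convergent_LIMSEQ_iff by blast
  have "(\<lambda>k. cmod (x (k + n) - x n)) \<longlonglongrightarrow> cmod (lim x - x n)"
    by (intro tendsto_intros LIMSEQ_ignore_initial_segment L)
  then show "cmod (lim x - x n) \<le> 2 * C / 2 ^ n"
    by (rule LIMSEQ_le_const2) (use **[of n] in \<open>auto simp: add.commute\<close>)
qed

text \<open>The right-hand side is nonlocal: \<open>F\<close> sees the whole slice at time
  \<open>t\<close>, so the labels are coupled and the Lipschitz condition refers to the supremum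
  norm relative to \<open>w\<close>. Growth is linear and pointwise in the label, which bounds all
  iterates on any time interval although the Lipschitz constant depends on the radius
  \<open>R\<close>.\<close>

locale picard =
  fixes w :: "real \<Rightarrow> real" and z0 :: "real \<Rightarrow> complex" and F :: "(real \<Rightarrow> complex) \<Rightarrow> real \<Rightarrow> real \<Rightarrow> complex"
  assumes z0_measurable [measurable]: "z0 \<in> borel_measurable borel"
    and w_ge_0: "\<And>\<xi>. w \<xi> \<ge> 0"
    and z0_bound: "\<And>\<xi>. cmod (z0 \<xi>) \<le> w \<xi>"
    and F_measurable: "\<And>z. case_prod z \<in> borel_plane \<Longrightarrow>
          (\<lambda>(t, \<xi>). F (z t) t \<xi>) \<in> borel_plane"
    and F_growth: "\<And>T. \<exists>\<kappa>>0. \<forall>t\<in>{0..T}. \<forall>z\<in>borel_measurable borel. \<forall>\<xi>. cmod (F z t \<xi>) \<le> \<kappa> * cmod (z \<xi>)"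
    and F_Lipschitz: "\<And>T R. \<exists>K>0. \<forall>t\<in>{0..T}. \<forall>z\<in>borel_measurable borel. \<forall>z'\<in>borel_measurable borel. \<forall>\<delta>.
          (\<forall>\<xi>. cmod (z \<xi>) \<le> R * w \<xi>) \<longrightarrow> (\<forall>\<xi>. cmod (z' \<xi>) \<le> R * w \<xi>) \<longrightarrow>
          (\<forall>\<xi>. cmod (z \<xi> - z' \<xi>) \<le> \<delta> * w \<xi>) \<longrightarrow> (\<forall>\<xi>. cmod (F z t \<xi> - F z' t \<xi>) \<le> K * \<delta> * w \<xi>)"
begin

definition lip_on :: "real \<Rightarrow> real \<Rightarrow> real \<Rightarrow> bool" where
  "lip_on T R K \<longleftrightarrow> K > 0 \<and> (\<forall>t\<in>{0..T}. \<forall>z\<in>borel_measurable borel. \<forall>z'\<in>borel_measurable borel. \<forall>\<delta>.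
          (\<forall>\<xi>. cmod (z \<xi>) \<le> R * w \<xi>) \<longrightarrow> (\<forall>\<xi>. cmod (z' \<xi>) \<le> R * w \<xi>) \<longrightarrow>
          (\<forall>\<xi>. cmod (z \<xi> - z' \<xi>) \<le> \<delta> * w \<xi>) \<longrightarrow> (\<forall>\<xi>. cmod (F z t \<xi> - F z' t \<xi>) \<le> K * \<delta> * w \<xi>))"

lemma ex_lip_on: "\<exists>K. lip_on T R K"
  using F_Lipschitz[of T R] unfolding lip_on_def by blast

lemma lip_onD:
  assumes "lip_on T R K" "t \<in> {0..T}" "z \<in> borel_measurable borel" "z' \<in> borel_measurable borel"
    "\<And>\<xi>. cmod (z \<xi>) \<le> R * w \<xi>" "\<And>\<xi>. cmod (z' \<xi>) \<le> R * w \<xi>" "\<And>\<xi>. cmod (z \<xi> - z' \<xi>) \<le> \<delta> * w \<xi>"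
  shows "cmod (F z t \<xi> - F z' t \<xi>) \<le> K * \<delta> * w \<xi>"
  using assms unfolding lip_on_def by simp

primrec iter :: "nat \<Rightarrow> real \<Rightarrow> real \<Rightarrow> complex" where
  "iter 0 t \<xi> = z0 \<xi>"
| "iter (Suc n) t \<xi> = z0 \<xi> + (LBINT s:{0..t}. F (iter n s) s \<xi>)"

lemma measurable_step:
  assumes "case_prod z \<in> borel_plane"
  shows "(\<lambda>(t, \<xi>). z0 \<xi> + (LBINT s:{0..t}. F (z s) s \<xi>)) \<in> borel_plane"
proof -
  have m: "case_prod (\<lambda>s \<xi>. F (z s) s \<xi>) \<in> borel_plane"
    using F_measurable[OF assms] by simp
  have [measurable]: "(\<lambda>x. F (z (snd x)) (snd x) (snd (fst x))) \<in> borel_measurable ((borel \<Otimes>\<^sub>M borel) \<Otimes>\<^sub>M lborel)"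
    by (rule measurable_Pair_apply[OF m]) auto
  have "(\<lambda>x. LBINT s. indicator {0..fst x} s *\<^sub>R F (z s) s (snd x)) \<in> borel_plane"
    unfolding indicator_def by (rule lborel.borel_measurable_lebesgue_integral) (simp add: case_prod_beta')
  then show ?thesis by (simp add: set_lebesgue_integral_def case_prod_beta')
qed

lemma iter_measurable: "case_prod (iter n) \<in> borel_plane"
proof (induction n)
  case (Suc n)
  from measurable_step[OF this] show ?case by (simp add: case_prod_beta')
qed (simp add: case_prod_beta')

lemma slice_measurable:
  fixes z :: "real \<Rightarrow> real \<Rightarrow> complex"
  assumes "case_prod z \<in> borel_plane"
  shows "z t \<in> borel_measurable borel" and "(\<lambda>s. F (z s) s \<xi>) \<in> borel_measurable borel"
proof -
  show "z t \<in> borel_measurable borel" by (rule measurable_Pair_apply[OF assms]) auto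
  have "case_prod (\<lambda>s \<xi>. F (z s) s \<xi>) \<in> borel_plane"
    using F_measurable[OF assms] by simp
  then show "(\<lambda>s. F (z s) s \<xi>) \<in> borel_measurable borel" by (rule measurable_Pair_apply) auto
qed

text \<open>Linear growth keeps every iterate below \<open>w * exp (\<kappa> * t)\<close>, so one
  ball, and with it one Lipschitz constant, serves all iterates.\<close>

lemma iter_bound:
  assumes "T \<ge> 0"
  shows "\<exists>R\<ge>1. \<forall>n. \<forall>t\<in>{0..T}. \<forall>\<xi>. cmod (iter n t \<xi>) \<le> R * w \<xi>"
proof -
  obtain \<kappa> where \<kappa>: "\<kappa> > 0" "\<And>t z \<xi>. t \<in> {0..T} \<Longrightarrow> z \<in> borel_measurable borel \<Longrightarrow> cmod (F z t \<xi>) \<le> \<kappa> * cmod (z \<xi>)"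
    using F_growth[of T] by blast
  have *: "cmod (iter n t \<xi>) \<le> w \<xi> * exp (\<kappa> * t)" if "t \<in> {0..T}" for n t \<xi>
    using that
  proof (induction n arbitrary: t)
    case 0
    have "w \<xi> * 1 \<le> w \<xi> * exp (\<kappa> * t)" using 0 \<kappa>(1) by (intro mult_left_mono w_ge_0) auto
    then show ?case using z0_bound[of \<xi>] by simp
  next
    case (Suc n)
    have "cmod (F (iter n s) s \<xi>) \<le> w \<xi> * \<kappa> * exp (\<kappa> * s)" if "s \<in> {0..t}" for s
    proof -
      have "s \<in> {0..T}" using that Suc.prems by auto
      then have "cmod (F (iter n s) s \<xi>) \<le> \<kappa> * cmod (iter n s \<xi>)"
        by (rule \<kappa>(2)) (rule slice_measurable[OF iter_measurable])
      also have "\<dots> \<le> \<kappa> * (w \<xi> * exp (\<kappa> * s))" using Suc.IH[OF \<open>s \<in> {0..T}\<close>] \<kappa>(1) by simp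
      finally show ?thesis by (simp add: mult_ac)
    qed
    then have "cmod (LBINT s:{0..t}. F (iter n s) s \<xi>) \<le> w \<xi> * (exp (\<kappa> * t) - 1)"
      using Suc.prems by (intro integral_exp_bound) auto
    then have "cmod (iter (Suc n) t \<xi>) \<le> w \<xi> + w \<xi> * (exp (\<kappa> * t) - 1)"
      using z0_bound[of \<xi>] by (auto intro: norm_triangle_le)
    then show ?case by (simp add: algebra_simps)
  qed
  show ?thesis
  proof (intro exI[of _ "exp (\<kappa> * T)"] conjI allI ballI)
    fix n t \<xi> assume t: "t \<in> {0..T}"
    have "w \<xi> * exp (\<kappa> * t) \<le> w \<xi> * exp (\<kappa> * T)" using t \<kappa>(1) by (intro mult_left_mono w_ge_0) auto
    then show "cmod (iter n t \<xi>) \<le> exp (\<kappa> * T) * w \<xi>" using *[OF t, of n \<xi>] by (simp add: mult.commute)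
  qed (use assms \<kappa>(1) in simp)
qed

lemma F_integrable:
  assumes z: "case_prod z \<in> borel_plane" and T: "t \<in> {0..T}"
    and R: "\<And>s \<xi>. s \<in> {0..T} \<Longrightarrow> cmod (z s \<xi>) \<le> R * w \<xi>"
  shows "set_integrable lborel {0..t} (\<lambda>s. F (z s) s \<xi>)"
proof -
  obtain \<kappa> where \<kappa>: "\<kappa> > 0" "\<And>t z \<xi>. t \<in> {0..T} \<Longrightarrow> z \<in> borel_measurable borel \<Longrightarrow> cmod (F z t \<xi>) \<le> \<kappa> * cmod (z \<xi>)"
    using F_growth[of T] by blast
  show ?thesis
  proof (rule set_integrable_bounded_Icc[OF slice_measurable(2)[OF z]])
    fix s assume "s \<in> {0..t}"
    then have s: "s \<in> {0..T}" using T by auto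
    have "cmod (F (z s) s \<xi>) \<le> \<kappa> * cmod (z s \<xi>)" by (rule \<kappa>(2)[OF s slice_measurable(1)[OF z]])
    also have "\<dots> \<le> \<kappa> * (R * w \<xi>)" using R[OF s] \<kappa>(1) by simp
    finally show "cmod (F (z s) s \<xi>) \<le> \<kappa> * (R * w \<xi>)" .
  qed
qed

text \<open>The time weight \<open>exp (2 * K * t)\<close> makes the integral operator a contraction
  with factor 1/2 on all of \<open>[0, T]\<close>, without a restriction to short times.\<close>

lemma step_contraction:
  assumes z: "case_prod z \<in> borel_plane" and z': "case_prod z' \<in> borel_plane"
    and t: "t \<in> {0..T}"
    and R: "\<And>s \<xi>. s \<in> {0..T} \<Longrightarrow> cmod (z s \<xi>) \<le> R * w \<xi>" "\<And>s \<xi>. s \<in> {0..T} \<Longrightarrow> cmod (z' s \<xi>) \<le> R * w \<xi>"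
    and K: "lip_on T R K"
    and d: "\<And>s \<xi>. s \<in> {0..T} \<Longrightarrow> cmod (z s \<xi> - z' s \<xi>) \<le> B * exp (2 * K * s) * w \<xi>"
  shows "cmod ((LBINT s:{0..t}. F (z s) s \<xi>) - (LBINT s:{0..t}. F (z' s) s \<xi>)) \<le> B / 2 * exp (2 * K * t) * w \<xi>"
proof -
  have "0 \<le> B * exp (2 * K * t) * w \<xi>" using d[OF t, of \<xi>] by (meson norm_ge_zero order_trans)
  then have "0 * exp (2 * K * t) \<le> (B * w \<xi>) * exp (2 * K * t)" by (simp add: mult_ac)
  then have B: "0 \<le> B * w \<xi>" by (rule mult_right_le_imp_le) simp
  have "(LBINT s:{0..t}. F (z s) s \<xi>) - (LBINT s:{0..t}. F (z' s) s \<xi>) = (LBINT s:{0..t}. F (z s) s \<xi> - F (z' s) s \<xi>)"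
    by (rule set_integral_diff(2)[symmetric]; rule F_integrable[OF _ t R(1)] F_integrable[OF _ t R(2)]; use z z' in simp)
  also have "cmod \<dots> \<le> (B / 2 * w \<xi>) * (exp (2 * K * t) - 1)"
  proof (rule integral_exp_bound)
    fix s assume "s \<in> {0..t}"
    then have s: "s \<in> {0..T}" using t by auto
    have "cmod (F (z s) s \<xi> - F (z' s) s \<xi>) \<le> K * (B * exp (2 * K * s)) * w \<xi>"
      by (rule lip_onD[OF K s]) (use slice_measurable(1)[OF z] slice_measurable(1)[OF z'] R[OF s] d[OF s] in auto)
    then show "cmod (F (z s) s \<xi> - F (z' s) s \<xi>) \<le> B / 2 * w \<xi> * (2 * K) * exp (2 * K * s)"
      by (simp add: mult_ac)
  qed (use t in auto)
  also have "\<dots> \<le> B / 2 * exp (2 * K * t) * w \<xi>" using B by (simp add: algebra_simps)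
  finally show ?thesis .
qed

theorem picard_solution:
  obtains z where "case_prod z \<in> borel_plane"
    "\<And>t \<xi>. t \<ge> 0 \<Longrightarrow> z t \<xi> = z0 \<xi> + (LBINT s:{0..t}. F (z s) s \<xi>)"
    "\<And>T. T \<ge> 0 \<Longrightarrow> \<exists>R\<ge>1. \<forall>t\<in>{0..T}. \<forall>\<xi>. cmod (z t \<xi>) \<le> R * w \<xi>"
proof -
  \<comment> \<open>The limit is defined pointwise and independently of the time horizon, which
    enters only the estimates; measurability is that of a limit of measurable functions.\<close>
  define z where "z t \<xi> = lim (\<lambda>n. iter n t \<xi>)" for t \<xi>
  have key: "\<exists>R K B. R \<ge> 1 \<and> lip_on T R K \<and> (\<forall>n. \<forall>t\<in>{0..T}. \<forall>\<xi>. cmod (iter n t \<xi>) \<le> R * w \<xi>) \<and>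
     (\<forall>n. \<forall>t\<in>{0..T}. \<forall>\<xi>. cmod (iter (Suc n) t \<xi> - iter n t \<xi>) \<le> B / 2 ^ n * exp (2 * K * t) * w \<xi>)" if T: "T \<ge> 0" for T
  proof -
    obtain R where R: "R \<ge> 1" "\<And>n t \<xi>. t \<in> {0..T} \<Longrightarrow> cmod (iter n t \<xi>) \<le> R * w \<xi>"
      using iter_bound[OF T] by blast
    obtain K where K: "lip_on T R K"
      using ex_lip_on by blast
    have K0: "K > 0" using K by (simp add: lip_on_def)
    have "cmod (iter (Suc n) t \<xi> - iter n t \<xi>) \<le> 2 * R / 2 ^ n * exp (2 * K * t) * w \<xi>" if "t \<in> {0..T}" for n t \<xi>
      using that
    proof (induction n arbitrary: t \<xi>)
      case 0
      have "cmod (iter (Suc 0) t \<xi> - iter 0 t \<xi>) \<le> cmod (iter (Suc 0) t \<xi>) + cmod (iter 0 t \<xi>)"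
        by (rule norm_triangle_ineq4)
      also have "\<dots> \<le> R * w \<xi> + R * w \<xi>" by (intro add_mono R 0)
      also have "\<dots> = 2 * R * 1 * w \<xi>" by simp
      also have "\<dots> \<le> 2 * R * exp (2 * K * t) * w \<xi>"
        using R(1) K0 0 by (intro mult_right_mono mult_left_mono w_ge_0) auto
      finally show ?case by simp
    next
      case (Suc n)
      have "iter (Suc (Suc n)) t \<xi> - iter (Suc n) t \<xi>
          = (LBINT s:{0..t}. F (iter (Suc n) s) s \<xi>) - (LBINT s:{0..t}. F (iter n s) s \<xi>)"
        by (simp only: iter.simps add_diff_cancel_left)
      also have "cmod \<dots> \<le> (2 * R / 2 ^ n) / 2 * exp (2 * K * t) * w \<xi>"
        by (rule step_contraction[OF iter_measurable iter_measurable Suc.prems R(2) R(2) K Suc.IH])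
      finally show ?case by (simp add: field_simps)
    qed
    then have "\<forall>n. \<forall>t\<in>{0..T}. \<forall>\<xi>. cmod (iter (Suc n) t \<xi> - iter n t \<xi>) \<le> 2 * R / 2 ^ n * exp (2 * K * t) * w \<xi>" by blast
    then show ?thesis using R K by blast
  qed
  have zm: "case_prod z \<in> borel_plane"
  proof -
    have "(\<lambda>x. lim (\<lambda>n. case_prod (iter n) x)) \<in> borel_plane"
      by (rule borel_measurable_lim_metric) (rule iter_measurable)
    then show ?thesis by (simp add: z_def case_prod_beta')
  qed
  have main: "(\<forall>t\<in>{0..T}. \<forall>\<xi>. z t \<xi> = z0 \<xi> + (LBINT s:{0..t}. F (z s) s \<xi>)) \<and>
      (\<exists>R\<ge>1. \<forall>t\<in>{0..T}. \<forall>\<xi>. cmod (z t \<xi>) \<le> R * w \<xi>)" if T: "T \<ge> 0" for T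
  proof -
    obtain R K B where R: "R \<ge> 1" "\<And>n t \<xi>. t \<in> {0..T} \<Longrightarrow> cmod (iter n t \<xi>) \<le> R * w \<xi>"
      and K: "lip_on T R K"
      and B: "\<And>n t \<xi>. t \<in> {0..T} \<Longrightarrow> cmod (iter (Suc n) t \<xi> - iter n t \<xi>) \<le> B / 2 ^ n * exp (2 * K * t) * w \<xi>"
      using key[OF T] by blast
    have dz: "(\<lambda>n. iter n t \<xi>) \<longlonglongrightarrow> z t \<xi>" "cmod (z t \<xi> - iter n t \<xi>) \<le> 2 * B / 2 ^ n * exp (2 * K * t) * w \<xi>"
      if t: "t \<in> {0..T}" for t \<xi> n
    proof -
      have "cmod (iter (Suc n) t \<xi> - iter n t \<xi>) \<le> (B * exp (2 * K * t) * w \<xi>) / 2 ^ n" for n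
        using B[OF t, of n \<xi>] by simp
      note c = geometric_convergence[OF this]
      show "(\<lambda>n. iter n t \<xi>) \<longlonglongrightarrow> z t \<xi>" unfolding z_def by (rule c(1))
      show "cmod (z t \<xi> - iter n t \<xi>) \<le> 2 * B / 2 ^ n * exp (2 * K * t) * w \<xi>"
        using c(2)[of n] by (simp add: z_def mult_ac)
    qed
    have Rz: "cmod (z t \<xi>) \<le> R * w \<xi>" if "t \<in> {0..T}" for t \<xi>
      by (rule LIMSEQ_le_const2[OF tendsto_norm[OF dz(1)[OF that]]]) (use R(2)[OF that] in auto)
    have "z t \<xi> = z0 \<xi> + (LBINT s:{0..t}. F (z s) s \<xi>)" if t: "t \<in> {0..T}" for t \<xi>
    proof -
      let ?e = "\<lambda>n. 2 * B / 2 ^ n / 2 * exp (2 * K * t) * w \<xi>"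
      have "cmod ((LBINT s:{0..t}. F (z s) s \<xi>) - (LBINT s:{0..t}. F (iter n s) s \<xi>)) \<le> ?e n" for n
        by (rule step_contraction[OF zm iter_measurable t Rz R(2) K]) (use dz(2) in auto)
      then have le: "norm (iter (Suc n) t \<xi> - (z0 \<xi> + (LBINT s:{0..t}. F (z s) s \<xi>))) \<le> ?e n" for n
        by (simp add: norm_minus_commute)
      have "(\<lambda>n. (1 / 2) ^ n * (B * exp (2 * K * t) * w \<xi>)) \<longlonglongrightarrow> 0"
        by (rule tendsto_mult_left_zero[OF LIMSEQ_power_zero]) simp
      then have e: "?e \<longlonglongrightarrow> 0" by (simp add: power_divide mult_ac)
      have "(\<lambda>n. iter (Suc n) t \<xi> - (z0 \<xi> + (LBINT s:{0..t}. F (z s) s \<xi>))) \<longlonglongrightarrow> 0"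
        by (rule Lim_null_comparison[OF _ e]) (use le in auto)
      then have "(\<lambda>n. iter (Suc n) t \<xi>) \<longlonglongrightarrow> z0 \<xi> + (LBINT s:{0..t}. F (z s) s \<xi>)"
        by (rule LIM_zero_cancel)
      then show ?thesis using LIMSEQ_unique[OF LIMSEQ_Suc[OF dz(1)[OF t]]] by blast
    qed
    then show ?thesis using R(1) Rz by blast
  qed
  show ?thesis
  proof (rule that[OF zm])
    show "z t \<xi> = z0 \<xi> + (LBINT s:{0..t}. F (z s) s \<xi>)" if "t \<ge> 0" for t \<xi>
      using main[OF that] that by auto
    show "\<exists>R\<ge>1. \<forall>t\<in>{0..T}. \<forall>\<xi>. cmod (z t \<xi>) \<le> R * w \<xi>" if "T \<ge> 0" for T
      using main[OF that] by blast
  qed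
qed

end

text \<open>The pair is coded as the complex number \<open>p + i r\<close>. Clipping the pressure at
  \<open>M\<close> gives linear growth, and the lower bound with \<open>D\<close> in the kernel
  gives the Lipschitz estimate; by monotonicity the levels at the final time serve the whole
  interval.\<close>

lemma (in label_weight) clipped_solution:
  fixes M D :: "real \<Rightarrow> real"
  assumes M: "mono M" "\<And>t. M t \<ge> 0" and D: "mono D"
  obtains p r where "case_prod p \<in> borel_plane" "case_prod r \<in> borel_plane"
    "\<And>t \<xi>. t \<ge> 0 \<Longrightarrow> p t \<xi> = 1 + (LBINT s:{0..t}. r s \<xi> / 2)"
    "\<And>t \<xi>. t \<ge> 0 \<Longrightarrow> r t \<xi> = g \<xi> +
        (LBINT s:{0..t}. - (min (M s) (kerint (\<lambda>_ _. 1) l (D s) (p s) (r s) \<xi> / (4 * l)) * p s \<xi>))"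
    "\<And>T. T \<ge> 0 \<Longrightarrow> \<exists>R\<ge>1. \<forall>t\<in>{0..T}. \<forall>\<xi>. \<bar>p t \<xi>\<bar> \<le> R * w \<xi> \<and> \<bar>r t \<xi>\<bar> \<le> R * w \<xi>"
proof -
  define P where "P z t \<xi> = min (M t) (kerint (\<lambda>_ _. 1) l (D t) (\<lambda>\<eta>. Re (z \<eta>)) (\<lambda>\<eta>. Im (z \<eta>)) \<xi> / (4 * l))" for z t \<xi>
  define F where "F z t \<xi> = Complex (Im (z \<xi>) / 2) (- (P z t \<xi> * Re (z \<xi>)))" for z t \<xi>
  have Dm: "D \<in> borel_measurable borel" and Mm [measurable]: "M \<in> borel_measurable borel"
    by (rule borel_measurable_mono[OF D] borel_measurable_mono[OF M(1)])+
  have cm: "cmod (Complex a b) \<le> \<bar>a\<bar> + \<bar>b\<bar>" for a b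
    using cmod_le[of "Complex a b"] by simp
  have P: "0 \<le> P z t \<xi>" "P z t \<xi> \<le> M t" for z t \<xi>
  proof -
    have "kerint (\<lambda>_ _. 1) l (D t) (\<lambda>\<eta>. Re (z \<eta>)) (\<lambda>\<eta>. Im (z \<eta>)) \<xi> \<ge> 0"
      unfolding kerint_def by (intro integral_nonneg_AE AE_I2) (simp add: ker_pos less_imp_le)
    then show "0 \<le> P z t \<xi>" "P z t \<xi> \<le> M t" using M(2)[of t] l_pos by (auto simp: P_def)
  qed
  interpret picard w "\<lambda>\<xi>. Complex 1 (g \<xi>)" F
  proof
    have "(\<lambda>\<xi>. 1 + \<i> * of_real (g \<xi>)) \<in> borel_measurable borel" by measurable
    also have "(\<lambda>\<xi>. 1 + \<i> * of_real (g \<xi>)) = (\<lambda>\<xi>. Complex 1 (g \<xi>))" by (simp add: complex_eq_iff fun_eq_iff)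
    finally show "(\<lambda>\<xi>. Complex 1 (g \<xi>)) \<in> borel_measurable borel" .
    show "w \<xi> \<ge> 0" "cmod (Complex 1 (g \<xi>)) \<le> w \<xi>" for \<xi>
      by (auto simp: w_def cmod_def)
  next
    fix z :: "real \<Rightarrow> real \<Rightarrow> complex"
    assume [measurable]: "case_prod z \<in> borel_plane"
    have "(\<lambda>x. Re (case_prod z x)) \<in> borel_plane" "(\<lambda>x. Im (case_prod z x)) \<in> borel_plane"
      by measurable
    then have m: "case_prod (\<lambda>t \<xi>. Re (z t \<xi>)) \<in> borel_plane"
        "case_prod (\<lambda>t \<xi>. Im (z t \<xi>)) \<in> borel_plane"
      by (simp_all add: case_prod_beta')
    have k: "(\<lambda>x. kerint (\<lambda>_ _. 1) l (D (fst x)) (\<lambda>\<xi>. Re (z (fst x) \<xi>)) (\<lambda>\<xi>. Im (z (fst x) \<xi>)) (snd x)) \<in> borel_plane"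
      using measurable_kerint[OF m Dm, of "\<lambda>_ _. 1" l] by (simp add: case_prod_beta')
    have [measurable]: "(\<lambda>x. P (z (fst x)) (fst x) (snd x)) \<in> borel_plane"
      unfolding P_def using k by measurable
    have [measurable]: "(\<lambda>x. z (fst x) (snd x)) \<in> borel_plane"
      using \<open>case_prod z \<in> _\<close> by (simp add: case_prod_beta')
    have "(\<lambda>x. of_real (Im (z (fst x) (snd x)) / 2) + \<i> * of_real (- (P (z (fst x)) (fst x) (snd x) * Re (z (fst x) (snd x)))))
        \<in> borel_plane" by measurable
    then show "(\<lambda>(t, \<xi>). F (z t) t \<xi>) \<in> borel_plane"
      by (simp add: F_def Complex_eq case_prod_beta')
  next
    fix T
    have "cmod (F z t \<xi>) \<le> (1 / 2 + M T) * cmod (z \<xi>)" if "t \<in> {0..T}" for z t \<xi>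
    proof -
      have "cmod (F z t \<xi>) \<le> \<bar>Im (z \<xi>) / 2\<bar> + \<bar>P z t \<xi> * Re (z \<xi>)\<bar>"
        unfolding F_def using cm[of "Im (z \<xi>) / 2" "- (P z t \<xi> * Re (z \<xi>))"] by simp
      also have "\<bar>P z t \<xi> * Re (z \<xi>)\<bar> \<le> M T * cmod (z \<xi>)"
        unfolding abs_mult using P[of z t \<xi>] monoD[OF M(1), of t T] that abs_Re_le_cmod[of "z \<xi>"]
        by (intro mult_mono) auto
      also have "\<bar>Im (z \<xi>) / 2\<bar> \<le> 1 / 2 * cmod (z \<xi>)" using abs_Im_le_cmod[of "z \<xi>"] by simp
      finally show ?thesis by (simp add: algebra_simps)
    qed
    then show "\<exists>\<kappa>>0. \<forall>t\<in>{0..T}. \<forall>z\<in>borel_measurable borel. \<forall>\<xi>. cmod (F z t \<xi>) \<le> \<kappa> * cmod (z \<xi>)"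
      using M(2)[of T] by (intro exI[of _ "1 / 2 + M T"]) auto
  next
    fix T R
    \<comment> \<open>The summands come from \<open>r / 2\<close>, from the variation of the
      pressure times a bound for \<open>p\<close>, and from the clipped pressure times the variation
      of \<open>p\<close>.\<close>
    define K where "K = 1 / 2 + \<bar>lip_const R (D T)\<bar> / (4 * l) * \<bar>R\<bar> + M T"
    have "cmod (F z t \<xi> - F z' t \<xi>) \<le> K * \<delta> * w \<xi>"
      if t: "t \<in> {0..T}" and m [measurable]: "z \<in> borel_measurable borel" "z' \<in> borel_measurable borel"
        and R: "\<And>\<xi>. cmod (z \<xi>) \<le> R * w \<xi>" "\<And>\<xi>. cmod (z' \<xi>) \<le> R * w \<xi>" and d: "\<And>\<xi>. cmod (z \<xi> - z' \<xi>) \<le> \<delta> * w \<xi>"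
      for t z z' \<delta> \<xi>
    proof -
      have "0 \<le> R * w 0" "0 \<le> \<delta> * w 0" using R(1)[of 0] d[of 0] by (meson norm_ge_zero order_trans)+
      then have R0: "R \<ge> 0" and \<delta>0: "\<delta> \<ge> 0" using w_ge_1[of 0] by (simp_all add: zero_le_mult_iff)
      have "lip_const R (D t) \<le> lip_const R (D T)"
      proof -
        have "exp (D t / l) \<le> exp (D T / l)" using t monoD[OF D, of t T] l_pos by (simp add: divide_right_mono)
        moreover have "(LBINT \<eta>. exp (- \<bar>\<eta>\<bar> / (4 * l))) \<ge> 0" by (rule integral_nonneg_AE) simp
        ultimately show ?thesis unfolding lip_const_def
          using R0 l_pos G_nonneg by (intro mult_right_mono mult_left_mono) auto
      qed
      then have L: "lip_const R (D t) \<le> \<bar>lip_const R (D T)\<bar>" by linarith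
      have Re_d: "\<bar>Re (z \<xi>) - Re (z' \<xi>)\<bar> \<le> \<delta> * w \<xi>" "\<bar>Im (z \<xi>) - Im (z' \<xi>)\<bar> \<le> \<delta> * w \<xi>" for \<xi>
        using abs_Re_le_cmod[of "z \<xi> - z' \<xi>"] abs_Im_le_cmod[of "z \<xi> - z' \<xi>"] d[of \<xi>] by auto
      have Re_R: "\<bar>Re (z \<xi>)\<bar> \<le> R * w \<xi>" "\<bar>Im (z \<xi>)\<bar> \<le> R * w \<xi>" "\<bar>Re (z' \<xi>)\<bar> \<le> R * w \<xi>" "\<bar>Im (z' \<xi>)\<bar> \<le> R * w \<xi>" for \<xi>
        using abs_Re_le_cmod[of "z \<xi>"] abs_Im_le_cmod[of "z \<xi>"] abs_Re_le_cmod[of "z' \<xi>"] abs_Im_le_cmod[of "z' \<xi>"] R[of \<xi>]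
        by linarith+
      have dP: "\<bar>P z t \<xi> - P z' t \<xi>\<bar> \<le> \<bar>lip_const R (D T)\<bar> / (4 * l) * \<delta>"
      proof -
        let ?k = "\<lambda>z. kerint (\<lambda>_ _. 1) l (D t) (\<lambda>\<eta>. Re (z \<eta>)) (\<lambda>\<eta>. Im (z \<eta>)) \<xi>"
        have "\<bar>?k z - ?k z'\<bar> \<le> lip_const R (D t) * \<delta>"
          by (rule kerint_Lipschitz) (use Re_d Re_R in auto)
        also have "\<dots> \<le> \<bar>lip_const R (D T)\<bar> * \<delta>" by (intro mult_right_mono L \<delta>0)
        finally have "\<bar>?k z - ?k z'\<bar> / (4 * l) \<le> \<bar>lip_const R (D T)\<bar> * \<delta> / (4 * l)"
          using l_pos by (intro divide_right_mono) auto
        moreover have "\<bar>?k z - ?k z'\<bar> / (4 * l) = \<bar>?k z / (4 * l) - ?k z' / (4 * l)\<bar>"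
          using l_pos by (simp add: diff_divide_distrib[symmetric])
        moreover have "\<bar>P z t \<xi> - P z' t \<xi>\<bar> \<le> \<bar>?k z / (4 * l) - ?k z' / (4 * l)\<bar>"
          unfolding P_def by linarith
        ultimately show ?thesis by simp
      qed
      have "F z t \<xi> - F z' t \<xi> = Complex ((Im (z \<xi>) - Im (z' \<xi>)) / 2) (- (P z t \<xi> * Re (z \<xi>) - P z' t \<xi> * Re (z' \<xi>)))"
        by (simp add: F_def complex_eq_iff diff_divide_distrib)
      then have "cmod (F z t \<xi> - F z' t \<xi>) \<le> \<bar>(Im (z \<xi>) - Im (z' \<xi>)) / 2\<bar> + \<bar>P z t \<xi> * Re (z \<xi>) - P z' t \<xi> * Re (z' \<xi>)\<bar>"
        using cm by (metis abs_minus_cancel)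
      also have "P z t \<xi> * Re (z \<xi>) - P z' t \<xi> * Re (z' \<xi>) = (P z t \<xi> - P z' t \<xi>) * Re (z \<xi>) + P z' t \<xi> * (Re (z \<xi>) - Re (z' \<xi>))"
        by (simp add: algebra_simps)
      also have "\<bar>\<dots>\<bar> \<le> \<bar>lip_const R (D T)\<bar> / (4 * l) * \<delta> * (R * w \<xi>) + M T * (\<delta> * w \<xi>)"
      proof -
        have "\<bar>(P z t \<xi> - P z' t \<xi>) * Re (z \<xi>)\<bar> \<le> \<bar>lip_const R (D T)\<bar> / (4 * l) * \<delta> * (R * w \<xi>)"
          unfolding abs_mult[of "P z t \<xi> - P z' t \<xi>"] by (intro mult_mono dP Re_R) (use l_pos \<delta>0 in auto)
        moreover have "\<bar>P z' t \<xi> * (Re (z \<xi>) - Re (z' \<xi>))\<bar> \<le> M T * (\<delta> * w \<xi>)"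
          unfolding abs_mult[of "P z' t \<xi>"] using P[of z' t \<xi>] monoD[OF M(1), of t T] t M(2)[of T]
          by (intro mult_mono Re_d) auto
        ultimately show ?thesis by linarith
      qed
      also have "\<bar>(Im (z \<xi>) - Im (z' \<xi>)) / 2\<bar> \<le> \<delta> * w \<xi> / 2" using Re_d(2)[of \<xi>] by simp
      finally show ?thesis using R0 by (simp add: K_def algebra_simps)
    qed
    moreover have "K > 0" using M(2)[of T] l_pos by (simp add: K_def add_pos_nonneg)
    ultimately show "\<exists>K>0. \<forall>t\<in>{0..T}. \<forall>z\<in>borel_measurable borel. \<forall>z'\<in>borel_measurable borel. \<forall>\<delta>.
          (\<forall>\<xi>. cmod (z \<xi>) \<le> R * w \<xi>) \<longrightarrow> (\<forall>\<xi>. cmod (z' \<xi>) \<le> R * w \<xi>) \<longrightarrow>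
          (\<forall>\<xi>. cmod (z \<xi> - z' \<xi>) \<le> \<delta> * w \<xi>) \<longrightarrow> (\<forall>\<xi>. cmod (F z t \<xi> - F z' t \<xi>) \<le> K * \<delta> * w \<xi>)"
      by blast
  qed
  obtain z where z: "case_prod z \<in> borel_plane"
    "\<And>t \<xi>. t \<ge> 0 \<Longrightarrow> z t \<xi> = Complex 1 (g \<xi>) + (LBINT s:{0..t}. F (z s) s \<xi>)"
    "\<And>T. T \<ge> 0 \<Longrightarrow> \<exists>R\<ge>1. \<forall>t\<in>{0..T}. \<forall>\<xi>. cmod (z t \<xi>) \<le> R * w \<xi>"
    using picard_solution by blast
  have int: "set_integrable lborel {0..t} (\<lambda>s. F (z s) s \<xi>)" if t: "t \<ge> 0" for t \<xi>
  proof -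
    obtain R where "\<forall>s\<in>{0..t}. \<forall>\<xi>. cmod (z s \<xi>) \<le> R * w \<xi>" using z(3)[OF t] by blast
    then show ?thesis using t by (intro F_integrable[OF z(1), of t t R]) auto
  qed
  show ?thesis
  proof (rule that[of "\<lambda>t \<xi>. Re (z t \<xi>)" "\<lambda>t \<xi>. Im (z t \<xi>)"])
    have "(\<lambda>x. Re (case_prod z x)) \<in> borel_plane" "(\<lambda>x. Im (case_prod z x)) \<in> borel_plane"
      using z(1) by measurable
    then show "case_prod (\<lambda>t \<xi>. Re (z t \<xi>)) \<in> borel_plane"
        "case_prod (\<lambda>t \<xi>. Im (z t \<xi>)) \<in> borel_plane"
      by (simp_all add: case_prod_beta')
    fix t :: real and \<xi> assume t: "t \<ge> 0"
    note i = int[OF t, of \<xi>, unfolded set_integrable_def]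
    have "Re (z t \<xi>) = 1 + (LBINT s. Re (indicator {0..t} s *\<^sub>R F (z s) s \<xi>))"
      using z(2)[OF t, of \<xi>] integral_Re[OF i] by (simp add: set_lebesgue_integral_def)
    then show "Re (z t \<xi>) = 1 + (LBINT s:{0..t}. Im (z s \<xi>) / 2)"
      by (simp add: F_def set_lebesgue_integral_def)
    have "Im (z t \<xi>) = g \<xi> + (LBINT s. Im (indicator {0..t} s *\<^sub>R F (z s) s \<xi>))"
      using z(2)[OF t, of \<xi>] integral_Im[OF i] by (simp add: set_lebesgue_integral_def)
    then show "Im (z t \<xi>) = g \<xi> + (LBINT s:{0..t}. - (min (M s) (kerint (\<lambda>_ _. 1) l (D s) (\<lambda>\<xi>. Re (z s \<xi>)) (\<lambda>\<xi>. Im (z s \<xi>)) \<xi> / (4 * l)) * Re (z s \<xi>)))"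
      by (simp add: F_def P_def set_lebesgue_integral_def)
  next
    fix T :: real assume "T \<ge> 0"
    then obtain R where "R \<ge> 1" and R: "\<forall>t\<in>{0..T}. \<forall>\<xi>. cmod (z t \<xi>) \<le> R * w \<xi>" using z(3) by blast
    have "\<bar>Re (z t \<xi>)\<bar> \<le> R * w \<xi> \<and> \<bar>Im (z t \<xi>)\<bar> \<le> R * w \<xi>" if "t \<in> {0..T}" for t \<xi>
      using R that abs_Re_le_cmod[of "z t \<xi>"] abs_Im_le_cmod[of "z t \<xi>"] by (auto intro: order_trans)
    then show "\<exists>R\<ge>1. \<forall>t\<in>{0..T}. \<forall>\<xi>. \<bar>Re (z t \<xi>)\<bar> \<le> R * w \<xi> \<and> \<bar>Im (z t \<xi>)\<bar> \<le> R * w \<xi>"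
      using \<open>R \<ge> 1\<close> by blast
  qed
qed

section \<open>The characteristic system\<close>

lemma slice_borel:
  fixes f :: "real \<Rightarrow> real \<Rightarrow> real"
  assumes "case_prod f \<in> borel_plane"
  shows "f t \<in> borel_measurable borel" and "(\<lambda>s. f s \<xi>) \<in> borel_measurable borel"
  by (rule measurable_Pair_apply[OF assms]; simp)+

lemma time_integral_Lipschitz:
  fixes \<phi> :: "real \<Rightarrow> real"
  assumes "\<phi> \<in> borel_measurable borel" "\<And>s. s \<in> {0..T} \<Longrightarrow> \<bar>\<phi> s\<bar> \<le> B" "s \<in> {0..T}" "t \<in> {0..T}"
  shows "\<bar>(LBINT s:{0..t}. \<phi> s) - (LBINT s:{0..s}. \<phi> s)\<bar> \<le> B * \<bar>t - s\<bar>"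
proof -
  have *: "\<bar>(LBINT s:{0..t}. \<phi> s) - (LBINT s:{0..s}. \<phi> s)\<bar> \<le> B * \<bar>t - s\<bar>"
    if st: "s \<in> {0..T}" "t \<in> {0..T}" "s \<le> t" for s t
  proof -
    have i: "set_integrable lborel {a..b} \<phi>" if "{a..b} \<subseteq> {0..T}" for a b
      by (rule set_integrable_bounded_Icc[OF assms(1), of _ _ B]) (use that assms(2) in auto)
    have "(\<phi> has_integral (LBINT s:{0..s}. \<phi> s)) {0..s}" "(\<phi> has_integral (LBINT s:{0..t}. \<phi> s)) {0..t}"
      "(\<phi> has_integral (LBINT s:{s..t}. \<phi> s)) {s..t}"
      by (subst set_borel_integral_eq_integral(2); use i st in \<open>auto intro!: integrable_integral set_borel_integral_eq_integral(1)\<close>)+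
    from has_integral_unique[OF has_integral_combine[OF _ _ this(1,3)] this(2)]
    have "(LBINT s:{0..t}. \<phi> s) - (LBINT s:{0..s}. \<phi> s) = (LBINT s:{s..t}. \<phi> s)"
      using st by simp
    also have "\<bar>\<dots>\<bar> \<le> (LBINT s:{s..t}. B)"
      unfolding set_lebesgue_integral_def
      by (rule LINT_abs_le)
        (use assms(2) st borel_integrable_atLeastAtMost'[of s t "\<lambda>_. B"] in \<open>auto simp: indicator_def set_integrable_def\<close>)
    also have "\<dots> = B * (t - s)" using st by (simp add: set_lebesgue_integral_def)
    finally show ?thesis using st by simp
  qed
  show ?thesis using *[of s t] *[of t s] assms(3,4) by (cases "s \<le> t") (auto simp: abs_minus_commute)
qed

lemma Lipschitz_imp_continuous_on:
  fixes f :: "real \<Rightarrow> real"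
  assumes "\<And>s t. s \<in> A \<Longrightarrow> t \<in> A \<Longrightarrow> \<bar>f t - f s\<bar> \<le> B * \<bar>t - s\<bar>"
  shows "continuous_on A f"
proof (cases "A = {}")
  case False
  then have "(max B 0)-lipschitz_on A f"
  proof (intro lipschitz_onI)
    fix x y assume "x \<in> A" "y \<in> A"
    then have "\<bar>f x - f y\<bar> \<le> B * \<bar>x - y\<bar>" using assms by blast
    also have "\<dots> \<le> max B 0 * \<bar>x - y\<bar>" by (intro mult_right_mono) auto
    finally show "dist (f x) (f y) \<le> max B 0 * dist x y" by (simp add: dist_real_def)
  qed auto
  then show ?thesis by (rule lipschitz_on_continuous_on)
qed simp

lemma time_integral_derivative:
  fixes \<phi> :: "real \<Rightarrow> real"
  assumes "continuous_on {0..T} \<phi>" "t \<in> {0..T}"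
  shows "((\<lambda>t. c + (LBINT s:{0..t}. \<phi> s)) has_real_derivative \<phi> t) (at t within {0..T})"
proof -
  have "((\<lambda>t. c + integral {0..t} \<phi>) has_real_derivative \<phi> t) (at t within {0..T})"
    using integral_has_real_derivative[OF assms] by (auto intro!: derivative_eq_intros)
  then show ?thesis
  proof (rule has_field_derivative_transform_within[of _ _ _ _ 1])
    fix u assume "u \<in> {0..T}"
    then have "set_integrable lborel {0..u} \<phi>"
      by (intro borel_integrable_atLeastAtMost' continuous_on_subset[OF assms(1)]) auto
    then show "c + integral {0..u} \<phi> = c + (LBINT s:{0..u}. \<phi> s)"
      by (simp add: set_borel_integral_eq_integral(2))
  qed (use assms in auto)
qed

lemma derivative_imp_LINT:
  fixes F f :: "real \<Rightarrow> real"
  assumes "\<And>s. s \<in> {a..b} \<Longrightarrow> (F has_real_derivative f s) (at s within {a..b})" "a \<le> b"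
    and "f \<in> borel_measurable borel" "\<And>s. s \<in> {a..b} \<Longrightarrow> \<bar>f s\<bar> \<le> B"
  shows "(LBINT s:{a..b}. f s) = F b - F a"
proof -
  have "(f has_integral F b - F a) {a..b}"
    by (rule fundamental_theorem_of_calculus[OF assms(2)])
       (use assms(1) in \<open>simp add: has_real_derivative_iff_has_vector_derivative\<close>)
  moreover have "set_integrable lborel {a..b} f"
    by (rule set_integrable_bounded_Icc[OF assms(3)]) (use assms(4) in auto)
  ultimately show ?thesis by (simp add: set_borel_integral_eq_integral(2) integral_unique)
qed

lemma Fubini_strip:
  fixes f :: "real \<Rightarrow> real \<Rightarrow> real"
  assumes f: "case_prod f \<in> borel_plane"
    and k: "integrable lborel k" and le: "\<And>s \<eta>. s \<in> {a..b} \<Longrightarrow> \<bar>f s \<eta>\<bar> \<le> k \<eta>"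
  shows "(LBINT \<eta>. (LBINT s:{a..b}. f s \<eta>)) = (LBINT s:{a..b}. (LBINT \<eta>. f s \<eta>))"
    and "integrable lborel (\<lambda>\<eta>. LBINT s:{a..b}. f s \<eta>)"
    and "set_integrable lborel {a..b} (\<lambda>s. LBINT \<eta>. f s \<eta>)"
    and "s \<in> {a..b} \<Longrightarrow> integrable lborel (f s)"
proof -
  note sl = slice_borel[OF f]
  have [measurable]: "(\<lambda>x. f (fst x) (snd x)) \<in> borel_plane"
    using f by (simp add: case_prod_beta')
  show ints: "s \<in> {a..b} \<Longrightarrow> integrable lborel (f s)" for s
    by (rule Bochner_Integration.integrable_bound[OF k])
       (use le sl in \<open>auto intro!: AE_I2 order_trans[OF _ abs_ge_self]\<close>)
  define h where "h = (\<lambda>(s, \<eta>). indicator {a..b} s * f s \<eta>)"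
  have [measurable]: "h \<in> borel_measurable (lborel \<Otimes>\<^sub>M lborel)"
    unfolding h_def case_prod_beta' by simp
  have h: "integrable (lborel \<Otimes>\<^sub>M lborel) h"
  proof (rule lborel_pair.Fubini_integrable)
    have "integrable lborel (\<lambda>s. indicator {a..b} s * (LBINT \<eta>. k \<eta>))"
      using borel_integrable_atLeastAtMost'[of a b "\<lambda>_. LBINT \<eta>. k \<eta>"] by (simp add: set_integrable_def)
    then show "integrable lborel (\<lambda>s. LBINT \<eta>. norm (h (s, \<eta>)))"
    proof (rule Bochner_Integration.integrable_bound)
      have "(\<lambda>s. LBINT \<eta>. norm (h (s, \<eta>))) \<in> borel_measurable borel"
        by (rule lborel.borel_measurable_lebesgue_integral) (simp add: case_prod_beta')
      then show "(\<lambda>s. LBINT \<eta>. norm (h (s, \<eta>))) \<in> borel_measurable lborel" by simp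
      show "AE s in lborel. norm (LBINT \<eta>. norm (h (s, \<eta>))) \<le> norm (indicator {a..b} s * (LBINT \<eta>. k \<eta>))"
      proof (intro AE_I2)
        fix s
        show "norm (LBINT \<eta>. norm (h (s, \<eta>))) \<le> norm (indicator {a..b} s * (LBINT \<eta>. k \<eta>))"
        proof (cases "s \<in> {a..b}")
          case True
          have "norm (LBINT \<eta>. norm (h (s, \<eta>))) \<le> (LBINT \<eta>. k \<eta>)"
            by (rule LINT_norm_le[OF k]) (use True le in \<open>auto simp: h_def\<close>)
          then show ?thesis using True by simp
        qed (simp add: h_def)
      qed
    qed
    show "AE s in lborel. integrable lborel (\<lambda>\<eta>. h (s, \<eta>))"
      using ints by (intro AE_I2) (auto simp: h_def indicator_def)
  qed simp
  show "(LBINT \<eta>. (LBINT s:{a..b}. f s \<eta>)) = (LBINT s:{a..b}. (LBINT \<eta>. f s \<eta>))"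
    using lborel_pair.Fubini_integral[of "\<lambda>s \<eta>. h (s, \<eta>)"] h
    by (simp add: h_def set_lebesgue_integral_def)
  show "integrable lborel (\<lambda>\<eta>. LBINT s:{a..b}. f s \<eta>)"
    using lborel_pair.integrable_snd[of "\<lambda>s \<eta>. h (s, \<eta>)"] h by (simp add: h_def set_lebesgue_integral_def)
  show "set_integrable lborel {a..b} (\<lambda>s. LBINT \<eta>. f s \<eta>)"
    using lborel_pair.integrable_fst'[OF h] by (simp add: h_def set_integrable_def)
qed

text \<open>Unlike \<open>ker\<close>, the kernels of \<open>P\<close> and \<open>Q\<close> carry no lower bound on the distance of the labels.\<close>

definition lagP :: "real \<Rightarrow> (real \<Rightarrow> real) \<Rightarrow> (real \<Rightarrow> real) \<Rightarrow> real \<Rightarrow> real" where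
  "lagP l p r \<xi> = (LBINT \<eta>. exp (- \<bar>sint (\<lambda>s. (p s)\<^sup>2) \<xi> - sint (\<lambda>s. (p s)\<^sup>2) \<eta>\<bar> / l) * (r \<eta>)\<^sup>2) / (4 * l)"

text \<open>This is \<open>-l^2 P_x\<close> along the characteristics. The sign is taken from the
  labels, not from the positions, so energy concentrated at one position, where \<open>p\<close>
  vanishes and \<open>r\<close> does not, is split according to the order of its labels.\<close>

definition lagQ :: "real \<Rightarrow> (real \<Rightarrow> real) \<Rightarrow> (real \<Rightarrow> real) \<Rightarrow> real \<Rightarrow> real" where
  "lagQ l p r \<xi> = (LBINT \<eta>. (if \<eta> \<le> \<xi> then 1 else -1) *
      exp (- \<bar>sint (\<lambda>s. (p s)\<^sup>2) \<xi> - sint (\<lambda>s. (p s)\<^sup>2) \<eta>\<bar> / l) * (r \<eta>)\<^sup>2) / 4"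

lemma measurable_lagPQ:
  assumes p: "case_prod p \<in> borel_plane" and r: "case_prod r \<in> borel_plane"
  shows "case_prod (\<lambda>t. lagP l (p t) (r t)) \<in> borel_plane"
    and "case_prod (\<lambda>t. lagQ l (p t) (r t)) \<in> borel_plane"
proof -
  have "case_prod (\<lambda>t s. (p t s)\<^sup>2) = (\<lambda>x. (case_prod p x)\<^sup>2)" by auto
  then have "case_prod (\<lambda>t s. (p t s)\<^sup>2) \<in> borel_plane"
    using p by simp
  note S = measurable_sint[OF this]
  have [measurable]: "(\<lambda>x. sint (\<lambda>s. (p (fst (fst x)) s)\<^sup>2) (snd (fst x))) \<in> borel_measurable ((borel \<Otimes>\<^sub>M borel) \<Otimes>\<^sub>M borel)"
    "(\<lambda>x. sint (\<lambda>s. (p (fst (fst x)) s)\<^sup>2) (snd x)) \<in> borel_measurable ((borel \<Otimes>\<^sub>M borel) \<Otimes>\<^sub>M borel)"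
    "(\<lambda>x. r (fst (fst x)) (snd x)) \<in> borel_measurable ((borel \<Otimes>\<^sub>M borel) \<Otimes>\<^sub>M borel)"
    by (rule measurable_Pair_apply[OF S] measurable_Pair_apply[OF r]; simp)+
  have "(\<lambda>x. LBINT \<eta>. exp (- \<bar>sint (\<lambda>s. (p (fst x) s)\<^sup>2) (snd x) - sint (\<lambda>s. (p (fst x) s)\<^sup>2) \<eta>\<bar> / l) * (r (fst x) \<eta>)\<^sup>2)
      \<in> borel_plane"
    by (rule lborel.borel_measurable_lebesgue_integral) (simp add: case_prod_beta')
  then show "case_prod (\<lambda>t. lagP l (p t) (r t)) \<in> borel_plane"
    by (simp add: lagP_def case_prod_beta')
  have "(\<lambda>x. LBINT \<eta>. (if \<eta> \<le> snd x then 1 else -1) *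
      exp (- \<bar>sint (\<lambda>s. (p (fst x) s)\<^sup>2) (snd x) - sint (\<lambda>s. (p (fst x) s)\<^sup>2) \<eta>\<bar> / l) * (r (fst x) \<eta>)\<^sup>2)
      \<in> borel_plane"
    by (rule lborel.borel_measurable_lebesgue_integral) (simp add: case_prod_beta')
  then show "case_prod (\<lambda>t. lagQ l (p t) (r t)) \<in> borel_plane"
    by (simp add: lagQ_def case_prod_beta')
qed

lemma measurable_time_integral:
  fixes f :: "real \<Rightarrow> real \<Rightarrow> real"
  assumes f: "case_prod f \<in> borel_plane"
  shows "case_prod (\<lambda>t \<xi>. LBINT s:{0..t}. f s \<xi>) \<in> borel_plane"
proof -
  have [measurable]: "(\<lambda>x. f (snd x) (snd (fst x))) \<in> borel_measurable ((borel \<Otimes>\<^sub>M borel) \<Otimes>\<^sub>M lborel)"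
    by (rule measurable_Pair_apply[OF f]) auto
  have "(\<lambda>x. LBINT s. indicator {0..fst x} s * f s (snd x)) \<in> borel_plane"
    unfolding indicator_def by (rule lborel.borel_measurable_lebesgue_integral) (simp add: case_prod_beta')
  then show ?thesis by (simp add: set_lebesgue_integral_def case_prod_beta')
qed

text \<open>The squares \<open>p\<^sup>2\<close>, \<open>p r\<close> and \<open>r\<^sup>2\<close> are \<open>y\<^sub>\<xi>\<close>, \<open>U\<^sub>\<xi>\<close> and the energy density \<open>u\<^sub>x\<^sup>2 y\<^sub>\<xi>\<close> in the labels \<open>\<xi>\<close>;
  in these variables the flow is the linear system \<open>p' = r/2\<close>, \<open>r' = -P p\<close> and continues through the
  times where \<open>p\<close> vanishes, that is, where \<open>u\<^sub>x = r/p\<close> blows up.\<close>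

locale flow = label_weight l g for l g +
  fixes v0 :: "real \<Rightarrow> real" and p r :: "real \<Rightarrow> real \<Rightarrow> real" and m T R D :: real
  assumes v0: "ac v0 g" and v0_bound: "\<And>x. \<bar>v0 x\<bar> \<le> m"
    and p_measurable: "case_prod p \<in> borel_plane"
    and r_measurable: "case_prod r \<in> borel_plane"
    and T_nonneg: "T \<ge> 0" and R_ge_1: "R \<ge> 1" and D_nonneg: "D \<ge> 0"
    and p_bound: "\<And>t \<xi>. t \<in> {0..T} \<Longrightarrow> \<bar>p t \<xi>\<bar> \<le> R * w \<xi>"
    and r_bound: "\<And>t \<xi>. t \<in> {0..T} \<Longrightarrow> \<bar>r t \<xi>\<bar> \<le> R * w \<xi>"
    and growth: "\<And>t \<xi> \<eta>. t \<in> {0..T} \<Longrightarrow> \<bar>\<xi> - \<eta>\<bar> / 2 - D \<le> \<bar>sint (\<lambda>s. (p t s)\<^sup>2) \<xi> - sint (\<lambda>s. (p t s)\<^sup>2) \<eta>\<bar>"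
    and p_eq: "\<And>t \<xi>. t \<in> {0..T} \<Longrightarrow> p t \<xi> = 1 + (LBINT s:{0..t}. r s \<xi> / 2)"
    and r_eq: "\<And>t \<xi>. t \<in> {0..T} \<Longrightarrow> r t \<xi> = g \<xi> + (LBINT s:{0..t}. - (lagP l (p s) (r s) \<xi> * p s \<xi>))"
begin

abbreviation "P t \<equiv> lagP l (p t) (r t)"
abbreviation "Q t \<equiv> lagQ l (p t) (r t)"
abbreviation "S t \<equiv> sint (\<lambda>s. (p t s)\<^sup>2)"
definition U :: "real \<Rightarrow> real \<Rightarrow> real" where "U t \<xi> = v0 \<xi> + (LBINT s:{0..t}. Q s \<xi>)"
definition y :: "real \<Rightarrow> real \<Rightarrow> real" where "y t \<xi> = \<xi> + (LBINT s:{0..t}. U s \<xi>)"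

lemma v0_measurable [measurable]: "v0 \<in> borel_measurable borel"
  by (rule ac_borel[OF v0])

lemma P_measurable: "case_prod (\<lambda>t. P t) \<in> borel_plane"
  and Q_measurable: "case_prod (\<lambda>t. Q t) \<in> borel_plane"
  by (rule measurable_lagPQ[OF p_measurable r_measurable])+

lemma U_measurable: "case_prod U \<in> borel_plane"
proof -
  have "(\<lambda>x. v0 (snd x) + case_prod (\<lambda>t \<xi>. LBINT s:{0..t}. Q s \<xi>) x) \<in> borel_plane"
    using measurable_time_integral[OF Q_measurable] by measurable
  then show ?thesis by (simp add: U_def case_prod_beta')
qed

lemma y_measurable: "case_prod y \<in> borel_plane"
proof -
  have "(\<lambda>x. snd x + case_prod (\<lambda>t \<xi>. LBINT s:{0..t}. U s \<xi>) x) \<in> borel_plane"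
    using measurable_time_integral[OF U_measurable] by measurable
  then show ?thesis by (simp add: y_def case_prod_beta')
qed

lemmas p_slice [measurable] = slice_borel[OF p_measurable]
lemmas r_slice [measurable] = slice_borel[OF r_measurable]
lemmas P_slice [measurable] = slice_borel[OF P_measurable]
lemmas Q_slice [measurable] = slice_borel[OF Q_measurable]
lemmas U_slice [measurable] = slice_borel[OF U_measurable]
lemmas y_slice [measurable] = slice_borel[OF y_measurable]

text \<open>By \<open>growth\<close> the clipping of the distance is inactive, so every bound for
  \<open>kerint\<close> passes to \<open>P\<close> and \<open>Q\<close>.\<close>

lemma ker_eq:
  assumes "t \<in> {0..T}"
  shows "ker l D (p t) \<xi> \<eta> = exp (- \<bar>S t \<xi> - S t \<eta>\<bar> / l)"
  using growth[OF assms, of \<xi> \<eta>] by (simp add: ker_def max_def)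

lemma P_eq_kerint: "t \<in> {0..T} \<Longrightarrow> P t \<xi> = kerint (\<lambda>_ _. 1) l D (p t) (r t) \<xi> / (4 * l)"
  by (simp add: lagP_def kerint_def ker_eq)

lemma Q_eq_kerint: "t \<in> {0..T} \<Longrightarrow> Q t \<xi> = kerint (\<lambda>\<xi> \<eta>. if \<eta> \<le> \<xi> then 1 else -1) l D (p t) (r t) \<xi> / 4"
  by (simp add: lagQ_def kerint_def ker_eq)

lemma P_nonneg: "P t \<xi> \<ge> 0"
  using l_pos by (auto simp: lagP_def intro!: divide_nonneg_pos integral_nonneg_AE)

lemma kernel_integrable:
  assumes "t \<in> {0..T}"
  shows "integrable lborel (\<lambda>\<eta>. exp (- \<bar>S t \<xi> - S t \<eta>\<bar> / l) * (r t \<eta>)\<^sup>2)"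
  using kerint_bound(1)[of "p t" "r t" "\<lambda>_ _. 1" \<xi> R D] r_bound[OF assms] by (simp add: ker_eq[OF assms])

lemma abs_Q_le: "t \<in> {0..T} \<Longrightarrow> \<bar>Q t \<xi>\<bar> \<le> l * P t \<xi>"
proof -
  assume t: "t \<in> {0..T}"
  have "\<bar>LBINT \<eta>. (if \<eta> \<le> \<xi> then 1 else -1) * exp (- \<bar>S t \<xi> - S t \<eta>\<bar> / l) * (r t \<eta>)\<^sup>2\<bar>
      \<le> (LBINT \<eta>. exp (- \<bar>S t \<xi> - S t \<eta>\<bar> / l) * (r t \<eta>)\<^sup>2)"
    by (rule LINT_abs_le[OF kernel_integrable[OF t]]) (auto simp: abs_mult)
  then show ?thesis using l_pos by (simp add: lagP_def lagQ_def)
qed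

definition Pmax :: real where "Pmax = R\<^sup>2 * exp (D / l) * kerint_const / (4 * l)"

lemma P_le: "t \<in> {0..T} \<Longrightarrow> P t \<xi> \<le> Pmax"
proof -
  assume t: "t \<in> {0..T}"
  have "\<bar>kerint (\<lambda>_ _. 1) l D (p t) (r t) \<xi>\<bar> \<le> R\<^sup>2 * exp (D / l) * kerint_const"
    by (rule kerint_bound(2)) (use r_bound[OF t] in auto)
  then have "kerint (\<lambda>_ _. 1) l D (p t) (r t) \<xi> \<le> R\<^sup>2 * exp (D / l) * kerint_const" by simp
  then show ?thesis unfolding P_eq_kerint[OF t] Pmax_def using l_pos by (intro divide_right_mono) auto
qed

lemma Pmax_nonneg: "Pmax \<ge> 0"
  using P_le[of 0 0] P_nonneg[of 0 0] T_nonneg by simp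

lemma Q_le: "t \<in> {0..T} \<Longrightarrow> \<bar>Q t \<xi>\<bar> \<le> l * Pmax"
  using abs_Q_le[of t \<xi>] P_le[of t \<xi>] l_pos by (meson mult_left_mono order_trans less_imp_le)

definition Umax :: real where "Umax = m + l * Pmax * T"

lemma U_le:
  assumes "t \<in> {0..T}"
  shows "\<bar>U t \<xi>\<bar> \<le> Umax"
proof -
  have "\<bar>(LBINT s:{0..t}. Q s \<xi>) - (LBINT s:{0..0}. Q s \<xi>)\<bar> \<le> l * Pmax * \<bar>t - 0\<bar>"
    by (rule time_integral_Lipschitz[of _ T]) (use assms Q_le in auto)
  moreover have "(LBINT s:{0..0}. Q s \<xi>) = 0"
    using has_integral_refl(1)[of "\<lambda>s. Q s \<xi>" 0] by (simp add: set_integral_at_point)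
  ultimately have "\<bar>LBINT s:{0..t}. Q s \<xi>\<bar> \<le> l * Pmax * t" using assms by simp
  also have "\<dots> \<le> l * Pmax * T" using assms l_pos Pmax_nonneg by (intro mult_left_mono) auto
  finally show ?thesis using v0_bound[of \<xi>] by (simp add: U_def Umax_def)
qed

lemma Umax_nonneg: "Umax \<ge> 0"
  using U_le[of 0 0] T_nonneg by simp

lemma y_0 [simp]: "y 0 \<xi> = \<xi>" and U_0 [simp]: "U 0 \<xi> = v0 \<xi>"
  by (simp_all add: y_def U_def set_integral_at_point)

lemma U_Lipschitz: "s \<in> {0..T} \<Longrightarrow> t \<in> {0..T} \<Longrightarrow> \<bar>U t \<xi> - U s \<xi>\<bar> \<le> l * Pmax * \<bar>t - s\<bar>"
  using time_integral_Lipschitz[of "\<lambda>s. Q s \<xi>" T "l * Pmax" s t] Q_le by (simp add: U_def)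

lemma y_Lipschitz: "s \<in> {0..T} \<Longrightarrow> t \<in> {0..T} \<Longrightarrow> \<bar>y t \<xi> - y s \<xi>\<bar> \<le> Umax * \<bar>t - s\<bar>"
  using time_integral_Lipschitz[of "\<lambda>s. U s \<xi>" T Umax s t] U_le by (simp add: y_def)

lemma y_id: "t \<in> {0..T} \<Longrightarrow> \<bar>y t \<xi> - \<xi>\<bar> \<le> Umax * T"
  using y_Lipschitz[of 0 t \<xi>] Umax_nonneg T_nonneg by (auto intro: order_trans mult_left_mono)

definition Lip :: real where "Lip = (1 + Pmax) * R"

lemma p_Lipschitz: "s \<in> {0..T} \<Longrightarrow> t \<in> {0..T} \<Longrightarrow> \<bar>p t \<xi> - p s \<xi>\<bar> \<le> Lip * \<bar>t - s\<bar> * w \<xi>"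
proof -
  assume st: "s \<in> {0..T}" "t \<in> {0..T}"
  have "\<bar>r t \<xi> / 2\<bar> \<le> Lip * w \<xi>" if "t \<in> {0..T}" for t
  proof -
    have "\<bar>r t \<xi> / 2\<bar> \<le> 1 * R * w \<xi>" using r_bound[OF that, of \<xi>] by simp
    also have "\<dots> \<le> Lip * w \<xi>" unfolding Lip_def using Pmax_nonneg R_ge_1 w_ge_1[of \<xi>] by (intro mult_right_mono) auto
    finally show ?thesis .
  qed
  from time_integral_Lipschitz[of "\<lambda>s. r s \<xi> / 2" T, OF _ this st] show ?thesis
    by (simp add: p_eq[OF st(1)] p_eq[OF st(2)] mult_ac)
qed

lemma r_Lipschitz: "s \<in> {0..T} \<Longrightarrow> t \<in> {0..T} \<Longrightarrow> \<bar>r t \<xi> - r s \<xi>\<bar> \<le> Lip * \<bar>t - s\<bar> * w \<xi>"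
proof -
  assume st: "s \<in> {0..T}" "t \<in> {0..T}"
  have "\<bar>- (P t \<xi> * p t \<xi>)\<bar> \<le> Lip * w \<xi>" if "t \<in> {0..T}" for t
  proof -
    have "\<bar>- (P t \<xi> * p t \<xi>)\<bar> \<le> Pmax * (R * w \<xi>)"
      using P_le[OF that, of \<xi>] P_nonneg[of t \<xi>] p_bound[OF that, of \<xi>] Pmax_nonneg
      by (auto simp: abs_mult intro!: mult_mono)
    also have "\<dots> \<le> Lip * w \<xi>" unfolding Lip_def mult.assoc[symmetric]
      using Pmax_nonneg R_ge_1 w_ge_1[of \<xi>] by (intro mult_right_mono) auto
    finally show ?thesis .
  qed
  from time_integral_Lipschitz[of "\<lambda>s. - (P s \<xi> * p s \<xi>)" T, OF _ this st] show ?thesis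
    by (simp add: r_eq[OF st(1)] r_eq[OF st(2)] mult_ac)
qed

lemma PQ_Lipschitz:
  assumes st: "s \<in> {0..T}" "t \<in> {0..T}"
  shows "\<bar>P t \<xi> - P s \<xi>\<bar> \<le> lip_const R D * Lip / (4 * l) * \<bar>t - s\<bar>"
    and "\<bar>Q t \<xi> - Q s \<xi>\<bar> \<le> lip_const R D * Lip / 4 * \<bar>t - s\<bar>"
proof -
  have *: "\<bar>kerint \<sigma> l D (p t) (r t) \<xi> - kerint \<sigma> l D (p s) (r s) \<xi>\<bar> \<le> lip_const R D * (Lip * \<bar>t - s\<bar>)"
    if "\<sigma> \<xi> \<in> borel_measurable borel" "\<And>\<eta>. \<bar>\<sigma> \<xi> \<eta>\<bar> \<le> 1" for \<sigma>
    by (rule kerint_Lipschitz) (use that p_bound r_bound p_Lipschitz r_Lipschitz st in auto)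
  show "\<bar>P t \<xi> - P s \<xi>\<bar> \<le> lip_const R D * Lip / (4 * l) * \<bar>t - s\<bar>"
    using *[of "\<lambda>_ _. 1"] l_pos unfolding P_eq_kerint[OF st(1)] P_eq_kerint[OF st(2)]
    by (simp add: diff_divide_distrib[symmetric] divide_right_mono mult.assoc)
  show "\<bar>Q t \<xi> - Q s \<xi>\<bar> \<le> lip_const R D * Lip / 4 * \<bar>t - s\<bar>"
    using *[of "\<lambda>\<xi> \<eta>. if \<eta> \<le> \<xi> then 1 else -1"] unfolding Q_eq_kerint[OF st(1)] Q_eq_kerint[OF st(2)]
    by (simp add: diff_divide_distrib[symmetric] mult.assoc)
qed

lemma time_continuous:
  shows "continuous_on {0..T} (\<lambda>t. p t \<xi>)" "continuous_on {0..T} (\<lambda>t. r t \<xi>)"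
    "continuous_on {0..T} (\<lambda>t. P t \<xi>)" "continuous_on {0..T} (\<lambda>t. Q t \<xi>)"
    "continuous_on {0..T} (\<lambda>t. U t \<xi>)" "continuous_on {0..T} (\<lambda>t. y t \<xi>)"
proof -
  show "continuous_on {0..T} (\<lambda>t. p t \<xi>)"
    by (rule Lipschitz_imp_continuous_on[of _ _ "Lip * w \<xi>"]) (use p_Lipschitz[of _ _ \<xi>] in \<open>simp add: mult_ac\<close>)
  show "continuous_on {0..T} (\<lambda>t. r t \<xi>)"
    by (rule Lipschitz_imp_continuous_on[of _ _ "Lip * w \<xi>"]) (use r_Lipschitz[of _ _ \<xi>] in \<open>simp add: mult_ac\<close>)
qed (rule Lipschitz_imp_continuous_on, rule PQ_Lipschitz U_Lipschitz y_Lipschitz, assumption, assumption)+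

lemma time_derivatives:
  assumes t: "t \<in> {0..T}"
  shows "((\<lambda>t. p t \<xi>) has_real_derivative r t \<xi> / 2) (at t within {0..T})"
    and "((\<lambda>t. r t \<xi>) has_real_derivative - (P t \<xi> * p t \<xi>)) (at t within {0..T})"
    and "((\<lambda>t. U t \<xi>) has_real_derivative Q t \<xi>) (at t within {0..T})"
    and "((\<lambda>t. y t \<xi>) has_real_derivative U t \<xi>) (at t within {0..T})"
proof -
  have "((\<lambda>t. 1 + (LBINT s:{0..t}. r s \<xi> / 2)) has_real_derivative r t \<xi> / 2) (at t within {0..T})"
    by (rule time_integral_derivative[OF _ t]) (intro continuous_intros time_continuous, simp)
  then show "((\<lambda>t. p t \<xi>) has_real_derivative r t \<xi> / 2) (at t within {0..T})"
    by (rule has_field_derivative_transform_within[of _ _ _ _ 1]) (use t p_eq in auto)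
  have "((\<lambda>t. g \<xi> + (LBINT s:{0..t}. - (P s \<xi> * p s \<xi>))) has_real_derivative - (P t \<xi> * p t \<xi>)) (at t within {0..T})"
    by (rule time_integral_derivative[OF _ t]) (intro continuous_intros time_continuous)
  then show "((\<lambda>t. r t \<xi>) has_real_derivative - (P t \<xi> * p t \<xi>)) (at t within {0..T})"
    by (rule has_field_derivative_transform_within[of _ _ _ _ 1]) (use t r_eq in auto)
  show "((\<lambda>t. U t \<xi>) has_real_derivative Q t \<xi>) (at t within {0..T})"
    unfolding U_def by (rule time_integral_derivative[OF time_continuous(4) t])
  show "((\<lambda>t. y t \<xi>) has_real_derivative U t \<xi>) (at t within {0..T})"
    unfolding y_def by (rule time_integral_derivative[OF time_continuous(5) t])
qed

lemma ac_S: "t \<in> {0..T} \<Longrightarrow> ac (S t) (\<lambda>\<xi>. (p t \<xi>)\<^sup>2)"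
  by (rule ac_sint_square[of _ R]) (use p_bound in auto)

lemma S_mono: "t \<in> {0..T} \<Longrightarrow> \<xi> \<le> \<eta> \<Longrightarrow> S t \<xi> \<le> S t \<eta>"
  by (rule ac_mono[OF ac_S]) auto

end

section \<open>Dependence on the label\<close>

lemma ac_left_integral:
  fixes \<phi> :: "real \<Rightarrow> real"
  assumes [measurable]: "\<phi> \<in> borel_measurable borel" and int: "\<And>\<xi>. integrable lborel (\<lambda>\<eta>. indicator {..\<xi>} \<eta> * \<phi> \<eta>)"
  shows "ac (\<lambda>\<xi>. LBINT \<eta>. indicator {..\<xi>} \<eta> * \<phi> \<eta>) \<phi>"
  unfolding ac_def
proof (intro conjI allI impI)
  fix a b :: real assume "a \<le> b"
  show s: "set_integrable lborel {a..b} \<phi>"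
    unfolding set_integrable_def
    by (rule Bochner_Integration.integrable_bound[OF int[of b]]) (auto simp: indicator_def)
  have "(LBINT \<eta>. indicator {..b} \<eta> * \<phi> \<eta>) - (LBINT \<eta>. indicator {..a} \<eta> * \<phi> \<eta>)
      = (LBINT \<eta>. indicator {..b} \<eta> * \<phi> \<eta> - indicator {..a} \<eta> * \<phi> \<eta>)"
    by (rule Bochner_Integration.integral_diff[symmetric, OF int int])
  also have "\<dots> = (LBINT \<eta>:{a..b}. \<phi> \<eta>)"
    unfolding set_lebesgue_integral_def
  proof (rule integral_cong_AE)
    have "AE \<eta> in lborel. \<eta> \<noteq> a" by (rule AE_lborel_singleton)
    then show "AE \<eta> in lborel. indicator {..b} \<eta> * \<phi> \<eta> - indicator {..a} \<eta> * \<phi> \<eta> = indicator {a..b} \<eta> *\<^sub>R \<phi> \<eta>"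
      by eventually_elim (use \<open>a \<le> b\<close> in \<open>auto simp: indicator_def\<close>)
  qed measurable
  finally show "(LBINT \<eta>:{a..b}. \<phi> \<eta>)
      = (LBINT \<eta>. indicator {..b} \<eta> * \<phi> \<eta>) - (LBINT \<eta>. indicator {..a} \<eta> * \<phi> \<eta>)" by simp
qed simp

lemma ac_right_integral:
  fixes \<phi> :: "real \<Rightarrow> real"
  assumes [measurable]: "\<phi> \<in> borel_measurable borel" and int: "\<And>\<xi>. integrable lborel (\<lambda>\<eta>. indicator {\<xi><..} \<eta> * \<phi> \<eta>)"
  shows "ac (\<lambda>\<xi>. LBINT \<eta>. indicator {\<xi><..} \<eta> * \<phi> \<eta>) (\<lambda>\<eta>. - \<phi> \<eta>)"
  unfolding ac_def
proof (intro conjI allI impI)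
  fix a b :: real assume "a \<le> b"
  have "integrable lborel (\<lambda>\<eta>. indicator {a - 1<..} \<eta> * \<phi> \<eta>)" by (rule int)
  then show s: "set_integrable lborel {a..b} (\<lambda>\<eta>. - \<phi> \<eta>)"
    unfolding set_integrable_def
    by (rule Bochner_Integration.integrable_bound) (auto simp: indicator_def)
  have "(LBINT \<eta>. indicator {b<..} \<eta> * \<phi> \<eta>) - (LBINT \<eta>. indicator {a<..} \<eta> * \<phi> \<eta>)
      = (LBINT \<eta>. indicator {b<..} \<eta> * \<phi> \<eta> - indicator {a<..} \<eta> * \<phi> \<eta>)"
    by (rule Bochner_Integration.integral_diff[symmetric, OF int int])
  also have "\<dots> = (LBINT \<eta>:{a..b}. - \<phi> \<eta>)"
    unfolding set_lebesgue_integral_def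
  proof (rule integral_cong_AE)
    have "AE \<eta> in lborel. \<eta> \<noteq> a" by (rule AE_lborel_singleton)
    then show "AE \<eta> in lborel. indicator {b<..} \<eta> * \<phi> \<eta> - indicator {a<..} \<eta> * \<phi> \<eta> = indicator {a..b} \<eta> *\<^sub>R - \<phi> \<eta>"
      by eventually_elim (use \<open>a \<le> b\<close> in \<open>auto simp: indicator_def\<close>)
  qed measurable
  finally show "(LBINT \<eta>:{a..b}. - \<phi> \<eta>)
      = (LBINT \<eta>. indicator {b<..} \<eta> * \<phi> \<eta>) - (LBINT \<eta>. indicator {a<..} \<eta> * \<phi> \<eta>)" by simp
qed simp

text \<open>If \<open>F s\<close> has label density \<open>\<phi> s\<close> and
  \<open>\<phi>\<close> is the time derivative of \<open>f\<close>, then exchanging the integrals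
  over time and label shows that the time integral of \<open>F\<close> has density
  \<open>f t - f 0\<close>. Applied twice, it gives the densities of \<open>U\<close> from those of
  \<open>Q\<close>, and of \<open>y\<close> from those of \<open>U\<close>.\<close>

lemma (in label_weight) ac_time_integral:
  fixes F \<phi> f :: "real \<Rightarrow> real \<Rightarrow> real"
  assumes F0: "ac F0 (f 0)" and F: "\<And>s. s \<in> {0..t} \<Longrightarrow> ac (F s) (\<phi> s)" and t: "t \<ge> 0"
    and Fm: "\<And>\<xi>. (\<lambda>s. F s \<xi>) \<in> borel_measurable borel" and FB: "\<And>s \<xi>. s \<in> {0..t} \<Longrightarrow> \<bar>F s \<xi>\<bar> \<le> B"
    and \<phi>m: "case_prod \<phi> \<in> borel_plane" and \<phi>C: "\<And>s \<eta>. s \<in> {0..t} \<Longrightarrow> \<bar>\<phi> s \<eta>\<bar> \<le> C * (w \<eta>)\<^sup>2"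
    and der: "\<And>s \<eta>. s \<in> {0..t} \<Longrightarrow> ((\<lambda>s. f s \<eta>) has_real_derivative \<phi> s \<eta>) (at s within {0..t})"
    and fm: "f t \<in> borel_measurable borel" and fC: "\<And>\<eta>. \<bar>f t \<eta>\<bar> \<le> C' * (w \<eta>)\<^sup>2"
  shows "ac (\<lambda>\<xi>. F0 \<xi> + (LBINT s:{0..t}. F s \<xi>)) (f t)"
  unfolding ac_def
proof (intro conjI allI impI)
  fix a b :: real assume ab: "a \<le> b"
  show "set_integrable lborel {a..b} (f t)" by (rule weighted_square_interval(1)[OF fm fC])
  have iF: "set_integrable lborel {0..t} (\<lambda>s. F s \<xi>)" for \<xi>
    by (rule set_integrable_bounded_Icc[OF Fm]) (use FB in auto)
  have m: "case_prod (\<lambda>s \<eta>. indicator {a..b} \<eta> * \<phi> s \<eta>) \<in> borel_plane"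
  proof -
    have "(\<lambda>x. indicator {a..b} (snd x) * case_prod \<phi> x) \<in> borel_plane"
      using \<phi>m by measurable
    then show ?thesis by (simp add: case_prod_beta')
  qed
  have k: "integrable lborel (\<lambda>\<eta>. indicator {a..b} \<eta> * (C * (w \<eta>)\<^sup>2))"
    using set_integrable_mult_right[where a=C, OF w_interval(1)[of a b]] by (simp add: set_integrable_def)
  have le: "\<bar>indicator {a..b} \<eta> * \<phi> s \<eta>\<bar> \<le> indicator {a..b} \<eta> * (C * (w \<eta>)\<^sup>2)" if "s \<in> {0..t}" for s \<eta>
    using \<phi>C[OF that, of \<eta>] by (simp add: indicator_def)
  note Fub = Fubini_strip[OF m k le]
  have "(LBINT s:{0..t}. F s b) - (LBINT s:{0..t}. F s a) = (LBINT s:{0..t}. F s b - F s a)"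
    by (rule set_integral_diff(2)[symmetric, OF iF iF])
  also have "\<dots> = (LBINT s:{0..t}. (LBINT \<eta>. indicator {a..b} \<eta> * \<phi> s \<eta>))"
    using ac_integral[OF F ab] by (intro set_lebesgue_integral_cong) (auto simp: set_lebesgue_integral_def)
  also have "\<dots> = (LBINT \<eta>. (LBINT s:{0..t}. indicator {a..b} \<eta> * \<phi> s \<eta>))"
    by (rule Fub(1)[symmetric])
  also have "\<dots> = (LBINT \<eta>:{a..b}. (LBINT s:{0..t}. \<phi> s \<eta>))"
    by (simp add: set_lebesgue_integral_def)
  also have "\<dots> = (LBINT \<eta>:{a..b}. f t \<eta> - f 0 \<eta>)"
  proof (rule set_lebesgue_integral_cong)
    show "\<forall>\<eta>. \<eta> \<in> {a..b} \<longrightarrow> (LBINT s:{0..t}. \<phi> s \<eta>) = f t \<eta> - f 0 \<eta>"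
      using derivative_imp_LINT[OF der t slice_borel(2)[OF \<phi>m] \<phi>C] by blast
  qed simp
  also have "\<dots> = (LBINT \<eta>:{a..b}. f t \<eta>) - (LBINT \<eta>:{a..b}. f 0 \<eta>)"
    by (rule set_integral_diff(2)[OF weighted_square_interval(1)[OF fm fC] ac_set_integrable[OF F0]])
  finally show "(LBINT \<eta>:{a..b}. f t \<eta>)
      = F0 b + (LBINT s:{0..t}. F s b) - (F0 a + (LBINT s:{0..t}. F s a))"
    using ac_integral[OF F0 ab] by simp
qed (rule fm)

text \<open>The label derivative \<zeta> of a flux vanishing at both ends has integral zero and may
  be subtracted from the rate of change \<theta>. What remains, \<open>\<theta> - \<zeta>\<close>,
  is the genuine source of a balance law; the flux is chosen to make it small or to give it the
  required form.\<close>

lemma transport: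
  fixes \<Theta> \<theta> \<Xi> \<zeta> :: "real \<Rightarrow> real \<Rightarrow> real"
  assumes t: "t \<ge> 0"
    and der: "\<And>s \<xi>. s \<in> {0..t} \<Longrightarrow> ((\<lambda>s. \<Theta> s \<xi>) has_real_derivative \<theta> s \<xi>) (at s within {0..t})"
    and ac: "\<And>s. s \<in> {0..t} \<Longrightarrow> ac (\<Xi> s) (\<zeta> s)"
    and lim: "\<And>s. s \<in> {0..t} \<Longrightarrow> (\<Xi> s \<longlongrightarrow> 0) at_top" "\<And>s. s \<in> {0..t} \<Longrightarrow> (\<Xi> s \<longlongrightarrow> 0) at_bot"
    and m: "case_prod \<theta> \<in> borel_plane" "case_prod \<zeta> \<in> borel_plane"
    and k: "integrable lborel k" "\<And>s \<xi>. s \<in> {0..t} \<Longrightarrow> \<bar>\<theta> s \<xi>\<bar> \<le> k \<xi>"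
    and k': "integrable lborel k'" "\<And>s \<xi>. s \<in> {0..t} \<Longrightarrow> \<bar>\<zeta> s \<xi>\<bar> \<le> k' \<xi>"
    and i0: "integrable lborel (\<Theta> 0)"
  shows "integrable lborel (\<Theta> t)"
    and "(LBINT \<xi>. \<Theta> t \<xi>) - (LBINT \<xi>. \<Theta> 0 \<xi>) = (LBINT s:{0..t}. (LBINT \<xi>. \<theta> s \<xi> - \<zeta> s \<xi>))"
proof -
  note F = Fubini_strip[where a=0 and b=t, OF m(1) k]
  have eq: "(LBINT s:{0..t}. \<theta> s \<xi>) = \<Theta> t \<xi> - \<Theta> 0 \<xi>" for \<xi>
    by (rule derivative_imp_LINT[OF der t slice_borel(2)[OF m(1)] k(2)])
  have id: "integrable lborel (\<lambda>\<xi>. \<Theta> t \<xi> - \<Theta> 0 \<xi>)" using F(2) by (simp add: eq)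
  from Bochner_Integration.integrable_add[OF id i0] show it: "integrable lborel (\<Theta> t)" by simp
  have "(LBINT \<xi>. \<Theta> t \<xi>) - (LBINT \<xi>. \<Theta> 0 \<xi>) = (LBINT \<xi>. (LBINT s:{0..t}. \<theta> s \<xi>))"
    using it i0 by (simp add: eq)
  also have "\<dots> = (LBINT s:{0..t}. (LBINT \<xi>. \<theta> s \<xi>))" by (rule F(1))
  also have "\<dots> = (LBINT s:{0..t}. (LBINT \<xi>. \<theta> s \<xi> - \<zeta> s \<xi>))"
  proof (rule set_lebesgue_integral_cong; safe?)
    fix s assume s: "s \<in> {0..t}"
    have i: "integrable lborel (\<theta> s)" by (rule F(4)) (use s in auto)
    have i': "integrable lborel (\<zeta> s)" by (rule Fubini_strip(4)[OF m(2) k'(1) _ s]) (rule k'(2))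
    have "(LBINT \<xi>. \<zeta> s \<xi>) = 0" by (rule ac_integral_zero[OF ac[OF s] i' lim(1)[OF s] lim(2)[OF s]])
    then show "(LBINT \<xi>. \<theta> s \<xi>) = (LBINT \<xi>. \<theta> s \<xi> - \<zeta> s \<xi>)" using i i' by simp
  qed simp
  finally show "(LBINT \<xi>. \<Theta> t \<xi>) - (LBINT \<xi>. \<Theta> 0 \<xi>) = (LBINT s:{0..t}. (LBINT \<xi>. \<theta> s \<xi> - \<zeta> s \<xi>))" .
qed

context flow
begin

text \<open>Split the integral at the label \<xi>. On either side the monotonicity of
  \<open>S\<close> resolves the absolute value, and the exponential factors into a function of \<xi>
  and a function of \<eta>. The two halves satisfy \<open>A' = r^2/(4l) - p^2 A/l\<close> and
  \<open>B' = p^2 B/l - r^2/(4l)\<close>, while \<open>P = A + B\<close> and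
  \<open>Q = l (A - B)\<close>. Together this is \<open>P - l^2 P_xx = u_x^2 / 2\<close> in the
  labels.\<close>

lemma ac_PQ:
  assumes t: "t \<in> {0..T}"
  shows "ac (P t) (\<lambda>\<xi>. - ((p t \<xi>)\<^sup>2 * Q t \<xi> / l\<^sup>2))"
    and "ac (Q t) (\<lambda>\<xi>. (r t \<xi>)\<^sup>2 / 2 - (p t \<xi>)\<^sup>2 * P t \<xi>)"
proof -
  define kk where "kk \<xi> \<eta> = exp (- \<bar>S t \<xi> - S t \<eta>\<bar> / l) * (r t \<eta>)\<^sup>2" for \<xi> \<eta>
  have acS: "ac (S t) (\<lambda>\<xi>. (p t \<xi>)\<^sup>2)" by (rule ac_S[OF t])
  have [measurable]: "S t \<in> borel_measurable borel" by (rule ac_borel[OF acS])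
  have kk [measurable]: "kk \<xi> \<in> borel_measurable borel" for \<xi> unfolding kk_def by measurable
  have ik: "integrable lborel (kk \<xi>)" for \<xi> unfolding kk_def by (rule kernel_integrable[OF t])
  define \<alpha> where "\<alpha> \<eta> = exp (S t \<eta> / l) * (r t \<eta>)\<^sup>2" for \<eta>
  define \<beta> where "\<beta> \<eta> = exp (- S t \<eta> / l) * (r t \<eta>)\<^sup>2" for \<eta>
  have [measurable]: "\<alpha> \<in> borel_measurable borel" "\<beta> \<in> borel_measurable borel" unfolding \<alpha>_def \<beta>_def by measurable
  have e1: "indicator {..\<xi>} \<eta> * kk \<xi> \<eta> = exp (- S t \<xi> / l) * (indicator {..\<xi>} \<eta> * \<alpha> \<eta>)" for \<xi> \<eta>
  proof (cases "\<eta> \<le> \<xi>")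
    case True
    have "- \<bar>S t \<xi> - S t \<eta>\<bar> / l = - S t \<xi> / l + S t \<eta> / l"
      using S_mono[OF t True] by (simp add: diff_divide_distrib)
    then have "exp (- \<bar>S t \<xi> - S t \<eta>\<bar> / l) = exp (- S t \<xi> / l) * exp (S t \<eta> / l)" by (simp only: exp_add)
    then show ?thesis by (simp only: kk_def \<alpha>_def mult_ac)
  qed simp
  have e2: "indicator {\<xi><..} \<eta> * kk \<xi> \<eta> = exp (S t \<xi> / l) * (indicator {\<xi><..} \<eta> * \<beta> \<eta>)" for \<xi> \<eta>
  proof (cases "\<xi> < \<eta>")
    case True
    have "- \<bar>S t \<xi> - S t \<eta>\<bar> / l = S t \<xi> / l + - S t \<eta> / l"
      using S_mono[OF t, of \<xi> \<eta>] True by (simp add: diff_divide_distrib)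
    then have "exp (- \<bar>S t \<xi> - S t \<eta>\<bar> / l) = exp (S t \<xi> / l) * exp (- S t \<eta> / l)" by (simp only: exp_add)
    then show ?thesis by (simp only: kk_def \<beta>_def mult_ac)
  qed simp
  have i1: "integrable lborel (\<lambda>\<eta>. indicator {..\<xi>} \<eta> * kk \<xi> \<eta>)" and i2: "integrable lborel (\<lambda>\<eta>. indicator {\<xi><..} \<eta> * kk \<xi> \<eta>)" for \<xi>
    by (rule Bochner_Integration.integrable_bound[OF ik[of \<xi>]]; simp add: indicator_def)+
  have ia: "integrable lborel (\<lambda>\<eta>. indicator {..\<xi>} \<eta> * \<alpha> \<eta>)" and ib: "integrable lborel (\<lambda>\<eta>. indicator {\<xi><..} \<eta> * \<beta> \<eta>)" for \<xi>
    using i1[of \<xi>] i2[of \<xi>] by (simp_all add: e1 e2)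
  note acA = ac_left_integral[OF _ ia, simplified]
  note acB = ac_right_integral[OF _ ib, simplified]
  define A where "A \<xi> = (1 / (4 * l)) * (exp (- S t \<xi> / l) * (LBINT \<eta>. indicator {..\<xi>} \<eta> * \<alpha> \<eta>))" for \<xi>
  define B where "B \<xi> = (1 / (4 * l)) * (exp (S t \<xi> / l) * (LBINT \<eta>. indicator {\<xi><..} \<eta> * \<beta> \<eta>))" for \<xi>
  have acE: "ac (\<lambda>\<xi>. exp (c * S t \<xi>)) (\<lambda>\<xi>. c * exp (c * S t \<xi>) * (p t \<xi>)\<^sup>2)" for c
    by (rule ac_chain[OF acS, of "\<lambda>x. exp (c * x)" "\<lambda>x. c * exp (c * x)"]) (auto intro!: derivative_eq_intros continuous_intros)
  have ac1: "ac A (\<lambda>\<xi>. (r t \<xi>)\<^sup>2 / (4 * l) - (p t \<xi>)\<^sup>2 * A \<xi> / l)"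
    by (rule ac_cong[OF ac_cmult[where c="1 / (4 * l)", OF ac_mult[OF acE[of "- 1 / l"] acA]]])
       (use l_pos in \<open>auto simp: A_def \<alpha>_def field_simps exp_add[symmetric]\<close>)
  have ac2: "ac B (\<lambda>\<xi>. (p t \<xi>)\<^sup>2 * B \<xi> / l - (r t \<xi>)\<^sup>2 / (4 * l))"
    by (rule ac_cong[OF ac_cmult[where c="1 / (4 * l)", OF ac_mult[OF acE[of "1 / l"] acB]]])
       (use l_pos in \<open>auto simp: B_def \<beta>_def field_simps exp_add[symmetric]\<close>)
  have A_eq: "A \<xi> = (1 / (4 * l)) * (LBINT \<eta>. indicator {..\<xi>} \<eta> * kk \<xi> \<eta>)" for \<xi>
    by (simp add: A_def e1)
  have B_eq: "B \<xi> = (1 / (4 * l)) * (LBINT \<eta>. indicator {\<xi><..} \<eta> * kk \<xi> \<eta>)" for \<xi>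
    by (simp add: B_def e2)
  have P: "P t \<xi> = A \<xi> + B \<xi>" for \<xi>
  proof -
    have "(LBINT \<eta>. kk \<xi> \<eta>) = (LBINT \<eta>. indicator {..\<xi>} \<eta> * kk \<xi> \<eta> + indicator {\<xi><..} \<eta> * kk \<xi> \<eta>)"
      by (rule Bochner_Integration.integral_cong) (auto simp: indicator_def)
    moreover have "P t \<xi> = (LBINT \<eta>. kk \<xi> \<eta>) / (4 * l)" by (simp only: lagP_def kk_def)
    ultimately show ?thesis using i1 i2 by (simp add: A_eq B_eq add_divide_distrib)
  qed
  have Q: "Q t \<xi> = l * (A \<xi> - B \<xi>)" for \<xi>
  proof -
    have "(LBINT \<eta>. (if \<eta> \<le> \<xi> then 1 else -1) * exp (- \<bar>S t \<xi> - S t \<eta>\<bar> / l) * (r t \<eta>)\<^sup>2)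
        = (LBINT \<eta>. indicator {..\<xi>} \<eta> * kk \<xi> \<eta> - indicator {\<xi><..} \<eta> * kk \<xi> \<eta>)"
      by (rule Bochner_Integration.integral_cong) (auto simp: indicator_def kk_def)
    also have "\<dots> = 4 * l * (A \<xi> - B \<xi>)" using i1 i2 l_pos by (simp add: A_eq B_eq right_diff_distrib)
    finally show ?thesis by (simp add: lagQ_def)
  qed
  show "ac (P t) (\<lambda>\<xi>. - ((p t \<xi>)\<^sup>2 * Q t \<xi> / l\<^sup>2))"
    by (rule ac_cong[OF ac_add[OF ac1 ac2]]) (use l_pos in \<open>auto simp: P Q field_simps power2_eq_square\<close>)
  show "ac (Q t) (\<lambda>\<xi>. (r t \<xi>)\<^sup>2 / 2 - (p t \<xi>)\<^sup>2 * P t \<xi>)"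
    by (rule ac_cong[OF ac_cmult[where c=l, OF ac_diff[OF ac1 ac2]]]) (use l_pos in \<open>auto simp: P Q field_simps power2_eq_square\<close>)
qed

lemma p_0 [simp]: "p 0 \<xi> = 1" and r_0 [simp]: "r 0 \<xi> = g \<xi>"
  using p_eq[of 0 \<xi>] r_eq[of 0 \<xi>] T_nonneg by (simp_all add: set_integral_at_point)

lemma squares_bound:
  assumes "t \<in> {0..T}"
  shows "(p t \<xi>)\<^sup>2 \<le> R\<^sup>2 * (w \<xi>)\<^sup>2" "(r t \<xi>)\<^sup>2 \<le> R\<^sup>2 * (w \<xi>)\<^sup>2" "\<bar>p t \<xi> * r t \<xi>\<bar> \<le> R\<^sup>2 * (w \<xi>)\<^sup>2"
proof -
  show "(p t \<xi>)\<^sup>2 \<le> R\<^sup>2 * (w \<xi>)\<^sup>2" "(r t \<xi>)\<^sup>2 \<le> R\<^sup>2 * (w \<xi>)\<^sup>2"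
    by (rule square_le_w[OF p_bound[OF assms]], rule square_le_w[OF r_bound[OF assms]])
  have "\<bar>p t \<xi>\<bar> * \<bar>r t \<xi>\<bar> \<le> (R * w \<xi>) * (R * w \<xi>)"
    by (rule mult_mono) (use p_bound[OF assms] r_bound[OF assms] R_ge_1 w_ge_1[of \<xi>] in auto)
  then show "\<bar>p t \<xi> * r t \<xi>\<bar> \<le> R\<^sup>2 * (w \<xi>)\<^sup>2" by (simp add: abs_mult power2_eq_square mult_ac)
qed

lemma pair_measurable [measurable]:
  "(\<lambda>x. p (fst x) (snd x)) \<in> borel_plane"
  "(\<lambda>x. r (fst x) (snd x)) \<in> borel_plane"
  "(\<lambda>x. P (fst x) (snd x)) \<in> borel_plane"
  "(\<lambda>x. Q (fst x) (snd x)) \<in> borel_plane"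
  "(\<lambda>x. U (fst x) (snd x)) \<in> borel_plane"
  "(\<lambda>x. y (fst x) (snd x)) \<in> borel_plane"
  using p_measurable r_measurable P_measurable Q_measurable U_measurable y_measurable
  by (simp_all add: case_prod_beta')

lemma time_derivatives_within:
  assumes "s \<in> {0..t}" "t \<in> {0..T}"
  shows "((\<lambda>t. p t \<xi>) has_real_derivative r s \<xi> / 2) (at s within {0..t})"
    and "((\<lambda>t. r t \<xi>) has_real_derivative - (P s \<xi> * p s \<xi>)) (at s within {0..t})"
    and "((\<lambda>t. U t \<xi>) has_real_derivative Q s \<xi>) (at s within {0..t})"
    and "((\<lambda>t. y t \<xi>) has_real_derivative U s \<xi>) (at s within {0..t})"
  using assms by (intro has_field_derivative_subset[OF time_derivatives(1)] has_field_derivative_subset[OF time_derivatives(2)]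
     has_field_derivative_subset[OF time_derivatives(3)] has_field_derivative_subset[OF time_derivatives(4)]; force)+

text \<open>The product \<open>p r\<close> starts at \<open>g\<close>, the density of
  \<open>v0\<close>, and its time derivative \<open>r^2/2 - p^2 P\<close> is the density of
  \<open>Q\<close>. The same scheme, with \<open>(p^2)' = p r\<close>, then gives the density of
  \<open>y\<close>.\<close>

lemma ac_U:
  assumes t: "t \<in> {0..T}"
  shows "ac (U t) (\<lambda>\<xi>. p t \<xi> * r t \<xi>)"
proof -
  have "ac (\<lambda>\<xi>. v0 \<xi> + (LBINT s:{0..t}. Q s \<xi>)) (\<lambda>\<xi>. p t \<xi> * r t \<xi>)"
  proof (rule ac_time_integral[where \<phi>="\<lambda>s \<xi>. (r s \<xi>)\<^sup>2 / 2 - (p s \<xi>)\<^sup>2 * P s \<xi>" and f="\<lambda>t \<xi>. p t \<xi> * r t \<xi>"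
        and B="l * Pmax" and C="(1 + Pmax) * R\<^sup>2" and C'="R\<^sup>2"])
    show "ac v0 (\<lambda>\<xi>. p 0 \<xi> * r 0 \<xi>)" using v0 by simp
    fix s assume "s \<in> {0..t}"
    then have s: "s \<in> {0..T}" using t by auto
    show "ac (Q s) (\<lambda>\<xi>. (r s \<xi>)\<^sup>2 / 2 - (p s \<xi>)\<^sup>2 * P s \<xi>)" by (rule ac_PQ[OF s])
    show "\<bar>Q s \<xi>\<bar> \<le> l * Pmax" for \<xi> by (rule Q_le[OF s])
    show "((\<lambda>s. p s \<eta> * r s \<eta>) has_real_derivative (r s \<eta>)\<^sup>2 / 2 - (p s \<eta>)\<^sup>2 * P s \<eta>) (at s within {0..t})" for \<eta>
      using time_derivatives_within[OF \<open>s \<in> {0..t}\<close> t, of \<eta>]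
      by (auto intro!: derivative_eq_intros simp: power2_eq_square)
    show "\<bar>(r s \<eta>)\<^sup>2 / 2 - (p s \<eta>)\<^sup>2 * P s \<eta>\<bar> \<le> (1 + Pmax) * R\<^sup>2 * (w \<eta>)\<^sup>2" for \<eta>
    proof -
      have "(p s \<eta>)\<^sup>2 * P s \<eta> \<le> (R\<^sup>2 * (w \<eta>)\<^sup>2) * Pmax"
        using squares_bound[OF s, of \<eta>] P_le[OF s, of \<eta>] P_nonneg[of s \<eta>] by (intro mult_mono) auto
      moreover have "0 \<le> (p s \<eta>)\<^sup>2 * P s \<eta>" using P_nonneg[of s \<eta>] by simp
      moreover have "0 \<le> (r s \<eta>)\<^sup>2" "(r s \<eta>)\<^sup>2 \<le> R\<^sup>2 * (w \<eta>)\<^sup>2" using squares_bound[OF s, of \<eta>] by auto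
      moreover have "0 \<le> (R\<^sup>2 * (w \<eta>)\<^sup>2) * Pmax" using Pmax_nonneg by simp
      ultimately have "\<bar>(r s \<eta>)\<^sup>2 / 2 - (p s \<eta>)\<^sup>2 * P s \<eta>\<bar> \<le> R\<^sup>2 * (w \<eta>)\<^sup>2 + (R\<^sup>2 * (w \<eta>)\<^sup>2) * Pmax" by linarith
      then show ?thesis by (simp add: algebra_simps)
    qed
  next
    show "\<bar>p t \<eta> * r t \<eta>\<bar> \<le> R\<^sup>2 * (w \<eta>)\<^sup>2" for \<eta> by (rule squares_bound[OF t])
    show "case_prod (\<lambda>s \<xi>. (r s \<xi>)\<^sup>2 / 2 - (p s \<xi>)\<^sup>2 * P s \<xi>) \<in> borel_plane"
      unfolding case_prod_beta' by measurable
  qed (use t in auto)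
  then show ?thesis by (simp add: U_def[abs_def])
qed

lemma ac_y:
  assumes t: "t \<in> {0..T}"
  shows "ac (y t) (\<lambda>\<xi>. (p t \<xi>)\<^sup>2)"
proof -
  have "ac (\<lambda>\<xi>. \<xi> + (LBINT s:{0..t}. U s \<xi>)) (\<lambda>\<xi>. (p t \<xi>)\<^sup>2)"
  proof (rule ac_time_integral[where \<phi>="\<lambda>s \<xi>. p s \<xi> * r s \<xi>" and f="\<lambda>t \<xi>. (p t \<xi>)\<^sup>2"
        and B="Umax" and C="R\<^sup>2" and C'="R\<^sup>2"])
    show "ac (\<lambda>\<xi>. \<xi>) (\<lambda>\<xi>. (p 0 \<xi>)\<^sup>2)" using ac_id by simp
    fix s assume "s \<in> {0..t}"
    then have s: "s \<in> {0..T}" using t by auto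
    show "ac (U s) (\<lambda>\<xi>. p s \<xi> * r s \<xi>)" by (rule ac_U[OF s])
    show "\<bar>U s \<xi>\<bar> \<le> Umax" for \<xi> by (rule U_le[OF s])
    show "((\<lambda>s. (p s \<eta>)\<^sup>2) has_real_derivative p s \<eta> * r s \<eta>) (at s within {0..t})" for \<eta>
      using time_derivatives_within[OF \<open>s \<in> {0..t}\<close> t, of \<eta>]
      by (auto intro!: derivative_eq_intros)
    show "\<bar>p s \<eta> * r s \<eta>\<bar> \<le> R\<^sup>2 * (w \<eta>)\<^sup>2" for \<eta> by (rule squares_bound[OF s])
  next
    show "\<bar>(p t \<eta>)\<^sup>2\<bar> \<le> R\<^sup>2 * (w \<eta>)\<^sup>2" for \<eta> using squares_bound[OF t] by simp
    show "case_prod (\<lambda>s \<xi>. p s \<xi> * r s \<xi>) \<in> borel_plane"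
      unfolding case_prod_beta' by measurable
  qed (use t in auto)
  then show ?thesis by (simp add: y_def[abs_def])
qed

text \<open>Both sides have density \<open>p^2\<close>. Hence the kernels of \<open>lagP\<close> and
  \<open>lagQ\<close> involve true distances of positions; writing them with \<open>S\<close> makes
  them functionals of \<open>(p, r)\<close> alone.\<close>

lemma y_diff:
  assumes t: "t \<in> {0..T}"
  shows "y t \<xi> - y t \<eta> = S t \<xi> - S t \<eta>"
proof -
  have *: "y t b - y t a = S t b - S t a" if "a \<le> b" for a b
    using ac_integral[OF ac_y[OF t] that] ac_integral[OF ac_S[OF t] that] by simp
  show ?thesis using *[of \<xi> \<eta>] *[of \<eta> \<xi>] by (cases "\<xi> \<le> \<eta>") auto
qed

lemma y_limits:
  assumes t: "t \<in> {0..T}"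
  shows "filterlim (y t) at_top at_top" "filterlim (y t) at_bot at_bot"
proof -
  have 1: "\<xi> - Umax * T \<le> y t \<xi>" "y t \<xi> \<le> \<xi> + Umax * T" for \<xi> using y_id[OF t, of \<xi>] by linarith+
  have "filterlim (\<lambda>\<xi>. - (Umax * T) + \<xi>) at_top at_top"
    by (rule filterlim_tendsto_add_at_top[OF tendsto_const filterlim_ident])
  then show "filterlim (y t) at_top at_top"
    by (rule filterlim_at_top_mono) (use 1(1) in \<open>auto simp: add.commute\<close>)
  show "filterlim (y t) at_bot at_bot"
    unfolding filterlim_at_bot
  proof (intro allI)
    fix Z
    show "\<forall>\<^sub>F x in at_bot. y t x \<le> Z"
      using eventually_le_at_bot[of "Z - Umax * T"]
    proof eventually_elim
      case (elim x)
      then show ?case using 1(2)[of x] by linarith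
    qed
  qed
qed

end

section \<open>The energy estimate\<close>

lemma gronwall:
  fixes f :: "real \<Rightarrow> real"
  assumes cont: "continuous_on {0..T} f" and K: "K \<ge> 0" and d: "d \<ge> 0"
    and le: "\<And>t. t \<in> {0..T} \<Longrightarrow> f t \<le> c + (LBINT s:{0..t}. K * f s + d)" and t: "t \<in> {0..T}"
  shows "f t \<le> (c + d * t) * exp (K * t)"
proof -
  define F where "F t = c + (LBINT s:{0..t}. K * f s + d)" for t
  \<comment> \<open>\<open>H\<close> starts at 0 and is nondecreasing because \<open>f\<close> lies
    below \<open>F\<close>.\<close>
  define H where "H s = c + d * s - F s * exp (- K * s)" for s
  have DF: "(F has_real_derivative K * f s + d) (at s within {0..t})" if "s \<in> {0..t}" for s
    unfolding F_def[abs_def]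
    by (rule time_integral_derivative[OF _ that]) (use t in \<open>auto intro!: continuous_intros continuous_on_subset[OF cont]\<close>)
  have DH: "(H has_real_derivative d - (K * f s + d - K * F s) * exp (- K * s)) (at s within {0..t})" if "s \<in> {0..t}" for s
    unfolding H_def[abs_def] by (auto intro!: derivative_eq_intros DF[OF that] simp: algebra_simps)
  have pos: "0 \<le> d - (K * f s + d - K * F s) * exp (- K * s)" if "s \<in> {0..t}" for s
  proof -
    have "f s \<le> F s" using le[of s] that t by (simp add: F_def)
    then have "K * f s + d - K * F s \<le> d" using K by (simp add: mult_left_mono)
    then have "(K * f s + d - K * F s) * exp (- K * s) \<le> d * exp (- K * s)" by (intro mult_right_mono) auto
    also have "\<dots> \<le> d * 1" using d K that by (intro mult_left_mono) auto
    finally show ?thesis by simp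
  qed
  have "H 0 \<le> H t"
  proof (cases "t = 0")
    case False
    then have "0 < t" using t by simp
    have "\<exists>x\<in>{0<..<t}. H t - H 0 = (d - (K * f x + d - K * F x) * exp (- K * x)) * (t - 0)"
      by (rule mvt_simple[OF \<open>0 < t\<close>, of H "\<lambda>s h. (d - (K * f s + d - K * F s) * exp (- K * s)) * h"])
         (use DH in \<open>simp add: has_field_derivative_def\<close>)
    then obtain x where "x \<in> {0<..<t}" "H t - H 0 = (d - (K * f x + d - K * F x) * exp (- K * x)) * t" by auto
    then show ?thesis using pos[of x] \<open>0 < t\<close> by (smt (verit) atLeastAtMost_iff greaterThanLessThan_iff mult_nonneg_nonneg)
  qed simp
  moreover have "H 0 = 0" by (simp add: H_def F_def set_integral_at_point)
  ultimately have "F t * exp (- K * t) \<le> c + d * t" by (simp add: H_def)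
  then have "F t * exp (- K * t) * exp (K * t) \<le> (c + d * t) * exp (K * t)" by (rule mult_right_mono) simp
  then have "F t \<le> (c + d * t) * exp (K * t)" by (simp add: mult.assoc exp_add[symmetric])
  then show ?thesis using le[OF t] by (simp add: F_def)
qed

text \<open>A C^1 substitute for \<open>exp (- \<epsilon> * \<bar>x\<bar>)\<close>. Its derivative
  is at most \<epsilon> times the weight itself, so the cutoff costs terms of order \<epsilon>
  relative to the weighted quantities.\<close>

definition rho :: "real \<Rightarrow> real \<Rightarrow> real" where "rho \<epsilon> x = exp (- \<epsilon> * sqrt (1 + x\<^sup>2))"
definition rho' :: "real \<Rightarrow> real \<Rightarrow> real" where "rho' \<epsilon> x = - \<epsilon> * (x / sqrt (1 + x\<^sup>2)) * rho \<epsilon> x"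

lemma rho_pos: "rho \<epsilon> x > 0" by (simp add: rho_def)

lemma rho_le_1: "\<epsilon> \<ge> 0 \<Longrightarrow> rho \<epsilon> x \<le> 1"
  by (simp add: rho_def)

lemma sqrt_1_plus_pos: "sqrt (1 + x\<^sup>2) > 0" for x :: real
  by (simp add: add_pos_nonneg)

lemma rho_derivative: "(rho \<epsilon> has_real_derivative rho' \<epsilon> x) (at x)"
proof -
  have "1 + x\<^sup>2 > 0" by (simp add: add_pos_nonneg)
  then show ?thesis unfolding rho_def[abs_def] rho'_def
    by (auto intro!: derivative_eq_intros simp: field_simps)
qed

lemma continuous_rho': "continuous_on UNIV (rho' \<epsilon>)"
  unfolding rho'_def rho_def using sqrt_1_plus_pos by (auto intro!: continuous_intros simp: less_imp_neq[symmetric])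

lemma abs_rho'_le: "\<epsilon> \<ge> 0 \<Longrightarrow> \<bar>rho' \<epsilon> x\<bar> \<le> \<epsilon> * rho \<epsilon> x"
proof -
  assume e: "\<epsilon> \<ge> 0"
  have "\<bar>x\<bar> \<le> sqrt (1 + x\<^sup>2)" by (rule real_le_rsqrt) simp
  then have "\<bar>x / sqrt (1 + x\<^sup>2)\<bar> \<le> 1" using sqrt_1_plus_pos[of x] by simp
  then have "\<epsilon> * \<bar>x / sqrt (1 + x\<^sup>2)\<bar> * rho \<epsilon> x \<le> \<epsilon> * 1 * rho \<epsilon> x"
    using e rho_pos[of \<epsilon> x] by (intro mult_right_mono mult_left_mono) auto
  then show ?thesis using e rho_pos[of \<epsilon> x] by (simp add: rho'_def abs_mult)
qed

lemma rho_shift: "\<epsilon> \<ge> 0 \<Longrightarrow> rho \<epsilon> x \<le> rho \<epsilon> z * exp (\<epsilon> * \<bar>x - z\<bar>)"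
proof -
  assume e: "\<epsilon> \<ge> 0"
  have "\<bar>x\<bar> \<le> sqrt (1 + x\<^sup>2)" "\<bar>z\<bar> \<le> sqrt (1 + z\<^sup>2)" by (rule real_le_rsqrt; simp)+
  have "sqrt (1 + z\<^sup>2) \<le> sqrt (1 + x\<^sup>2) + \<bar>x - z\<bar>"
  proof (rule real_le_lsqrt)
    have "z\<^sup>2 = x\<^sup>2 + 2 * x * (z - x) + (z - x)\<^sup>2" by (simp add: power2_eq_square algebra_simps)
    also have "2 * x * (z - x) \<le> 2 * sqrt (1 + x\<^sup>2) * \<bar>x - z\<bar>"
    proof -
      have "2 * x * (z - x) \<le> \<bar>2 * x * (z - x)\<bar>" by (rule abs_ge_self)
      also have "\<dots> = 2 * \<bar>x\<bar> * \<bar>x - z\<bar>" by (simp add: abs_mult abs_minus_commute)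
      also have "\<dots> \<le> 2 * sqrt (1 + x\<^sup>2) * \<bar>x - z\<bar>" using \<open>\<bar>x\<bar> \<le> _\<close> by (intro mult_right_mono) auto
      finally show ?thesis .
    qed
    finally show "1 + z\<^sup>2 \<le> (sqrt (1 + x\<^sup>2) + \<bar>x - z\<bar>)\<^sup>2"
      by (simp add: power2_sum power2_commute[of x z] add_nonneg_nonneg)
  qed auto
  then have "\<epsilon> * sqrt (1 + z\<^sup>2) \<le> \<epsilon> * (sqrt (1 + x\<^sup>2) + \<bar>x - z\<bar>)" using e by (rule mult_left_mono)
  then show ?thesis unfolding rho_def exp_add[symmetric] by (simp add: algebra_simps)
qed

lemma rho_le_exp: "\<epsilon> \<ge> 0 \<Longrightarrow> rho \<epsilon> x \<le> exp (- \<epsilon> * \<bar>x\<bar>)"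
proof -
  assume "\<epsilon> \<ge> 0"
  moreover have "\<bar>x\<bar> \<le> sqrt (1 + x\<^sup>2)" by (rule real_le_rsqrt) simp
  ultimately show ?thesis by (simp add: rho_def mult_left_mono)
qed

lemma rho_tendsto: "((\<lambda>\<epsilon>. rho \<epsilon> x) \<longlongrightarrow> 1) (at_right 0)"
proof -
  have "((\<lambda>\<epsilon>. exp (- \<epsilon> * sqrt (1 + x\<^sup>2))) \<longlongrightarrow> exp (- 0 * sqrt (1 + x\<^sup>2))) (at_right 0)"
    by (intro tendsto_intros)
  then show ?thesis by (simp add: rho_def)
qed

section \<open>Majorants uniform in time and the weighted pressure bound\<close>

context flow
begin

text \<open>Majorants with a constant uniform on \<open>{0..T}\<close>, closed under sums and
  products. \<open>bdd\<close> is meant for bounded coefficients, \<open>dens\<close> for densities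
  of order \<open>w^2\<close>; one \<open>dens\<close> factor times one decaying or compactly
  supported factor is integrable.\<close>

definition dom :: "(real \<Rightarrow> real) \<Rightarrow> (real \<Rightarrow> real \<Rightarrow> real) \<Rightarrow> bool" where
  "dom k f \<longleftrightarrow> (\<exists>C. \<forall>t\<in>{0..T}. \<forall>\<xi>. \<bar>f t \<xi>\<bar> \<le> C * k \<xi>)"

abbreviation "bdd \<equiv> dom (\<lambda>_. 1)"
abbreviation "dens \<equiv> dom (\<lambda>\<xi>. (w \<xi>)\<^sup>2)"

lemma domI: "(\<And>t \<xi>. t \<in> {0..T} \<Longrightarrow> \<bar>f t \<xi>\<bar> \<le> C * k \<xi>) \<Longrightarrow> dom k f"
  unfolding dom_def by blast

lemma dom_add: "dom k f \<Longrightarrow> dom k h \<Longrightarrow> dom k (\<lambda>t \<xi>. f t \<xi> + h t \<xi>)"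
proof -
  assume "dom k f" "dom k h"
  then obtain C C' where C: "\<And>t \<xi>. t \<in> {0..T} \<Longrightarrow> \<bar>f t \<xi>\<bar> \<le> C * k \<xi>" "\<And>t \<xi>. t \<in> {0..T} \<Longrightarrow> \<bar>h t \<xi>\<bar> \<le> C' * k \<xi>"
    unfolding dom_def by blast
  have "\<bar>f t \<xi> + h t \<xi>\<bar> \<le> (C + C') * k \<xi>" if "t \<in> {0..T}" for t \<xi>
    using C[OF that, of \<xi>] by (simp add: distrib_right)
  then show ?thesis by (rule domI)
qed

lemma dom_minus: "dom k f \<Longrightarrow> dom k (\<lambda>t \<xi>. - f t \<xi>)"
  by (simp add: dom_def)

lemma dom_diff: "dom k f \<Longrightarrow> dom k h \<Longrightarrow> dom k (\<lambda>t \<xi>. f t \<xi> - h t \<xi>)"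
  using dom_add[OF _ dom_minus, of k f h] by simp

lemma dom_times:
  assumes "dom k f" "dom k' h"
  shows "dom (\<lambda>\<xi>. k \<xi> * k' \<xi>) (\<lambda>t \<xi>. f t \<xi> * h t \<xi>)"
proof -
  obtain C C' where C: "\<And>t \<xi>. t \<in> {0..T} \<Longrightarrow> \<bar>f t \<xi>\<bar> \<le> C * k \<xi>" "\<And>t \<xi>. t \<in> {0..T} \<Longrightarrow> \<bar>h t \<xi>\<bar> \<le> C' * k' \<xi>"
    using assms unfolding dom_def by blast
  have "\<bar>f t \<xi> * h t \<xi>\<bar> \<le> (C * C') * (k \<xi> * k' \<xi>)" if "t \<in> {0..T}" for t \<xi>
  proof -
    have "\<bar>f t \<xi>\<bar> * \<bar>h t \<xi>\<bar> \<le> (C * k \<xi>) * (C' * k' \<xi>)"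
      using C[OF that, of \<xi>] by (intro mult_mono) (auto intro: order_trans[OF abs_ge_zero])
    then show ?thesis by (simp add: abs_mult mult_ac)
  qed
  then show ?thesis by (rule domI)
qed

lemma dom_mult: "bdd f \<Longrightarrow> dom k h \<Longrightarrow> dom k (\<lambda>t \<xi>. f t \<xi> * h t \<xi>)"
  using dom_times[of "\<lambda>_. 1" f k h] by simp

lemma bdd_const: "bdd (\<lambda>t \<xi>. c)"
  by (rule domI[of _ "\<bar>c\<bar>"]) simp

lemma bdd_basic: "bdd P" "bdd Q" "bdd U"
  by (rule domI[of _ Pmax], use P_le P_nonneg in simp, rule domI[of _ "l * Pmax"], use Q_le in simp,
      rule domI[of _ Umax], use U_le in simp)

lemma dens_basic: "dens (\<lambda>t \<xi>. (p t \<xi>)\<^sup>2)" "dens (\<lambda>t \<xi>. (r t \<xi>)\<^sup>2)" "dens (\<lambda>t \<xi>. p t \<xi> * r t \<xi>)"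
  by (rule domI[of _ "R\<^sup>2"], use squares_bound in simp)+

lemma bdd_compose_y: "(\<And>x. \<bar>f x\<bar> \<le> C) \<Longrightarrow> bdd (\<lambda>t \<xi>. f (y t \<xi>))"
  by (rule domI[of _ C]) simp

text \<open>This is \<open>exp (- \<epsilon> * \<bar>\<xi>\<bar>)\<close>, written in the shape of
  \<open>w_exp\<close> with centre 0 and length \<open>1 / \<epsilon>\<close> so that its
  integrability against \<open>w^2\<close> is immediate.\<close>

definition decay :: "real \<Rightarrow> real \<Rightarrow> real" where "decay \<epsilon> \<xi> = exp (- \<bar>0 - \<xi>\<bar> / (1 / \<epsilon>))"

lemma decay_rho: "\<epsilon> > 0 \<Longrightarrow> dom (decay \<epsilon>) (\<lambda>t \<xi>. rho \<epsilon> (y t \<xi>))"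
proof (rule domI[of _ "exp (\<epsilon> * (Umax * T))"])
  fix t \<xi> assume e: "\<epsilon> > 0" and t: "t \<in> {0..T}"
  have "\<bar>\<xi>\<bar> - Umax * T \<le> \<bar>y t \<xi>\<bar>" using y_id[OF t, of \<xi>] by linarith
  then have "\<epsilon> * (\<bar>\<xi>\<bar> - Umax * T) \<le> \<epsilon> * \<bar>y t \<xi>\<bar>" using e by (intro mult_left_mono) auto
  then have "exp (- \<epsilon> * \<bar>y t \<xi>\<bar>) \<le> exp (\<epsilon> * (Umax * T)) * decay \<epsilon> \<xi>"
    unfolding decay_def exp_add[symmetric] by (simp add: algebra_simps)
  then show "\<bar>rho \<epsilon> (y t \<xi>)\<bar> \<le> exp (\<epsilon> * (Umax * T)) * decay \<epsilon> \<xi>"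
    using rho_le_exp[of \<epsilon> "y t \<xi>"] e rho_pos[of \<epsilon> "y t \<xi>"] by simp
qed

lemma decay_rho': "\<epsilon> > 0 \<Longrightarrow> dom (decay \<epsilon>) (\<lambda>t \<xi>. rho' \<epsilon> (y t \<xi>))"
proof -
  assume e: "\<epsilon> > 0"
  obtain C where C: "\<And>t \<xi>. t \<in> {0..T} \<Longrightarrow> \<bar>rho \<epsilon> (y t \<xi>)\<bar> \<le> C * decay \<epsilon> \<xi>"
    using decay_rho[OF e] unfolding dom_def by blast
  show ?thesis
  proof (rule domI[of _ "\<epsilon> * C"])
    fix t \<xi> assume t: "t \<in> {0..T}"
    have "\<bar>rho' \<epsilon> (y t \<xi>)\<bar> \<le> \<epsilon> * \<bar>rho \<epsilon> (y t \<xi>)\<bar>" using abs_rho'_le[of \<epsilon> "y t \<xi>"] e rho_pos[of \<epsilon> "y t \<xi>"] by simp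
    also have "\<dots> \<le> \<epsilon> * (C * decay \<epsilon> \<xi>)" using C[OF t, of \<xi>] e by (intro mult_left_mono) auto
    finally show "\<bar>rho' \<epsilon> (y t \<xi>)\<bar> \<le> \<epsilon> * C * decay \<epsilon> \<xi>" by (simp add: mult.assoc)
  qed
qed

lemma decay_limits:
  assumes "dom (decay \<epsilon>) f" "\<epsilon> > 0" "t \<in> {0..T}"
  shows "(f t \<longlongrightarrow> 0) at_top" "(f t \<longlongrightarrow> 0) at_bot"
proof -
  obtain C where C: "\<And>\<xi>. \<bar>f t \<xi>\<bar> \<le> C * decay \<epsilon> \<xi>" using assms unfolding dom_def by blast
  have top: "((\<lambda>\<xi>. C * exp (- (\<epsilon> * \<xi>))) \<longlongrightarrow> 0) at_top"
    by (rule tendsto_mult_right_zero)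
       (intro filterlim_compose[OF exp_at_bot] filterlim_compose[OF filterlim_uminus_at_bot_at_top]
         filterlim_tendsto_pos_mult_at_top[OF tendsto_const assms(2)] filterlim_ident)
  show "(f t \<longlongrightarrow> 0) at_top"
  proof (rule Lim_null_comparison[OF _ top])
    show "\<forall>\<^sub>F \<xi> in at_top. norm (f t \<xi>) \<le> C * exp (- (\<epsilon> * \<xi>))"
      using eventually_ge_at_top[of 0] 
    proof eventually_elim
      case (elim \<xi>)
      then show ?case using C[of \<xi>] by (simp add: decay_def mult.commute)
    qed
  qed
  have "((\<lambda>\<xi>. f t (- \<xi>)) \<longlongrightarrow> 0) at_top"
  proof (rule Lim_null_comparison[OF _ top])
    show "\<forall>\<^sub>F \<xi> in at_top. norm (f t (- \<xi>)) \<le> C * exp (- (\<epsilon> * \<xi>))"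
      using eventually_ge_at_top[of 0]
    proof eventually_elim
      case (elim \<xi>)
      then show ?case using C[of "- \<xi>"] by (simp add: decay_def mult.commute)
    qed
  qed
  then show "(f t \<longlongrightarrow> 0) at_bot" by (simp add: filterlim_at_bot_mirror)
qed

lemma decay_dens_bound:
  assumes "dom (\<lambda>\<xi>. decay \<epsilon> \<xi> * (w \<xi>)\<^sup>2) f" "\<epsilon> > 0"
  obtains k where "integrable lborel k" "\<And>t \<xi>. t \<in> {0..T} \<Longrightarrow> \<bar>f t \<xi>\<bar> \<le> k \<xi>"
proof -
  obtain C where C: "\<And>t \<xi>. t \<in> {0..T} \<Longrightarrow> \<bar>f t \<xi>\<bar> \<le> C * (decay \<epsilon> \<xi> * (w \<xi>)\<^sup>2)" using assms unfolding dom_def by blast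
  have "integrable lborel (\<lambda>\<xi>. C * (decay \<epsilon> \<xi> * (w \<xi>)\<^sup>2))"
    unfolding decay_def by (intro integrable_mult_right w_exp) (use assms(2) in simp)
  then show ?thesis using C that by blast
qed

lemma decay_dens_integrable:
  assumes "dom (\<lambda>\<xi>. decay \<epsilon> \<xi> * (w \<xi>)\<^sup>2) f" "\<epsilon> > 0" "t \<in> {0..T}" "f t \<in> borel_measurable borel"
  shows "integrable lborel (f t)"
proof -
  obtain k where k: "integrable lborel k" "\<And>t \<xi>. t \<in> {0..T} \<Longrightarrow> \<bar>f t \<xi>\<bar> \<le> k \<xi>"
    using decay_dens_bound[OF assms(1,2)] by blast
  show ?thesis
    by (rule Bochner_Integration.integrable_bound[OF k(1)])
       (use k(2)[OF assms(3)] assms(4) in \<open>auto intro!: AE_I2 order_trans[OF _ abs_ge_self]\<close>)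
qed

lemma rho_measurable [measurable]: "rho \<epsilon> \<in> borel_measurable borel" "rho' \<epsilon> \<in> borel_measurable borel"
  by (rule borel_measurable_continuous_onI, rule continuous_at_imp_continuous_on, use rho_derivative DERIV_isCont in blast,
      rule borel_measurable_continuous_onI[OF continuous_rho'])

text \<open>The weighted form of the identity that the integral of \<open>P\<close> is that of
  \<open>u_x^2 / 2\<close>. Integrating the label derivative of \<open>rho Q\<close> equates the
  integral of \<open>rho p^2 P\<close> with half of that of \<open>rho r^2\<close> plus an error
  with \<open>rho' Q p^2\<close>. Since \<open>\<bar>rho'\<bar> \<le> \<epsilon> rho\<close> and
  \<open>\<bar>Q\<bar> \<le> l P\<close>, the condition \<open>\<epsilon> * l \<le> 1/2\<close> lets
  half of the left side absorb the error; this doubles the constant to 1.\<close>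

lemma integral_rho_P_le:
  assumes t: "t \<in> {0..T}" and e: "0 < \<epsilon>" "\<epsilon> * l \<le> 1 / 2"
  shows "(LBINT \<xi>. rho \<epsilon> (y t \<xi>) * ((p t \<xi>)\<^sup>2 * P t \<xi>)) \<le> (LBINT \<xi>. rho \<epsilon> (y t \<xi>) * (r t \<xi>)\<^sup>2)"
proof -
  have aQ: "ac (\<lambda>\<xi>. rho \<epsilon> (y t \<xi>) * Q t \<xi>)
     (\<lambda>\<xi>. rho \<epsilon> (y t \<xi>) * ((r t \<xi>)\<^sup>2 / 2 - (p t \<xi>)\<^sup>2 * P t \<xi>) + (rho' \<epsilon> (y t \<xi>) * (p t \<xi>)\<^sup>2) * Q t \<xi>)"
    by (rule ac_mult[OF ac_chain[OF ac_y[OF t] rho_derivative continuous_rho'] ac_PQ(2)[OF t]])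
  have iP: "integrable lborel (\<lambda>\<xi>. rho \<epsilon> (y t \<xi>) * (P t \<xi> * (p t \<xi>)\<^sup>2))"
    by (rule decay_dens_integrable[OF _ e(1) t]) (intro dom_times dom_mult decay_rho bdd_basic dens_basic e, measurable)
  have ih: "integrable lborel (\<lambda>\<xi>. rho \<epsilon> (y t \<xi>) * (r t \<xi>)\<^sup>2)"
    by (rule decay_dens_integrable[OF _ e(1) t]) (intro dom_times dom_mult decay_rho bdd_basic dens_basic e, measurable)
  have iQ: "integrable lborel (\<lambda>\<xi>. rho' \<epsilon> (y t \<xi>) * (Q t \<xi> * (p t \<xi>)\<^sup>2))"
    by (rule decay_dens_integrable[OF _ e(1) t]) (intro dom_times dom_mult decay_rho' bdd_basic dens_basic e, measurable)
  have eq: "rho \<epsilon> (y t \<xi>) * ((r t \<xi>)\<^sup>2 / 2 - (p t \<xi>)\<^sup>2 * P t \<xi>) + (rho' \<epsilon> (y t \<xi>) * (p t \<xi>)\<^sup>2) * Q t \<xi>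
      = (1/2) * (rho \<epsilon> (y t \<xi>) * (r t \<xi>)\<^sup>2) - rho \<epsilon> (y t \<xi>) * (P t \<xi> * (p t \<xi>)\<^sup>2) + rho' \<epsilon> (y t \<xi>) * (Q t \<xi> * (p t \<xi>)\<^sup>2)" for \<xi>
    by (simp add: algebra_simps)
  have "bdd Q" by (rule bdd_basic)
  have dQ: "dom (decay \<epsilon>) (\<lambda>t \<xi>. rho \<epsilon> (y t \<xi>) * Q t \<xi>)"
    using dom_mult[OF \<open>bdd Q\<close> decay_rho[OF e(1)]] by (simp add: mult.commute)
  have "(LBINT \<xi>. (1/2) * (rho \<epsilon> (y t \<xi>) * (r t \<xi>)\<^sup>2) - rho \<epsilon> (y t \<xi>) * (P t \<xi> * (p t \<xi>)\<^sup>2) + rho' \<epsilon> (y t \<xi>) * (Q t \<xi> * (p t \<xi>)\<^sup>2)) = 0"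
    by (rule ac_integral_zero[OF aQ[unfolded eq] _ decay_limits[OF dQ e(1) t]])
       (intro Bochner_Integration.integrable_add Bochner_Integration.integrable_diff integrable_mult_right iP ih iQ)
  then have "(1/2) * (LBINT \<xi>. rho \<epsilon> (y t \<xi>) * (r t \<xi>)\<^sup>2) - (LBINT \<xi>. rho \<epsilon> (y t \<xi>) * (P t \<xi> * (p t \<xi>)\<^sup>2))
      + (LBINT \<xi>. rho' \<epsilon> (y t \<xi>) * (Q t \<xi> * (p t \<xi>)\<^sup>2)) = 0"
    using iP ih iQ by simp
  moreover have "(LBINT \<xi>. rho' \<epsilon> (y t \<xi>) * (Q t \<xi> * (p t \<xi>)\<^sup>2)) \<le> (LBINT \<xi>. (1/2) * (rho \<epsilon> (y t \<xi>) * (P t \<xi> * (p t \<xi>)\<^sup>2)))"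
  proof (rule integral_mono[OF iQ integrable_mult_right[OF iP]])
    fix \<xi>
    have "rho' \<epsilon> (y t \<xi>) * (Q t \<xi> * (p t \<xi>)\<^sup>2) \<le> \<bar>rho' \<epsilon> (y t \<xi>)\<bar> * (\<bar>Q t \<xi>\<bar> * (p t \<xi>)\<^sup>2)"
      using abs_ge_self[of "rho' \<epsilon> (y t \<xi>) * (Q t \<xi> * (p t \<xi>)\<^sup>2)"] by (simp add: abs_mult)
    also have "\<dots> \<le> (\<epsilon> * rho \<epsilon> (y t \<xi>)) * ((l * P t \<xi>) * (p t \<xi>)\<^sup>2)"
      using abs_rho'_le[of \<epsilon> "y t \<xi>"] abs_Q_le[OF t, of \<xi>] e rho_pos[of \<epsilon> "y t \<xi>"]
      by (intro mult_mono mult_right_mono) auto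
    also have "\<dots> = (\<epsilon> * l) * (rho \<epsilon> (y t \<xi>) * (P t \<xi> * (p t \<xi>)\<^sup>2))" by (simp add: mult_ac)
    also have "\<dots> \<le> 1 / 2 * (rho \<epsilon> (y t \<xi>) * (P t \<xi> * (p t \<xi>)\<^sup>2))"
      using e(2) rho_pos[of \<epsilon> "y t \<xi>"] P_nonneg[of t \<xi>] by (intro mult_right_mono) auto
    finally show "rho' \<epsilon> (y t \<xi>) * (Q t \<xi> * (p t \<xi>)\<^sup>2) \<le> 1 / 2 * (rho \<epsilon> (y t \<xi>) * (P t \<xi> * (p t \<xi>)\<^sup>2))" .
  qed
  ultimately show ?thesis by (simp add: mult.commute)
qed

end

text \<open>The energy is measured relative to a smooth bounded profile \<open>\<phi>\<close> with the same behaviour at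
  infinity as the solution; \<open>\<gamma>\<close> controls \<open>\<phi>'\<^sup>2\<close>. For data in \<open>H\<^sup>1\<close> the profile is \<open>0\<close> and \<open>L = k = 0\<close>.\<close>

locale energy = flow +
  fixes \<phi> \<phi>' \<gamma> :: "real \<Rightarrow> real" and L k :: real
  assumes \<phi>_derivative: "\<And>x. (\<phi> has_real_derivative \<phi>' x) (at x)" and \<phi>'_continuous: "continuous_on UNIV \<phi>'"
    and \<phi>_bound: "\<And>x. \<bar>\<phi> x\<bar> \<le> m" and \<phi>'_bound: "\<And>x. \<bar>\<phi>' x\<bar> \<le> L" and k_nonneg: "k \<ge> 0"
    and \<gamma>_measurable [measurable]: "\<gamma> \<in> borel_measurable borel" and \<gamma>_nonneg: "\<And>x. \<gamma> x \<ge> 0" and \<gamma>_integrable: "integrable lborel \<gamma>"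
    and cross_bound: "\<And>x v. 2 * \<bar>v * \<phi> x * \<phi>' x\<bar> \<le> k * (v\<^sup>2 + \<gamma> x)"
begin

definition N :: real where "N = (LBINT x. \<gamma> x)"
definition V :: "real \<Rightarrow> real \<Rightarrow> real" where "V t \<xi> = U t \<xi> - \<phi> (y t \<xi>)"
definition e :: "real \<Rightarrow> real \<Rightarrow> real" where "e t \<xi> = (V t \<xi>)\<^sup>2 * (p t \<xi>)\<^sup>2 + l\<^sup>2 * (r t \<xi>)\<^sup>2"
definition E :: "real \<Rightarrow> real \<Rightarrow> real" where "E \<epsilon> t = (LBINT \<xi>. rho \<epsilon> (y t \<xi>) * e t \<xi>)"
definition Wmax :: real where "Wmax = Umax + m"

lemma L_nonneg: "L \<ge> 0" using \<phi>'_bound[of 0] by linarith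

lemma N_nonneg: "N \<ge> 0" unfolding N_def by (rule integral_nonneg_AE) (simp add: \<gamma>_nonneg)

lemma e_nonneg: "e t \<xi> \<ge> 0" by (simp add: e_def)

lemma \<phi>_measurable [measurable]: "\<phi> \<in> borel_measurable borel" "\<phi>' \<in> borel_measurable borel"
  using \<phi>'_continuous \<phi>_derivative
  by (auto intro!: borel_measurable_continuous_onI continuous_at_imp_continuous_on DERIV_isCont)

lemma V_measurable [measurable]: "(\<lambda>x. V (fst x) (snd x)) \<in> borel_plane" "V t \<in> borel_measurable borel"
  unfolding V_def by measurable

lemma e_measurable [measurable]: "(\<lambda>x. e (fst x) (snd x)) \<in> borel_plane" "e t \<in> borel_measurable borel"
  unfolding e_def by measurable

lemma Wmax_nonneg: "Wmax \<ge> 0"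
  using Umax_nonneg \<phi>_bound[of 0] by (simp add: Wmax_def)

lemma V_le: "t \<in> {0..T} \<Longrightarrow> \<bar>V t \<xi>\<bar> \<le> Wmax"
  using U_le[of t \<xi>] \<phi>_bound[of "y t \<xi>"] by (simp add: V_def Wmax_def)

lemma U_le_Wmax: "t \<in> {0..T} \<Longrightarrow> \<bar>U t \<xi>\<bar> \<le> Wmax"
  using U_le[of t \<xi>] \<phi>_bound[of 0] by (simp add: Wmax_def)

lemma bdd_V: "bdd V"
  by (rule domI[of _ Wmax]) (use V_le in simp)

lemma bdd_\<phi>': "bdd (\<lambda>t \<xi>. \<phi>' (y t \<xi>))"
  by (rule bdd_compose_y[OF \<phi>'_bound])

lemma dens_e: "dens e"
proof -
  have "dens (\<lambda>t \<xi>. V t \<xi> * (V t \<xi> * (p t \<xi>)\<^sup>2) + l\<^sup>2 * (r t \<xi>)\<^sup>2)"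
    by (intro dom_add dom_mult bdd_V bdd_const dens_basic)
  then show ?thesis by (simp add: e_def[abs_def] power2_eq_square mult.assoc)
qed

lemma E_integrable: "t \<in> {0..T} \<Longrightarrow> \<epsilon> > 0 \<Longrightarrow> integrable lborel (\<lambda>\<xi>. rho \<epsilon> (y t \<xi>) * e t \<xi>)"
  by (rule decay_dens_integrable[where f="\<lambda>t \<xi>. rho \<epsilon> (y t \<xi>) * e t \<xi>" and \<epsilon>=\<epsilon>])
     (intro dom_times decay_rho dens_e, assumption+, measurable)

text \<open>\<open>\<theta>\<close> is the time derivative of \<open>rho (y) e\<close>, and
  \<open>\<zeta>\<close> below is the label derivative of the flux
  \<open>rho (y) (V^3/3 - 2 l^2 V P)\<close>. The flux is chosen so that in the difference every
  term carries \<open>rho'\<close> or the derivative of the profile; a zero profile leaves only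
  cutoff errors.\<close>

definition \<theta> :: "real \<Rightarrow> real \<Rightarrow> real \<Rightarrow> real" where
  "\<theta> \<epsilon> t \<xi> = rho' \<epsilon> (y t \<xi>) * (U t \<xi> * e t \<xi>) + rho \<epsilon> (y t \<xi>) *
     (2 * V t \<xi> * (Q t \<xi> - \<phi>' (y t \<xi>) * U t \<xi>) * (p t \<xi>)\<^sup>2 + V t \<xi> * V t \<xi> * (p t \<xi> * r t \<xi>) - 2 * l\<^sup>2 * P t \<xi> * (p t \<xi> * r t \<xi>))"

definition \<zeta> :: "real \<Rightarrow> real \<Rightarrow> real \<Rightarrow> real" where
  "\<zeta> \<epsilon> t \<xi> = rho' \<epsilon> (y t \<xi>) * ((V t \<xi> * V t \<xi> * V t \<xi> * (1/3) - 2 * l\<^sup>2 * V t \<xi> * P t \<xi>) * (p t \<xi>)\<^sup>2) + rho \<epsilon> (y t \<xi>) *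
     (V t \<xi> * V t \<xi> * (p t \<xi> * r t \<xi> - \<phi>' (y t \<xi>) * (p t \<xi>)\<^sup>2)
      - 2 * l\<^sup>2 * P t \<xi> * (p t \<xi> * r t \<xi> - \<phi>' (y t \<xi>) * (p t \<xi>)\<^sup>2) + 2 * V t \<xi> * Q t \<xi> * (p t \<xi>)\<^sup>2)"

lemma \<theta>\<zeta>_dom:
  assumes "\<epsilon> > 0"
  shows "dom (\<lambda>\<xi>. decay \<epsilon> \<xi> * (w \<xi>)\<^sup>2) (\<theta> \<epsilon>)" and "dom (\<lambda>\<xi>. decay \<epsilon> \<xi> * (w \<xi>)\<^sup>2) (\<zeta> \<epsilon>)"
  unfolding \<theta>_def[abs_def] \<zeta>_def[abs_def]
  by (rule dom_add; rule dom_times;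
      intro decay_rho decay_rho' assms dom_add dom_diff dom_mult bdd_basic bdd_V bdd_\<phi>' bdd_const dens_basic dens_e)+

lemma \<theta>\<zeta>_measurable: "case_prod (\<theta> \<epsilon>) \<in> borel_plane" "case_prod (\<zeta> \<epsilon>) \<in> borel_plane"
  unfolding \<theta>_def[abs_def] \<zeta>_def[abs_def] case_prod_beta' by measurable

lemma e_derivative:
  assumes s: "s \<in> {0..t}" and t: "t \<in> {0..T}"
  shows "((\<lambda>s. rho \<epsilon> (y s \<xi>) * e s \<xi>) has_real_derivative \<theta> \<epsilon> s \<xi>) (at s within {0..t})"
proof -
  note d = time_derivatives_within[OF s t, of \<xi>]
  have dr: "((\<lambda>s. rho \<epsilon> (y s \<xi>)) has_real_derivative rho' \<epsilon> (y s \<xi>) * U s \<xi>) (at s within {0..t})"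
    by (rule DERIV_chain2[OF rho_derivative d(4)])
  have dp: "((\<lambda>s. \<phi> (y s \<xi>)) has_real_derivative \<phi>' (y s \<xi>) * U s \<xi>) (at s within {0..t})"
    by (rule DERIV_chain2[OF \<phi>_derivative d(4)])
  show ?thesis
    unfolding e_def V_def
    by (rule derivative_eq_intros dr dp d refl)+ (simp add: \<theta>_def e_def V_def algebra_simps power2_eq_square)
qed

lemma flux_ac:
  assumes t: "t \<in> {0..T}"
  shows "ac (\<lambda>\<xi>. rho \<epsilon> (y t \<xi>) * (V t \<xi> * V t \<xi> * V t \<xi> * (1/3) - 2 * l\<^sup>2 * V t \<xi> * P t \<xi>)) (\<zeta> \<epsilon> t)"
proof -
  have acV: "ac (V t) (\<lambda>\<xi>. p t \<xi> * r t \<xi> - \<phi>' (y t \<xi>) * (p t \<xi>)\<^sup>2)"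
    unfolding V_def[abs_def] by (rule ac_diff[OF ac_U[OF t] ac_chain[OF ac_y[OF t] \<phi>_derivative \<phi>'_continuous]])
  note acVV = ac_mult[OF ac_mult[OF acV acV] acV]
  note acr = ac_chain[OF ac_y[OF t] rho_derivative continuous_rho', of \<epsilon>]
  note acF = ac_diff[OF ac_cmult[where c="1/3", OF acVV] ac_cmult[where c="2 * l\<^sup>2", OF ac_mult[OF acV ac_PQ(1)[OF t]]]]
  show ?thesis
    by (rule ac_cong[OF ac_mult[OF acr acF]]) (use l_pos in \<open>auto simp: \<zeta>_def field_simps power2_eq_square\<close>)
qed

text \<open>The terms with \<open>rho'\<close> contribute \<open>2 \<epsilon> Wmax\<close> directly
  and as much again through the pressure, which \<open>integral_rho_P_le\<close> converts into
  energy. The terms with the derivative of \<phi> give \<open>L\<close> from \<open>V^2\<close> and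
  \<open>2 L\<close> from the pressure. The mixed term \<open>2 V \<phi> \<phi>'\<close> is linear
  in \<open>V\<close>, hence not bounded by the energy alone; \<open>cross_bound\<close> splits it
  into \<open>k V^2\<close> and the integrable \<open>k \<gamma>\<close>.\<close>

lemma dissipation_bound:
  assumes t: "t \<in> {0..T}" and eps: "0 < \<epsilon>" "\<epsilon> * l \<le> 1 / 2"
  shows "\<bar>LBINT \<xi>. \<theta> \<epsilon> t \<xi> - \<zeta> \<epsilon> t \<xi>\<bar> \<le> (4 * \<epsilon> * Wmax + 3 * L + k) * E \<epsilon> t + k * N"
proof -
  let ?\<rho> = "\<lambda>\<xi>. rho \<epsilon> (y t \<xi>)"
  let ?a = "\<lambda>\<xi>. (p t \<xi>)\<^sup>2"
  have iE: "integrable lborel (\<lambda>\<xi>. ?\<rho> \<xi> * e t \<xi>)" by (rule E_integrable[OF t eps(1)])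
  have iP: "integrable lborel (\<lambda>\<xi>. ?\<rho> \<xi> * (P t \<xi> * ?a \<xi>))"
    by (rule decay_dens_integrable[OF _ eps(1) t]) (intro dom_times dom_mult decay_rho bdd_basic dens_basic eps, measurable)
  have ih: "integrable lborel (\<lambda>\<xi>. ?\<rho> \<xi> * (r t \<xi>)\<^sup>2)"
    by (rule decay_dens_integrable[OF _ eps(1) t]) (intro dom_times dom_mult decay_rho bdd_basic dens_basic eps, measurable)
  have i\<gamma>: "integrable lborel (\<lambda>\<xi>. ?a \<xi> * \<gamma> (y t \<xi>))"
    using integrable_ac_subst[OF ac_y[OF t] _ y_limits[OF t], of \<gamma>] \<gamma>_integrable by simp
  have N: "(LBINT \<xi>. ?a \<xi> * \<gamma> (y t \<xi>)) = N"
    using integral_ac_subst[OF ac_y[OF t] _ y_limits[OF t], of \<gamma>] by (simp add: N_def)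
  have le: "\<bar>\<theta> \<epsilon> t \<xi> - \<zeta> \<epsilon> t \<xi>\<bar> \<le> (2 * \<epsilon> * Wmax + L + k) * (?\<rho> \<xi> * e t \<xi>) + (2 * \<epsilon> * Wmax + 2 * L) * l\<^sup>2 * (?\<rho> \<xi> * (P t \<xi> * ?a \<xi>))
      + k * (?a \<xi> * \<gamma> (y t \<xi>))" for \<xi>
  proof -
    define v where "v = V t \<xi>"
    define f where "f = \<phi> (y t \<xi>)"
    define f' where "f' = \<phi>' (y t \<xi>)"
    define a where "a = ?a \<xi>"
    have U: "U t \<xi> = v + f" by (simp add: v_def f_def V_def)
    have a: "a \<ge> 0" by (simp add: a_def)
    have Pn: "P t \<xi> \<ge> 0" by (rule P_nonneg)
    have e: "e t \<xi> = v\<^sup>2 * a + l\<^sup>2 * (r t \<xi>)\<^sup>2" by (simp add: e_def v_def a_def)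
    have va: "v\<^sup>2 * a \<le> e t \<xi>" by (simp add: e)
    have eq: "\<theta> \<epsilon> t \<xi> - \<zeta> \<epsilon> t \<xi> = rho' \<epsilon> (y t \<xi>) * (U t \<xi> * e t \<xi> - (v * v * v * (1/3) - 2 * l\<^sup>2 * v * P t \<xi>) * a)
        - ?\<rho> \<xi> * (f' * (v\<^sup>2 * a) + (2 * (v * f * f')) * a + 2 * l\<^sup>2 * (f' * (P t \<xi> * a)))"
      unfolding \<theta>_def \<zeta>_def U v_def[symmetric] f'_def[symmetric] a_def[symmetric]
      by (simp add: algebra_simps power2_eq_square)
    have A: "\<bar>U t \<xi> * e t \<xi> - (v * v * v * (1/3) - 2 * l\<^sup>2 * v * P t \<xi>) * a\<bar> \<le> 2 * Wmax * e t \<xi> + 2 * Wmax * l\<^sup>2 * (P t \<xi> * a)"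
    proof -
      have "\<bar>U t \<xi> * e t \<xi>\<bar> \<le> Wmax * e t \<xi>"
        unfolding abs_mult using U_le_Wmax[OF t, of \<xi>] e_nonneg[of t \<xi>] by (simp add: mult_right_mono)
      moreover have "\<bar>v * v * v * (1/3) * a\<bar> \<le> Wmax * e t \<xi>"
      proof -
        have "\<bar>v * v * v * (1/3) * a\<bar> = \<bar>v\<bar> * (v\<^sup>2 * a) / 3" using a by (simp add: abs_mult power2_eq_square)
        also have "\<dots> \<le> \<bar>v\<bar> * (v\<^sup>2 * a)" using a by simp
        also have "\<dots> \<le> Wmax * e t \<xi>" using V_le[OF t, of \<xi>] va a by (intro mult_mono) (auto simp: v_def)
        finally show ?thesis .
      qed
      moreover have "\<bar>2 * l\<^sup>2 * v * P t \<xi> * a\<bar> \<le> 2 * Wmax * l\<^sup>2 * (P t \<xi> * a)"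
      proof -
        have "\<bar>2 * l\<^sup>2 * v * P t \<xi> * a\<bar> = \<bar>v\<bar> * (2 * l\<^sup>2 * (P t \<xi> * a))" using a Pn by (simp add: abs_mult)
        also have "\<dots> \<le> Wmax * (2 * l\<^sup>2 * (P t \<xi> * a))" using V_le[OF t, of \<xi>] a Pn by (intro mult_right_mono) (auto simp: v_def)
        finally show ?thesis by (simp add: mult_ac)
      qed
      moreover have "U t \<xi> * e t \<xi> - (v * v * v * (1/3) - 2 * l\<^sup>2 * v * P t \<xi>) * a
         = U t \<xi> * e t \<xi> - v * v * v * (1/3) * a + 2 * l\<^sup>2 * v * P t \<xi> * a" by (simp add: algebra_simps)
      ultimately show ?thesis by linarith
    qed
    have B: "\<bar>f' * (v\<^sup>2 * a) + (2 * (v * f * f')) * a + 2 * l\<^sup>2 * (f' * (P t \<xi> * a))\<bar>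
       \<le> (L + k) * e t \<xi> + 2 * L * l\<^sup>2 * (P t \<xi> * a) + k * (a * \<gamma> (y t \<xi>))"
    proof -
      have "\<bar>f' * (v\<^sup>2 * a)\<bar> \<le> L * e t \<xi>"
        unfolding abs_mult using \<phi>'_bound[of "y t \<xi>"] va a by (intro mult_mono) (auto simp: f'_def L_nonneg abs_mult)
      moreover have "\<bar>(2 * (v * f * f')) * a\<bar> \<le> k * (v\<^sup>2 + \<gamma> (y t \<xi>)) * a"
      proof -
        have "\<bar>(2 * (v * f * f')) * a\<bar> = 2 * \<bar>v * f * f'\<bar> * a" using a by (simp add: abs_mult)
        also have "\<dots> \<le> k * (v\<^sup>2 + \<gamma> (y t \<xi>)) * a" using cross_bound[of v "y t \<xi>"] a by (intro mult_right_mono) (simp_all add: f_def f'_def)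
        finally show ?thesis .
      qed
      moreover have "k * (v\<^sup>2 + \<gamma> (y t \<xi>)) * a \<le> k * e t \<xi> + k * (a * \<gamma> (y t \<xi>))"
        using mult_left_mono[OF va k_nonneg] by (simp add: algebra_simps)
      moreover have "\<bar>2 * l\<^sup>2 * (f' * (P t \<xi> * a))\<bar> \<le> 2 * L * l\<^sup>2 * (P t \<xi> * a)"
      proof -
        have "\<bar>2 * l\<^sup>2 * (f' * (P t \<xi> * a))\<bar> = \<bar>f'\<bar> * (2 * l\<^sup>2 * (P t \<xi> * a))" using a Pn by (simp add: abs_mult)
        also have "\<dots> \<le> L * (2 * l\<^sup>2 * (P t \<xi> * a))" using \<phi>'_bound[of "y t \<xi>"] a Pn by (intro mult_right_mono) (auto simp: f'_def)
        finally show ?thesis by (simp add: mult_ac)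
      qed
      ultimately show ?thesis by (simp add: algebra_simps)
    qed
    have "\<bar>\<theta> \<epsilon> t \<xi> - \<zeta> \<epsilon> t \<xi>\<bar> \<le> \<bar>rho' \<epsilon> (y t \<xi>)\<bar> * (2 * Wmax * e t \<xi> + 2 * Wmax * l\<^sup>2 * (P t \<xi> * a))
        + ?\<rho> \<xi> * ((L + k) * e t \<xi> + 2 * L * l\<^sup>2 * (P t \<xi> * a) + k * (a * \<gamma> (y t \<xi>)))"
    proof -
      have "\<bar>rho' \<epsilon> (y t \<xi>) * (U t \<xi> * e t \<xi> - (v * v * v * (1/3) - 2 * l\<^sup>2 * v * P t \<xi>) * a)\<bar>
        \<le> \<bar>rho' \<epsilon> (y t \<xi>)\<bar> * (2 * Wmax * e t \<xi> + 2 * Wmax * l\<^sup>2 * (P t \<xi> * a))"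
        unfolding abs_mult[of "rho' \<epsilon> (y t \<xi>)"] by (rule mult_left_mono[OF A]) simp
      moreover have "\<bar>?\<rho> \<xi> * (f' * (v\<^sup>2 * a) + (2 * (v * f * f')) * a + 2 * l\<^sup>2 * (f' * (P t \<xi> * a)))\<bar>
        \<le> ?\<rho> \<xi> * ((L + k) * e t \<xi> + 2 * L * l\<^sup>2 * (P t \<xi> * a) + k * (a * \<gamma> (y t \<xi>)))"
        unfolding abs_mult[of "?\<rho> \<xi>"] using mult_left_mono[OF B, of "?\<rho> \<xi>"] rho_pos[of \<epsilon> "y t \<xi>"] by simp
      ultimately show ?thesis unfolding eq by (intro order_trans[OF abs_triangle_ineq4] add_mono)
    qed
    also have "\<dots> \<le> (\<epsilon> * ?\<rho> \<xi>) * (2 * Wmax * e t \<xi> + 2 * Wmax * l\<^sup>2 * (P t \<xi> * a))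
        + (?\<rho> \<xi> * ((L + k) * e t \<xi> + 2 * L * l\<^sup>2 * (P t \<xi> * a)) + k * (a * \<gamma> (y t \<xi>)))"
    proof (intro add_mono mult_right_mono)
      show "\<bar>rho' \<epsilon> (y t \<xi>)\<bar> \<le> \<epsilon> * ?\<rho> \<xi>" using abs_rho'_le[of \<epsilon> "y t \<xi>"] eps by simp
      show "0 \<le> 2 * Wmax * e t \<xi> + 2 * Wmax * l\<^sup>2 * (P t \<xi> * a)" using Wmax_nonneg e_nonneg[of t \<xi>] a Pn by simp
      have "?\<rho> \<xi> * (k * (a * \<gamma> (y t \<xi>))) \<le> 1 * (k * (a * \<gamma> (y t \<xi>)))"
        using rho_le_1[of \<epsilon> "y t \<xi>"] eps k_nonneg a \<gamma>_nonneg by (intro mult_right_mono) auto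
      then show "?\<rho> \<xi> * ((L + k) * e t \<xi> + 2 * L * l\<^sup>2 * (P t \<xi> * a) + k * (a * \<gamma> (y t \<xi>)))
        \<le> ?\<rho> \<xi> * ((L + k) * e t \<xi> + 2 * L * l\<^sup>2 * (P t \<xi> * a)) + k * (a * \<gamma> (y t \<xi>))" by (simp add: distrib_left)
    qed
    finally show ?thesis by (simp add: a_def algebra_simps)
  qed
  have "\<bar>LBINT \<xi>. \<theta> \<epsilon> t \<xi> - \<zeta> \<epsilon> t \<xi>\<bar> \<le> (LBINT \<xi>. (2 * \<epsilon> * Wmax + L + k) * (?\<rho> \<xi> * e t \<xi>)
      + (2 * \<epsilon> * Wmax + 2 * L) * l\<^sup>2 * (?\<rho> \<xi> * (P t \<xi> * ?a \<xi>)) + k * (?a \<xi> * \<gamma> (y t \<xi>)))"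
    by (rule LINT_abs_le) (intro Bochner_Integration.integrable_add integrable_mult_right iE iP i\<gamma>, rule le)
  also have "\<dots> = (2 * \<epsilon> * Wmax + L + k) * E \<epsilon> t + (2 * \<epsilon> * Wmax + 2 * L) * l\<^sup>2 * (LBINT \<xi>. ?\<rho> \<xi> * (P t \<xi> * ?a \<xi>)) + k * N"
    using iE iP i\<gamma> by (simp add: E_def N)
  also have "(2 * \<epsilon> * Wmax + 2 * L) * l\<^sup>2 * (LBINT \<xi>. ?\<rho> \<xi> * (P t \<xi> * ?a \<xi>)) \<le> (2 * \<epsilon> * Wmax + 2 * L) * E \<epsilon> t"
  proof -
    have "l\<^sup>2 * (LBINT \<xi>. ?\<rho> \<xi> * (P t \<xi> * ?a \<xi>)) \<le> l\<^sup>2 * (LBINT \<xi>. ?\<rho> \<xi> * (r t \<xi>)\<^sup>2)"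
      using integral_rho_P_le[OF t eps] by (intro mult_left_mono) (simp_all add: mult.commute)
    also have "\<dots> = (LBINT \<xi>. l\<^sup>2 * (?\<rho> \<xi> * (r t \<xi>)\<^sup>2))" by simp
    also have "\<dots> \<le> E \<epsilon> t"
      unfolding E_def
    proof (rule integral_mono[OF integrable_mult_right[OF ih] iE])
      fix \<xi>
      have "?\<rho> \<xi> * (l\<^sup>2 * (r t \<xi>)\<^sup>2) \<le> ?\<rho> \<xi> * e t \<xi>" using rho_pos[of \<epsilon> "y t \<xi>"] by (intro mult_left_mono) (auto simp: e_def)
      then show "l\<^sup>2 * (?\<rho> \<xi> * (r t \<xi>)\<^sup>2) \<le> ?\<rho> \<xi> * e t \<xi>" by (simp add: mult_ac)
    qed
    finally have "l\<^sup>2 * (LBINT \<xi>. ?\<rho> \<xi> * (P t \<xi> * ?a \<xi>)) \<le> E \<epsilon> t" .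
    then have "(2 * \<epsilon> * Wmax + 2 * L) * (l\<^sup>2 * (LBINT \<xi>. ?\<rho> \<xi> * (P t \<xi> * ?a \<xi>))) \<le> (2 * \<epsilon> * Wmax + 2 * L) * E \<epsilon> t"
      using eps Wmax_nonneg L_nonneg by (intro mult_left_mono) auto
    then show ?thesis by (simp add: mult.assoc)
  qed
  finally show ?thesis by (simp add: algebra_simps)
qed

lemma E_integral_bound:
  assumes t: "t \<in> {0..T}" and eps: "0 < \<epsilon>" "\<epsilon> * l \<le> 1 / 2"
  shows "\<bar>E \<epsilon> t - E \<epsilon> 0\<bar> \<le> (LBINT s:{0..t}. (4 * \<epsilon> * Wmax + 3 * L + k) * E \<epsilon> s + k * N)"
    and "continuous_on {0..T} (E \<epsilon>)"
proof -
  obtain k1 where k1: "integrable lborel k1" "\<And>t \<xi>. t \<in> {0..T} \<Longrightarrow> \<bar>\<theta> \<epsilon> t \<xi>\<bar> \<le> k1 \<xi>"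
    using decay_dens_bound[OF \<theta>\<zeta>_dom(1) eps(1)] eps(1) by blast
  obtain k2 where k2: "integrable lborel k2" "\<And>t \<xi>. t \<in> {0..T} \<Longrightarrow> \<bar>\<zeta> \<epsilon> t \<xi>\<bar> \<le> k2 \<xi>"
    using decay_dens_bound[OF \<theta>\<zeta>_dom(2) eps(1)] eps(1) by blast
  have T0: "0 \<in> {0..T}" using T_nonneg by simp
  have dF: "dom (decay \<epsilon>) (\<lambda>t \<xi>. rho \<epsilon> (y t \<xi>) * (V t \<xi> * V t \<xi> * V t \<xi> * (1/3) - 2 * l\<^sup>2 * V t \<xi> * P t \<xi>))"
  proof -
    have "bdd (\<lambda>t \<xi>. V t \<xi> * V t \<xi> * V t \<xi> * (1/3) - 2 * l\<^sup>2 * V t \<xi> * P t \<xi>)"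
      by (intro dom_diff dom_mult bdd_V bdd_basic bdd_const)
    from dom_mult[OF this decay_rho[OF eps(1)]] show ?thesis by (simp add: mult.commute)
  qed
  define J where "J s = (LBINT \<xi>. \<theta> \<epsilon> s \<xi> - \<zeta> \<epsilon> s \<xi>)" for s
  have tr: "E \<epsilon> t - E \<epsilon> 0 = (LBINT s:{0..t}. J s)" if t: "t \<in> {0..T}" for t
    unfolding E_def J_def
  proof (rule transport(2)[where k=k1 and k'=k2 and \<Xi>="\<lambda>t \<xi>. rho \<epsilon> (y t \<xi>) * (V t \<xi> * V t \<xi> * V t \<xi> * (1/3) - 2 * l\<^sup>2 * V t \<xi> * P t \<xi>)"])
    fix s assume s: "s \<in> {0..t}"
    then have s': "s \<in> {0..T}" using t by auto
    show "((\<lambda>s. rho \<epsilon> (y s \<xi>) * e s \<xi>) has_real_derivative \<theta> \<epsilon> s \<xi>) (at s within {0..t})" for \<xi>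
      by (rule e_derivative[OF s t])
    show "ac (\<lambda>\<xi>. rho \<epsilon> (y s \<xi>) * (V s \<xi> * V s \<xi> * V s \<xi> * (1/3) - 2 * l\<^sup>2 * V s \<xi> * P s \<xi>)) (\<zeta> \<epsilon> s)"
      by (rule flux_ac[OF s'])
    show "((\<lambda>\<xi>. rho \<epsilon> (y s \<xi>) * (V s \<xi> * V s \<xi> * V s \<xi> * (1/3) - 2 * l\<^sup>2 * V s \<xi> * P s \<xi>)) \<longlongrightarrow> 0) at_top"
      "((\<lambda>\<xi>. rho \<epsilon> (y s \<xi>) * (V s \<xi> * V s \<xi> * V s \<xi> * (1/3) - 2 * l\<^sup>2 * V s \<xi> * P s \<xi>)) \<longlongrightarrow> 0) at_bot"
      by (rule decay_limits[OF dF eps(1) s'])+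
    show "\<bar>\<theta> \<epsilon> s \<xi>\<bar> \<le> k1 \<xi>" "\<bar>\<zeta> \<epsilon> s \<xi>\<bar> \<le> k2 \<xi>" for \<xi> by (rule k1(2)[OF s'] k2(2)[OF s'])+
  qed (use t k1 k2 \<theta>\<zeta>_measurable E_integrable[OF T0 eps(1)] in auto)
  have Jm [measurable]: "J \<in> borel_measurable borel"
  proof -
    have [measurable]: "(\<lambda>x. \<theta> \<epsilon> (fst x) (snd x)) \<in> borel_plane" "(\<lambda>x. \<zeta> \<epsilon> (fst x) (snd x)) \<in> borel_plane"
      using \<theta>\<zeta>_measurable[of \<epsilon>] by (simp_all add: case_prod_beta')
    show ?thesis unfolding J_def[abs_def]
      by (rule lborel.borel_measurable_lebesgue_integral) (simp add: case_prod_beta')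
  qed
  have Jb: "\<bar>J s\<bar> \<le> (LBINT \<xi>. k1 \<xi> + k2 \<xi>)" if "s \<in> {0..T}" for s
    unfolding J_def
    by (rule LINT_abs_le) (use k1(1) k2(1) k1(2)[OF that] k2(2)[OF that] in \<open>auto intro!: order_trans[OF abs_triangle_ineq4] add_mono\<close>)
  show cont: "continuous_on {0..T} (E \<epsilon>)"
  proof (rule Lipschitz_imp_continuous_on)
    fix s t assume st: "s \<in> {0..T}" "t \<in> {0..T}"
    show "\<bar>E \<epsilon> t - E \<epsilon> s\<bar> \<le> (LBINT \<xi>. k1 \<xi> + k2 \<xi>) * \<bar>t - s\<bar>"
      using time_integral_Lipschitz[OF Jm Jb st] tr[OF st(1)] tr[OF st(2)] by simp
  qed
  have "\<bar>LBINT s:{0..t}. J s\<bar> \<le> (LBINT s:{0..t}. (4 * \<epsilon> * Wmax + 3 * L + k) * E \<epsilon> s + k * N)"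
    unfolding set_lebesgue_integral_def
  proof (rule LINT_abs_le)
    have "set_integrable lborel {0..t} (\<lambda>s. (4 * \<epsilon> * Wmax + 3 * L + k) * E \<epsilon> s + k * N)"
      by (rule borel_integrable_atLeastAtMost') (use t in \<open>auto intro!: continuous_intros continuous_on_subset[OF cont]\<close>)
    then show "integrable lborel (\<lambda>s. indicator {0..t} s *\<^sub>R ((4 * \<epsilon> * Wmax + 3 * L + k) * E \<epsilon> s + k * N))"
      by (simp add: set_integrable_def)
    fix s
    show "\<bar>indicator {0..t} s *\<^sub>R J s\<bar> \<le> indicator {0..t} s *\<^sub>R ((4 * \<epsilon> * Wmax + 3 * L + k) * E \<epsilon> s + k * N)"
      using dissipation_bound[of s, OF _ eps] t by (auto simp: indicator_def J_def)
  qed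
  then show "\<bar>E \<epsilon> t - E \<epsilon> 0\<bar> \<le> (LBINT s:{0..t}. (4 * \<epsilon> * Wmax + 3 * L + k) * E \<epsilon> s + k * N)"
    by (simp add: tr[OF t])
qed

lemma E_le:
  assumes t: "t \<in> {0..T}" and eps: "0 < \<epsilon>" "\<epsilon> * l \<le> 1 / 2"
  shows "E \<epsilon> t \<le> (E \<epsilon> 0 + k * N * t) * exp ((4 * \<epsilon> * Wmax + 3 * L + k) * t)"
proof (rule gronwall[OF E_integral_bound(2)[OF t eps] _ _ _ t])
  show "E \<epsilon> t \<le> E \<epsilon> 0 + (LBINT s:{0..t}. (4 * \<epsilon> * Wmax + 3 * L + k) * E \<epsilon> s + k * N)" if "t \<in> {0..T}" for t
    using E_integral_bound(1)[OF that eps] by linarith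
qed (use eps Wmax_nonneg L_nonneg k_nonneg N_nonneg in auto)

text \<open>Moving the weight from the position of \<xi> to that of \<eta> costs
  \<open>exp (\<epsilon> * \<bar>y t \<xi> - y t \<eta>\<bar>)\<close>, which the kernel pays for
  since \<open>\<epsilon> \<le> 1 / l\<close>. The rest is \<open>r^2 \<le> e / l^2\<close>.\<close>

lemma P_le_E:
  assumes t: "t \<in> {0..T}" and eps: "0 < \<epsilon>" "\<epsilon> * l \<le> 1 / 2"
  shows "rho \<epsilon> (y t \<xi>) * P t \<xi> \<le> E \<epsilon> t / (4 * l ^ 3)"
proof -
  have "rho \<epsilon> (y t \<xi>) * (LBINT \<eta>. exp (- \<bar>S t \<xi> - S t \<eta>\<bar> / l) * (r t \<eta>)\<^sup>2)
      = (LBINT \<eta>. rho \<epsilon> (y t \<xi>) * (exp (- \<bar>S t \<xi> - S t \<eta>\<bar> / l) * (r t \<eta>)\<^sup>2))" by simp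
  also have "\<dots> \<le> (LBINT \<eta>. (1 / l\<^sup>2) * (rho \<epsilon> (y t \<eta>) * e t \<eta>))"
  proof (rule integral_mono)
    show "integrable lborel (\<lambda>\<eta>. rho \<epsilon> (y t \<xi>) * (exp (- \<bar>S t \<xi> - S t \<eta>\<bar> / l) * (r t \<eta>)\<^sup>2))"
      by (intro integrable_mult_right kernel_integrable[OF t])
    show "integrable lborel (\<lambda>\<eta>. (1 / l\<^sup>2) * (rho \<epsilon> (y t \<eta>) * e t \<eta>))"
      by (intro integrable_mult_right E_integrable[OF t eps(1)])
    fix \<eta>
    have "\<epsilon> * \<bar>y t \<xi> - y t \<eta>\<bar> \<le> \<bar>y t \<xi> - y t \<eta>\<bar> / l"
    proof -
      have "\<epsilon> * l * \<bar>y t \<xi> - y t \<eta>\<bar> \<le> 1 * \<bar>y t \<xi> - y t \<eta>\<bar>" using eps by (intro mult_right_mono) auto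
      then show ?thesis using l_pos by (simp add: field_simps)
    qed
    then have "exp (\<epsilon> * \<bar>y t \<xi> - y t \<eta>\<bar>) * exp (- \<bar>y t \<xi> - y t \<eta>\<bar> / l) \<le> 1"
      by (simp add: exp_add[symmetric])
    then have "rho \<epsilon> (y t \<eta>) * (exp (\<epsilon> * \<bar>y t \<xi> - y t \<eta>\<bar>) * exp (- \<bar>y t \<xi> - y t \<eta>\<bar> / l)) \<le> rho \<epsilon> (y t \<eta>) * 1"
      using rho_pos[of \<epsilon> "y t \<eta>"] by (intro mult_left_mono) auto
    moreover have "rho \<epsilon> (y t \<xi>) * exp (- \<bar>y t \<xi> - y t \<eta>\<bar> / l) \<le> (rho \<epsilon> (y t \<eta>) * exp (\<epsilon> * \<bar>y t \<xi> - y t \<eta>\<bar>)) * exp (- \<bar>y t \<xi> - y t \<eta>\<bar> / l)"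
      using eps by (intro mult_right_mono rho_shift) auto
    ultimately have "rho \<epsilon> (y t \<xi>) * exp (- \<bar>S t \<xi> - S t \<eta>\<bar> / l) \<le> rho \<epsilon> (y t \<eta>)"
      unfolding y_diff[OF t] mult.assoc mult_1_right by (rule order_trans[rotated])
    then have "rho \<epsilon> (y t \<xi>) * exp (- \<bar>S t \<xi> - S t \<eta>\<bar> / l) * (r t \<eta>)\<^sup>2 \<le> rho \<epsilon> (y t \<eta>) * (r t \<eta>)\<^sup>2"
      by (rule mult_right_mono) simp
    also have "(r t \<eta>)\<^sup>2 \<le> e t \<eta> / l\<^sup>2" using l_pos by (simp add: e_def field_simps)
    then have "rho \<epsilon> (y t \<eta>) * (r t \<eta>)\<^sup>2 \<le> rho \<epsilon> (y t \<eta>) * (e t \<eta> / l\<^sup>2)"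
      using rho_pos[of \<epsilon> "y t \<eta>"] by (intro mult_left_mono) auto
    finally show "rho \<epsilon> (y t \<xi>) * (exp (- \<bar>S t \<xi> - S t \<eta>\<bar> / l) * (r t \<eta>)\<^sup>2) \<le> (1 / l\<^sup>2) * (rho \<epsilon> (y t \<eta>) * e t \<eta>)"
      by (simp add: mult_ac)
  qed
  also have "\<dots> = E \<epsilon> t / l\<^sup>2" by (simp add: E_def)
  finally have "rho \<epsilon> (y t \<xi>) * (LBINT \<eta>. exp (- \<bar>S t \<xi> - S t \<eta>\<bar> / l) * (r t \<eta>)\<^sup>2) / (4 * l) \<le> E \<epsilon> t / l\<^sup>2 / (4 * l)"
    using l_pos by (intro divide_right_mono) auto
  then show ?thesis by (simp add: lagP_def power3_eq_cube power2_eq_square mult_ac)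
qed

end

section \<open>Global existence of the flow\<close>

lemma (in label_weight) lip_const_mono:
  assumes "R \<ge> 0" "D \<le> D'"
  shows "lip_const R D \<le> lip_const R D'"
proof -
  have "exp (D / l) \<le> exp (D' / l)" using assms(2) l_pos by (simp add: divide_right_mono)
  moreover have "(LBINT \<eta>. exp (- \<bar>\<eta>\<bar> / (4 * l))) \<ge> 0" by (rule integral_nonneg_AE) simp
  ultimately show ?thesis unfolding lip_const_def
    using assms(1) l_pos G_nonneg by (intro mult_right_mono mult_left_mono) auto
qed

context energy
begin

lemma E_0_le:
  assumes i0: "integrable lborel (\<lambda>\<xi>. (v0 \<xi> - \<phi> \<xi>)\<^sup>2)" and "\<epsilon> > 0"
  shows "E \<epsilon> 0 \<le> (LBINT \<xi>. (v0 \<xi> - \<phi> \<xi>)\<^sup>2 + l\<^sup>2 * (g \<xi>)\<^sup>2)"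
proof -
  have "0 \<in> {0..T}" using T_nonneg by simp
  have e0: "e 0 \<xi> = (v0 \<xi> - \<phi> \<xi>)\<^sup>2 + l\<^sup>2 * (g \<xi>)\<^sup>2" for \<xi> by (simp add: e_def V_def)
  show ?thesis
    unfolding E_def
  proof (rule integral_mono[OF E_integrable[OF \<open>0 \<in> {0..T}\<close> assms(2)]])
    show "integrable lborel (\<lambda>\<xi>. (v0 \<xi> - \<phi> \<xi>)\<^sup>2 + l\<^sup>2 * (g \<xi>)\<^sup>2)"
      using i0 g_square_integrable by simp
    fix \<xi>
    have "rho \<epsilon> (y 0 \<xi>) * e 0 \<xi> \<le> 1 * e 0 \<xi>"
      using rho_le_1[of \<epsilon> "y 0 \<xi>"] assms(2) e_nonneg[of 0 \<xi>] by (intro mult_right_mono) auto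
    then show "rho \<epsilon> (y 0 \<xi>) * e 0 \<xi> \<le> (v0 \<xi> - \<phi> \<xi>)\<^sup>2 + l\<^sup>2 * (g \<xi>)\<^sup>2" by (simp add: e0)
  qed
qed

lemma eventually_small: "\<forall>\<^sub>F \<epsilon> in at_right 0. 0 < \<epsilon> \<and> \<epsilon> * l \<le> 1 / 2"
proof -
  have "\<forall>\<^sub>F \<epsilon> in at_right 0. \<epsilon> \<in> {0<..<1 / (2 * l)}"
    using l_pos by (intro eventually_at_right_real) simp
  then show ?thesis
  proof eventually_elim
    case (elim \<epsilon>)
    then show ?case using l_pos by (auto simp: field_simps)
  qed
qed

text \<open>As \<epsilon> tends to 0 the weight tends to 1 and \<open>Wmax\<close>, the only
  quantity in the estimate depending on \<open>R\<close> and \<open>D\<close>, drops out with its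
  factor \<epsilon>. The bound is therefore independent of the clipping levels.\<close>

lemma P_apriori:
  assumes i0: "integrable lborel (\<lambda>\<xi>. (v0 \<xi> - \<phi> \<xi>)\<^sup>2)" and t: "t \<in> {0..T}"
  shows "P t \<xi> \<le> ((LBINT \<xi>. (v0 \<xi> - \<phi> \<xi>)\<^sup>2 + l\<^sup>2 * (g \<xi>)\<^sup>2) + k * N * t) * exp ((3 * L + k) * t) / (4 * l ^ 3)"
    (is "_ \<le> (?E0 + _) * _ / _")
proof -
  have l1: "((\<lambda>\<epsilon>. rho \<epsilon> (y t \<xi>) * P t \<xi>) \<longlongrightarrow> 1 * P t \<xi>) (at_right 0)"
    by (intro tendsto_intros rho_tendsto)
  have l2: "((\<lambda>\<epsilon>. (?E0 + k * N * t) * exp ((4 * \<epsilon> * Wmax + 3 * L + k) * t) / (4 * l ^ 3))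
     \<longlongrightarrow> (?E0 + k * N * t) * exp ((4 * 0 * Wmax + 3 * L + k) * t) / (4 * l ^ 3)) (at_right 0)"
    by (intro tendsto_intros) (use l_pos in simp)
  have "1 * P t \<xi> \<le> (?E0 + k * N * t) * exp ((4 * 0 * Wmax + 3 * L + k) * t) / (4 * l ^ 3)"
  proof (rule tendsto_le[OF _ l2 l1])
    show "\<forall>\<^sub>F \<epsilon> in at_right 0. rho \<epsilon> (y t \<xi>) * P t \<xi> \<le> (?E0 + k * N * t) * exp ((4 * \<epsilon> * Wmax + 3 * L + k) * t) / (4 * l ^ 3)"
      using eventually_small
    proof eventually_elim
      case (elim \<epsilon>)
      have "rho \<epsilon> (y t \<xi>) * P t \<xi> \<le> E \<epsilon> t / (4 * l ^ 3)" using elim by (intro P_le_E t) auto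
      also have "E \<epsilon> t \<le> (E \<epsilon> 0 + k * N * t) * exp ((4 * \<epsilon> * Wmax + 3 * L + k) * t)"
        using elim by (intro E_le t) auto
      also have "\<dots> \<le> (?E0 + k * N * t) * exp ((4 * \<epsilon> * Wmax + 3 * L + k) * t)"
        using E_0_le[OF i0, of \<epsilon>] elim by (intro mult_right_mono) auto
      finally show ?case using l_pos by (simp add: divide_right_mono)
    qed
  qed simp
  then show ?thesis by simp
qed

end

locale profile = label_weight l g for l g +
  fixes v0 :: "real \<Rightarrow> real" and m :: real and \<phi> \<phi>' \<gamma> :: "real \<Rightarrow> real" and L k :: real
  assumes v0: "ac v0 g" and v0_bound: "\<And>x. \<bar>v0 x\<bar> \<le> m"
    and \<phi>_derivative: "\<And>x. (\<phi> has_real_derivative \<phi>' x) (at x)" and \<phi>'_continuous: "continuous_on UNIV \<phi>'"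
    and \<phi>_bound: "\<And>x. \<bar>\<phi> x\<bar> \<le> m" and \<phi>'_bound: "\<And>x. \<bar>\<phi>' x\<bar> \<le> L" and k_nonneg: "k \<ge> 0"
    and \<gamma>_measurable: "\<gamma> \<in> borel_measurable borel" and \<gamma>_nonneg: "\<And>x. \<gamma> x \<ge> 0" and \<gamma>_integrable: "integrable lborel \<gamma>"
    and cross_bound: "\<And>x v. 2 * \<bar>v * \<phi> x * \<phi>' x\<bar> \<le> k * (v\<^sup>2 + \<gamma> x)"
    and v0_\<phi>: "integrable lborel (\<lambda>\<xi>. (v0 \<xi> - \<phi> \<xi>)\<^sup>2)"
begin

definition E0 :: real where "E0 = (LBINT \<xi>. (v0 \<xi> - \<phi> \<xi>)\<^sup>2 + l\<^sup>2 * (g \<xi>)\<^sup>2)"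

definition Ebound :: "real \<Rightarrow> real" where
  "Ebound t = (E0 + k * (LBINT x. \<gamma> x) * t) * exp ((3 * L + k) * t)"

definition Pbound :: "real \<Rightarrow> real" where "Pbound t = Ebound t / (4 * l ^ 3)"

definition Ybound :: "real \<Rightarrow> real" where "Ybound t = (m + l * Pbound t * t) * t"

lemma energyI: "flow l g v0 p r m T R D \<Longrightarrow> energy l g v0 p r m T R D \<phi> \<phi>' \<gamma> L k"
  by (intro energy.intro energy_axioms.intro)
     (use \<phi>_derivative \<phi>'_continuous \<phi>_bound \<phi>'_bound k_nonneg \<gamma>_measurable \<gamma>_nonneg \<gamma>_integrable cross_bound in auto)

lemma m_nonneg: "m \<ge> 0" using v0_bound[of 0] by linarith

lemma Ebound_mono: "0 \<le> s \<Longrightarrow> s \<le> t \<Longrightarrow> Ebound s \<le> Ebound t" and Ebound_nonneg: "0 \<le> t \<Longrightarrow> 0 \<le> Ebound t"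
proof -
  have L: "L \<ge> 0" using \<phi>'_bound[of 0] by linarith
  have N: "0 \<le> k * (LBINT x. \<gamma> x)"
    using k_nonneg by (intro mult_nonneg_nonneg integral_nonneg_AE) (auto simp: \<gamma>_nonneg)
  have E: "E0 \<ge> 0" unfolding E0_def by (rule integral_nonneg_AE) simp
  show "Ebound s \<le> Ebound t" if "0 \<le> s" "s \<le> t"
    unfolding Ebound_def
  proof (rule mult_mono)
    show "E0 + k * (LBINT x. \<gamma> x) * s \<le> E0 + k * (LBINT x. \<gamma> x) * t"
      using mult_left_mono[OF that(2) N] by simp
    show "exp ((3 * L + k) * s) \<le> exp ((3 * L + k) * t)"
      using that L k_nonneg by (simp add: mult_left_mono)
    have "0 \<le> k * (LBINT x. \<gamma> x) * t" using mult_nonneg_nonneg[OF N, of t] that by simp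
    then show "0 \<le> E0 + k * (LBINT x. \<gamma> x) * t" using E by simp
  qed simp
  show "0 \<le> Ebound t" if "0 \<le> t"
  proof -
    have "0 \<le> k * (LBINT x. \<gamma> x) * t" using mult_nonneg_nonneg[OF N, of t] that by simp
    then show ?thesis using E by (simp add: Ebound_def)
  qed
qed

lemma Pbound_mono: "0 \<le> s \<Longrightarrow> s \<le> t \<Longrightarrow> Pbound s \<le> Pbound t" and Pbound_nonneg: "0 \<le> t \<Longrightarrow> 0 \<le> Pbound t"
  unfolding Pbound_def using l_pos Ebound_mono Ebound_nonneg by (auto intro!: divide_right_mono)

lemma Ybound_mono: "0 \<le> s \<Longrightarrow> s \<le> t \<Longrightarrow> Ybound s \<le> Ybound t" and Ybound_nonneg: "0 \<le> t \<Longrightarrow> 0 \<le> Ybound t"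
  unfolding Ybound_def using l_pos Pbound_mono Pbound_nonneg m_nonneg
  by (auto intro!: mult_mono add_mono add_nonneg_nonneg mult_nonneg_nonneg)

text \<open>The bound for \<open>P\<close> gives one for \<open>Q\<close> by
  \<open>\<bar>Q\<bar> \<le> l P\<close>, and integrating twice in time bounds \<open>U\<close> and
  the displacement of \<open>y\<close>. The resulting growth of position distances has slope 1,
  while \<open>growth\<close> asks for slope 1/2; the continuation argument lives on this
  surplus.\<close>

lemma flow_apriori:
  assumes "flow l g v0 p r m T R D" and t: "t \<in> {0..T}"
  shows "lagP l (p t) (r t) \<xi> \<le> Pbound t"
    and "\<bar>\<xi> - \<eta>\<bar> - 2 * Ybound t \<le> \<bar>sint (\<lambda>s. (p t s)\<^sup>2) \<xi> - sint (\<lambda>s. (p t s)\<^sup>2) \<eta>\<bar>"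
    and "\<bar>flow.U l v0 p r t \<xi>\<bar> \<le> m + l * Pbound t * t"
proof -
  interpret F: energy l g v0 p r m T R D \<phi> \<phi>' \<gamma> L k by (rule energyI[OF assms(1)])
  have P: "F.P s \<xi> \<le> Pbound s" if "s \<in> {0..T}" for s \<xi>
    using F.P_apriori[OF v0_\<phi> that] by (simp add: Pbound_def Ebound_def E0_def F.N_def)
  show "lagP l (p t) (r t) \<xi> \<le> Pbound t" by (rule P[OF t])
  have U: "\<bar>F.U s \<xi>\<bar> \<le> m + l * Pbound t * t" if s: "s \<in> {0..t}" for s \<xi>
  proof -
    have "\<bar>F.Q \<tau> \<xi>\<bar> \<le> l * Pbound t" if "\<tau> \<in> {0..t}" for \<tau>
    proof -
      have \<tau>: "\<tau> \<in> {0..T}" using that t by auto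
      have "l * F.P \<tau> \<xi> \<le> l * Pbound \<tau>" using P[OF \<tau>] l_pos by (intro mult_left_mono) auto
      also have "\<dots> \<le> l * Pbound t" using Pbound_mono[of \<tau> t] that l_pos by (intro mult_left_mono) auto
      finally show ?thesis using F.abs_Q_le[OF \<tau>, of \<xi>] by linarith
    qed
    then have "\<bar>(LBINT \<tau>:{0..s}. F.Q \<tau> \<xi>) - (LBINT \<tau>:{0..0}. F.Q \<tau> \<xi>)\<bar> \<le> l * Pbound t * \<bar>s - 0\<bar>"
      by (intro time_integral_Lipschitz[OF F.Q_slice(2), of t]) (use s in auto)
    then have "\<bar>LBINT \<tau>:{0..s}. F.Q \<tau> \<xi>\<bar> \<le> l * Pbound t * s" using s by (simp add: set_integral_at_point)
    also have "\<dots> \<le> l * Pbound t * t" using s t l_pos Pbound_nonneg[of t] by (intro mult_left_mono mult_nonneg_nonneg) auto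
    finally show ?thesis using v0_bound[of \<xi>] by (simp add: F.U_def)
  qed
  show "\<bar>F.U t \<xi>\<bar> \<le> m + l * Pbound t * t" by (rule U) (use t in auto)
  have y: "\<bar>F.y t \<xi> - \<xi>\<bar> \<le> Ybound t" for \<xi>
  proof -
    have "\<bar>(LBINT \<tau>:{0..t}. F.U \<tau> \<xi>) - (LBINT \<tau>:{0..0}. F.U \<tau> \<xi>)\<bar> \<le> (m + l * Pbound t * t) * \<bar>t - 0\<bar>"
      by (intro time_integral_Lipschitz[OF F.U_slice(2) U, of t]) (use t in auto)
    then show ?thesis using t by (simp add: F.y_def Ybound_def set_integral_at_point)
  qed
  show "\<bar>\<xi> - \<eta>\<bar> - 2 * Ybound t \<le> \<bar>sint (\<lambda>s. (p t s)\<^sup>2) \<xi> - sint (\<lambda>s. (p t s)\<^sup>2) \<eta>\<bar>"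
    unfolding F.y_diff[OF t, symmetric] using y[of \<xi>] y[of \<eta>] by linarith
qed

text \<open>The a priori bounds show that the clipped system never reaches its clipping levels; both
  levels lie strictly above the a priori bounds, so that the solution stays unclipped on a further
  time interval whose length is bounded below.\<close>

theorem global_flow:
  obtains p r where "\<And>T. T \<ge> 0 \<Longrightarrow> \<exists>R D. flow l g v0 p r m T R D"
proof -
  \<comment> \<open>\<open>max t 0\<close> makes the levels monotone on the whole line. The summands
    1 here and in \<open>D\<close> are the margins spent by the choice of \<delta> below.\<close>
  define M where "M t = Pbound (max t 0) + 1" for t
  define D where "D t = 2 * Ybound (max t 0) + 1" for t
  have M: "mono M" "\<And>t. M t \<ge> 0" and D: "mono D" "\<And>t. D t \<ge> 0"
  proof -
    show "mono M" unfolding M_def[abs_def] by (intro monoI add_mono Pbound_mono) auto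
    show "mono D" unfolding D_def[abs_def] by (intro monoI add_mono mult_left_mono Ybound_mono) auto
    show "M t \<ge> 0" "D t \<ge> 0" for t
      using Pbound_nonneg[of "max t 0"] Ybound_nonneg[of "max t 0"] by (simp_all add: M_def D_def)
  qed
  obtain p r where p: "case_prod p \<in> borel_plane" and r: "case_prod r \<in> borel_plane"
    and p_eq: "\<And>t \<xi>. t \<ge> 0 \<Longrightarrow> p t \<xi> = 1 + (LBINT s:{0..t}. r s \<xi> / 2)"
    and r_eq: "\<And>t \<xi>. t \<ge> 0 \<Longrightarrow> r t \<xi> = g \<xi> +
        (LBINT s:{0..t}. - (min (M s) (kerint (\<lambda>_ _. 1) l (D s) (p s) (r s) \<xi> / (4 * l)) * p s \<xi>))"
    and bounds: "\<And>T. T \<ge> 0 \<Longrightarrow> \<exists>R\<ge>1. \<forall>t\<in>{0..T}. \<forall>\<xi>. \<bar>p t \<xi>\<bar> \<le> R * w \<xi> \<and> \<bar>r t \<xi>\<bar> \<le> R * w \<xi>"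
    using clipped_solution[OF M D(1)] by blast
  note [measurable] = slice_borel[OF p] slice_borel[OF r]
  let ?S = "\<lambda>t. sint (\<lambda>s. (p t s)\<^sup>2)"
  define K where "K t \<xi> = kerint (\<lambda>_ _. 1) l (D t) (p t) (r t) \<xi> / (4 * l)" for t \<xi>
  have r_eq': "r t \<xi> = g \<xi> + (LBINT s:{0..t}. - (min (M s) (K s \<xi>) * p s \<xi>))" if "t \<ge> 0" for t \<xi>
    unfolding K_def by (rule r_eq[OF that])
  have K_nonneg: "K t \<xi> \<ge> 0" for t \<xi>
    using l_pos unfolding K_def kerint_def
    by (intro divide_nonneg_pos integral_nonneg_AE AE_I2) (auto simp: ker_pos less_imp_le)
  have K_measurable: "(\<lambda>s. min (M s) (K s \<xi>)) \<in> borel_measurable borel" for \<xi>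
  proof -
    have m: "case_prod (\<lambda>t \<xi>. kerint (\<lambda>_ _. 1) l (D t) (p t) (r t) \<xi>) \<in> borel_plane"
      using measurable_kerint[OF p r borel_measurable_mono[OF D(1)], of "\<lambda>_ _. 1" l] by (simp add: case_prod_beta')
    note [measurable] = slice_borel(2)[OF m, of \<xi>] borel_measurable_mono[OF M(1)]
    show ?thesis unfolding K_def by measurable
  qed
  define good where "good R T \<longleftrightarrow> flow l g v0 p r m T R (D T)" for R T
  have goodI: "good R T"
    if T: "T \<ge> 0" and R: "R \<ge> 1" "\<And>t \<xi>. t \<in> {0..T} \<Longrightarrow> \<bar>p t \<xi>\<bar> \<le> R * w \<xi> \<and> \<bar>r t \<xi>\<bar> \<le> R * w \<xi>"
      and gr: "\<And>t \<xi> \<eta>. t \<in> {0..T} \<Longrightarrow> \<bar>\<xi> - \<eta>\<bar> / 2 - D t \<le> \<bar>?S t \<xi> - ?S t \<eta>\<bar>"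
      and Kle: "\<And>t \<xi>. t \<in> {0..T} \<Longrightarrow> T > 0 \<Longrightarrow> K t \<xi> \<le> M t" for R T
    unfolding good_def
  proof
    show "\<bar>\<xi> - \<eta>\<bar> / 2 - D T \<le> \<bar>?S t \<xi> - ?S t \<eta>\<bar>" if "t \<in> {0..T}" for t \<xi> \<eta>
      using gr[OF that, of \<xi> \<eta>] monoD[OF D(1), of t T] that by auto
    show "r t \<xi> = g \<xi> + (LBINT s:{0..t}. - (lagP l (p s) (r s) \<xi> * p s \<xi>))" if t: "t \<in> {0..T}" for t \<xi>
    proof (cases "T > 0")
      case True
      have "min (M s) (kerint (\<lambda>_ _. 1) l (D s) (p s) (r s) \<xi> / (4 * l)) = lagP l (p s) (r s) \<xi>" if "s \<in> {0..t}" for s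
      proof -
        have s: "s \<in> {0..T}" using that t by auto
        have "K s \<xi> = lagP l (p s) (r s) \<xi>"
          unfolding K_def kerint_def lagP_def ker_def using gr[OF s] by (simp add: max_absorb1)
        then show ?thesis using Kle[OF s True, of \<xi>] by (simp add: K_def)
      qed
      then have "(LBINT s:{0..t}. - (min (M s) (kerint (\<lambda>_ _. 1) l (D s) (p s) (r s) \<xi> / (4 * l)) * p s \<xi>))
        = (LBINT s:{0..t}. - (lagP l (p s) (r s) \<xi> * p s \<xi>))"
        by (intro set_lebesgue_integral_cong) auto
      then show ?thesis using r_eq[of t \<xi>] t by simp
    next
      case False
      then have "t = 0" using t by simp
      then show ?thesis using r_eq[of 0 \<xi>] by (simp add: set_integral_at_point)
    qed
  qed (use T R p r p_eq v0 v0_bound D in auto)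
  have "\<exists>R. good R T" if T: "T \<ge> 0" for T
  proof -
    obtain R where R: "R \<ge> 1" "\<And>t \<xi>. t \<in> {0..T} \<Longrightarrow> \<bar>p t \<xi>\<bar> \<le> R * w \<xi>" "\<And>t \<xi>. t \<in> {0..T} \<Longrightarrow> \<bar>r t \<xi>\<bar> \<le> R * w \<xi>"
      using bounds[OF T] by blast
    define \<kappa> where "\<kappa> = (1 + M T) * R"
    have \<kappa>: "\<kappa> \<ge> 0" using M(2)[of T] R(1) by (simp add: \<kappa>_def)
    have dp: "\<bar>p t \<xi> - p s \<xi>\<bar> \<le> \<kappa> * \<bar>t - s\<bar> * w \<xi>" if st: "s \<in> {0..T}" "t \<in> {0..T}" for s t \<xi>
    proof -
      have "\<bar>r t \<xi> / 2\<bar> \<le> \<kappa> * w \<xi>" if "t \<in> {0..T}" for t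
      proof -
        have "\<bar>r t \<xi> / 2\<bar> \<le> 1 * R * w \<xi>" using R(3)[OF that, of \<xi>] by simp
        also have "\<dots> \<le> \<kappa> * w \<xi>" unfolding \<kappa>_def using M(2)[of T] R(1) w_ge_1[of \<xi>] by (intro mult_right_mono) auto
        finally show ?thesis .
      qed
      from time_integral_Lipschitz[of "\<lambda>s. r s \<xi> / 2" T, OF _ this st] show ?thesis
        using p_eq[of s \<xi>] p_eq[of t \<xi>] st by (simp add: mult_ac)
    qed
    have dr: "\<bar>r t \<xi> - r s \<xi>\<bar> \<le> \<kappa> * \<bar>t - s\<bar> * w \<xi>" if st: "s \<in> {0..T}" "t \<in> {0..T}" for s t \<xi>
    proof -
      have "\<bar>- (min (M t) (K t \<xi>) * p t \<xi>)\<bar> \<le> \<kappa> * w \<xi>" if "t \<in> {0..T}" for t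
      proof -
        have "\<bar>min (M t) (K t \<xi>)\<bar> \<le> 1 + M T"
          using M(2)[of t] K_nonneg[of t \<xi>] monoD[OF M(1), of t T] that by auto
        then have "\<bar>min (M t) (K t \<xi>)\<bar> * \<bar>p t \<xi>\<bar> \<le> (1 + M T) * (R * w \<xi>)"
          using R(2)[OF that, of \<xi>] M(2)[of T] by (intro mult_mono) auto
        then show ?thesis by (simp add: \<kappa>_def abs_mult mult_ac)
      qed
      from time_integral_Lipschitz[of "\<lambda>s. - (min (M s) (K s \<xi>) * p s \<xi>)" T, OF _ this st] show ?thesis
        using r_eq'[of s \<xi>] r_eq'[of t \<xi>] st K_measurable[of \<xi>] by (simp add: mult_ac)
    qed
    have acS: "ac (?S t) (\<lambda>s. (p t s)\<^sup>2)" if "t \<in> {0..T}" for t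
      by (rule ac_sint_square[of _ R]) (use R(2)[OF that] in auto)
    have dS: "\<bar>(?S t \<xi> - ?S t \<eta>) - (?S s \<xi> - ?S s \<eta>)\<bar> \<le> 2 * R * \<kappa> * \<bar>t - s\<bar> * (\<bar>\<xi> - \<eta>\<bar> + G)"
      if st: "s \<in> {0..T}" "t \<in> {0..T}" for s t \<xi> \<eta>
    proof -
      have le: "\<bar>(p t \<eta>)\<^sup>2 - (p s \<eta>)\<^sup>2\<bar> \<le> 2 * R * \<kappa> * \<bar>t - s\<bar> * (w \<eta>)\<^sup>2" for \<eta>
      proof -
        have "\<bar>(p t \<eta>)\<^sup>2 - (p s \<eta>)\<^sup>2\<bar> = \<bar>p t \<eta> + p s \<eta>\<bar> * \<bar>p t \<eta> - p s \<eta>\<bar>"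
          by (simp add: power2_eq_square square_diff_square_factored abs_mult)
        also have "\<dots> \<le> (2 * (R * w \<eta>)) * (\<kappa> * \<bar>t - s\<bar> * w \<eta>)"
          by (rule mult_mono) (use R(2)[OF st(1), of \<eta>] R(2)[OF st(2), of \<eta>] dp[OF st, of \<eta>] R(1) w_ge_1[of \<eta>] in auto)
        finally show ?thesis by (simp add: power2_eq_square mult_ac)
      qed
      have *: "\<bar>(?S t b - ?S s b) - (?S t a - ?S s a)\<bar> \<le> 2 * R * \<kappa> * \<bar>t - s\<bar> * ((b - a) + G)" if "a \<le> b" for a b
        using weighted_square_interval(2)[OF _ le that] ac_integral[OF ac_diff[OF acS[OF st(2)] acS[OF st(1)]] that] by simp
      show ?thesis using *[of \<xi> \<eta>] *[of \<eta> \<xi>] by (cases "\<xi> \<le> \<eta>") (auto simp: abs_if split: if_splits)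
    qed
    define c where "c = 2 * R * \<kappa>"
    define C where "C = lip_const R (D T) * \<kappa> / (4 * l)"
    have "R \<ge> 0" using R(1) by simp
    then have C: "C \<ge> 0" unfolding C_def lip_const_def using \<kappa> l_pos G_nonneg
      by (intro divide_nonneg_pos mult_nonneg_nonneg add_nonneg_nonneg integral_nonneg_AE) auto
    have c: "c \<ge> 0" using R(1) \<kappa> by (simp add: c_def)
    \<comment> \<open>The step length depends on \<open>T\<close> but not on the time already
      reached. \<open>c * \<delta> \<le> 1/2\<close> lets the slope of position distances fall from
      1 to at most 1/2, \<open>c * \<delta> * G \<le> 1\<close> uses the margin in \<open>D\<close>,
      and \<open>C * \<delta> \<le> 1\<close> the margin in \<open>M\<close>.\<close>
    define \<delta> where "\<delta> = 1 / (2 * c + c * G + C + 1)"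
    have dpos: "2 * c + c * G + C + 1 > 0" using c C G_nonneg by (simp add: add_nonneg_pos)
    have \<delta>: "\<delta> > 0" "c * \<delta> \<le> 1 / 2" "c * \<delta> * G \<le> 1" "C * \<delta> \<le> 1"
    proof -
      have "0 \<le> c * G" using c G_nonneg by simp
      then show "\<delta> > 0" "c * \<delta> \<le> 1 / 2" "c * \<delta> * G \<le> 1" "C * \<delta> \<le> 1"
        using dpos c C by (simp_all add: \<delta>_def field_simps)
    qed
    have R': "\<bar>p s \<xi>\<bar> \<le> R * w \<xi> \<and> \<bar>r s \<xi>\<bar> \<le> R * w \<xi>" if "s \<in> {0..t}" "t \<le> T" for s t \<xi>
      using R that by auto
    have step: "good R t'" if "good R t" and tt': "0 \<le> t" "t \<le> t'" "t' \<le> T" "t' - t \<le> \<delta>" for t t'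
    proof -
      have fl: "flow l g v0 p r m t R (D t)" using that(1) by (simp add: good_def)
      interpret F: flow l g v0 p r m t R "D t" by (rule fl)
      have tT: "t \<in> {0..T}" "t \<in> {0..t}" using tt' by auto
      have ap: "lagP l (p s) (r s) \<xi> + 1 \<le> M s" "\<bar>\<xi> - \<eta>\<bar> - D s + 1 \<le> \<bar>?S s \<xi> - ?S s \<eta>\<bar>" if "s \<in> {0..t}" for s \<xi> \<eta>
        using flow_apriori(1)[OF fl that, of \<xi>] flow_apriori(2)[OF fl that, of \<xi> \<eta>] that by (auto simp: M_def D_def)
      have K_eq: "K s \<xi> = lagP l (p s) (r s) \<xi>" if "\<And>\<xi> \<eta>. \<bar>\<xi> - \<eta>\<bar> / 2 - D s \<le> \<bar>?S s \<xi> - ?S s \<eta>\<bar>" for s \<xi>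
        unfolding K_def kerint_def lagP_def ker_def using that by (simp add: max_absorb1)
      have gr: "\<bar>\<xi> - \<eta>\<bar> / 2 - D t \<le> \<bar>?S s \<xi> - ?S s \<eta>\<bar>" if s: "s \<in> {t..t'}" for s \<xi> \<eta>
      proof -
        have sT: "s \<in> {0..T}" and st: "\<bar>s - t\<bar> \<le> \<delta>" using s tt' by auto
        have "\<bar>(?S s \<xi> - ?S s \<eta>) - (?S t \<xi> - ?S t \<eta>)\<bar> \<le> c * \<bar>s - t\<bar> * (\<bar>\<xi> - \<eta>\<bar> + G)"
          using dS[OF tT(1) sT] by (simp add: c_def)
        also have "\<dots> \<le> c * \<delta> * (\<bar>\<xi> - \<eta>\<bar> + G)" using st c G_nonneg by (intro mult_right_mono mult_left_mono) auto
        also have "\<dots> \<le> 1 / 2 * \<bar>\<xi> - \<eta>\<bar> + 1"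
          using mult_right_mono[OF \<delta>(2), of "\<bar>\<xi> - \<eta>\<bar>"] \<delta>(3) by (simp add: distrib_left)
        finally have "\<bar>(?S s \<xi> - ?S s \<eta>) - (?S t \<xi> - ?S t \<eta>)\<bar> \<le> 1 / 2 * \<bar>\<xi> - \<eta>\<bar> + 1" .
        moreover have "\<bar>b\<bar> \<le> \<bar>a\<bar> + \<bar>a - b\<bar>" for a b :: real by linarith
        note this[of "?S t \<xi> - ?S t \<eta>" "?S s \<xi> - ?S s \<eta>"]
        moreover note ap(2)[OF tT(2), of \<xi> \<eta>]
        ultimately show ?thesis by argo
      qed
      have gr2: "\<bar>\<xi> - \<eta>\<bar> / 2 - D s \<le> \<bar>?S s \<xi> - ?S s \<eta>\<bar>" if "s \<in> {0..t'}" for s \<xi> \<eta>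
      proof (cases "s \<le> t")
        case True
        then have "s \<in> {0..t}" using that by auto
        from ap(2)[OF this, of \<xi> \<eta>] abs_ge_zero[of "\<xi> - \<eta>"] show ?thesis by argo
      next
        case False
        then show ?thesis using gr[of s \<xi> \<eta>] that monoD[OF D(1), of t s] by auto
      qed
      have Kle: "K s \<xi> \<le> M s" if "s \<in> {0..t'}" for s \<xi>
      proof (cases "s \<le> t")
        case True
        then show ?thesis using ap(1)[of s \<xi>] K_eq[OF gr2[OF that], of \<xi>] that by simp
      next
        case False
        then have sT: "s \<in> {0..T}" and st: "s \<in> {t..t'}" "\<bar>s - t\<bar> \<le> \<delta>" using that tt' by auto
        \<comment> \<open>Neither the lower bound with \<open>D s\<close> nor that with
          \<open>D t\<close> is active at time \<open>s\<close>, so the level may be frozen at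
          \<open>D t\<close>, as the Lipschitz estimate requires.\<close>
        have kD: "kerint (\<lambda>_ _. 1) l (D s) (p s) (r s) \<xi> = kerint (\<lambda>_ _. 1) l (D t) (p s) (r s) \<xi>"
          unfolding kerint_def ker_def using gr[OF st(1)] gr2[OF that] by (simp add: max_absorb1)
        have "\<bar>kerint (\<lambda>_ _. 1) l (D t) (p s) (r s) \<xi> - kerint (\<lambda>_ _. 1) l (D t) (p t) (r t) \<xi>\<bar> \<le> lip_const R (D t) * (\<kappa> * \<bar>s - t\<bar>)"
          by (rule kerint_Lipschitz) (use R(2,3)[OF sT] R(2,3)[OF tT(1)] dp[OF tT(1) sT] dr[OF tT(1) sT] in auto)
        also have "\<dots> \<le> lip_const R (D T) * (\<kappa> * \<bar>s - t\<bar>)"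
          using lip_const_mono[of R "D t" "D T"] R(1) monoD[OF D(1), of t T] tt' \<kappa> by (intro mult_right_mono) auto
        also have "\<dots> = 4 * l * (C * \<bar>s - t\<bar>)" using l_pos by (simp add: C_def)
        also have "C * \<bar>s - t\<bar> \<le> 1" using mult_left_mono[OF st(2) C] \<delta>(4) by linarith
        finally have "\<bar>kerint (\<lambda>_ _. 1) l (D t) (p s) (r s) \<xi> - kerint (\<lambda>_ _. 1) l (D t) (p t) (r t) \<xi>\<bar> \<le> 4 * l * 1"
          using l_pos by simp
        then have "kerint (\<lambda>_ _. 1) l (D s) (p s) (r s) \<xi> \<le> kerint (\<lambda>_ _. 1) l (D t) (p t) (r t) \<xi> + 4 * l"
          using kD by linarith
        then have "K s \<xi> \<le> K t \<xi> + 1" using l_pos by (simp add: K_def field_simps)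
        also have "K t \<xi> + 1 \<le> M t" using ap(1)[OF tT(2), of \<xi>] K_eq[OF gr2, of t \<xi>] tt' by simp
        also have "\<dots> \<le> M s" using monoD[OF M(1), of t s] st by simp
        finally show ?thesis .
      qed
      show ?thesis by (rule goodI) (use tt' R(1) R' gr2 Kle in auto)
    qed
    have good0: "good R 0"
    proof (rule goodI)
      fix t \<xi> \<eta> :: real assume "t \<in> {0..0}"
      then have "t = 0" by simp
      have p0: "p 0 \<xi> = 1" for \<xi> using p_eq[of 0 \<xi>] by (simp add: set_integral_at_point)
      have 0: "0 \<in> {0..T}" using T by simp
      have "?S 0 b - ?S 0 a = b - a" if "a \<le> b" for a b
        using ac_integral[OF acS[OF 0] that] ac_integral[OF ac_id that] by (simp add: p0)
      then have "\<bar>?S 0 \<xi> - ?S 0 \<eta>\<bar> = \<bar>\<xi> - \<eta>\<bar>" by (metis abs_minus_commute linear)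
      moreover have "b / 2 - d \<le> a" if "a = b" "0 \<le> d" "0 \<le> b" for a b d :: real using that by simp
      ultimately show "\<bar>\<xi> - \<eta>\<bar> / 2 - D t \<le> \<bar>?S t \<xi> - ?S t \<eta>\<bar>"
        unfolding \<open>t = 0\<close> using D(2)[of 0] abs_ge_zero by blast
    qed (use R(1) R' T in auto)
    have "good R (min (real n * \<delta>) T)" for n
    proof (induction n)
      case (Suc n)
      show ?case
        by (rule step[OF Suc]) (use \<delta>(1) T in \<open>auto simp: algebra_simps min_def\<close>)
    qed (use good0 T in simp)
    moreover obtain n :: nat where "T < real n * \<delta>" using reals_Archimedean3[OF \<delta>(1)] by blast
    ultimately have "good R T" by (metis min.absorb2 less_imp_le)
    then show ?thesis by blast
  qed
  then show ?thesis using that unfolding good_def by blast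
qed

end

section \<open>Return to the spatial variable\<close>

text \<open>One time slice: \<open>Z\<close> selects the leftmost label of a position. Two labels of one position differ only
  by labels where \<open>p\<close> vanishes, so the choice is immaterial almost everywhere.\<close>

locale slice =
  fixes Y Uf pf rf :: "real \<Rightarrow> real"
  assumes acY: "ac Y (\<lambda>\<xi>. (pf \<xi>)\<^sup>2)" and acU: "ac Uf (\<lambda>\<xi>. pf \<xi> * rf \<xi>)"
    and Y_top: "filterlim Y at_top at_top" and Y_bot: "filterlim Y at_bot at_bot"
    and pf_measurable [measurable]: "pf \<in> borel_measurable borel"
    and rf_measurable [measurable]: "rf \<in> borel_measurable borel"
begin

definition Z :: "real \<Rightarrow> real" where "Z x = Inf {\<xi>. x \<le> Y \<xi>}"

lemma Y_mono: "\<xi> \<le> \<eta> \<Longrightarrow> Y \<xi> \<le> Y \<eta>"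
  by (rule ac_mono[OF acY]) auto

text \<open>The infimum is attained because \<open>Y\<close> is continuous. The resulting adjunction
  between \<open>Z\<close> and \<open>Y\<close> yields monotonicity and measurability of
  \<open>Z\<close>.\<close>

lemma Z_le_iff: "Z x \<le> \<xi> \<longleftrightarrow> x \<le> Y \<xi>"
proof -
  obtain x1 where x1: "Y x1 = x" using ac_surj[OF acY Y_top Y_bot] by blast
  obtain x0 where x0: "Y x0 = x - 1" using ac_surj[OF acY Y_top Y_bot] by blast
  have bdd: "bdd_below {\<xi>. x \<le> Y \<xi>}"
  proof (rule bdd_belowI[of _ x0])
    fix \<xi> assume "\<xi> \<in> {\<xi>. x \<le> Y \<xi>}"
    then show "x0 \<le> \<xi>" using Y_mono[of \<xi> x0] x0 by (cases "x0 \<le> \<xi>") auto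
  qed
  have cl: "closed {\<xi>. x \<le> Y \<xi>}"
    by (intro closed_Collect_le ac_continuous[OF acY] continuous_on_const)
  have "Z x \<in> {\<xi>. x \<le> Y \<xi>}"
    unfolding Z_def by (rule closed_contains_Inf[OF _ bdd cl]) (use x1 in auto)
  then show ?thesis
    using cInf_lower[OF _ bdd, of \<xi>] Y_mono[of "Z x" \<xi>] unfolding Z_def by force
qed

lemma Y_Z [simp]: "Y (Z x) = x"
proof -
  obtain x1 where x1: "Y x1 = x" using ac_surj[OF acY Y_top Y_bot] by blast
  have "Z x \<le> x1" using x1 by (simp add: Z_le_iff)
  then have "Y (Z x) \<le> x" using Y_mono x1 by blast
  moreover have "x \<le> Y (Z x)" using Z_le_iff[of x "Z x"] by simp
  ultimately show ?thesis by simp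
qed

lemma Z_Y_le: "Z (Y \<xi>) \<le> \<xi>"
  by (simp add: Z_le_iff)

lemma Z_mono_iff: "Z x \<le> Z z \<longleftrightarrow> x \<le> z"
  by (simp add: Z_le_iff)

lemma Z_measurable [measurable]: "Z \<in> borel_measurable borel"
  by (rule borel_measurable_mono) (simp add: mono_def Z_mono_iff)

lemma plateau:
  assumes "\<xi> \<le> \<eta>" "Y \<xi> = Y \<eta>"
  shows "AE s in lborel. s \<in> {\<xi>..\<eta>} \<longrightarrow> pf s = 0"
proof -
  have i: "integrable lborel (\<lambda>s. indicator {\<xi>..\<eta>} s * (pf s)\<^sup>2)"
    using ac_set_integrable[OF acY, of \<xi> \<eta>] by (simp add: set_integrable_def)
  have "(LBINT s. indicator {\<xi>..\<eta>} s * (pf s)\<^sup>2) = 0"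
    using ac_integral[OF acY assms(1)] assms(2) by (simp add: set_lebesgue_integral_def)
  then have "AE s in lborel. indicator {\<xi>..\<eta>} s * (pf s)\<^sup>2 = 0"
    using integral_nonneg_eq_0_iff_AE[OF i] by simp
  then show ?thesis by eventually_elim (auto simp: indicator_def)
qed

text \<open>On a plateau of \<open>Y\<close> the factor \<open>p\<close> vanishes almost everywhere,
  and with it the density \<open>p r\<close>: labels of one position have one velocity.\<close>

lemma U_Z [simp]: "Uf (Z (Y \<xi>)) = Uf \<xi>"
proof -
  have "AE s in lborel. s \<in> {Z (Y \<xi>)..\<xi>} \<longrightarrow> pf s = 0"
    by (rule plateau[OF Z_Y_le]) simp
  then have "AE s in lborel. indicator {Z (Y \<xi>)..\<xi>} s *\<^sub>R (pf s * rf s) = 0"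
    by eventually_elim (auto simp: indicator_def)
  then have "(LBINT s:{Z (Y \<xi>)..\<xi>}. pf s * rf s) = 0"
    unfolding set_lebesgue_integral_def by (rule integral_eq_zero_AE)
  then show ?thesis using ac_integral[OF acU Z_Y_le, of \<xi>] by simp
qed

text \<open>A label that is not leftmost on its plateau either lies strictly inside it, hence
  between two rationals of equal position, where \<open>p\<close> vanishes almost everywhere; or it
  is the right end of a plateau containing a rational, and there are countably many of
  these.\<close>

lemma AE_Z_Y: "AE \<xi> in lborel. pf \<xi> \<noteq> 0 \<longrightarrow> Z (Y \<xi>) = \<xi>"
proof -
  have "AE s in lborel. \<forall>q\<in>\<rat>. \<forall>q'\<in>\<rat>. q \<le> q' \<longrightarrow> Y q = Y q' \<longrightarrow> s \<in> {q..q'} \<longrightarrow> pf s = 0"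
  proof (intro AE_ball_countable' countable_rat)
    fix q q' :: real
    show "AE s in lborel. q \<le> q' \<longrightarrow> Y q = Y q' \<longrightarrow> s \<in> {q..q'} \<longrightarrow> pf s = 0"
      using plateau[of q q'] by (cases "q \<le> q' \<and> Y q = Y q'") auto
  qed
  moreover have "AE s in lborel. \<forall>q\<in>\<rat>. s \<noteq> Sup {\<eta>. Y \<eta> \<le> Y q}"
    by (intro AE_ball_countable' countable_rat AE_lborel_singleton)
  ultimately show ?thesis
  proof eventually_elim
    case (elim \<xi>)
    show ?case
    proof (intro impI)
      assume "pf \<xi> \<noteq> 0"
      show "Z (Y \<xi>) = \<xi>"
      proof (rule ccontr)
        assume "Z (Y \<xi>) \<noteq> \<xi>"
        then have "Z (Y \<xi>) < \<xi>" using Z_Y_le[of \<xi>] by simp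
        then obtain q where q: "q \<in> \<rat>" "Z (Y \<xi>) < q" "q < \<xi>" using Rats_dense_in_real by blast
        have Yq: "Y q = Y \<xi>" using Y_mono[of "Z (Y \<xi>)" q] Y_mono[of q \<xi>] q by simp
        have above: "Y \<eta> > Y \<xi>" if "\<eta> > \<xi>" for \<eta>
        proof (rule ccontr)
          assume "\<not> Y \<eta> > Y \<xi>"
          then have "Y \<eta> = Y \<xi>" using Y_mono[of \<xi> \<eta>] that by simp
          obtain q' where q': "q' \<in> \<rat>" "\<xi> < q'" "q' < \<eta>" using Rats_dense_in_real[OF \<open>\<eta> > \<xi>\<close>] by blast
          have "Y q' = Y \<xi>" using Y_mono[of \<xi> q'] Y_mono[of q' \<eta>] q' \<open>Y \<eta> = Y \<xi>\<close> by simp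
          then have "pf \<xi> = 0" using elim(1) q q' Yq by force
          then show False using \<open>pf \<xi> \<noteq> 0\<close> by simp
        qed
        have "Sup {\<eta>. Y \<eta> \<le> Y q} = \<xi>"
        proof (rule cSup_eq_maximum)
          show "\<xi> \<in> {\<eta>. Y \<eta> \<le> Y q}" using Yq by simp
          fix \<eta> assume "\<eta> \<in> {\<eta>. Y \<eta> \<le> Y q}"
          then show "\<eta> \<le> \<xi>" using above[of \<eta>] Yq by (cases "\<eta> \<le> \<xi>") auto
        qed
        then show False using elim(2) q(1) by blast
      qed
    qed
  qed
qed

definition u :: "real \<Rightarrow> real" where "u x = Uf (Z x)"
text \<open>Where \<open>p\<close> vanishes at the chosen label the quotient is 0 by convention;
  such positions form a null set because positions have label density \<open>p^2\<close>.\<close>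

definition ux :: "real \<Rightarrow> real" where "ux x = rf (Z x) / pf (Z x)"

lemma u_Y [simp]: "u (Y \<xi>) = Uf \<xi>"
  by (simp add: u_def)

lemma ux_measurable [measurable]: "ux \<in> borel_measurable borel"
  unfolding ux_def by measurable

lemma AE_ux_Y: "AE \<xi> in lborel. pf \<xi> \<noteq> 0 \<longrightarrow> ux (Y \<xi>) = rf \<xi> / pf \<xi>"
  using AE_Z_Y by eventually_elim (simp add: ux_def)

lemma
  assumes F: "case_prod F \<in> borel_plane"
  shows integral_subst: "(LBINT x. F x (ux x)) = (LBINT \<xi>. (pf \<xi>)\<^sup>2 * F (Y \<xi>) (rf \<xi> / pf \<xi>))"
    and integrable_subst: "integrable lborel (\<lambda>x. F x (ux x)) \<longleftrightarrow> integrable lborel (\<lambda>\<xi>. (pf \<xi>)\<^sup>2 * F (Y \<xi>) (rf \<xi> / pf \<xi>))"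
proof -
  have [measurable]: "Y \<in> borel_measurable borel" by (rule ac_borel[OF acY])
  have m: "(\<lambda>x. F x (ux x)) \<in> borel_measurable borel" by (rule measurable_Pair_apply[OF F]) auto
  have m1: "(\<lambda>\<xi>. (pf \<xi>)\<^sup>2 * F (Y \<xi>) (ux (Y \<xi>))) \<in> borel_measurable lborel"
    "(\<lambda>\<xi>. (pf \<xi>)\<^sup>2 * F (Y \<xi>) (rf \<xi> / pf \<xi>)) \<in> borel_measurable lborel"
    using measurable_Pair_apply[OF F, of Y borel "\<lambda>\<xi>. ux (Y \<xi>)"] measurable_Pair_apply[OF F, of Y borel "\<lambda>\<xi>. rf \<xi> / pf \<xi>"]
    by (auto intro!: borel_measurable_times)
  have AE: "AE \<xi> in lborel. (pf \<xi>)\<^sup>2 * F (Y \<xi>) (ux (Y \<xi>)) = (pf \<xi>)\<^sup>2 * F (Y \<xi>) (rf \<xi> / pf \<xi>)"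
    using AE_ux_Y by eventually_elim auto
  show "(LBINT x. F x (ux x)) = (LBINT \<xi>. (pf \<xi>)\<^sup>2 * F (Y \<xi>) (rf \<xi> / pf \<xi>))"
    unfolding integral_ac_subst[OF acY zero_le_power2 Y_top Y_bot m] by (rule integral_cong_AE[OF m1 AE])
  show "integrable lborel (\<lambda>x. F x (ux x)) \<longleftrightarrow> integrable lborel (\<lambda>\<xi>. (pf \<xi>)\<^sup>2 * F (Y \<xi>) (rf \<xi> / pf \<xi>))"
    unfolding integrable_ac_subst[OF acY zero_le_power2 Y_top Y_bot m] by (rule integrable_cong_AE[OF m1 AE])
qed

lemma AE_subst:
  assumes "Measurable.pred borel Q"
  shows "(AE x in lborel. Q (ux x)) \<longleftrightarrow> (AE \<xi> in lborel. pf \<xi> \<noteq> 0 \<longrightarrow> Q (rf \<xi> / pf \<xi>))"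
proof -
  have "Measurable.pred borel (\<lambda>x. Q (ux x))" by (rule measurable_compose[OF ux_measurable assms])
  then have "(AE x in lborel. Q (ux x)) \<longleftrightarrow> (AE \<xi> in lborel. (pf \<xi>)\<^sup>2 > 0 \<longrightarrow> Q (ux (Y \<xi>)))"
    by (rule AE_ac_subst[OF acY zero_le_power2 Y_top Y_bot])
  also have "\<dots> \<longleftrightarrow> (AE \<xi> in lborel. pf \<xi> \<noteq> 0 \<longrightarrow> Q (rf \<xi> / pf \<xi>))"
  proof
    assume "AE \<xi> in lborel. (pf \<xi>)\<^sup>2 > 0 \<longrightarrow> Q (ux (Y \<xi>))"
    then show "AE \<xi> in lborel. pf \<xi> \<noteq> 0 \<longrightarrow> Q (rf \<xi> / pf \<xi>)"
      using AE_ux_Y by eventually_elim simp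
  next
    assume "AE \<xi> in lborel. pf \<xi> \<noteq> 0 \<longrightarrow> Q (rf \<xi> / pf \<xi>)"
    then show "AE \<xi> in lborel. (pf \<xi>)\<^sup>2 > 0 \<longrightarrow> Q (ux (Y \<xi>))"
      using AE_ux_Y by eventually_elim simp
  qed
  finally show ?thesis .
qed

text \<open>Only an inequality holds at a general time: labels with \<open>p = 0\<close> may carry
  energy \<open>r^2\<close> that no function of the position sees.\<close>

lemma ux_square_integrable:
  assumes "integrable lborel (\<lambda>\<xi>. (rf \<xi>)\<^sup>2)"
  shows "integrable lborel (\<lambda>x. (ux x)\<^sup>2)" and "(LBINT x. (ux x)\<^sup>2) \<le> (LBINT \<xi>. (rf \<xi>)\<^sup>2)"
proof -
  have m: "case_prod (\<lambda>(x::real) (q::real). q\<^sup>2) \<in> borel_plane"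
    by (simp add: case_prod_beta')
  have le: "(pf \<xi>)\<^sup>2 * (rf \<xi> / pf \<xi>)\<^sup>2 \<le> (rf \<xi>)\<^sup>2" for \<xi>
    by (cases "pf \<xi> = 0") (auto simp: power_divide)
  have i: "integrable lborel (\<lambda>\<xi>. (pf \<xi>)\<^sup>2 * (rf \<xi> / pf \<xi>)\<^sup>2)"
    by (rule Bochner_Integration.integrable_bound[OF assms]) (use le in auto)
  then show "integrable lborel (\<lambda>x. (ux x)\<^sup>2)" using integrable_subst[OF m] by simp
  show "(LBINT x. (ux x)\<^sup>2) \<le> (LBINT \<xi>. (rf \<xi>)\<^sup>2)"
    unfolding integral_subst[OF m] by (rule integral_mono[OF i assms]) (rule le)
qed

text \<open>Up to labels with \<open>p = 0\<close>, the positions in \<open>[a, b]\<close> are those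
  of the labels in \<open>[Z a, Z b]\<close>, and \<open>p^2 (r/p) = p r\<close> is the density of
  \<open>U\<close>.\<close>

lemma ac_u: "ac u ux"
  unfolding ac_def
proof (intro conjI allI impI)
  fix a b :: real assume "a \<le> b"
  define F where "F x q = indicator {a..b} x * q" for x q :: real
  have m: "case_prod F \<in> borel_plane"
    unfolding F_def case_prod_beta' by measurable
  have [measurable]: "Y \<in> borel_measurable borel" by (rule ac_borel[OF acY])
  have "AE \<xi> in lborel. indicator {Z a..Z b} \<xi> *\<^sub>R (pf \<xi> * rf \<xi>) = (pf \<xi>)\<^sup>2 * F (Y \<xi>) (rf \<xi> / pf \<xi>)"
    using AE_Z_Y
  proof eventually_elim
    case (elim \<xi>)
    show ?case
    proof (cases "pf \<xi> = 0")
      case False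
      then have "Z (Y \<xi>) = \<xi>" using elim by simp
      then have "\<xi> \<in> {Z a..Z b} \<longleftrightarrow> Y \<xi> \<in> {a..b}" using Z_mono_iff[of a "Y \<xi>"] Z_mono_iff[of "Y \<xi>" b] by simp
      then show ?thesis using False by (auto simp: F_def indicator_def power2_eq_square)
    qed simp
  qed
  note AE = this
  have m1: "(\<lambda>\<xi>. indicator {Z a..Z b} \<xi> *\<^sub>R (pf \<xi> * rf \<xi>)) \<in> borel_measurable lborel"
    "(\<lambda>\<xi>. (pf \<xi>)\<^sup>2 * F (Y \<xi>) (rf \<xi> / pf \<xi>)) \<in> borel_measurable lborel"
    unfolding F_def by measurable
  have Zab: "Z a \<le> Z b" using \<open>a \<le> b\<close> by (simp add: Z_mono_iff)
  have "integrable lborel (\<lambda>\<xi>. (pf \<xi>)\<^sup>2 * F (Y \<xi>) (rf \<xi> / pf \<xi>))"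
    using ac_set_integrable[OF acU, of "Z a" "Z b"] integrable_cong_AE[OF m1 AE] by (simp add: set_integrable_def)
  then show "set_integrable lborel {a..b} ux"
    using integrable_subst[OF m] by (simp add: set_integrable_def F_def)
  have "(LBINT x:{a..b}. ux x) = (LBINT \<xi>. (pf \<xi>)\<^sup>2 * F (Y \<xi>) (rf \<xi> / pf \<xi>))"
    using integral_subst[OF m] by (simp add: set_lebesgue_integral_def F_def)
  also have "\<dots> = (LBINT \<xi>:{Z a..Z b}. pf \<xi> * rf \<xi>)"
    unfolding set_lebesgue_integral_def by (rule integral_cong_AE[OF m1 AE, symmetric])
  also have "\<dots> = u b - u a" using ac_integral[OF acU Zab] by (simp add: u_def)
  finally show "(LBINT x:{a..b}. ux x) = u b - u a" .
qed simp

end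

text \<open>Cauchy-Schwarz, from the nonnegativity of the integral of
  \<open>(\<bar>f\<bar> - c)^2\<close> with \<open>c\<close> the mean of
  \<open>\<bar>f\<bar>\<close>.\<close>

lemma square_integral_le:
  fixes f :: "real \<Rightarrow> real"
  assumes f [measurable]: "f \<in> borel_measurable borel" and "a < b" and i2: "set_integrable lborel {a..b} (\<lambda>x. (f x)\<^sup>2)"
  shows "(LBINT x:{a..b}. \<bar>f x\<bar>)\<^sup>2 \<le> (b - a) * (LBINT x:{a..b}. (f x)\<^sup>2)"
proof -
  have one: "set_integrable lborel {a..b} (\<lambda>x. d)" for d :: real
    by (rule borel_integrable_atLeastAtMost') simp
  have i1: "set_integrable lborel {a..b} (\<lambda>x. \<bar>f x\<bar>)"
    unfolding set_integrable_def
  proof (rule Bochner_Integration.integrable_bound)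
    show "integrable lborel (\<lambda>x. indicator {a..b} x * (1 + (f x)\<^sup>2))"
      using set_integral_add(1)[OF one[of 1] i2] by (simp add: set_integrable_def)
    show "AE x in lborel. norm (indicator {a..b} x *\<^sub>R \<bar>f x\<bar>) \<le> norm (indicator {a..b} x * (1 + (f x)\<^sup>2))"
    proof (intro AE_I2)
      fix x
      have "0 \<le> (\<bar>f x\<bar> - 1)\<^sup>2" by simp
      then have "\<bar>f x\<bar> * 2 \<le> 1 + (f x)\<^sup>2" by (simp add: power2_diff)
      then have "\<bar>f x\<bar> \<le> 1 + (f x)\<^sup>2" using abs_ge_zero[of "f x"] by linarith
      then show "norm (indicator {a..b} x *\<^sub>R \<bar>f x\<bar>) \<le> norm (indicator {a..b} x * (1 + (f x)\<^sup>2))"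
        by (simp add: indicator_def)
    qed
  qed simp
  define I where "I = (LBINT x:{a..b}. \<bar>f x\<bar>)"
  define c where "c = I / (b - a)"
  have "0 \<le> (LBINT x:{a..b}. (\<bar>f x\<bar> - c)\<^sup>2)"
    unfolding set_lebesgue_integral_def by (intro integral_nonneg_AE AE_I2) simp
  also have "\<dots> = (LBINT x:{a..b}. (f x)\<^sup>2 - 2 * c * \<bar>f x\<bar> + c\<^sup>2)"
    by (simp add: power2_diff mult_ac algebra_simps)
  also have "\<dots> = (LBINT x:{a..b}. (f x)\<^sup>2) - 2 * c * I + c\<^sup>2 * (b - a)"
  proof -
    have "(LBINT x:{a..b}. c\<^sup>2) = c\<^sup>2 * (b - a)" using \<open>a < b\<close> by (simp add: set_lebesgue_integral_def)
    moreover have ic: "set_integrable lborel {a..b} (\<lambda>x. 2 * c * \<bar>f x\<bar>)" using i1 by simp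
    ultimately show ?thesis
      using set_integral_add(2)[OF set_integral_diff(1)[OF i2 ic] one[of "c\<^sup>2"]] set_integral_diff(2)[OF i2 ic]
      by (simp add: I_def)
  qed
  also have "\<dots> = (LBINT x:{a..b}. (f x)\<^sup>2) - I\<^sup>2 / (b - a)"
  proof -
    have cI: "c * (b - a) = I" using \<open>a < b\<close> by (simp add: c_def)
    have "c\<^sup>2 * (b - a) = c * I" by (simp only: power2_eq_square mult.assoc cI)
    moreover have "c * I = I\<^sup>2 / (b - a)" by (simp add: c_def power2_eq_square)
    ultimately show ?thesis by simp
  qed
  finally have "I\<^sup>2 / (b - a) \<le> (LBINT x:{a..b}. (f x)\<^sup>2)" by simp
  then show ?thesis using \<open>a < b\<close> by (simp add: I_def field_simps)
qed

text \<open>By Tonelli, each \<open>s\<close> is counted by the \<open>x\<close> in an interval of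
  length \<open>b - a\<close>.\<close>

lemma window_integral:
  fixes h :: "real \<Rightarrow> real"
  assumes h: "integrable lborel h" "\<And>x. h x \<ge> 0" and ab: "a \<le> b"
  shows "integrable lborel (\<lambda>x. LBINT s:{x+a..x+b}. h s)"
    and "(LBINT x. (LBINT s:{x+a..x+b}. h s)) = (b - a) * (LBINT s. h s)"
proof -
  have [measurable]: "h \<in> borel_measurable borel" using h(1) by auto
  have im: "(\<lambda>x. LBINT s. indicator {x+a..x+b} s * h s) \<in> borel_measurable borel"
    unfolding indicator_def by (rule lborel.borel_measurable_lebesgue_integral) (simp add: case_prod_beta')
  have ind: "indicator {x+a..x+b} s = (indicator {s-b..s-a} x :: real)" for x s :: real
    by (auto simp: indicator_def)
  have i: "integrable lborel (\<lambda>s. indicator {x+a..x+b} s * h s)" for x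
    by (rule Bochner_Integration.integrable_bound[OF h(1)]) (use h(2) in \<open>auto simp: indicator_def\<close>)
  have "(\<integral>\<^sup>+x. ennreal (LBINT s. indicator {x+a..x+b} s * h s) \<partial>lborel)
      = (\<integral>\<^sup>+x. (\<integral>\<^sup>+s. ennreal (indicator {x+a..x+b} s * h s) \<partial>lborel) \<partial>lborel)"
    using h(2) i by (intro nn_integral_cong nn_integral_eq_integral[symmetric]) auto
  also have "\<dots> = (\<integral>\<^sup>+s. (\<integral>\<^sup>+x. ennreal (indicator {x+a..x+b} s * h s) \<partial>lborel) \<partial>lborel)"
    unfolding indicator_def
    by (rule lborel_pair.Fubini'[symmetric]) (simp add: case_prod_beta')
  also have "\<dots> = (\<integral>\<^sup>+s. ennreal (b - a) * ennreal (h s) \<partial>lborel)"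
  proof (rule nn_integral_cong)
    fix s
    have "(\<integral>\<^sup>+x. ennreal (indicator {x+a..x+b} s * h s) \<partial>lborel) = (\<integral>\<^sup>+x. ennreal (h s) * indicator {s-b..s-a} x \<partial>lborel)"
      unfolding ind by (intro nn_integral_cong) (auto simp: indicator_def)
    also have "\<dots> = ennreal (b - a) * ennreal (h s)"
      using ab by (simp add: nn_integral_cmult_indicator mult.commute)
    finally show "(\<integral>\<^sup>+x. ennreal (indicator {x+a..x+b} s * h s) \<partial>lborel) = ennreal (b - a) * ennreal (h s)" .
  qed
  also have "\<dots> = ennreal (b - a) * ennreal (LBINT s. h s)"
    using h by (simp add: nn_integral_cmult nn_integral_eq_integral)
  also have "\<dots> = ennreal ((b - a) * (LBINT s. h s))"
    using ab by (simp add: ennreal_mult')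
  finally have eq: "(\<integral>\<^sup>+x. ennreal (LBINT s. indicator {x+a..x+b} s * h s) \<partial>lborel) = ennreal ((b - a) * (LBINT s. h s))" .
  have nn: "0 \<le> (LBINT s. indicator {x+a..x+b} s * h s)" for x
    using h(2) by (intro integral_nonneg_AE) auto
  have int: "integrable lborel (\<lambda>x. LBINT s. indicator {x+a..x+b} s * h s)"
    by (rule integrableI_nonneg) (use im nn eq in auto)
  then show "integrable lborel (\<lambda>x. LBINT s:{x+a..x+b}. h s)" by (simp add: set_lebesgue_integral_def)
  have "0 \<le> (b - a) * (LBINT s. h s)" using ab h(2) by (intro mult_nonneg_nonneg integral_nonneg_AE) auto
  then have "(LBINT x. (LBINT s. indicator {x+a..x+b} s * h s)) = (b - a) * (LBINT s. h s)"
    using eq nn_integral_eq_integral[OF int] nn by (simp add: integral_nonneg_AE)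
  then show "(LBINT x. (LBINT s:{x+a..x+b}. h s)) = (b - a) * (LBINT s. h s)"
    by (simp add: set_lebesgue_integral_def)
qed

section \<open>Removal of the spatial weight and conservation of the label energy\<close>

context energy
begin

text \<open>The sequence starts at the threshold \<open>\<epsilon> * l = 1/2\<close> of the energy
  estimate and decreases, so that the weights increase and monotone convergence applies.\<close>

definition eps :: "nat \<Rightarrow> real" where "eps n = (1 / (2 * l)) * inverse (real (Suc n))"

lemma eps: "0 < eps n" "eps n * l \<le> 1 / 2" "eps (Suc n) \<le> eps n" "eps n \<le> eps 0" "eps \<longlonglongrightarrow> 0"
proof -
  have inv: "inverse (real (Suc n)) \<le> 1" "inverse (real (Suc (Suc n))) \<le> inverse (real (Suc n))"
    by (auto intro!: le_imp_inverse_le simp: inverse_le_1_iff)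
  show "0 < eps n" using l_pos by (simp add: eps_def)
  show "eps n * l \<le> 1 / 2" using l_pos inv(1) by (simp add: eps_def)
  show "eps (Suc n) \<le> eps n" unfolding eps_def using l_pos by (intro mult_left_mono inv(2)) simp
  show "eps n \<le> eps 0" unfolding eps_def using l_pos inv(1) by (intro mult_left_mono) auto
  have "(\<lambda>n. (1 / (2 * l)) * inverse (real (Suc n))) \<longlonglongrightarrow> (1 / (2 * l)) * 0"
    by (intro tendsto_mult_left LIMSEQ_inverse_real_of_nat)
  then show "eps \<longlonglongrightarrow> 0" by (simp add: eps_def[abs_def])
qed

abbreviation "e_init \<equiv> (LBINT \<xi>. (v0 \<xi> - \<phi> \<xi>)\<^sup>2 + l\<^sup>2 * (g \<xi>)\<^sup>2)"

lemma E_eps_le: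
  assumes i0: "integrable lborel (\<lambda>\<xi>. (v0 \<xi> - \<phi> \<xi>)\<^sup>2)" and t: "t \<in> {0..T}"
  shows "E (eps n) t \<le> (e_init + k * N * t) * exp ((4 * eps n * Wmax + 3 * L + k) * t)"
    and "E (eps n) t \<le> (e_init + k * N * T) * exp ((4 * eps 0 * Wmax + 3 * L + k) * T)"
proof -
  have "E (eps n) t \<le> (E (eps n) 0 + k * N * t) * exp ((4 * eps n * Wmax + 3 * L + k) * t)"
    by (rule E_le[OF t eps(1,2)])
  also have "\<dots> \<le> (e_init + k * N * t) * exp ((4 * eps n * Wmax + 3 * L + k) * t)"
    using E_0_le[OF i0 eps(1), of n] by (intro mult_right_mono) auto
  finally show 1: "E (eps n) t \<le> (e_init + k * N * t) * exp ((4 * eps n * Wmax + 3 * L + k) * t)" .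
  have "0 \<le> e_init" by (rule integral_nonneg_AE) simp
  have kN: "0 \<le> k * N" using k_nonneg N_nonneg by simp
  have kNt: "k * N * t \<le> k * N * T" using t by (intro mult_left_mono kN) auto
  have a1: "4 * eps n * Wmax \<le> 4 * eps 0 * Wmax" using eps(4)[of n] Wmax_nonneg by (intro mult_right_mono) auto
  have a2: "0 \<le> 4 * eps 0 * Wmax" using less_imp_le[OF eps(1)[of 0]] Wmax_nonneg by simp
  have "(4 * eps n * Wmax + 3 * L + k) * t \<le> (4 * eps 0 * Wmax + 3 * L + k) * T"
    by (intro mult_mono) (use a1 a2 L_nonneg k_nonneg t in auto)
  then have "(e_init + k * N * t) * exp ((4 * eps n * Wmax + 3 * L + k) * t) \<le> (e_init + k * N * T) * exp ((4 * eps 0 * Wmax + 3 * L + k) * T)"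
    using \<open>0 \<le> e_init\<close> kNt mult_nonneg_nonneg[OF kN T_nonneg] by (intro mult_mono) auto
  then show "E (eps n) t \<le> (e_init + k * N * T) * exp ((4 * eps 0 * Wmax + 3 * L + k) * T)"
    using 1 by linarith
qed

text \<open>The weights increase to 1 and the weighted energies are bounded uniformly in
  \<open>n\<close>, so monotone convergence yields both finiteness of the full energy and the
  limit.\<close>

lemma E_limit:
  assumes i0: "integrable lborel (\<lambda>\<xi>. (v0 \<xi> - \<phi> \<xi>)\<^sup>2)" and t: "t \<in> {0..T}"
  shows "integrable lborel (e t)" and "(\<lambda>n. E (eps n) t) \<longlonglongrightarrow> (LBINT \<xi>. e t \<xi>)"
proof -
  have mono: "rho (eps n) x \<le> rho (eps (Suc n)) x" for n x
    using eps(3)[of n] by (simp add: rho_def mult_right_mono)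
  have mono': "mono (\<lambda>n. rho (eps n) (y t \<xi>) * e t \<xi>)" for \<xi>
    by (intro incseq_SucI mult_right_mono mono) (use e_nonneg in auto)
  have "incseq (\<lambda>n. E (eps n) t)"
    unfolding E_def
    by (intro incseq_SucI integral_mono E_integrable[OF t eps(1)] mult_right_mono mono e_nonneg)
  then obtain M where M: "(\<lambda>n. E (eps n) t) \<longlonglongrightarrow> M"
    using incseq_convergent[of "\<lambda>n. E (eps n) t"] E_eps_le(2)[OF assms] by blast
  have lim: "(\<lambda>n. rho (eps n) (y t \<xi>) * e t \<xi>) \<longlonglongrightarrow> e t \<xi>" for \<xi>
  proof -
    have "(\<lambda>n. exp (- eps n * sqrt (1 + (y t \<xi>)\<^sup>2)) * e t \<xi>) \<longlonglongrightarrow> exp (- 0 * sqrt (1 + (y t \<xi>)\<^sup>2)) * e t \<xi>"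
      by (intro tendsto_intros eps)
    then show ?thesis by (simp add: rho_def)
  qed
  have "has_bochner_integral lborel (e t) M"
    by (rule has_bochner_integral_monotone_convergence[where f="\<lambda>n \<xi>. rho (eps n) (y t \<xi>) * e t \<xi>"])
       (use M mono' lim E_integrable[OF t eps(1)] in \<open>auto simp: E_def\<close>)
  then show "integrable lborel (e t)" "(\<lambda>n. E (eps n) t) \<longlonglongrightarrow> (LBINT \<xi>. e t \<xi>)"
    using M by (auto simp: has_bochner_integral_iff)
qed

lemma energy_le:
  assumes i0: "integrable lborel (\<lambda>\<xi>. (v0 \<xi> - \<phi> \<xi>)\<^sup>2)" and t: "t \<in> {0..T}"
  shows "(LBINT \<xi>. e t \<xi>) \<le> (e_init + k * N * t) * exp ((3 * L + k) * t)"
proof -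
  have "(\<lambda>n. (e_init + k * N * t) * exp ((4 * eps n * Wmax + 3 * L + k) * t)) \<longlonglongrightarrow> (e_init + k * N * t) * exp ((4 * 0 * Wmax + 3 * L + k) * t)"
    by (intro tendsto_intros eps)
  then have "(\<lambda>n. (e_init + k * N * t) * exp ((4 * eps n * Wmax + 3 * L + k) * t)) \<longlonglongrightarrow> (e_init + k * N * t) * exp ((3 * L + k) * t)"
    by simp
  then show ?thesis
    by (rule LIMSEQ_le[OF E_limit(2)[OF assms]]) (use E_eps_le(1)[OF assms] in auto)
qed

text \<open>For \<open>L = k = 0\<close> the source consists of cutoff errors only. They are of
  order \<open>eps n\<close> because the weighted energies are bounded uniformly in \<open>n\<close>
  and in time.\<close>

lemma energy_conserved:
  assumes i0: "integrable lborel (\<lambda>\<xi>. (v0 \<xi> - \<phi> \<xi>)\<^sup>2)" and t: "t \<in> {0..T}" and "L = 0" "k = 0"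
  shows "(LBINT \<xi>. e t \<xi>) = (LBINT \<xi>. e 0 \<xi>)"
proof -
  define B where "B = (e_init + k * N * T) * exp ((4 * eps 0 * Wmax + 3 * L + k) * T)"
  have 0: "0 \<in> {0..T}" using T_nonneg by simp
  have le: "\<bar>E (eps n) t - E (eps n) 0\<bar> \<le> eps n * (4 * Wmax * B * t)" for n
  proof -
    have "\<bar>E (eps n) t - E (eps n) 0\<bar> \<le> (LBINT s:{0..t}. (4 * eps n * Wmax) * E (eps n) s)"
      using E_integral_bound(1)[OF t eps(1,2), of n] assms(3,4) by simp
    also have "\<dots> \<le> (LBINT s:{0..t}. (4 * eps n * Wmax) * B)"
    proof (rule set_integral_mono)
      show "set_integrable lborel {0..t} (\<lambda>s. (4 * eps n * Wmax) * E (eps n) s)"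
        by (rule borel_integrable_atLeastAtMost')
           (use t E_integral_bound(2)[OF t eps(1,2), of n] in \<open>auto intro!: continuous_intros elim!: continuous_on_subset\<close>)
      show "set_integrable lborel {0..t} (\<lambda>s. (4 * eps n * Wmax) * B)"
        by (rule borel_integrable_atLeastAtMost') simp
      fix s assume "s \<in> {0..t}"
      then have "s \<in> {0..T}" using t by auto
      then show "(4 * eps n * Wmax) * E (eps n) s \<le> (4 * eps n * Wmax) * B"
        using E_eps_le(2)[OF i0, of s n] less_imp_le[OF eps(1)[of n]] Wmax_nonneg
        by (intro mult_left_mono) (auto simp: B_def)
    qed
    also have "\<dots> = eps n * (4 * Wmax * B * t)" using t by (simp add: set_lebesgue_integral_def mult_ac)
    finally show ?thesis .
  qed
  have "(\<lambda>n. eps n * (4 * Wmax * B * t)) \<longlonglongrightarrow> 0" by (rule tendsto_mult_left_zero[OF eps(5)])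
  then have "(\<lambda>n. E (eps n) t - E (eps n) 0) \<longlonglongrightarrow> 0"
    by (rule Lim_null_comparison[rotated]) (use le in auto)
  moreover have "(\<lambda>n. E (eps n) t - E (eps n) 0) \<longlonglongrightarrow> (LBINT \<xi>. e t \<xi>) - (LBINT \<xi>. e 0 \<xi>)"
    by (intro tendsto_diff E_limit[OF i0] t 0)
  ultimately show ?thesis using LIMSEQ_unique by fastforce
qed

end

section \<open>Zeros of \<open>p\<close> in time\<close>

context flow
begin

text \<open>The linear system never reaches \<open>(p, r) = 0\<close>, so the zeros of \<open>p\<close> are isolated in time.\<close>

lemma pr_nonzero:
  assumes t: "t \<in> {0..T}"
  shows "p t \<xi> \<noteq> 0 \<or> r t \<xi> \<noteq> 0"
proof (rule ccontr)
  assume "\<not> ?thesis"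
  then have z: "p t \<xi> = 0" "r t \<xi> = 0" by auto
  then have "t \<noteq> 0" by auto
  then have "0 < t" using t by simp
  \<comment> \<open>The derivative of \<open>p^2 + r^2\<close> is \<open>(1 - 2 P) p r\<close>,
    bounded in absolute value by \<open>K (p^2 + r^2)\<close>. With the factor
    \<open>exp (K * s)\<close> the sum is nondecreasing, so it cannot fall from a positive value to
    0.\<close>
  define K where "K = 1 + 2 * Pmax"
  define n where "n s = ((p s \<xi>)\<^sup>2 + (r s \<xi>)\<^sup>2) * exp (K * s)" for s
  define n' where "n' s = ((1 - 2 * P s \<xi>) * (p s \<xi> * r s \<xi>) + K * ((p s \<xi>)\<^sup>2 + (r s \<xi>)\<^sup>2)) * exp (K * s)" for s
  have der: "(n has_real_derivative n' s) (at s within {0..t})" if s: "s \<in> {0..t}" for s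
    unfolding n_def[abs_def] n'_def using time_derivatives_within[OF s t, of \<xi>]
    by (auto intro!: derivative_eq_intros simp: algebra_simps power2_eq_square)
  have "\<exists>s\<in>{0<..<t}. n t - n 0 = n' s * (t - 0)"
    by (rule mvt_simple[OF \<open>0 < t\<close>, of n "\<lambda>s h. n' s * h"]) (use der in \<open>simp add: has_field_derivative_def\<close>)
  then obtain s where s: "s \<in> {0<..<t}" "n t - n 0 = n' s * t" by auto
  have sT: "s \<in> {0..T}" using s t by auto
  have "\<bar>(1 - 2 * P s \<xi>) * (p s \<xi> * r s \<xi>)\<bar> \<le> K * ((p s \<xi>)\<^sup>2 + (r s \<xi>)\<^sup>2)"
  proof -
    have "\<bar>1 - 2 * P s \<xi>\<bar> \<le> K" using P_le[OF sT, of \<xi>] P_nonneg[of s \<xi>] by (simp add: K_def abs_le_iff)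
    moreover have "\<bar>p s \<xi> * r s \<xi>\<bar> \<le> (p s \<xi>)\<^sup>2 + (r s \<xi>)\<^sup>2"
    proof -
      have "0 \<le> (\<bar>p s \<xi>\<bar> - \<bar>r s \<xi>\<bar>)\<^sup>2" by simp
      then have "2 * (\<bar>p s \<xi>\<bar> * \<bar>r s \<xi>\<bar>) \<le> (p s \<xi>)\<^sup>2 + (r s \<xi>)\<^sup>2" by (simp add: power2_diff)
      moreover have "0 \<le> \<bar>p s \<xi>\<bar> * \<bar>r s \<xi>\<bar>" by simp
      ultimately show ?thesis unfolding abs_mult by linarith
    qed
    ultimately show ?thesis unfolding abs_mult[of "1 - 2 * P s \<xi>"] using Pmax_nonneg
      by (intro mult_mono) (auto simp: K_def)
  qed
  then have "n' s \<ge> 0" unfolding n'_def by (intro mult_nonneg_nonneg) (auto simp: abs_le_iff)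
  then have "n t - n 0 \<ge> 0" using s(2) \<open>0 < t\<close> by simp
  moreover have "n t = 0" using z by (simp add: n_def)
  moreover have "n 0 > 0" by (simp add: n_def add_pos_nonneg)
  ultimately show False by simp
qed

text \<open>At an accumulation point of zeros continuity gives \<open>p = 0\<close> and the
  difference quotients along the zeros give \<open>r = 0\<close>.\<close>

lemma finite_zeros: "finite {t \<in> {0..T}. p t \<xi> = 0}"
proof (rule ccontr)
  let ?Z = "{t \<in> {0..T}. p t \<xi> = 0}"
  assume "infinite ?Z"
  moreover have "compact {0..T}" by simp
  ultimately obtain s where s: "s \<in> {0..T}" "s islimpt ?Z"
    unfolding compact_eq_Bolzano_Weierstrass by blast
  have nt: "\<not> trivial_limit (at s within ?Z)" using s(2) by (simp add: trivial_limit_within)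
  have "((\<lambda>t. p t \<xi>) \<longlongrightarrow> p s \<xi>) (at s within ?Z)"
    by (rule tendsto_within_subset[of _ _ _ "{0..T}"])
       (use time_continuous(1)[of \<xi>] s(1) in \<open>auto simp: continuous_on_def\<close>)
  moreover have "eventually (\<lambda>t. p t \<xi> = 0) (at s within ?Z)"
    by (auto simp: eventually_at_filter)
  ultimately have ps: "p s \<xi> = 0"
    using tendsto_unique[OF nt _ tendsto_eventually] by blast
  have "((\<lambda>t. (p t \<xi> - p s \<xi>) / (t - s)) \<longlongrightarrow> r s \<xi> / 2) (at s within ?Z)"
    by (rule tendsto_within_subset[of _ _ _ "{0..T}"])
       (use time_derivatives(1)[OF s(1), of \<xi>] in \<open>auto simp: has_field_derivative_iff\<close>)
  moreover have "eventually (\<lambda>t. (p t \<xi> - p s \<xi>) / (t - s) = 0) (at s within ?Z)"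
    using ps by (auto simp: eventually_at_filter)
  ultimately have "r s \<xi> / 2 = 0"
    using tendsto_unique[OF nt _ tendsto_eventually] by blast
  then show False using pr_nonzero[OF s(1), of \<xi>] ps by simp
qed

text \<open>For every label the exceptional times are finite in number; Fubini exchanges the roles
  of label and time.\<close>

lemma AE_p_nonzero: "AE t in lborel. t \<in> {0..T} \<longrightarrow> (AE \<xi> in lborel. p t \<xi> \<noteq> 0)"
proof -
  have "AE \<xi> in lborel. AE t in lborel. t \<in> {0..T} \<longrightarrow> p t \<xi> \<noteq> 0"
  proof (rule AE_I2)
    fix \<xi>
    have "{t \<in> {0..T}. p t \<xi> = 0} \<in> null_sets lborel"
      by (rule finite_imp_null_set_lborel[OF finite_zeros])
    from AE_not_in[OF this] show "AE t in lborel. t \<in> {0..T} \<longrightarrow> p t \<xi> \<noteq> 0"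
      by eventually_elim auto
  qed
  then have "AE t in lborel. AE \<xi> in lborel. t \<in> {0..T} \<longrightarrow> p t \<xi> \<noteq> 0"
  proof (subst lborel_pair.AE_commute)
    have "Measurable.pred (lborel \<Otimes>\<^sub>M lborel) (\<lambda>x. fst x \<in> {0..T} \<longrightarrow> p (fst x) (snd x) \<noteq> 0)" by measurable
    then show "{x \<in> space (lborel \<Otimes>\<^sub>M lborel). fst x \<in> {0..T} \<longrightarrow> p (fst x) (snd x) \<noteq> 0} \<in> sets (lborel \<Otimes>\<^sub>M lborel)"
      by (simp add: pred_def)
  qed
  then show ?thesis by eventually_elim auto
qed

end

text \<open>The total derivative serves the chain rule along characteristics. Vanishing at
  \<open>t \<le> 0\<close>, at \<open>t \<ge> T\<close> and for large \<open>\<bar>x\<bar>\<close>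
  removes all boundary terms.\<close>

definition test_data :: "(real \<Rightarrow> real \<Rightarrow> real) \<Rightarrow> (real \<Rightarrow> real \<Rightarrow> real) \<Rightarrow> (real \<Rightarrow> real \<Rightarrow> real) \<Rightarrow> real \<Rightarrow> real \<Rightarrow> bool" where
  "test_data \<psi> \<psi>t \<psi>x T X \<longleftrightarrow> T > 0 \<and> X > 0 \<and>
     (\<forall>t x. ((\<lambda>z. \<psi> (fst z) (snd z)) has_derivative (\<lambda>h. \<psi>t t x * fst h + \<psi>x t x * snd h)) (at (t, x))) \<and>
     continuous_on UNIV (\<lambda>z. \<psi>t (fst z) (snd z)) \<and> continuous_on UNIV (\<lambda>z. \<psi>x (fst z) (snd z)) \<and>
     (\<forall>t x. t \<le> 0 \<or> t \<ge> T \<or> \<bar>x\<bar> \<ge> X \<longrightarrow> \<psi> t x = 0 \<and> \<psi>t t x = 0 \<and> \<psi>x t x = 0)"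

lemma test_function_data:
  assumes "\<psi> \<in> test_functions ({0<..} \<times> UNIV)"
  obtains \<psi>t \<psi>x T X where "test_data (\<lambda>t x. \<psi> (t, x)) \<psi>t \<psi>x T X"
    "\<And>t x. deriv (\<lambda>s. \<psi> (s, x)) t = \<psi>t t x" "\<And>t x. deriv (\<lambda>z. \<psi> (t, z)) x = \<psi>x t x"
proof -
  let ?K = "closure {z. \<psi> z \<noteq> 0}"
  have C: "Ck (Suc 0) \<psi>" and K: "compact ?K" "?K \<subseteq> {0<..} \<times> UNIV"
    using assms unfolding test_functions_def by blast+
  define \<psi>t where "\<psi>t t x = frechet_derivative \<psi> (at (t, x)) (1, 0)" for t x
  define \<psi>x where "\<psi>x t x = frechet_derivative \<psi> (at (t, x)) (0, 1)" for t x
  have D: "(\<psi> has_derivative (\<lambda>h. \<psi>t t x * fst h + \<psi>x t x * snd h)) (at (t, x))" for t x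
  proof -
    have d: "(\<psi> has_derivative frechet_derivative \<psi> (at (t, x))) (at (t, x))"
      using C frechet_derivative_works by auto
    interpret bounded_linear "frechet_derivative \<psi> (at (t, x))" by (rule has_derivative_bounded_linear[OF d])
    have eq: "frechet_derivative \<psi> (at (t, x)) h = \<psi>t t x * fst h + \<psi>x t x * snd h" for h
    proof -
      have "h = fst h *\<^sub>R (1, 0) + snd h *\<^sub>R (0, 1)" by (cases h) simp
      then have "frechet_derivative \<psi> (at (t, x)) h = frechet_derivative \<psi> (at (t, x)) (fst h *\<^sub>R (1, 0) + snd h *\<^sub>R (0, 1))" by simp
      also have "\<dots> = fst h * \<psi>t t x + snd h * \<psi>x t x" by (simp only: add scaleR \<psi>t_def \<psi>x_def real_scaleR_def)
      finally show ?thesis by (simp add: mult.commute)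
    qed
    have "frechet_derivative \<psi> (at (t, x)) = (\<lambda>h. \<psi>t t x * fst h + \<psi>x t x * snd h)"
      by (rule ext) (rule eq)
    then show ?thesis using d by metis
  qed
  have dt: "deriv (\<lambda>s. \<psi> (s, x)) t = \<psi>t t x" for t x
  proof (rule DERIV_imp_deriv)
    have d: "((\<lambda>s. (s, x)) has_derivative (\<lambda>h. (h, 0))) (at t)" by (auto intro!: derivative_eq_intros)
    have "((\<lambda>s. \<psi> (s, x)) has_derivative (\<lambda>h. \<psi>t t x * h)) (at t)"
      using has_derivative_compose[OF d D[of t x]] by simp
    then show "((\<lambda>s. \<psi> (s, x)) has_real_derivative \<psi>t t x) (at t)"
      by (simp add: has_field_derivative_def)
  qed
  have dx: "deriv (\<lambda>z. \<psi> (t, z)) x = \<psi>x t x" for t x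
  proof (rule DERIV_imp_deriv)
    have d: "((\<lambda>z. (t, z)) has_derivative (\<lambda>h. (0, h))) (at x)" by (auto intro!: derivative_eq_intros)
    have "((\<lambda>z. \<psi> (t, z)) has_derivative (\<lambda>h. \<psi>x t x * h)) (at x)"
      using has_derivative_compose[OF d D[of t x]] by simp
    then show "((\<lambda>z. \<psi> (t, z)) has_real_derivative \<psi>x t x) (at x)"
      by (simp add: has_field_derivative_def)
  qed
  obtain B where B: "\<And>z. z \<in> ?K \<Longrightarrow> norm z \<le> B" using compact_imp_bounded[OF K(1)] unfolding bounded_iff by blast
  define T where "T = \<bar>B\<bar> + 1"
  have out: "(t, x) \<notin> ?K" if "t \<le> 0 \<or> t \<ge> T \<or> \<bar>x\<bar> \<ge> T" for t x
  proof
    assume z: "(t, x) \<in> ?K"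
    have "norm (t, x) \<le> B" by (rule B[OF z])
    moreover have "\<bar>t\<bar> \<le> norm (t, x)" "\<bar>x\<bar> \<le> norm (t, x)" using norm_fst_le[of t x] norm_snd_le[of x t] by simp_all
    moreover have "t > 0" using K(2) z by auto
    ultimately show False using that unfolding T_def by linarith
  qed
  have zero: "\<psi> (t, x) = 0 \<and> \<psi>t t x = 0 \<and> \<psi>x t x = 0" if o: "(t, x) \<notin> ?K" for t x
  proof -
    have ev: "eventually (\<lambda>z. z \<in> - ?K) (nhds (t, x))"
      using o by (intro eventually_nhds_in_open) auto
    have "\<psi> z = 0" if "z \<in> - ?K" for z using that closure_subset[of "{z. \<psi> z \<noteq> 0}"] by auto
    then have ev0: "eventually (\<lambda>z. \<psi> z = 0) (nhds (t, x))" by (rule eventually_mono[OF ev])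
    have "((\<lambda>_. 0) has_derivative (\<lambda>_. 0)) (at (t, x))" by simp
    moreover have "\<psi> (t, x) = 0" by (rule eventually_nhds_x_imp_x[OF ev0])
    moreover have "eventually (\<lambda>z. 0 = \<psi> z) (at (t, x))"
      unfolding eventually_at_filter by (rule eventually_mono[OF ev0]) simp
    ultimately have "(\<psi> has_derivative (\<lambda>_. 0)) (at (t, x))"
      using has_derivative_transform_eventually[of "\<lambda>_. 0" "\<lambda>_. 0" "(t, x)" UNIV \<psi>] by simp
    then have "frechet_derivative \<psi> (at (t, x)) = (\<lambda>_. 0)" by (rule frechet_derivative_at[symmetric])
    then show ?thesis using eventually_nhds_x_imp_x[OF ev0] by (simp add: \<psi>t_def \<psi>x_def)
  qed
  have "test_data (\<lambda>t x. \<psi> (t, x)) \<psi>t \<psi>x T T"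
    unfolding test_data_def
  proof (intro conjI allI impI)
    have c: "continuous_on UNIV (\<lambda>z. frechet_derivative \<psi> (at z) v)" for v using C unfolding Ck.simps by blast
    show "continuous_on UNIV (\<lambda>z. \<psi>t (fst z) (snd z))" "continuous_on UNIV (\<lambda>z. \<psi>x (fst z) (snd z))"
      using c[of "(1, 0)"] c[of "(0, 1)"] by (simp_all add: \<psi>t_def \<psi>x_def)
  qed (use zero out D in \<open>auto simp: T_def\<close>)
  then show ?thesis using that dt dx by blast
qed

lemma test_data_bounded:
  assumes "test_data \<psi> \<psi>t \<psi>x T X"
  obtains B where "B \<ge> 0" "\<And>t x. \<bar>\<psi> t x\<bar> \<le> B" "\<And>t x. \<bar>\<psi>t t x\<bar> \<le> B" "\<And>t x. \<bar>\<psi>x t x\<bar> \<le> B"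
proof -
  note d = assms[unfolded test_data_def]
  have bd: "\<exists>B\<ge>0. \<forall>t x. \<bar>f t x\<bar> \<le> B"
    if c: "continuous_on UNIV (\<lambda>z. f (fst z) (snd z))" and o: "\<And>t x. t \<le> 0 \<or> t \<ge> T \<or> \<bar>x\<bar> \<ge> X \<Longrightarrow> f t x = 0" for f :: "real \<Rightarrow> real \<Rightarrow> real"
  proof -
    have "compact ((\<lambda>z. f (fst z) (snd z)) ` ({0..T} \<times> {-X..X}))"
      by (intro compact_continuous_image continuous_on_subset[OF c] compact_Times) auto
    then have "bounded ((\<lambda>z. f (fst z) (snd z)) ` ({0..T} \<times> {-X..X}))" by (rule compact_imp_bounded)
    then obtain B where B': "\<And>z. z \<in> {0..T} \<times> {-X..X} \<Longrightarrow> norm (f (fst z) (snd z)) \<le> B"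
      unfolding bounded_iff by blast
    have B: "\<bar>f t x\<bar> \<le> B" if "t \<in> {0..T}" "x \<in> {-X..X}" for t x
      using B'[of "(t, x)"] that by simp
    have "\<bar>f t x\<bar> \<le> \<bar>B\<bar>" for t x
    proof (cases "t \<in> {0..T} \<and> x \<in> {-X..X}")
      case True
      then show ?thesis using B[of t x] by linarith
    next
      case False
      then have "t \<le> 0 \<or> t \<ge> T \<or> \<bar>x\<bar> \<ge> X" by (auto simp: abs_le_iff)
      then show ?thesis using o[of t x] by simp
    qed
    then show ?thesis by (intro exI[of _ "\<bar>B\<bar>"]) auto
  qed
  have "continuous_on UNIV (\<lambda>z. \<psi> (fst z) (snd z))"
  proof (intro continuous_at_imp_continuous_on ballI)
    fix z :: "real \<times> real"
    have "((\<lambda>z. \<psi> (fst z) (snd z)) has_derivative (\<lambda>h. \<psi>t (fst z) (snd z) * fst h + \<psi>x (fst z) (snd z) * snd h)) (at (fst z, snd z))"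
      using d by blast
    then show "isCont (\<lambda>z. \<psi> (fst z) (snd z)) z" using has_derivative_continuous by fastforce
  qed
  then obtain B1 where B1: "B1 \<ge> 0" "\<And>t x. \<bar>\<psi> t x\<bar> \<le> B1" using bd[of \<psi>] d by blast
  obtain B2 where B2: "B2 \<ge> 0" "\<And>t x. \<bar>\<psi>t t x\<bar> \<le> B2" using bd[of \<psi>t] d by blast
  obtain B3 where B3: "B3 \<ge> 0" "\<And>t x. \<bar>\<psi>x t x\<bar> \<le> B3" using bd[of \<psi>x] d by blast
  show ?thesis
  proof (rule that[of "B1 + B2 + B3"])
    show "B1 + B2 + B3 \<ge> 0" using B1(1) B2(1) B3(1) by simp
    show "\<bar>\<psi> t x\<bar> \<le> B1 + B2 + B3" for t x using B1(2)[of t x] B2(1) B3(1) by linarith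
    show "\<bar>\<psi>t t x\<bar> \<le> B1 + B2 + B3" for t x using B2(2)[of t x] B1(1) B3(1) by linarith
    show "\<bar>\<psi>x t x\<bar> \<le> B1 + B2 + B3" for t x using B3(2)[of t x] B1(1) B2(1) by linarith
  qed
qed

section \<open>Conservation laws\<close>

lemma test_data_measurable:
  assumes "test_data \<psi> \<psi>t \<psi>x T X"
  shows "case_prod \<psi> \<in> borel_plane" "case_prod \<psi>t \<in> borel_plane"
    "case_prod \<psi>x \<in> borel_plane"
proof -
  note d = assms[unfolded test_data_def]
  have "continuous_on UNIV (\<lambda>z. \<psi> (fst z) (snd z))"
  proof (intro continuous_at_imp_continuous_on ballI)
    fix z :: "real \<times> real"
    have "((\<lambda>z. \<psi> (fst z) (snd z)) has_derivative (\<lambda>h. \<psi>t (fst z) (snd z) * fst h + \<psi>x (fst z) (snd z) * snd h)) (at (fst z, snd z))"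
      using d by blast
    then show "isCont (\<lambda>z. \<psi> (fst z) (snd z)) z" using has_derivative_continuous by fastforce
  qed
  then show "case_prod \<psi> \<in> borel_plane" "case_prod \<psi>t \<in> borel_plane"
    "case_prod \<psi>x \<in> borel_plane"
    using d unfolding borel_prod case_prod_beta' by (blast intro: borel_measurable_continuous_onI)+
qed

context flow
begin

lemma test_time_derivative:
  assumes d: "test_data \<psi> \<psi>t \<psi>x T' X" and s: "s \<in> {0..T}"
  shows "((\<lambda>s. \<psi> s (y s \<xi>)) has_real_derivative \<psi>t s (y s \<xi>) + \<psi>x s (y s \<xi>) * U s \<xi>) (at s within {0..T})"
proof -
  have D: "((\<lambda>z. \<psi> (fst z) (snd z)) has_derivative (\<lambda>h. \<psi>t s (y s \<xi>) * fst h + \<psi>x s (y s \<xi>) * snd h)) (at (s, y s \<xi>))"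
    using d unfolding test_data_def by blast
  have dy: "((\<lambda>s. y s \<xi>) has_derivative (\<lambda>h. U s \<xi> * h)) (at s within {0..T})"
    using time_derivatives(4)[OF s, of \<xi>] by (simp add: has_field_derivative_def)
  have "((\<lambda>s. (s, y s \<xi>)) has_derivative (\<lambda>h. (h, U s \<xi> * h))) (at s within {0..T})"
    by (intro has_derivative_Pair has_derivative_ident dy)
  from has_derivative_compose[OF this D]
  have "((\<lambda>s. \<psi> s (y s \<xi>)) has_derivative (\<lambda>h. (\<psi>t s (y s \<xi>) + \<psi>x s (y s \<xi>) * U s \<xi>) * h)) (at s within {0..T})"
    by (simp add: distrib_right mult.assoc)
  then show ?thesis by (simp add: has_field_derivative_def)
qed

lemma ac_test:
  assumes d: "test_data \<psi> \<psi>t \<psi>x T' X" and t: "t \<in> {0..T}"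
  shows "ac (\<lambda>\<xi>. \<psi> t (y t \<xi>)) (\<lambda>\<xi>. \<psi>x t (y t \<xi>) * (p t \<xi>)\<^sup>2)"
proof (rule ac_chain[OF ac_y[OF t]])
  fix x
  have D: "((\<lambda>z. \<psi> (fst z) (snd z)) has_derivative (\<lambda>h. \<psi>t t x * fst h + \<psi>x t x * snd h)) (at (t, x))"
    using d unfolding test_data_def by blast
  have dz: "((\<lambda>z. (t, z)) has_derivative (\<lambda>h. (0, h))) (at x)" by (auto intro!: derivative_eq_intros)
  from has_derivative_compose[OF dz D] show "(\<psi> t has_real_derivative \<psi>x t x) (at x)"
    by (simp add: has_field_derivative_def)
next
  have "continuous_on UNIV (\<lambda>z. \<psi>x (fst z) (snd z))" using d unfolding test_data_def by blast
  moreover have "continuous_on UNIV (\<lambda>x::real. (t, x))" by (intro continuous_intros)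
  ultimately have "continuous_on UNIV (\<lambda>x. \<psi>x (fst (t, x)) (snd (t, x)))"
    by (rule continuous_on_compose2) auto
  then show "continuous_on UNIV (\<psi>x t)" by simp
qed

text \<open>Labels and positions differ by at most \<open>Umax * T\<close>, so a function supported
  in \<open>\<bar>x\<bar> \<le> X\<close> lives on this interval of labels at all times.\<close>

definition box :: "real \<Rightarrow> real \<Rightarrow> real" where "box X \<xi> = indicator {-(X + Umax * T)..X + Umax * T} \<xi>"

lemma box_dom:
  assumes "\<And>t x. \<bar>f t x\<bar> \<le> B" "\<And>t x. \<bar>x\<bar> \<ge> X \<Longrightarrow> f t x = 0"
  shows "dom (box X) (\<lambda>t \<xi>. f t (y t \<xi>))"
proof (rule domI[of _ B])
  fix t \<xi> assume t: "t \<in> {0..T}"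
  show "\<bar>f t (y t \<xi>)\<bar> \<le> B * box X \<xi>"
  proof (cases "\<bar>y t \<xi>\<bar> \<ge> X")
    case True
    have "0 \<le> B" using assms(1)[of 0 0] by linarith
    then show ?thesis using assms(2)[OF True] by (simp add: box_def)
  next
    case False
    then have "\<bar>\<xi>\<bar> \<le> X + Umax * T" using y_id[OF t, of \<xi>] by linarith
    then have "box X \<xi> = 1" by (auto simp: box_def indicator_def abs_le_iff)
    then show ?thesis using assms(1) by simp
  qed
qed

lemma test_dom:
  assumes d: "test_data \<psi> \<psi>t \<psi>x T' X"
  shows "dom (box X) (\<lambda>t \<xi>. \<psi> t (y t \<xi>))" "dom (box X) (\<lambda>t \<xi>. \<psi>t t (y t \<xi>))" "dom (box X) (\<lambda>t \<xi>. \<psi>x t (y t \<xi>))"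
proof -
  obtain B where B: "B \<ge> 0" "\<And>t x. \<bar>\<psi> t x\<bar> \<le> B" "\<And>t x. \<bar>\<psi>t t x\<bar> \<le> B" "\<And>t x. \<bar>\<psi>x t x\<bar> \<le> B"
    using test_data_bounded[OF d] by blast
  note z = d[unfolded test_data_def]
  show "dom (box X) (\<lambda>t \<xi>. \<psi> t (y t \<xi>))" by (rule box_dom[OF B(2)]) (use z in blast)
  show "dom (box X) (\<lambda>t \<xi>. \<psi>t t (y t \<xi>))" by (rule box_dom[OF B(3)]) (use z in blast)
  show "dom (box X) (\<lambda>t \<xi>. \<psi>x t (y t \<xi>))" by (rule box_dom[OF B(4)]) (use z in blast)
qed

lemma box_dens_bound:
  assumes "dom (\<lambda>\<xi>. box X \<xi> * (w \<xi>)\<^sup>2) f"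
  obtains k where "integrable lborel k" "\<And>t \<xi>. t \<in> {0..T} \<Longrightarrow> \<bar>f t \<xi>\<bar> \<le> k \<xi>"
proof -
  obtain C where C: "\<And>t \<xi>. t \<in> {0..T} \<Longrightarrow> \<bar>f t \<xi>\<bar> \<le> C * (box X \<xi> * (w \<xi>)\<^sup>2)" using assms unfolding dom_def by blast
  have "integrable lborel (\<lambda>\<xi>. box X \<xi> * (w \<xi>)\<^sup>2)"
    using w_interval(1)[of "-(X + Umax * T)" "X + Umax * T"] by (simp add: set_integrable_def box_def)
  then have "integrable lborel (\<lambda>\<xi>. C * (box X \<xi> * (w \<xi>)\<^sup>2))" by (rule integrable_mult_right)
  then show ?thesis using C that by blast
qed

lemma box_limits:
  assumes "dom (box X) f" "t \<in> {0..T}"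
  shows "(f t \<longlongrightarrow> 0) at_top" "(f t \<longlongrightarrow> 0) at_bot"
proof -
  obtain C where C: "\<And>\<xi>. \<bar>f t \<xi>\<bar> \<le> C * box X \<xi>" using assms unfolding dom_def by blast
  have z: "f t \<xi> = 0" if "\<bar>\<xi>\<bar> > X + Umax * T" for \<xi>
  proof -
    have "box X \<xi> = 0" using that by (auto simp: box_def indicator_def abs_if split: if_splits)
    then show ?thesis using C[of \<xi>] by simp
  qed
  show "(f t \<longlongrightarrow> 0) at_top"
    by (intro tendsto_eventually eventually_mono[OF eventually_gt_at_top[of "\<bar>X + Umax * T\<bar>"]] z) linarith
  show "(f t \<longlongrightarrow> 0) at_bot"
    by (intro tendsto_eventually eventually_mono[OF eventually_at_bot_dense[THEN iffD2, OF exI, of "- \<bar>X + Umax * T\<bar>" "\<lambda>x. x < - \<bar>X + Umax * T\<bar>"]] z)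
       (simp, linarith)
qed

text \<open>Each conservation law is the identity \<open>A \<psi>\<^sub>t - B \<psi> + C \<psi>\<^sub>x = \<Theta>\<^sub>t - \<Xi>\<^sub>\<xi>\<close> in the labels.\<close>

lemma test_transport:
  assumes d: "test_data \<psi> \<psi>t \<psi>x T X"
    and f: "\<And>s \<xi>. s \<in> {0..T} \<Longrightarrow> ((\<lambda>s. f s \<xi>) has_real_derivative f' s \<xi>) (at s within {0..T})"
    and h: "\<And>s. s \<in> {0..T} \<Longrightarrow> ac (h s) (h' s)"
    and fd: "dens f" "dens f'" "bdd h" "dens h'"
    and m: "case_prod f \<in> borel_plane" "case_prod f' \<in> borel_plane"
       "case_prod h \<in> borel_plane" "case_prod h' \<in> borel_plane"
    and J: "\<And>s \<xi>. J s \<xi> = (\<psi>t s (y s \<xi>) + \<psi>x s (y s \<xi>) * U s \<xi>) * f s \<xi> + \<psi> s (y s \<xi>) * f' s \<xi>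
        - (\<psi> s (y s \<xi>) * h' s \<xi> + \<psi>x s (y s \<xi>) * (h s \<xi> * (p s \<xi>)\<^sup>2))"
  shows "(LBINT s:{0..T}. (LBINT \<xi>. J s \<xi>)) = 0"
    and "(\<lambda>s. LBINT \<xi>. J s \<xi>) \<in> borel_measurable borel"
proof -
  note z = d[unfolded test_data_def]
  note dm = test_dom[OF d]
  note tm = test_data_measurable[OF d]
  have [measurable]: "(\<lambda>x. \<psi> (fst x) (y (fst x) (snd x))) \<in> borel_plane"
    "(\<lambda>x. \<psi>t (fst x) (y (fst x) (snd x))) \<in> borel_plane"
    "(\<lambda>x. \<psi>x (fst x) (y (fst x) (snd x))) \<in> borel_plane"
    by (rule measurable_Pair_apply[OF tm(1)] measurable_Pair_apply[OF tm(2)] measurable_Pair_apply[OF tm(3)]; simp)+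
  have [measurable]: "(\<lambda>x. f (fst x) (snd x)) \<in> borel_plane" "(\<lambda>x. f' (fst x) (snd x)) \<in> borel_plane"
    "(\<lambda>x. h (fst x) (snd x)) \<in> borel_plane" "(\<lambda>x. h' (fst x) (snd x)) \<in> borel_plane"
    using m by (simp_all add: case_prod_beta')
  define \<theta> where "\<theta> s \<xi> = \<psi>t s (y s \<xi>) * f s \<xi> + \<psi>x s (y s \<xi>) * (U s \<xi> * f s \<xi>) + \<psi> s (y s \<xi>) * f' s \<xi>" for s \<xi>
  define \<zeta> where "\<zeta> s \<xi> = \<psi> s (y s \<xi>) * h' s \<xi> + \<psi>x s (y s \<xi>) * (h s \<xi> * (p s \<xi>)\<^sup>2)" for s \<xi>
  have "dom (\<lambda>\<xi>. box X \<xi> * (w \<xi>)\<^sup>2) \<theta>"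
    unfolding \<theta>_def[abs_def] by (intro dom_add dom_times dom_mult dm fd bdd_basic)
  then obtain k1 where k1: "integrable lborel k1" "\<And>t \<xi>. t \<in> {0..T} \<Longrightarrow> \<bar>\<theta> t \<xi>\<bar> \<le> k1 \<xi>"
    using box_dens_bound by blast
  have "dom (\<lambda>\<xi>. box X \<xi> * (w \<xi>)\<^sup>2) \<zeta>"
    unfolding \<zeta>_def[abs_def] by (intro dom_add dom_times dom_mult dm fd dens_basic)
  then obtain k2 where k2: "integrable lborel k2" "\<And>t \<xi>. t \<in> {0..T} \<Longrightarrow> \<bar>\<zeta> t \<xi>\<bar> \<le> k2 \<xi>"
    using box_dens_bound by blast
  have dh: "dom (box X) (\<lambda>s \<xi>. h s \<xi> * \<psi> s (y s \<xi>))"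
    by (intro dom_mult fd dm)
  have "(LBINT \<xi>. \<psi> T (y T \<xi>) * f T \<xi>) - (LBINT \<xi>. \<psi> 0 (y 0 \<xi>) * f 0 \<xi>) = (LBINT s:{0..T}. (LBINT \<xi>. \<theta> s \<xi> - \<zeta> s \<xi>))"
  proof (rule transport(2)[where \<Theta>="\<lambda>s \<xi>. \<psi> s (y s \<xi>) * f s \<xi>" and \<Xi>="\<lambda>s \<xi>. h s \<xi> * \<psi> s (y s \<xi>)" and k=k1 and k'=k2])
    fix s assume s: "s \<in> {0..T}"
    show "((\<lambda>s. \<psi> s (y s \<xi>) * f s \<xi>) has_real_derivative \<theta> s \<xi>) (at s within {0..T})" for \<xi>
      by (rule derivative_eq_intros test_time_derivative[OF d s] f[OF s] refl)+ (simp add: \<theta>_def algebra_simps)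
    show "ac (\<lambda>\<xi>. h s \<xi> * \<psi> s (y s \<xi>)) (\<zeta> s)"
      by (rule ac_cong[OF ac_mult[OF h[OF s] ac_test[OF d s]]]) (simp_all add: \<zeta>_def algebra_simps)
    show "((\<lambda>\<xi>. h s \<xi> * \<psi> s (y s \<xi>)) \<longlongrightarrow> 0) at_top" "((\<lambda>\<xi>. h s \<xi> * \<psi> s (y s \<xi>)) \<longlongrightarrow> 0) at_bot"
      by (rule box_limits[OF dh s])+
    show "\<bar>\<theta> s \<xi>\<bar> \<le> k1 \<xi>" "\<bar>\<zeta> s \<xi>\<bar> \<le> k2 \<xi>" for \<xi> by (rule k1(2)[OF s] k2(2)[OF s])+
  next
    show "case_prod \<theta> \<in> borel_plane" "case_prod \<zeta> \<in> borel_plane"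
      unfolding \<theta>_def \<zeta>_def case_prod_beta' by measurable
    show "integrable lborel (\<lambda>\<xi>. \<psi> 0 (y 0 \<xi>) * f 0 \<xi>)" using z by simp
  qed (use T_nonneg k1 k2 in auto)
  moreover have "\<psi> T x = 0" "\<psi> 0 x = 0" for x using z by auto
  moreover have J': "J s \<xi> = \<theta> s \<xi> - \<zeta> s \<xi>" for s \<xi> by (simp add: J \<theta>_def \<zeta>_def algebra_simps)
  ultimately show "(LBINT s:{0..T}. (LBINT \<xi>. J s \<xi>)) = 0" by simp
  have "(\<lambda>x. J (fst x) (snd x)) \<in> borel_measurable (borel \<Otimes>\<^sub>M lborel)"
    unfolding J' \<theta>_def \<zeta>_def by measurable
  then show "(\<lambda>s. LBINT \<xi>. J s \<xi>) \<in> borel_measurable borel"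
    by (intro lborel.borel_measurable_lebesgue_integral) (simp add: case_prod_beta')
qed

text \<open>The flux \<open>U^2 - l^2 P\<close> cancels the advective term
  \<open>\<psi>x U^2\<close>, since the equation is tested with \<open>u u_x\<close> as a source and
  only \<open>l^2 P\<close> under the derivative.\<close>

lemma momentum_law:
  assumes d: "test_data \<psi> \<psi>t \<psi>x T X"
    and J: "\<And>s \<xi>. J s \<xi> = \<psi>t s (y s \<xi>) * (U s \<xi> * (p s \<xi>)\<^sup>2) - \<psi> s (y s \<xi>) * (U s \<xi> * (p s \<xi> * r s \<xi>))
        + \<psi>x s (y s \<xi>) * (l\<^sup>2 * P s \<xi> * (p s \<xi>)\<^sup>2)"
  shows "(LBINT s:{0..T}. (LBINT \<xi>. J s \<xi>)) = 0"
    and "(\<lambda>s. LBINT \<xi>. J s \<xi>) \<in> borel_measurable borel"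
proof -
  have l2: "l\<^sup>2 \<noteq> 0" using l_pos by simp
  note * = test_transport[OF d, where f="\<lambda>s \<xi>. U s \<xi> * (p s \<xi>)\<^sup>2" and f'="\<lambda>s \<xi>. Q s \<xi> * (p s \<xi>)\<^sup>2 + U s \<xi> * (p s \<xi> * r s \<xi>)"
      and h="\<lambda>s \<xi>. U s \<xi> * U s \<xi> - l\<^sup>2 * P s \<xi>" and h'="\<lambda>s \<xi>. 2 * U s \<xi> * (p s \<xi> * r s \<xi>) + Q s \<xi> * (p s \<xi>)\<^sup>2" and J=J]
  have der: "((\<lambda>s. U s \<xi> * (p s \<xi>)\<^sup>2) has_real_derivative Q s \<xi> * (p s \<xi>)\<^sup>2 + U s \<xi> * (p s \<xi> * r s \<xi>)) (at s within {0..T})" if s: "s \<in> {0..T}" for s \<xi>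
    using time_derivatives[OF s, of \<xi>] by (auto intro!: derivative_eq_intros simp: algebra_simps)
  have ac: "ac (\<lambda>\<xi>. U s \<xi> * U s \<xi> - l\<^sup>2 * P s \<xi>) (\<lambda>\<xi>. 2 * U s \<xi> * (p s \<xi> * r s \<xi>) + Q s \<xi> * (p s \<xi>)\<^sup>2)" if s: "s \<in> {0..T}" for s
    by (rule ac_cong[OF ac_diff[OF ac_mult[OF ac_U[OF s] ac_U[OF s]] ac_cmult[where c="l\<^sup>2", OF ac_PQ(1)[OF s]]]])
       (use l2 in \<open>auto simp: field_simps\<close>)
  have dm: "dens (\<lambda>s \<xi>. U s \<xi> * (p s \<xi>)\<^sup>2)" "dens (\<lambda>s \<xi>. Q s \<xi> * (p s \<xi>)\<^sup>2 + U s \<xi> * (p s \<xi> * r s \<xi>))"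
    "bdd (\<lambda>s \<xi>. U s \<xi> * U s \<xi> - l\<^sup>2 * P s \<xi>)" "dens (\<lambda>s \<xi>. 2 * U s \<xi> * (p s \<xi> * r s \<xi>) + Q s \<xi> * (p s \<xi>)\<^sup>2)"
    by (intro dom_add dom_diff dom_mult bdd_basic bdd_const dens_basic)+
  have m: "case_prod (\<lambda>s \<xi>. U s \<xi> * (p s \<xi>)\<^sup>2) \<in> borel_plane"
    "case_prod (\<lambda>s \<xi>. Q s \<xi> * (p s \<xi>)\<^sup>2 + U s \<xi> * (p s \<xi> * r s \<xi>)) \<in> borel_plane"
    "case_prod (\<lambda>s \<xi>. U s \<xi> * U s \<xi> - l\<^sup>2 * P s \<xi>) \<in> borel_plane"
    "case_prod (\<lambda>s \<xi>. 2 * U s \<xi> * (p s \<xi> * r s \<xi>) + Q s \<xi> * (p s \<xi>)\<^sup>2) \<in> borel_plane"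
    unfolding case_prod_beta' by measurable
  show "(LBINT s:{0..T}. (LBINT \<xi>. J s \<xi>)) = 0" "(\<lambda>s. LBINT \<xi>. J s \<xi>) \<in> borel_measurable borel"
    by (rule *[OF der ac dm m]; simp add: J algebra_simps)+
qed

text \<open>The time derivative of the energy density equals the label derivative of
  \<open>U^3/6 - l^2 U P\<close>, so no source remains. Transport by \<open>U\<close> contributes
  \<open>U^3/2\<close> to the flux, and the coefficient becomes
  \<open>1/2 - 1/6 = 1/3\<close>.\<close>

lemma energy_law:
  assumes d: "test_data \<psi> \<psi>t \<psi>x T X"
    and J: "\<And>s \<xi>. J s \<xi> = \<psi>t s (y s \<xi>) * (1/2 * (U s \<xi>)\<^sup>2 * (p s \<xi>)\<^sup>2 + 1/2 * l\<^sup>2 * (r s \<xi>)\<^sup>2)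
        + \<psi>x s (y s \<xi>) * (1/3 * (U s \<xi>)^3 * (p s \<xi>)\<^sup>2 + l\<^sup>2 * U s \<xi> * P s \<xi> * (p s \<xi>)\<^sup>2 + 1/2 * l\<^sup>2 * U s \<xi> * (r s \<xi>)\<^sup>2)"
  shows "(LBINT s:{0..T}. (LBINT \<xi>. J s \<xi>)) = 0"
    and "(\<lambda>s. LBINT \<xi>. J s \<xi>) \<in> borel_measurable borel"
proof -
  have l2: "l\<^sup>2 \<noteq> 0" using l_pos by simp
  let ?f = "\<lambda>s \<xi>. 1/2 * U s \<xi> * U s \<xi> * (p s \<xi>)\<^sup>2 + 1/2 * l\<^sup>2 * (r s \<xi>)\<^sup>2"
  let ?f' = "\<lambda>s \<xi>. U s \<xi> * Q s \<xi> * (p s \<xi>)\<^sup>2 + 1/2 * U s \<xi> * U s \<xi> * (p s \<xi> * r s \<xi>) - l\<^sup>2 * P s \<xi> * (p s \<xi> * r s \<xi>)"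
  let ?h = "\<lambda>s \<xi>. 1/6 * U s \<xi> * U s \<xi> * U s \<xi> - l\<^sup>2 * U s \<xi> * P s \<xi>"
  let ?h' = "\<lambda>s \<xi>. 1/2 * U s \<xi> * U s \<xi> * (p s \<xi> * r s \<xi>) - l\<^sup>2 * P s \<xi> * (p s \<xi> * r s \<xi>) + U s \<xi> * Q s \<xi> * (p s \<xi>)\<^sup>2"
  note * = test_transport[OF d, where f="?f" and f'="?f'" and h="?h" and h'="?h'" and J=J]
  have der: "((\<lambda>s. ?f s \<xi>) has_real_derivative ?f' s \<xi>) (at s within {0..T})" if s: "s \<in> {0..T}" for s \<xi>
    using time_derivatives[OF s, of \<xi>] by (auto intro!: derivative_eq_intros simp: algebra_simps power2_eq_square)
  have ac: "ac (?h s) (?h' s)" if s: "s \<in> {0..T}" for s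
    by (rule ac_cong[OF ac_diff[OF ac_cmult[where c="1/6", OF ac_mult[OF ac_mult[OF ac_U[OF s] ac_U[OF s]] ac_U[OF s]]]
          ac_cmult[where c="l\<^sup>2", OF ac_mult[OF ac_U[OF s] ac_PQ(1)[OF s]]]]])
       (use l2 in \<open>auto simp: field_simps\<close>)
  have dm: "dens ?f" "dens ?f'" "bdd ?h" "dens ?h'"
    by (intro dom_add dom_diff dom_mult bdd_basic bdd_const dens_basic)+
  have m: "case_prod ?f \<in> borel_plane" "case_prod ?f' \<in> borel_plane"
    "case_prod ?h \<in> borel_plane" "case_prod ?h' \<in> borel_plane"
    unfolding case_prod_beta' by measurable
  show "(LBINT s:{0..T}. (LBINT \<xi>. J s \<xi>)) = 0" "(\<lambda>s. LBINT \<xi>. J s \<xi>) \<in> borel_measurable borel"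
    by (rule *[OF der ac dm m]; simp add: J algebra_simps power2_eq_square power3_eq_cube)+
qed

end

section \<open>The solution as a function of time and position\<close>

locale lagrangian = profile l g v0 m \<phi> \<phi>' \<gamma> L k
  for l :: real and g v0 :: "real \<Rightarrow> real" and m :: real and \<phi> \<phi>' \<gamma> :: "real \<Rightarrow> real" and L k :: real +
  fixes p r :: "real \<Rightarrow> real \<Rightarrow> real"
  assumes flows: "\<And>T. T \<ge> 0 \<Longrightarrow> \<exists>R D. flow l g v0 p r m T R D"
begin

abbreviation "P t \<equiv> lagP l (p t) (r t)"
abbreviation "U \<equiv> flow.U l v0 p r"
abbreviation "y \<equiv> flow.y l v0 p r"

text \<open>Times below \<open>0\<close> are sent to \<open>0\<close>, so that \<open>u\<close> and \<open>ux\<close> are Borel functions on the whole plane.\<close>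

definition u :: "real \<Rightarrow> real \<Rightarrow> real" where "u t = slice.u (y (max t 0)) (U (max t 0))"
definition ux :: "real \<Rightarrow> real \<Rightarrow> real" where "ux t = slice.ux (y (max t 0)) (p (max t 0)) (r (max t 0))"

lemma energyE:
  assumes "T \<ge> 0"
  obtains R D where "energy l g v0 p r m T R D \<phi> \<phi>' \<gamma> L k" "flow l g v0 p r m T R D"
  using flows[OF assms] energyI by blast

lemma slice_at: "t \<ge> 0 \<Longrightarrow> slice (y t) (U t) (p t) (r t)"
proof -
  assume t: "t \<ge> 0"
  then obtain R D where "flow l g v0 p r m t R D" using flows by blast
  then interpret F: flow l g v0 p r m t R D .
  have tt: "t \<in> {0..t}" using t by simp
  show ?thesis by standard (use F.ac_y[OF tt] F.ac_U[OF tt] F.y_limits[OF tt] F.p_slice F.r_slice in auto)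
qed

lemma measurable_ingredients:
  "case_prod p \<in> borel_plane" "case_prod r \<in> borel_plane"
  "case_prod U \<in> borel_plane" "case_prod y \<in> borel_plane"
proof -
  obtain R D where "flow l g v0 p r m 0 R D" using flows[of 0] by auto
  then interpret F: flow l g v0 p r m 0 R D .
  show "case_prod p \<in> borel_plane" "case_prod r \<in> borel_plane"
    "case_prod U \<in> borel_plane" "case_prod y \<in> borel_plane"
    by (rule F.p_measurable F.r_measurable F.U_measurable F.y_measurable)+
qed

text \<open>The adjunction turns a sublevel set of \<open>Z\<close> into a condition on
  \<open>y\<close> at one fixed label, which gives joint measurability in time and position.\<close>

lemma Z_measurable [measurable]:
  "(\<lambda>x. slice.Z (y (max (fst x) 0)) (snd x)) \<in> borel_plane"
proof (rule borel_measurableI_le)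
  fix c
  have [measurable]: "(\<lambda>x. y (max (fst x) 0) c) \<in> borel_plane"
    by (rule measurable_Pair_apply[OF measurable_ingredients(4)]) auto
  have "{x \<in> space (borel \<Otimes>\<^sub>M borel). slice.Z (y (max (fst x) 0)) (snd x) \<le> c}
      = {x \<in> space (borel \<Otimes>\<^sub>M borel). snd x \<le> y (max (fst x) 0) c}"
    using slice.Z_le_iff[OF slice_at] by auto
  also have "\<dots> \<in> sets (borel \<Otimes>\<^sub>M borel)" by measurable
  finally show "{x \<in> space (borel \<Otimes>\<^sub>M borel). slice.Z (y (max (fst x) 0)) (snd x) \<le> c} \<in> sets (borel \<Otimes>\<^sub>M borel)" .
qed

lemma u_measurable: "case_prod u \<in> borel_plane"
  and ux_measurable: "case_prod ux \<in> borel_plane"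
proof -
  have u: "u t x = U (max t 0) (slice.Z (y (max t 0)) x)" for t x
    unfolding u_def by (rule slice.u_def[OF slice_at]) simp
  have ux: "ux t x = r (max t 0) (slice.Z (y (max t 0)) x) / p (max t 0) (slice.Z (y (max t 0)) x)" for t x
    unfolding ux_def by (rule slice.ux_def[OF slice_at]) simp
  have [measurable]: "(\<lambda>x. U (max (fst x) 0) (slice.Z (y (max (fst x) 0)) (snd x))) \<in> borel_plane"
    "(\<lambda>x. r (max (fst x) 0) (slice.Z (y (max (fst x) 0)) (snd x))) \<in> borel_plane"
    "(\<lambda>x. p (max (fst x) 0) (slice.Z (y (max (fst x) 0)) (snd x))) \<in> borel_plane"
    by (rule measurable_Pair_apply[OF measurable_ingredients(3)] measurable_Pair_apply[OF measurable_ingredients(2)]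
        measurable_Pair_apply[OF measurable_ingredients(1)]; measurable)+
  show "case_prod u \<in> borel_plane" unfolding case_prod_beta' u by measurable
  show "case_prod ux \<in> borel_plane" unfolding case_prod_beta' ux by measurable
qed

lemmas u_slice [measurable] = slice_borel[OF u_measurable]
lemmas ux_slice [measurable] = slice_borel[OF ux_measurable]

lemma pair_measurable [measurable]:
  "(\<lambda>x. u (fst x) (snd x)) \<in> borel_plane" "(\<lambda>x. ux (fst x) (snd x)) \<in> borel_plane"
  using u_measurable ux_measurable by (simp_all add: case_prod_beta')

lemma u_at: "t \<ge> 0 \<Longrightarrow> u t = slice.u (y t) (U t)" and ux_at: "t \<ge> 0 \<Longrightarrow> ux t = slice.ux (y t) (p t) (r t)"
  by (simp_all add: u_def ux_def)

lemma u_y: "t \<ge> 0 \<Longrightarrow> u t (y t \<xi>) = U t \<xi>"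
  using slice.u_Y[OF slice_at] by (simp add: u_at)

lemma y_surj: "t \<ge> 0 \<Longrightarrow> \<exists>\<xi>. y t \<xi> = x"
  using slice.Y_Z[OF slice_at] by blast

lemma ac_u: "t \<ge> 0 \<Longrightarrow> ac (u t) (ux t)"
  using slice.ac_u[OF slice_at] by (simp add: u_at ux_at)

definition Ubound :: "real \<Rightarrow> real" where "Ubound t = m + l * Pbound t * t"

lemma Ubound_mono: "0 \<le> s \<Longrightarrow> s \<le> t \<Longrightarrow> Ubound s \<le> Ubound t"
  unfolding Ubound_def using l_pos Pbound_mono[of s t] Pbound_nonneg[of t] Pbound_nonneg[of s]
  by (intro add_mono mult_mono) auto

lemma U_bound: "t \<ge> 0 \<Longrightarrow> \<bar>U t \<xi>\<bar> \<le> Ubound t"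
proof -
  assume t: "t \<ge> 0"
  then obtain R D where "flow l g v0 p r m t R D" using flows by blast
  from flow_apriori(3)[OF this, of t \<xi>] t show ?thesis by (simp add: Ubound_def)
qed

lemma u_bound: "t \<ge> 0 \<Longrightarrow> \<bar>u t x\<bar> \<le> Ubound t"
  using U_bound u_y y_surj by metis

lemma P_bound: "t \<ge> 0 \<Longrightarrow> P t \<xi> \<le> Pbound t"
proof -
  assume t: "t \<ge> 0"
  then obtain R D where "flow l g v0 p r m t R D" using flows by blast
  from flow_apriori(1)[OF this, of t \<xi>] t show ?thesis by simp
qed

lemma energy_at:
  assumes t: "t \<ge> 0"
  shows "integrable lborel (\<lambda>\<xi>. (U t \<xi> - \<phi> (y t \<xi>))\<^sup>2 * (p t \<xi>)\<^sup>2 + l\<^sup>2 * (r t \<xi>)\<^sup>2)"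
    and "(LBINT \<xi>. (U t \<xi> - \<phi> (y t \<xi>))\<^sup>2 * (p t \<xi>)\<^sup>2 + l\<^sup>2 * (r t \<xi>)\<^sup>2) \<le> Ebound t"
    and "(U t \<xi> - \<phi> (y t \<xi>))\<^sup>2 * (p t \<xi>)\<^sup>2 + l\<^sup>2 * (r t \<xi>)\<^sup>2 \<ge> 0"
proof -
  obtain R D where "energy l g v0 p r m t R D \<phi> \<phi>' \<gamma> L k" using energyE[OF t] by blast
  then interpret F: energy l g v0 p r m t R D \<phi> \<phi>' \<gamma> L k .
  have tt: "t \<in> {0..t}" using t by simp
  have e: "F.e t = (\<lambda>\<xi>. (U t \<xi> - \<phi> (y t \<xi>))\<^sup>2 * (p t \<xi>)\<^sup>2 + l\<^sup>2 * (r t \<xi>)\<^sup>2)"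
    by (simp add: F.e_def F.V_def fun_eq_iff)
  show "integrable lborel (\<lambda>\<xi>. (U t \<xi> - \<phi> (y t \<xi>))\<^sup>2 * (p t \<xi>)\<^sup>2 + l\<^sup>2 * (r t \<xi>)\<^sup>2)"
    using F.E_limit(1)[OF v0_\<phi> tt] by (simp add: e)
  show "(LBINT \<xi>. (U t \<xi> - \<phi> (y t \<xi>))\<^sup>2 * (p t \<xi>)\<^sup>2 + l\<^sup>2 * (r t \<xi>)\<^sup>2) \<le> Ebound t"
    using F.energy_le[OF v0_\<phi> tt] by (simp add: e Ebound_def E0_def F.N_def)
  show "(U t \<xi> - \<phi> (y t \<xi>))\<^sup>2 * (p t \<xi>)\<^sup>2 + l\<^sup>2 * (r t \<xi>)\<^sup>2 \<ge> 0" by simp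
qed

lemma r_square:
  assumes t: "t \<ge> 0"
  shows "integrable lborel (\<lambda>\<xi>. (r t \<xi>)\<^sup>2)" and "l\<^sup>2 * (LBINT \<xi>. (r t \<xi>)\<^sup>2) \<le> Ebound t"
proof -
  have "integrable lborel (\<lambda>\<xi>. l\<^sup>2 * (r t \<xi>)\<^sup>2)"
    by (rule Bochner_Integration.integrable_bound[OF energy_at(1)[OF t]])
       (use slice_borel(1)[OF measurable_ingredients(2), of t] in auto)
  then show i: "integrable lborel (\<lambda>\<xi>. (r t \<xi>)\<^sup>2)" using l_pos by simp
  have "(LBINT \<xi>. l\<^sup>2 * (r t \<xi>)\<^sup>2) \<le> (LBINT \<xi>. (U t \<xi> - \<phi> (y t \<xi>))\<^sup>2 * (p t \<xi>)\<^sup>2 + l\<^sup>2 * (r t \<xi>)\<^sup>2)"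
    by (rule integral_mono[OF _ energy_at(1)[OF t]]) (use i in auto)
  then show "l\<^sup>2 * (LBINT \<xi>. (r t \<xi>)\<^sup>2) \<le> Ebound t"
    using energy_at(2)[OF t] by simp
qed

lemma ux_square:
  assumes t: "t \<ge> 0"
  shows "integrable lborel (\<lambda>x. (ux t x)\<^sup>2)" and "(LBINT x. (ux t x)\<^sup>2) \<le> Ebound t / l\<^sup>2"
proof -
  note s = slice.ux_square_integrable[OF slice_at[OF t] r_square(1)[OF t]]
  show "integrable lborel (\<lambda>x. (ux t x)\<^sup>2)" using s(1) by (simp add: ux_at[OF t])
  have "(LBINT x. (ux t x)\<^sup>2) \<le> (LBINT \<xi>. (r t \<xi>)\<^sup>2)" using s(2) by (simp add: ux_at[OF t])
  also have "\<dots> \<le> Ebound t / l\<^sup>2" using r_square(2)[OF t] l_pos by (simp add: field_simps)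
  finally show "(LBINT x. (ux t x)\<^sup>2) \<le> Ebound t / l\<^sup>2" .
qed

lemma u_minus_\<phi>:
  assumes t: "t \<ge> 0"
  shows "integrable lborel (\<lambda>x. (u t x - \<phi> x)\<^sup>2)"
proof -
  interpret s: slice "y t" "U t" "p t" "r t" by (rule slice_at[OF t])
  have [measurable]: "\<phi> \<in> borel_measurable borel"
    using \<phi>_derivative by (auto intro!: borel_measurable_continuous_onI continuous_at_imp_continuous_on DERIV_isCont)
  have [measurable]: "U t \<in> borel_measurable borel" "y t \<in> borel_measurable borel"
    by (rule slice_borel[OF measurable_ingredients(3)] slice_borel[OF measurable_ingredients(4)])+
  have "integrable lborel (\<lambda>\<xi>. (p t \<xi>)\<^sup>2 * (u t (y t \<xi>) - \<phi> (y t \<xi>))\<^sup>2)"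
    unfolding u_y[OF t]
    by (rule Bochner_Integration.integrable_bound[OF energy_at(1)[OF t]]) (auto simp: mult.commute)
  then show ?thesis
    by (subst integrable_ac_subst[OF s.acY zero_le_power2 s.Y_top s.Y_bot]) auto
qed

lemma AE_good: "AE t in lborel. t \<ge> 0 \<longrightarrow> (AE \<xi> in lborel. p t \<xi> \<noteq> 0)"
proof -
  have "AE t in lborel. t \<in> {0..real n} \<longrightarrow> (AE \<xi> in lborel. p t \<xi> \<noteq> 0)" for n
  proof -
    obtain R D where "flow l g v0 p r m (real n) R D" using flows[of "real n"] by auto
    then interpret F: flow l g v0 p r m "real n" R D .
    show ?thesis by (rule F.AE_p_nonzero)
  qed
  then have "AE t in lborel. \<forall>n. t \<in> {0..real n} \<longrightarrow> (AE \<xi> in lborel. p t \<xi> \<noteq> 0)"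
    by (subst AE_all_countable) blast
  then show ?thesis
  proof eventually_elim
    case (elim t)
    show ?case
    proof
      assume "t \<ge> 0"
      moreover obtain n :: nat where "t \<le> real n" using real_arch_simple by blast
      ultimately show "AE \<xi> in lborel. p t \<xi> \<noteq> 0" using elim by auto
    qed
  qed
qed

lemma \<GG>_measurable [measurable]: "\<GG> l \<in> borel_measurable borel"
  unfolding \<GG>_def by measurable

lemma \<GG>_bounds: "0 \<le> \<GG> l x" "\<GG> l x \<le> 1 / (2 * l)"
  using l_pos by (auto simp: \<GG>_def divide_right_mono)

lemma conv_integrable_ux: "t \<ge> 0 \<Longrightarrow> conv_integrable (\<GG> l) (\<lambda>z. 1/2 * (ux t z)\<^sup>2) x"
  and burgers_P_lborel: "burgers_P l ux t x = (LBINT z. \<GG> l (x - z) * (1/2 * (ux t z)\<^sup>2))"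
  and burgers_P_bounds: "t \<ge> 0 \<Longrightarrow> 0 \<le> burgers_P l ux t x \<and> burgers_P l ux t x \<le> Ebound t / (4 * l ^ 3)"
proof -
  have m: "(\<lambda>z. \<GG> l (x - z) * (1/2 * (ux t z)\<^sup>2)) \<in> borel_measurable borel" by measurable
  show eq: "burgers_P l ux t x = (LBINT z. \<GG> l (x - z) * (1/2 * (ux t z)\<^sup>2))"
    unfolding burgers_P_def convolution_def by (rule has_bochner_lebesgue_lborel(1)[OF m])
  assume t: "t \<ge> 0"
  have le: "\<GG> l (x - z) * (1/2 * (ux t z)\<^sup>2) \<le> 1 / (4 * l) * (ux t z)\<^sup>2" for z
  proof -
    have "\<GG> l (x - z) * (1/2 * (ux t z)\<^sup>2) \<le> 1 / (2 * l) * (1/2 * (ux t z)\<^sup>2)"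
      by (intro mult_right_mono \<GG>_bounds) simp
    then show ?thesis by simp
  qed
  have ik: "integrable lborel (\<lambda>z. 1 / (4 * l) * (ux t z)\<^sup>2)" by (intro integrable_mult_right ux_square t)
  have i: "integrable lborel (\<lambda>z. \<GG> l (x - z) * (1/2 * (ux t z)\<^sup>2))"
  proof (rule Bochner_Integration.integrable_bound[OF ik])
    show "AE z in lborel. norm (\<GG> l (x - z) * (1/2 * (ux t z)\<^sup>2)) \<le> norm (1 / (4 * l) * (ux t z)\<^sup>2)"
      using le \<GG>_bounds(1) l_pos by (auto simp: abs_mult)
  qed measurable
  then show "conv_integrable (\<GG> l) (\<lambda>z. 1/2 * (ux t z)\<^sup>2) x"
    unfolding conv_integrable_def using has_bochner_lebesgue_lborel(2)[OF m] by simp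
  have "(LBINT z. \<GG> l (x - z) * (1/2 * (ux t z)\<^sup>2)) \<le> (LBINT z. 1 / (4 * l) * (ux t z)\<^sup>2)"
    by (rule integral_mono[OF i ik le])
  also have "\<dots> = 1 / (4 * l) * (LBINT z. (ux t z)\<^sup>2)" by (rule integral_mult_right_zero)
  also have "\<dots> \<le> 1 / (4 * l) * (Ebound t / l\<^sup>2)"
    using l_pos by (intro mult_left_mono ux_square(2)[OF t]) simp
  also have "\<dots> = Ebound t / (4 * l ^ 3)" by (simp add: power3_eq_cube power2_eq_square)
  finally show "0 \<le> burgers_P l ux t x \<and> burgers_P l ux t x \<le> Ebound t / (4 * l ^ 3)"
    unfolding eq using \<GG>_bounds(1) by (auto intro!: integral_nonneg_AE)
qed

lemma burgers_P_measurable: "case_prod (burgers_P l ux) \<in> borel_plane"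
proof -
  have [measurable]: "(\<lambda>x. ux (fst (fst x)) (snd x)) \<in> borel_measurable ((borel \<Otimes>\<^sub>M borel) \<Otimes>\<^sub>M lborel)"
    by (rule measurable_Pair_apply[OF ux_measurable]) auto
  have "(\<lambda>x. LBINT z. \<GG> l (snd x - z) * (1/2 * (ux (fst x) z)\<^sup>2)) \<in> borel_plane"
    by (rule lborel.borel_measurable_lebesgue_integral) (simp add: case_prod_beta')
  then show ?thesis by (simp add: burgers_P_lborel case_prod_beta')
qed

text \<open>The substitution sees only labels with nonzero \<open>p\<close>, whereas
  \<open>P\<close> integrates \<open>r^2\<close> over all labels; \<open>good\<close> closes this
  gap.\<close>

lemma burgers_P_y:
  assumes t: "t \<ge> 0" and good: "AE \<xi> in lborel. p t \<xi> \<noteq> 0"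
  shows "burgers_P l ux t (y t \<xi>) = P t \<xi>"
proof -
  obtain R D where "flow l g v0 p r m t R D" using flows[OF t] by blast
  then interpret F: flow l g v0 p r m t R D .
  interpret s: slice "y t" "U t" "p t" "r t" by (rule slice_at[OF t])
  have tt: "t \<in> {0..t}" using t by simp
  have m: "case_prod (\<lambda>z q. \<GG> l (y t \<xi> - z) * (1/2 * q\<^sup>2)) \<in> borel_plane"
    unfolding case_prod_beta' by measurable
  have [measurable]: "F.S t \<in> borel_measurable borel" by (rule ac_borel[OF F.ac_S[OF tt]])
  have "burgers_P l ux t (y t \<xi>) = (LBINT \<eta>. (p t \<eta>)\<^sup>2 * (\<GG> l (y t \<xi> - y t \<eta>) * (1/2 * (r t \<eta> / p t \<eta>)\<^sup>2)))"
    unfolding burgers_P_lborel ux_at[OF t] by (rule s.integral_subst[OF m])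
  also have "\<dots> = (LBINT \<eta>. (1 / (4 * l)) * (exp (- \<bar>F.S t \<xi> - F.S t \<eta>\<bar> / l) * (r t \<eta>)\<^sup>2))"
  proof (rule integral_cong_AE)
    show "AE \<eta> in lborel. (p t \<eta>)\<^sup>2 * (\<GG> l (y t \<xi> - y t \<eta>) * (1/2 * (r t \<eta> / p t \<eta>)\<^sup>2))
      = (1 / (4 * l)) * (exp (- \<bar>F.S t \<xi> - F.S t \<eta>\<bar> / l) * (r t \<eta>)\<^sup>2)"
      using good by eventually_elim (simp add: \<GG>_def F.y_diff[OF tt] power_divide)
  qed measurable
  also have "\<dots> = P t \<xi>" by (simp add: lagP_def)
  finally show ?thesis .
qed

section \<open>Growth classes and the weak balance laws\<close>

definition loc_bounded :: "(real \<Rightarrow> real \<Rightarrow> real) \<Rightarrow> bool" where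
  "loc_bounded f \<longleftrightarrow> case_prod f \<in> borel_plane \<and> (\<forall>T\<ge>0. \<exists>C. \<forall>t\<in>{0..T}. \<forall>x. \<bar>f t x\<bar> \<le> C)"

text \<open>The energy density is the most singular term that occurs. Growth like
  \<open>1 + ux^2\<close> is integrable over bounded strips by the energy bound, which suffices for
  local integrability and for Fubini.\<close>

definition tame :: "(real \<Rightarrow> real \<Rightarrow> real) \<Rightarrow> bool" where
  "tame f \<longleftrightarrow> case_prod f \<in> borel_plane \<and> (\<forall>T\<ge>0. \<exists>C. \<forall>t\<in>{0..T}. \<forall>x. \<bar>f t x\<bar> \<le> C * (1 + (ux t x)\<^sup>2))"

lemma loc_bounded_const: "loc_bounded (\<lambda>t x. c)"
  by (auto simp: loc_bounded_def)

lemma loc_bounded_u: "loc_bounded u"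
  unfolding loc_bounded_def
proof (intro conjI allI impI)
  fix T :: real assume "T \<ge> 0"
  show "\<exists>C. \<forall>t\<in>{0..T}. \<forall>x. \<bar>u t x\<bar> \<le> C"
  proof (intro exI[of _ "Ubound T"] ballI allI)
    fix t x assume "t \<in> {0..T}"
    then show "\<bar>u t x\<bar> \<le> Ubound T" using u_bound[of t x] Ubound_mono[of t T] by simp
  qed
qed (rule u_measurable)

lemma loc_bounded_burgers_P: "loc_bounded (burgers_P l ux)"
  unfolding loc_bounded_def
proof (intro conjI allI impI)
  fix T :: real assume "T \<ge> 0"
  show "\<exists>C. \<forall>t\<in>{0..T}. \<forall>x. \<bar>burgers_P l ux t x\<bar> \<le> C"
  proof (intro exI[of _ "Ebound T / (4 * l ^ 3)"] ballI allI)
    fix t x assume t: "t \<in> {0..T}"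
    have "Ebound t / (4 * l ^ 3) \<le> Ebound T / (4 * l ^ 3)"
      using Ebound_mono[of t T] t l_pos by (intro divide_right_mono) auto
    then show "\<bar>burgers_P l ux t x\<bar> \<le> Ebound T / (4 * l ^ 3)" using burgers_P_bounds[of t x] t by simp
  qed
qed (rule burgers_P_measurable)

lemma loc_bounded_mult: "loc_bounded f \<Longrightarrow> loc_bounded h \<Longrightarrow> loc_bounded (\<lambda>t x. f t x * h t x)"
  unfolding loc_bounded_def
proof (elim conjE, intro conjI allI impI)
  assume m: "case_prod f \<in> borel_plane" "case_prod h \<in> borel_plane"
  have "(\<lambda>x. case_prod f x * case_prod h x) \<in> borel_plane" using m by measurable
  then show "case_prod (\<lambda>t x. f t x * h t x) \<in> borel_plane" by (simp add: case_prod_beta')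
  fix T :: real assume "T \<ge> 0" "\<forall>T\<ge>0. \<exists>C. \<forall>t\<in>{0..T}. \<forall>x. \<bar>f t x\<bar> \<le> C" "\<forall>T\<ge>0. \<exists>C. \<forall>t\<in>{0..T}. \<forall>x. \<bar>h t x\<bar> \<le> C"
  then obtain C C' where C: "\<And>t x. t \<in> {0..T} \<Longrightarrow> \<bar>f t x\<bar> \<le> C" "\<And>t x. t \<in> {0..T} \<Longrightarrow> \<bar>h t x\<bar> \<le> C'" by meson
  have "\<bar>f t x * h t x\<bar> \<le> C * C'" if "t \<in> {0..T}" for t x
    unfolding abs_mult using C[OF that, of x] by (intro mult_mono) auto
  then show "\<exists>C. \<forall>t\<in>{0..T}. \<forall>x. \<bar>f t x * h t x\<bar> \<le> C" by blast
qed

lemma tame_mult: "loc_bounded f \<Longrightarrow> tame h \<Longrightarrow> tame (\<lambda>t x. f t x * h t x)"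
  unfolding loc_bounded_def tame_def
proof (elim conjE, intro conjI allI impI)
  assume m: "case_prod f \<in> borel_plane" "case_prod h \<in> borel_plane"
  have "(\<lambda>x. case_prod f x * case_prod h x) \<in> borel_plane" using m by measurable
  then show "case_prod (\<lambda>t x. f t x * h t x) \<in> borel_plane" by (simp add: case_prod_beta')
  fix T :: real assume "T \<ge> 0" "\<forall>T\<ge>0. \<exists>C. \<forall>t\<in>{0..T}. \<forall>x. \<bar>f t x\<bar> \<le> C" "\<forall>T\<ge>0. \<exists>C. \<forall>t\<in>{0..T}. \<forall>x. \<bar>h t x\<bar> \<le> C * (1 + (ux t x)\<^sup>2)"
  then obtain C C' where C: "\<And>t x. t \<in> {0..T} \<Longrightarrow> \<bar>f t x\<bar> \<le> C" "\<And>t x. t \<in> {0..T} \<Longrightarrow> \<bar>h t x\<bar> \<le> C' * (1 + (ux t x)\<^sup>2)" by meson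
  have "\<bar>f t x * h t x\<bar> \<le> (C * C') * (1 + (ux t x)\<^sup>2)" if "t \<in> {0..T}" for t x
  proof -
    have "\<bar>f t x\<bar> * \<bar>h t x\<bar> \<le> C * (C' * (1 + (ux t x)\<^sup>2))"
      using C[OF that, of x] by (intro mult_mono) auto
    then show ?thesis by (simp add: abs_mult mult.assoc)
  qed
  then show "\<exists>C. \<forall>t\<in>{0..T}. \<forall>x. \<bar>f t x * h t x\<bar> \<le> C * (1 + (ux t x)\<^sup>2)" by blast
qed

lemma tame_add: "tame f \<Longrightarrow> tame h \<Longrightarrow> tame (\<lambda>t x. f t x + h t x)"
  unfolding tame_def
proof (elim conjE, intro conjI allI impI)
  assume m: "case_prod f \<in> borel_plane" "case_prod h \<in> borel_plane"
  have "(\<lambda>x. case_prod f x + case_prod h x) \<in> borel_plane" using m by measurable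
  then show "case_prod (\<lambda>t x. f t x + h t x) \<in> borel_plane" by (simp add: case_prod_beta')
  fix T :: real assume "T \<ge> 0" "\<forall>T\<ge>0. \<exists>C. \<forall>t\<in>{0..T}. \<forall>x. \<bar>f t x\<bar> \<le> C * (1 + (ux t x)\<^sup>2)" "\<forall>T\<ge>0. \<exists>C. \<forall>t\<in>{0..T}. \<forall>x. \<bar>h t x\<bar> \<le> C * (1 + (ux t x)\<^sup>2)"
  then obtain C C' where C: "\<And>t x. t \<in> {0..T} \<Longrightarrow> \<bar>f t x\<bar> \<le> C * (1 + (ux t x)\<^sup>2)" "\<And>t x. t \<in> {0..T} \<Longrightarrow> \<bar>h t x\<bar> \<le> C' * (1 + (ux t x)\<^sup>2)" by meson
  have "\<bar>f t x + h t x\<bar> \<le> (C + C') * (1 + (ux t x)\<^sup>2)" if "t \<in> {0..T}" for t x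
    unfolding distrib_right[of C C'] by (intro order_trans[OF abs_triangle_ineq] add_mono C that)
  then show "\<exists>C. \<forall>t\<in>{0..T}. \<forall>x. \<bar>f t x + h t x\<bar> \<le> C * (1 + (ux t x)\<^sup>2)" by blast
qed

lemma tame_basic: "tame (\<lambda>t x. c)" "tame ux" "tame (\<lambda>t x. (ux t x)\<^sup>2)"
proof -
  have le: "\<bar>q\<bar> \<le> 1 + q\<^sup>2" for q :: real
  proof -
    have "0 \<le> (\<bar>q\<bar> - 1)\<^sup>2" by simp
    then have "\<bar>q\<bar> * 2 \<le> 1 + q\<^sup>2" by (simp add: power2_diff)
    then show ?thesis using abs_ge_zero[of q] by linarith
  qed
  have c: "\<bar>c\<bar> \<le> \<bar>c\<bar> * (1 + (ux t x)\<^sup>2)" for t x by (simp add: algebra_simps)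
  show "tame (\<lambda>t x. c)" unfolding tame_def using c by auto
  show "tame ux" unfolding tame_def using ux_measurable le by (auto intro!: exI[of _ 1])
  have "(\<lambda>x. (case_prod ux x)\<^sup>2) \<in> borel_plane" using ux_measurable by measurable
  then show "tame (\<lambda>t x. (ux t x)\<^sup>2)" unfolding tame_def by (auto intro!: exI[of _ 1] simp: case_prod_beta')
qed

lemma loc_bounded_tame: "loc_bounded f \<Longrightarrow> tame f"
  using tame_mult[OF _ tame_basic(1)[of 1], of f] by simp

lemma strip_integrable:
  assumes T: "T \<ge> 0"
  shows "integrable lborel (\<lambda>z. indicator ({0..T} \<times> {-X..X}) z * (1 + (ux (fst z) (snd z))\<^sup>2))"
proof -
  define h where "h z = indicator ({0..T} \<times> {-X..X}) z * (1 + (ux (fst z) (snd z))\<^sup>2)" for z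
  have [measurable]: "h \<in> borel_measurable (lborel \<Otimes>\<^sub>M lborel)"
    unfolding h_def by measurable
  have iX: "integrable lborel (\<lambda>x. indicator {-X..X} x * (1 + (ux t x)\<^sup>2))" if "t \<ge> 0" for t
  proof -
    have "integrable lborel (indicator {-X..X} :: real \<Rightarrow> real)"
      using borel_integrable_atLeastAtMost'[of "-X" X "\<lambda>_. 1::real"] by (simp add: set_integrable_def)
    moreover have "integrable lborel (\<lambda>x. indicator {-X..X} x * (ux t x)\<^sup>2)"
      by (rule Bochner_Integration.integrable_bound[OF ux_square(1)[OF that]]) (auto simp: indicator_def)
    ultimately show ?thesis by (simp add: distrib_left)
  qed
  have hh: "h (t, x) = indicator {0..T} t * (indicator {-X..X} x * (1 + (ux t x)\<^sup>2))" for t x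
    by (auto simp: h_def indicator_def)
  have "integrable (lborel \<Otimes>\<^sub>M lborel) h"
  proof (rule lborel_pair.Fubini_integrable)
    have "integrable lborel (\<lambda>t. indicator {0..T} t * (\<bar>2 * X\<bar> + Ebound T / l\<^sup>2))"
      using borel_integrable_atLeastAtMost'[of 0 T "\<lambda>_. \<bar>2 * X\<bar> + Ebound T / l\<^sup>2"] by (simp add: set_integrable_def)
    then show "integrable lborel (\<lambda>t. LBINT x. norm (h (t, x)))"
    proof (rule Bochner_Integration.integrable_bound)
      have "(\<lambda>t. LBINT x. norm (h (t, x))) \<in> borel_measurable borel"
        by (rule lborel.borel_measurable_lebesgue_integral) (simp add: case_prod_beta')
      then show "(\<lambda>t. LBINT x. norm (h (t, x))) \<in> borel_measurable lborel" by simp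
      show "AE t in lborel. norm (LBINT x. norm (h (t, x))) \<le> norm (indicator {0..T} t * (\<bar>2 * X\<bar> + Ebound T / l\<^sup>2))"
      proof (intro AE_I2)
        fix t
        show "norm (LBINT x. norm (h (t, x))) \<le> norm (indicator {0..T} t * (\<bar>2 * X\<bar> + Ebound T / l\<^sup>2))"
        proof (cases "t \<in> {0..T}")
          case True
          then have t: "t \<ge> 0" by simp
          have iI: "integrable lborel (indicator {-X..X} :: real \<Rightarrow> real)"
            using borel_integrable_atLeastAtMost'[of "-X" X "\<lambda>_. 1::real"] by (simp add: set_integrable_def)
          have iS: "integrable lborel (\<lambda>x. indicator {-X..X} x + (ux t x)\<^sup>2)"
            by (rule Bochner_Integration.integrable_add[OF iI ux_square(1)[OF t]])
          have le: "norm (norm (h (t, x))) \<le> indicator {-X..X} x + (ux t x)\<^sup>2" for x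
            using True by (auto simp: hh indicator_def)
          have "norm (LBINT x. norm (h (t, x))) \<le> (LBINT x. indicator {-X..X} x + (ux t x)\<^sup>2)"
            by (rule LINT_norm_le[OF iS]) (rule le)
          also have "\<dots> = (LBINT x. indicator {-X..X} x) + (LBINT x. (ux t x)\<^sup>2)"
            by (rule Bochner_Integration.integral_add[OF iI ux_square(1)[OF t]])
          also have "(LBINT x. indicator {-X..X} x) \<le> \<bar>2 * X\<bar>" by (cases "X \<ge> 0") auto
          also have "(LBINT x. (ux t x)\<^sup>2) \<le> Ebound T / l\<^sup>2"
            using ux_square(2)[OF t] divide_right_mono[OF Ebound_mono[of t T], of "l\<^sup>2"] True by auto
          finally show ?thesis using True Ebound_nonneg[OF T] by simp
        qed (simp add: hh)
      qed
    qed
    show "AE t in lborel. integrable lborel (\<lambda>x. h (t, x))"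
      using iX by (intro AE_I2) (auto simp: hh indicator_def)
  qed simp
  then show ?thesis by (simp add: h_def[abs_def] lborel_prod)
qed

lemma tame_locally_integrable:
  assumes "tame f"
  shows "(\<lambda>(t, x). f t x) locally_integrable_on ({0<..} \<times> UNIV)"
  unfolding locally_integrable_on_def
proof (intro allI impI)
  fix K :: "(real \<times> real) set" assume K: "compact K \<and> K \<subseteq> {0<..} \<times> UNIV"
  have [measurable]: "case_prod f \<in> borel_measurable borel" using assms by (simp add: tame_def borel_prod)
  have [measurable]: "K \<in> sets borel" using K by (intro borel_compact) auto
  obtain B where B: "\<And>z. z \<in> K \<Longrightarrow> norm z \<le> B" using compact_imp_bounded[of K] K unfolding bounded_iff by blast
  define T where "T = \<bar>B\<bar>"
  obtain C where C: "\<And>t x. t \<in> {0..T} \<Longrightarrow> \<bar>f t x\<bar> \<le> C * (1 + (ux t x)\<^sup>2)"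
    using assms unfolding tame_def T_def by (meson abs_ge_zero)
  have in_box: "z \<in> {0..T} \<times> {-T..T}" if "z \<in> K" for z
  proof -
    have "norm z \<le> T" using B[OF that] by (simp add: T_def)
    moreover have "\<bar>fst z\<bar> \<le> norm z" "\<bar>snd z\<bar> \<le> norm z"
      using norm_fst_le[of "fst z" "snd z"] norm_snd_le[of "snd z" "fst z"] by simp_all
    moreover have "fst z > 0" using K that by auto
    ultimately show ?thesis by (cases z) auto
  qed
  have "integrable lborel (\<lambda>z. C * (indicator ({0..T} \<times> {-T..T}) z * (1 + (ux (fst z) (snd z))\<^sup>2)))"
    by (intro integrable_mult_right strip_integrable) (simp add: T_def)
  then have "integrable lborel (\<lambda>z. indicator K z *\<^sub>R case_prod f z)"
  proof (rule Bochner_Integration.integrable_bound)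
    show "AE z in lborel. norm (indicator K z *\<^sub>R case_prod f z) \<le> norm (C * (indicator ({0..T} \<times> {-T..T}) z * (1 + (ux (fst z) (snd z))\<^sup>2)))"
    proof (intro AE_I2)
      fix z :: "real \<times> real"
      show "norm (indicator K z *\<^sub>R case_prod f z) \<le> norm (C * (indicator ({0..T} \<times> {-T..T}) z * (1 + (ux (fst z) (snd z))\<^sup>2)))"
      proof (cases "z \<in> K")
        case True
        then have "\<bar>f (fst z) (snd z)\<bar> \<le> C * (1 + (ux (fst z) (snd z))\<^sup>2)" using in_box[OF True] by (intro C) auto
        then show ?thesis using True in_box[OF True] by (simp add: case_prod_beta')
      qed simp
    qed
  qed simp
  then show "(\<lambda>(t, x). f t x) absolutely_integrable_on K"
    unfolding set_integrable_def by (subst has_bochner_lebesgue_lborel(2)) auto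
qed

text \<open>Fubini reduces the identity to time slices. \<open>J\<close> has to agree with the
  spatial integral only at almost every time, so the passage to labels may be restricted to the
  times when \<open>p\<close> is nonzero almost everywhere.\<close>

lemma weak_balance_lawI:
  assumes A: "tame A" and B: "tame B" and C: "tame C"
    and J: "\<And>\<psi> \<psi>t \<psi>x T X. test_data \<psi> \<psi>t \<psi>x T X \<Longrightarrow> \<exists>J. J \<in> borel_measurable borel \<and> (LBINT t:{0..T}. J t) = 0 \<and>
      (AE t in lborel. t \<in> {0..T} \<longrightarrow> (LBINT x. A t x * \<psi>t t x - B t x * \<psi> t x + C t x * \<psi>x t x) = J t)"
  shows "weak_balance_law A B C"
  unfolding weak_balance_law_def
proof (intro conjI ballI tame_locally_integrable A B C)
  fix \<psi> :: "real \<times> real \<Rightarrow> real" assume \<psi>: "\<psi> \<in> test_functions ({0<..} \<times> UNIV)"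
  obtain \<psi>t \<psi>x T X where d: "test_data (\<lambda>t x. \<psi> (t, x)) \<psi>t \<psi>x T X"
    and dt: "\<And>t x. deriv (\<lambda>s. \<psi> (s, x)) t = \<psi>t t x" and dx: "\<And>t x. deriv (\<lambda>z. \<psi> (t, z)) x = \<psi>x t x"
    by (rule test_function_data[OF \<psi>]) (rule that)
  note z = d[unfolded test_data_def]
  obtain J where Jm: "J \<in> borel_measurable borel" and J0: "(LBINT t:{0..T}. J t) = 0"
    and JA: "AE t in lborel. t \<in> {0..T} \<longrightarrow> (LBINT x. A t x * \<psi>t t x - B t x * \<psi> (t, x) + C t x * \<psi>x t x) = J t"
    using J[OF d] by blast
  have T: "T \<ge> 0" using z by simp
  obtain bd where bd: "bd \<ge> 0" "\<And>t x. \<bar>\<psi> (t, x)\<bar> \<le> bd" "\<And>t x. \<bar>\<psi>t t x\<bar> \<le> bd" "\<And>t x. \<bar>\<psi>x t x\<bar> \<le> bd"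
    using test_data_bounded[OF d] by blast
  define I where "I t x = A t x * \<psi>t t x - B t x * \<psi> (t, x) + C t x * \<psi>x t x" for t x
  have [measurable]: "(\<lambda>x. A (fst x) (snd x)) \<in> borel_plane" "(\<lambda>x. B (fst x) (snd x)) \<in> borel_plane"
    "(\<lambda>x. C (fst x) (snd x)) \<in> borel_plane"
    using A B C by (simp_all add: tame_def case_prod_beta')
  have [measurable]: "(\<lambda>x. \<psi>t (fst x) (snd x)) \<in> borel_plane" "(\<lambda>x. \<psi>x (fst x) (snd x)) \<in> borel_plane"
    "(\<lambda>x. \<psi> (fst x, snd x)) \<in> borel_plane"
    using test_data_measurable[OF d] by (simp_all add: case_prod_beta')
  have Im: "(\<lambda>z. I (fst z) (snd z)) \<in> borel_plane"
    unfolding I_def by measurable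
  then have Im': "(\<lambda>z. I (fst z) (snd z)) \<in> borel_measurable borel" by (simp add: borel_prod)
  have Iz: "I t x = 0" if "t \<notin> {0..T} \<or> x \<notin> {-X..X}" for t x
  proof -
    have "t \<le> 0 \<or> t \<ge> T \<or> \<bar>x\<bar> \<ge> X" using that by (auto simp: abs_le_iff)
    then have "\<psi> (t, x) = 0 \<and> \<psi>t t x = 0 \<and> \<psi>x t x = 0" using z by blast
    then show ?thesis by (simp add: I_def)
  qed
  have tm: "\<exists>c. \<forall>t\<in>{0..T}. \<forall>x. \<bar>f t x\<bar> \<le> c * (1 + (ux t x)\<^sup>2)" if "tame f" for f
    using that T unfolding tame_def by blast
  obtain CA where CA: "\<forall>t\<in>{0..T}. \<forall>x. \<bar>A t x\<bar> \<le> CA * (1 + (ux t x)\<^sup>2)" using tm[OF A] by (rule exE)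
  obtain CB where CB: "\<forall>t\<in>{0..T}. \<forall>x. \<bar>B t x\<bar> \<le> CB * (1 + (ux t x)\<^sup>2)" using tm[OF B] by (rule exE)
  obtain CC where CC: "\<forall>t\<in>{0..T}. \<forall>x. \<bar>C t x\<bar> \<le> CC * (1 + (ux t x)\<^sup>2)" using tm[OF C] by (rule exE)
  have Ile: "\<bar>I t x\<bar> \<le> (CA + CB + CC) * bd * (1 + (ux t x)\<^sup>2)" if t: "t \<in> {0..T}" for t x
  proof -
    have "\<bar>A t x * \<psi>t t x\<bar> \<le> CA * (1 + (ux t x)\<^sup>2) * bd" "\<bar>B t x * \<psi> (t, x)\<bar> \<le> CB * (1 + (ux t x)\<^sup>2) * bd"
      "\<bar>C t x * \<psi>x t x\<bar> \<le> CC * (1 + (ux t x)\<^sup>2) * bd"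
      unfolding abs_mult using bspec[OF CA t, THEN spec, of x] bspec[OF CB t, THEN spec, of x] bspec[OF CC t, THEN spec, of x]
      by (auto intro!: mult_mono bd(2-4) intro: order_trans[OF abs_ge_zero])
    then have "\<bar>I t x\<bar> \<le> CA * (1 + (ux t x)\<^sup>2) * bd + CB * (1 + (ux t x)\<^sup>2) * bd + CC * (1 + (ux t x)\<^sup>2) * bd"
      unfolding I_def by linarith
    then show ?thesis by (simp add: algebra_simps)
  qed
  have Ii: "integrable lborel (\<lambda>z. I (fst z) (snd z))"
  proof (rule Bochner_Integration.integrable_bound)
    show "integrable lborel (\<lambda>z. (CA + CB + CC) * bd * (indicator ({0..T} \<times> {-X..X}) z * (1 + (ux (fst z) (snd z))\<^sup>2)))"
      by (intro integrable_mult_right strip_integrable T)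
    show "AE z in lborel. norm (I (fst z) (snd z)) \<le> norm ((CA + CB + CC) * bd * (indicator ({0..T} \<times> {-X..X}) z * (1 + (ux (fst z) (snd z))\<^sup>2)))"
    proof (intro AE_I2)
      fix z :: "real \<times> real"
      show "norm (I (fst z) (snd z)) \<le> norm ((CA + CB + CC) * bd * (indicator ({0..T} \<times> {-X..X}) z * (1 + (ux (fst z) (snd z))\<^sup>2)))"
      proof (cases "z \<in> {0..T} \<times> {-X..X}")
        case True
        then show ?thesis using Ile[of "fst z" "snd z"] by auto
      next
        case False
        then show ?thesis using Iz[of "fst z" "snd z"] by (cases z) auto
      qed
    qed
  qed (use Im' in simp)
  have "(LINT (t, x)|lebesgue. A t x * deriv (\<lambda>s. \<psi> (s, x)) t - B t x * \<psi> (t, x) + C t x * deriv (\<lambda>y. \<psi> (t, y)) x)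
      = (LINT z|lebesgue. I (fst z) (snd z))"
    by (simp add: dt dx I_def case_prod_beta')
  also have "\<dots> = (LBINT z. I (fst z) (snd z))" by (rule has_bochner_lebesgue_lborel(1)[OF Im'])
  also have "\<dots> = (LBINT t. (LBINT x. I t x))"
    using lborel_pair.integral_fst'[of "\<lambda>z. I (fst z) (snd z)"] Ii by (simp add: lborel_prod)
  also have "\<dots> = (LBINT t:{0..T}. J t)"
    unfolding set_lebesgue_integral_def
  proof (rule integral_cong_AE)
    show "(\<lambda>t. LBINT x. I t x) \<in> borel_measurable lborel"
      using lborel.borel_measurable_lebesgue_integral[of "\<lambda>t x. I t x" borel] Im by (simp add: case_prod_beta')
    show "AE t in lborel. (LBINT x. I t x) = indicator {0..T} t *\<^sub>R J t"
      using JA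
    proof eventually_elim
      case (elim t)
      then show ?case by (cases "t \<in> {0..T}") (auto simp: I_def[symmetric] Iz)
    qed
  qed (use Jm in simp)
  finally show "(LINT (t, x)|lebesgue. A t x * deriv (\<lambda>s. \<psi> (s, x)) t - B t x * \<psi> (t, x) + C t x * deriv (\<lambda>y. \<psi> (t, y)) x) = 0"
    using J0 by simp
qed

lemma momentum_balance: "weak_balance_law u (\<lambda>t x. u t x * ux t x) (\<lambda>t x. l\<^sup>2 * burgers_P l ux t x)"
proof (rule weak_balance_lawI)
  show "tame u" by (rule loc_bounded_tame[OF loc_bounded_u])
  show "tame (\<lambda>t x. u t x * ux t x)" by (rule tame_mult[OF loc_bounded_u tame_basic(2)])
  show "tame (\<lambda>t x. l\<^sup>2 * burgers_P l ux t x)"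
    by (rule loc_bounded_tame[OF loc_bounded_mult[OF loc_bounded_const loc_bounded_burgers_P]])
  fix \<psi> \<psi>t \<psi>x T X assume d: "test_data \<psi> \<psi>t \<psi>x T X"
  then have T: "T \<ge> 0" by (simp add: test_data_def)
  then obtain R D where "flow l g v0 p r m T R D" using flows by blast
  then interpret F: flow l g v0 p r m T R D .
  define J where "J s \<xi> = \<psi>t s (y s \<xi>) * (U s \<xi> * (p s \<xi>)\<^sup>2) - \<psi> s (y s \<xi>) * (U s \<xi> * (p s \<xi> * r s \<xi>))
        + \<psi>x s (y s \<xi>) * (l\<^sup>2 * P s \<xi> * (p s \<xi>)\<^sup>2)" for s \<xi>
  note law = F.momentum_law[OF d J_def]
  have [measurable]: "\<psi> t \<in> borel_measurable borel" "\<psi>t t \<in> borel_measurable borel" "\<psi>x t \<in> borel_measurable borel" "burgers_P l ux t \<in> borel_measurable borel" for t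
    using test_data_measurable[OF d] burgers_P_measurable by (auto intro: slice_borel(1))
  have "AE t in lborel. t \<in> {0..T} \<longrightarrow> (LBINT x. u t x * \<psi>t t x - u t x * ux t x * \<psi> t x + l\<^sup>2 * burgers_P l ux t x * \<psi>x t x) = (LBINT \<xi>. J t \<xi>)"
    using AE_good
  proof eventually_elim
    case (elim t)
    show ?case
    proof
      assume "t \<in> {0..T}"
      then have t: "t \<ge> 0" by simp
      interpret s: slice "y t" "U t" "p t" "r t" by (rule slice_at[OF t])
      have m: "case_prod (\<lambda>x q. u t x * \<psi>t t x - u t x * q * \<psi> t x + l\<^sup>2 * burgers_P l ux t x * \<psi>x t x) \<in> borel_plane"
        unfolding case_prod_beta' by measurable
      have "(LBINT x. u t x * \<psi>t t x - u t x * ux t x * \<psi> t x + l\<^sup>2 * burgers_P l ux t x * \<psi>x t x)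
        = (LBINT \<xi>. (p t \<xi>)\<^sup>2 * (u t (y t \<xi>) * \<psi>t t (y t \<xi>) - u t (y t \<xi>) * (r t \<xi> / p t \<xi>) * \<psi> t (y t \<xi>)
            + l\<^sup>2 * burgers_P l ux t (y t \<xi>) * \<psi>x t (y t \<xi>)))"
        using s.integral_subst[OF m] by (simp add: ux_at[OF t])
      also have "\<dots> = (LBINT \<xi>. J t \<xi>)"
        using elim t by (intro Bochner_Integration.integral_cong refl)
          (auto simp: u_y burgers_P_y J_def algebra_simps power2_eq_square)
      finally show "(LBINT x. u t x * \<psi>t t x - u t x * ux t x * \<psi> t x + l\<^sup>2 * burgers_P l ux t x * \<psi>x t x) = (LBINT \<xi>. J t \<xi>)" .
    qed
  qed
  then show "\<exists>J. J \<in> borel_measurable borel \<and> (LBINT t:{0..T}. J t) = 0 \<and>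
      (AE t in lborel. t \<in> {0..T} \<longrightarrow> (LBINT x. u t x * \<psi>t t x - u t x * ux t x * \<psi> t x + l\<^sup>2 * burgers_P l ux t x * \<psi>x t x) = J t)"
    using law by blast
qed

lemma energy_balance: "weak_balance_law (\<lambda>t x. 1/2 * (u t x)\<^sup>2 + 1/2 * l\<^sup>2 * (ux t x)\<^sup>2) (\<lambda>t x. 0)
    (\<lambda>t x. 1/3 * (u t x)^3 + l\<^sup>2 * u t x * burgers_P l ux t x + 1/2 * l\<^sup>2 * u t x * (ux t x)\<^sup>2)"
proof (rule weak_balance_lawI)
  note lb = loc_bounded_mult loc_bounded_const loc_bounded_u loc_bounded_burgers_P
  have "tame (\<lambda>t x. 1/2 * (u t x * u t x) + (1/2 * l\<^sup>2) * (ux t x)\<^sup>2)"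
    by (rule tame_add[OF loc_bounded_tame tame_mult[OF _ tame_basic(3)]]) (intro lb)+
  then show "tame (\<lambda>t x. 1/2 * (u t x)\<^sup>2 + 1/2 * l\<^sup>2 * (ux t x)\<^sup>2)" by (simp add: power2_eq_square)
  show "tame (\<lambda>t x. 0)" by (rule tame_basic)
  have "tame (\<lambda>t x. (1/3 * (u t x * (u t x * u t x)) + l\<^sup>2 * (u t x * burgers_P l ux t x)) + (1/2 * l\<^sup>2 * u t x) * (ux t x)\<^sup>2)"
    by (rule tame_add[OF tame_add[OF loc_bounded_tame loc_bounded_tame] tame_mult[OF _ tame_basic(3)]]) (intro lb)+
  then show "tame (\<lambda>t x. 1/3 * (u t x)^3 + l\<^sup>2 * u t x * burgers_P l ux t x + 1/2 * l\<^sup>2 * u t x * (ux t x)\<^sup>2)"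
    by (simp add: power3_eq_cube mult.assoc)
  fix \<psi> \<psi>t \<psi>x T X assume d: "test_data \<psi> \<psi>t \<psi>x T X"
  then have T: "T \<ge> 0" by (simp add: test_data_def)
  then obtain R D where "flow l g v0 p r m T R D" using flows by blast
  then interpret F: flow l g v0 p r m T R D .
  define J where "J s \<xi> = \<psi>t s (y s \<xi>) * (1/2 * (U s \<xi>)\<^sup>2 * (p s \<xi>)\<^sup>2 + 1/2 * l\<^sup>2 * (r s \<xi>)\<^sup>2)
        + \<psi>x s (y s \<xi>) * (1/3 * (U s \<xi>)^3 * (p s \<xi>)\<^sup>2 + l\<^sup>2 * U s \<xi> * P s \<xi> * (p s \<xi>)\<^sup>2 + 1/2 * l\<^sup>2 * U s \<xi> * (r s \<xi>)\<^sup>2)" for s \<xi>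
  note law = F.energy_law[OF d J_def]
  have [measurable]: "\<psi> t \<in> borel_measurable borel" "\<psi>t t \<in> borel_measurable borel" "\<psi>x t \<in> borel_measurable borel" "burgers_P l ux t \<in> borel_measurable borel" for t
    using test_data_measurable[OF d] burgers_P_measurable by (auto intro: slice_borel(1))
  let ?A = "\<lambda>t x q. 1/2 * (u t x)\<^sup>2 + 1/2 * l\<^sup>2 * q\<^sup>2"
  let ?C = "\<lambda>t x q. 1/3 * (u t x)^3 + l\<^sup>2 * u t x * burgers_P l ux t x + 1/2 * l\<^sup>2 * u t x * q\<^sup>2"
  have "AE t in lborel. t \<in> {0..T} \<longrightarrow> (LBINT x. ?A t x (ux t x) * \<psi>t t x - 0 * \<psi> t x + ?C t x (ux t x) * \<psi>x t x) = (LBINT \<xi>. J t \<xi>)"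
    using AE_good
  proof eventually_elim
    case (elim t)
    show ?case
    proof
      assume "t \<in> {0..T}"
      then have t: "t \<ge> 0" by simp
      interpret s: slice "y t" "U t" "p t" "r t" by (rule slice_at[OF t])
      have good: "AE \<xi> in lborel. p t \<xi> \<noteq> 0" using elim t by blast
      have [measurable]: "U t \<in> borel_measurable borel" "y t \<in> borel_measurable borel" "P t \<in> borel_measurable borel"
        by (rule F.U_slice F.y_slice F.P_slice)+
      have m: "case_prod (\<lambda>x q. ?A t x q * \<psi>t t x - 0 * \<psi> t x + ?C t x q * \<psi>x t x) \<in> borel_plane"
        unfolding case_prod_beta' by measurable
      have "(LBINT x. ?A t x (ux t x) * \<psi>t t x - 0 * \<psi> t x + ?C t x (ux t x) * \<psi>x t x)
        = (LBINT \<xi>. (p t \<xi>)\<^sup>2 * (?A t (y t \<xi>) (r t \<xi> / p t \<xi>) * \<psi>t t (y t \<xi>) - 0 * \<psi> t (y t \<xi>) + ?C t (y t \<xi>) (r t \<xi> / p t \<xi>) * \<psi>x t (y t \<xi>)))"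
        using s.integral_subst[OF m] unfolding ux_at[OF t] .
      also have "\<dots> = (LBINT \<xi>. J t \<xi>)"
      proof (rule integral_cong_AE)
        show "AE \<xi> in lborel. (p t \<xi>)\<^sup>2 * (?A t (y t \<xi>) (r t \<xi> / p t \<xi>) * \<psi>t t (y t \<xi>) - 0 * \<psi> t (y t \<xi>) + ?C t (y t \<xi>) (r t \<xi> / p t \<xi>) * \<psi>x t (y t \<xi>)) = J t \<xi>"
          using good
        proof eventually_elim
          case (elim \<xi>)
          define q where "q = r t \<xi> / p t \<xi>"
          \<comment> \<open>Here the energy of the labels becomes that of the positions: at a good
            time no part of \<open>r^2\<close> sits where \<open>p\<close> vanishes.\<close>
          have rr: "(r t \<xi>)\<^sup>2 = (p t \<xi>)\<^sup>2 * q\<^sup>2" using elim by (simp add: q_def power_divide)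
          show ?case unfolding u_y[OF t] burgers_P_y[OF t good] J_def q_def[symmetric] rr
            by (simp add: algebra_simps)
        qed
      qed (unfold J_def, measurable)
      finally show "(LBINT x. ?A t x (ux t x) * \<psi>t t x - 0 * \<psi> t x + ?C t x (ux t x) * \<psi>x t x) = (LBINT \<xi>. J t \<xi>)" .
    qed
  qed
  then show "\<exists>J. J \<in> borel_measurable borel \<and> (LBINT t:{0..T}. J t) = 0 \<and>
      (AE t in lborel. t \<in> {0..T} \<longrightarrow> (LBINT x. ?A t x (ux t x) * \<psi>t t x - 0 * \<psi> t x + ?C t x (ux t x) * \<psi>x t x) = J t)"
    using law by blast
qed

end

section \<open>Wave breaking and conservation of energy\<close>

text \<open>As long as \<open>P\<close> times the square of \<tau> = \<open>b - a\<close> is small,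
  \<open>r\<close> is almost constant and \<open>p\<close> almost affine with slope
  \<open>r a / 2\<close>. A value of \<open>r/p\<close> below \<open>-8/\<tau>\<close> places
  \<open>p a\<close> within \<open>\<bar>r a\<bar> \<tau> / 8\<close> of zero, on the side from
  which it is driven through zero. At time \<open>b\<close> the ratio of \<open>p b\<close> to
  \<open>r a\<close> lies between \<open>\<tau>/4\<close> and \<open>3\<tau>/4\<close>, that of
  \<open>r b\<close> to \<open>r a\<close> is at least 15/16, and the quotient exceeds
  \<open>1/\<tau>\<close>.\<close>

lemma (in flow) reversal:
  assumes ab: "0 \<le> a" "a < b" "b \<le> T" and M: "\<And>s. s \<in> {a..b} \<Longrightarrow> P s \<xi> \<le> M" "M * (b - a)\<^sup>2 \<le> 1/16"
    and p: "p a \<xi> \<noteq> 0" and steep: "r a \<xi> / p a \<xi> \<le> - (8 / (b - a))"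
  shows "p b \<xi> \<noteq> 0" and "r b \<xi> / p b \<xi> \<ge> 1 / (b - a)"
proof -
  define \<tau> where "\<tau> = b - a"
  have \<tau>: "\<tau> > 0" using ab by (simp add: \<tau>_def)
  have sub: "{a..b} \<subseteq> {0..T}" using ab by auto
  have D: "((\<lambda>s. p s \<xi>) has_real_derivative r s \<xi> / 2) (at s within {a..b})"
    "((\<lambda>s. r s \<xi>) has_real_derivative - (P s \<xi> * p s \<xi>)) (at s within {a..b})" if "s \<in> {a..b}" for s
    using time_derivatives(1,2)[of s \<xi>] that sub by (auto intro: DERIV_subset)
  obtain \<sigma> where \<sigma>: "\<sigma> \<in> {a..b}" "\<And>s. s \<in> {a..b} \<Longrightarrow> \<bar>p s \<xi>\<bar> \<le> \<bar>p \<sigma> \<xi>\<bar>"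
    using continuous_attains_sup[of "{a..b}" "\<lambda>s. \<bar>p s \<xi>\<bar>"] ab
      continuous_on_rabs[OF continuous_on_subset[OF time_continuous(1) sub, of \<xi>]] by auto
  define q where "q = \<bar>p \<sigma> \<xi>\<bar>"
  define r0 where "r0 = r a \<xi>"
  have q0: "q \<ge> 0" by (simp add: q_def)
  have M0: "M \<ge> 0" using M(1)[of a] P_nonneg[of a \<xi>] ab by simp
  have "M * \<tau> * \<tau> \<le> 1/16" using M(2) by (simp add: \<tau>_def power2_eq_square mult.assoc)
  have rle: "\<bar>r s \<xi> - r0\<bar> \<le> M * q * \<tau>" if s: "s \<in> {a..b}" for s
  proof -
    have "norm (r s \<xi> - r a \<xi>) \<le> M * q * norm (s - a)"
    proof (rule field_differentiable_bound[of "{a..b}", OF _ D(2)])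
      fix z assume z: "z \<in> {a..b}"
      have "\<bar>P z \<xi>\<bar> * \<bar>p z \<xi>\<bar> \<le> M * q"
        using M(1)[OF z] P_nonneg[of z \<xi>] \<sigma>(2)[OF z] M0 by (intro mult_mono) (auto simp: q_def)
      then show "norm (- (P z \<xi> * p z \<xi>)) \<le> M * q" by (simp add: abs_mult)
    qed (use s ab in auto)
    also have "\<dots> \<le> M * q * \<tau>" using s M0 q0 by (intro mult_left_mono) (auto simp: \<tau>_def)
    finally show ?thesis by (simp add: r0_def)
  qed
  have ple: "\<bar>p s \<xi> - p a \<xi> - r0 / 2 * (s - a)\<bar> \<le> q / 32" if s: "s \<in> {a..b}" for s
  proof -
    have "norm ((p s \<xi> - r0 / 2 * s) - (p a \<xi> - r0 / 2 * a)) \<le> (M * q * \<tau> / 2) * norm (s - a)"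
    proof (rule field_differentiable_bound[of "{a..b}" "\<lambda>s. p s \<xi> - r0 / 2 * s" "\<lambda>s. r s \<xi> / 2 - r0 / 2"])
      fix z assume z: "z \<in> {a..b}"
      show "((\<lambda>s. p s \<xi> - r0 / 2 * s) has_real_derivative r z \<xi> / 2 - r0 / 2) (at z within {a..b})"
        by (auto intro!: derivative_eq_intros D(1)[OF z])
      show "norm (r z \<xi> / 2 - r0 / 2) \<le> M * q * \<tau> / 2" using rle[OF z] by (simp add: diff_divide_distrib[symmetric])
    qed (use s ab in auto)
    also have "\<dots> \<le> (M * q * \<tau> / 2) * \<tau>" using s M0 q0 \<tau> by (intro mult_left_mono) (auto simp: \<tau>_def)
    also have "\<dots> = (M * \<tau> * \<tau>) * q / 2" by simp
    also have "\<dots> \<le> (1/16) * q / 2" using \<open>M * \<tau> * \<tau> \<le> 1/16\<close> q0 by (intro divide_right_mono mult_right_mono) auto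
    finally have "norm ((p s \<xi> - r0 / 2 * s) - (p a \<xi> - r0 / 2 * a)) \<le> q / 32" by simp
    moreover have "(p s \<xi> - r0 / 2 * s) - (p a \<xi> - r0 / 2 * a) = p s \<xi> - p a \<xi> - r0 / 2 * (s - a)"
      by (simp add: right_diff_distrib)
    ultimately show ?thesis by (simp only: real_norm_def)
  qed
  have pa: "\<bar>p a \<xi>\<bar> \<le> \<bar>r0\<bar> * \<tau> / 8"
  proof -
    have "8 / \<tau> \<le> \<bar>r0 / p a \<xi>\<bar>" using steep abs_ge_minus_self[of "r0 / p a \<xi>"] unfolding r0_def \<tau>_def by linarith
    then have "8 / \<tau> * \<bar>p a \<xi>\<bar> \<le> \<bar>r0\<bar>" using p by (simp add: abs_divide field_simps)
    then show ?thesis using \<tau> by (simp add: field_simps)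
  qed
  \<comment> \<open>The error \<open>q / 32\<close> is absorbed on the left: 31/32 of
    \<open>q\<close> is at most \<open>1/8 + 1/2\<close> times
    \<open>\<bar>r0\<bar> * \<tau>\<close>.\<close>
  have q_le: "q \<le> \<bar>r0\<bar> * \<tau>"
  proof -
    have "\<bar>r0 / 2 * (\<sigma> - a)\<bar> \<le> \<bar>r0\<bar> / 2 * \<tau>"
      unfolding abs_mult using \<sigma>(1) by (intro mult_mono) (auto simp: \<tau>_def)
    then have "q \<le> \<bar>p a \<xi>\<bar> + \<bar>r0\<bar> * \<tau> / 2 + q / 32" using ple[OF \<sigma>(1)] unfolding q_def by argo
    moreover have "0 \<le> \<bar>r0\<bar> * \<tau>" using \<tau> by simp
    ultimately show ?thesis using pa by linarith
  qed
  have r0: "r0 \<noteq> 0" using pa p by auto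
  have bb: "b \<in> {a..b}" using ab by simp
  define A where "A = p b \<xi> / r0"
  define B where "B = r b \<xi> / r0"
  have "\<bar>B - 1\<bar> \<le> 1/16"
  proof -
    have "M * q * \<tau> \<le> M * (\<bar>r0\<bar> * \<tau>) * \<tau>" using M0 \<tau> q_le by (intro mult_right_mono mult_left_mono) auto
    also have "\<dots> = (M * \<tau> * \<tau>) * \<bar>r0\<bar>" by simp
    also have "\<dots> \<le> (1/16) * \<bar>r0\<bar>" using \<open>M * \<tau> * \<tau> \<le> 1/16\<close> by (intro mult_right_mono) auto
    finally have "\<bar>r b \<xi> - r0\<bar> \<le> 1/16 * \<bar>r0\<bar>" using rle[OF bb] by linarith
    then have "\<bar>r b \<xi> - r0\<bar> / \<bar>r0\<bar> \<le> 1/16" using r0 by (subst pos_divide_le_eq) auto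
    moreover have "B - 1 = (r b \<xi> - r0) / r0" using r0 by (simp add: B_def diff_divide_distrib)
    ultimately show ?thesis by (simp only: abs_divide)
  qed
  moreover have "\<bar>A - \<tau> / 2\<bar> \<le> \<tau> / 4"
  proof -
    have "\<bar>p b \<xi> - r0 / 2 * \<tau>\<bar> \<le> \<bar>r0\<bar> * \<tau> / 4"
    proof -
      have "\<bar>p b \<xi> - p a \<xi> - r0 / 2 * \<tau>\<bar> \<le> q / 32" using ple[OF bb] by (simp add: \<tau>_def)
      then have "\<bar>p b \<xi> - r0 / 2 * \<tau>\<bar> \<le> q / 32 + \<bar>p a \<xi>\<bar>" by linarith
      moreover have "0 \<le> \<bar>r0\<bar> * \<tau>" using \<tau> by simp
      ultimately show ?thesis using pa q_le by linarith
    qed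
    then have "\<bar>p b \<xi> - r0 / 2 * \<tau>\<bar> / \<bar>r0\<bar> \<le> \<tau> / 4" using r0 by (subst pos_divide_le_eq) (auto simp: mult.commute)
    moreover have "A - \<tau> / 2 = (p b \<xi> - r0 / 2 * \<tau>) / r0" using r0 by (simp add: A_def diff_divide_distrib)
    ultimately show ?thesis by (simp only: abs_divide)
  qed
  ultimately have AB: "A > 0" "A \<le> 3 / 4 * \<tau>" "B \<ge> 15 / 16" using \<tau> by argo+
  then show "p b \<xi> \<noteq> 0" by (auto simp: A_def)
  have "(15 / 16) * \<tau> \<le> B * \<tau>" using AB(3) \<tau> by (intro mult_right_mono) auto
  then have "A \<le> B * \<tau>" using AB(2) \<tau> by linarith
  then have "1 / \<tau> \<le> B / A" using AB(1) \<tau> by (simp add: field_simps)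
  also have "B / A = r b \<xi> / p b \<xi>" using r0 by (simp add: A_def B_def)
  finally show "r b \<xi> / p b \<xi> \<ge> 1 / (b - a)" by (simp add: \<tau>_def)
qed

context lagrangian
begin

lemma weak_deriv_u: "t \<ge> 0 \<Longrightarrow> has_weak_deriv (u t) (ux t)"
  by (intro ac_imp_has_weak_deriv ac_u)

text \<open>Essential bounds on \<open>u_x\<close> become bounds on \<open>r/p\<close> over the
  labels with nonzero \<open>p\<close>, since the remaining labels fill a null set of
  positions.\<close>

lemma AE_ux_iff:
  assumes "t \<ge> 0" "Measurable.pred borel Q"
  shows "(AE x in lebesgue. Q (weak_deriv (u t) x)) \<longleftrightarrow> (AE \<xi> in lborel. p t \<xi> \<noteq> 0 \<longrightarrow> Q (r t \<xi> / p t \<xi>))"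
proof -
  have "AE x in lebesgue. weak_deriv (u t) x = ux t x" by (rule weak_deriv_AE(1)[OF weak_deriv_u[OF assms(1)]])
  then have "(AE x in lebesgue. Q (weak_deriv (u t) x)) \<longleftrightarrow> (AE x in lebesgue. Q (ux t x))"
    by (rule eventually_subst[OF eventually_mono]) simp
  also have "\<dots> \<longleftrightarrow> (AE x in lborel. Q (ux t x))" by (rule AE_completion_iff)
  also have "\<dots> \<longleftrightarrow> (AE \<xi> in lborel. p t \<xi> \<noteq> 0 \<longrightarrow> Q (r t \<xi> / p t \<xi>))"
    unfolding ux_at[OF assms(1)] by (rule slice.AE_subst[OF slice_at[OF assms(1)] assms(2)])
  finally show ?thesis .
qed

text \<open>By contradiction: were the supremum at time \<open>T + s\<close> below
  \<open>1/(2s)\<close>, then \<open>reversal\<close> from a time \<open>a\<close> in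
  \<open>(T - s, T)\<close> would exclude slopes below \<open>-8/s\<close> at time \<open>a\<close>,
  as the two times differ by between \<open>s\<close> and \<open>2s\<close>. The hypothesis on the
  infimum supplies an \<open>a\<close> at which such slopes occur on a set of positive
  measure.\<close>

lemma breaking:
  assumes T: "T > 0" and lim: "((\<lambda>t. essinf lebesgue (\<lambda>x. ereal (weak_deriv (u t) x))) \<longlongrightarrow> - \<infinity>) (at_left T)"
  shows "((\<lambda>t. esssup lebesgue (\<lambda>x. ereal (weak_deriv (u t) x))) \<longlongrightarrow> \<infinity>) (at_right T)"
proof -
  define M where "M = Pbound (T + 1)"
  have M: "M \<ge> 0" using T by (simp add: M_def Pbound_nonneg)
  \<comment> \<open>\<open>s \<le> 1\<close> keeps all times below \<open>T + 1\<close>, where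
    \<open>M\<close> bounds the pressure; \<open>s \<le> 1 / (8 * (M + 1))\<close> gives
    \<open>M (2 s)^2 \<le> 1/16\<close> as demanded by \<open>reversal\<close>.\<close>
  define s0 where "s0 = min 1 (1 / (8 * (M + 1)))"
  have s0: "s0 > 0" "s0 \<le> 1" using M by (auto simp: s0_def)
  have wm: "(\<lambda>x. ereal (weak_deriv (u t) x)) \<in> borel_measurable lebesgue" if "t \<ge> 0" for t
    using has_weak_deriv_measurable[OF weak_deriv_AE(2)[OF weak_deriv_u[OF that]]] by simp
  have key: "ereal (1 / (2 * s)) \<le> esssup lebesgue (\<lambda>x. ereal (weak_deriv (u (T + s)) x))" if s: "0 < s" "s < s0" for s
  proof (rule ccontr)
    assume "\<not> ?thesis"
    then have less: "esssup lebesgue (\<lambda>x. ereal (weak_deriv (u (T + s)) x)) < ereal (1 / (2 * s))" by simp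
    have "AE x in lebesgue. weak_deriv (u (T + s)) x < 1 / (2 * s)"
      using esssup_AE[of "\<lambda>x. ereal (weak_deriv (u (T + s)) x)" lebesgue]
    proof eventually_elim
      case (elim x)
      then have "ereal (weak_deriv (u (T + s)) x) < ereal (1 / (2 * s))" using less by (rule order.strict_trans1)
      then show ?case by simp
    qed
    then have flat: "AE \<xi> in lborel. p (T + s) \<xi> \<noteq> 0 \<longrightarrow> r (T + s) \<xi> / p (T + s) \<xi> < 1 / (2 * s)"
      using T s by (subst (asm) AE_ux_iff) auto
    have "\<forall>\<^sub>F t in at_left T. essinf lebesgue (\<lambda>x. ereal (weak_deriv (u t) x)) < ereal (- (8 / s))"
      using order_tendstoD(2)[OF lim, of "ereal (- (8 / s))"] by simp
    moreover have "\<forall>\<^sub>F t in at_left T. t \<in> {max 0 (T - s)<..<T}"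
      using T s by (intro eventually_at_left_real) auto
    ultimately have "\<forall>\<^sub>F t in at_left T. essinf lebesgue (\<lambda>x. ereal (weak_deriv (u t) x)) < ereal (- (8 / s)) \<and> t \<in> {max 0 (T - s)<..<T}"
      by (rule eventually_conj)
    then obtain a where a: "essinf lebesgue (\<lambda>x. ereal (weak_deriv (u a) x)) < ereal (- (8 / s))" "0 < a" "T - s < a" "a < T"
      using eventually_happens[of _ "at_left T"] by (auto simp: trivial_limit_at_left_real)
    define b where "b = T + s"
    have \<tau>: "s < b - a" "b - a < 2 * s" using a by (auto simp: b_def)
    obtain R D where "flow l g v0 p r m b R D" using flows[of b] T s by (auto simp: b_def)
    then interpret F: flow l g v0 p r m b R D .
    have PM: "P t \<xi> \<le> M" if "t \<in> {a..b}" for t \<xi>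
    proof -
      have "P t \<xi> \<le> Pbound t" using that a by (intro P_bound) auto
      also have "\<dots> \<le> M" unfolding M_def using that a s s0 by (intro Pbound_mono) (auto simp: b_def)
      finally show ?thesis .
    qed
    have Mb: "M * (b - a)\<^sup>2 \<le> 1/16"
    proof -
      have "(M + 1) * (8 * s) \<le> 1" using s M by (auto simp: s0_def min_less_iff_conj field_simps)
      moreover have "(b - a)\<^sup>2 \<le> (2 * s)\<^sup>2" using \<tau> s by (intro power_mono) auto
      moreover have "(2 * s)\<^sup>2 \<le> 4 * s * (1 / 8)"
      proof -
        have "(M + 1) * (8 * s) \<ge> 1 * (8 * s)" using M s by (intro mult_right_mono) auto
        then have "s \<le> 1/8" using \<open>(M + 1) * (8 * s) \<le> 1\<close> by linarith
        then have "4 * s * s \<le> 4 * s * (1 / 8)" using s by (intro mult_left_mono) auto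
        then show ?thesis by (simp add: power2_eq_square)
      qed
      ultimately have "M * (b - a)\<^sup>2 \<le> M * (s / 2)" using M by (intro mult_left_mono) auto
      also have "\<dots> \<le> (M + 1) * (8 * s) / 16" using M s by (simp add: field_simps)
      finally show ?thesis using \<open>(M + 1) * (8 * s) \<le> 1\<close> by linarith
    qed
    have "AE \<xi> in lborel. p a \<xi> \<noteq> 0 \<longrightarrow> r a \<xi> / p a \<xi> \<ge> - (8 / s)"
      using flat
    proof eventually_elim
      case (elim \<xi>)
      show ?case
      proof (rule impI, rule ccontr)
        assume p: "p a \<xi> \<noteq> 0" and "\<not> r a \<xi> / p a \<xi> \<ge> - (8 / s)"
        moreover have "8 / (b - a) \<le> 8 / s" using \<tau> s by (intro divide_left_mono) auto
        ultimately have st: "r a \<xi> / p a \<xi> \<le> - (8 / (b - a))" by linarith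
        have ab: "0 \<le> a" "a < b" "b \<le> b" using a s by (auto simp: b_def)
        note rev = F.reversal[OF ab PM Mb p st]
        have "1 / (2 * s) \<le> 1 / (b - a)" using \<tau> s by (intro divide_left_mono) auto
        then show False using elim rev unfolding b_def by auto
      qed
    qed
    then have "AE x in lebesgue. weak_deriv (u a) x \<ge> - (8 / s)"
      using a(2) by (subst AE_ux_iff) auto
    then have "esssup lebesgue (\<lambda>x. - ereal (weak_deriv (u a) x)) \<le> ereal (8 / s)"
      using a(2) by (intro esssup_I borel_measurable_uminus_ereal wm) (auto elim!: eventually_mono)
    then show False using a(1) unfolding essinf_def
      by (metis ereal_minus_le_minus linorder_not_less uminus_ereal.simps(1))
  qed
  show ?thesis
    unfolding tendsto_PInfty
  proof
    fix c :: real
    have "\<forall>\<^sub>F t in at_right T. t \<in> {T<..<T + min s0 (1 / (2 * (\<bar>c\<bar> + 1)))}"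
      using s0 by (intro eventually_at_right_real) auto
    then show "\<forall>\<^sub>F t in at_right T. ereal c < esssup lebesgue (\<lambda>x. ereal (weak_deriv (u t) x))"
    proof eventually_elim
      case (elim t)
      define s where "s = t - T"
      have s: "0 < s" "s < s0" "s < 1 / (2 * (\<bar>c\<bar> + 1))" using elim by (auto simp: s_def)
      have "c < 1 / (2 * s)"
      proof -
        have "s * (2 * (\<bar>c\<bar> + 1)) < 1" using s(3) by (simp add: pos_less_divide_eq)
        then have "\<bar>c\<bar> + 1 < 1 / (2 * s)" using s(1) by (simp add: pos_less_divide_eq mult_ac)
        then show ?thesis by linarith
      qed
      then have "ereal c < ereal (1 / (2 * s))" by simp
      also have "\<dots> \<le> esssup lebesgue (\<lambda>x. ereal (weak_deriv (u t) x))" using key[OF s(1,2)] by (simp add: s_def)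
      finally show ?case .
    qed
  qed
qed

text \<open>The same flow is viewed relative to the zero profile, for which the label energy is
  constant at all times. It equals the energy in the positions whenever \<open>p\<close> is nonzero
  for almost every label.\<close>

lemma energy_equality:
  assumes i0: "integrable lborel (\<lambda>\<xi>. (v0 \<xi>)\<^sup>2)"
  shows "AE t in lborel. t \<ge> 0 \<longrightarrow> (LBINT x. (u t x)\<^sup>2 + l\<^sup>2 * (ux t x)\<^sup>2) = (LBINT \<xi>. (v0 \<xi>)\<^sup>2 + l\<^sup>2 * (g \<xi>)\<^sup>2)"
  using AE_good
proof eventually_elim
  case (elim t)
  show ?case
  proof
    assume t: "t \<ge> 0"
    interpret s: slice "y t" "U t" "p t" "r t" by (rule slice_at[OF t])
    have good: "AE \<xi> in lborel. p t \<xi> \<noteq> 0" using elim t by blast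
    obtain R D where "flow l g v0 p r m t R D" using flows[OF t] by blast
    moreover have "profile l g v0 m (\<lambda>_. 0) (\<lambda>_. 0) (\<lambda>_. 0) 0 0"
      by unfold_locales (use v0 v0_bound i0 m_nonneg in auto)
    ultimately interpret F: energy l g v0 p r m t R D "\<lambda>_. 0" "\<lambda>_. 0" "\<lambda>_. 0" 0 0 by (rule profile.energyI[rotated])
    have [measurable]: "U t \<in> borel_measurable borel" "y t \<in> borel_measurable borel"
      by (rule F.U_slice F.y_slice)+
    have m: "case_prod (\<lambda>x q. (u t x)\<^sup>2 + l\<^sup>2 * q\<^sup>2) \<in> borel_plane"
      unfolding case_prod_beta' by measurable
    have "(LBINT x. (u t x)\<^sup>2 + l\<^sup>2 * (ux t x)\<^sup>2)
        = (LBINT \<xi>. (p t \<xi>)\<^sup>2 * ((u t (y t \<xi>))\<^sup>2 + l\<^sup>2 * (r t \<xi> / p t \<xi>)\<^sup>2))"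
      using s.integral_subst[OF m] unfolding ux_at[OF t] .
    also have "\<dots> = (LBINT \<xi>. F.e t \<xi>)"
    proof (rule integral_cong_AE)
      show "AE \<xi> in lborel. (p t \<xi>)\<^sup>2 * ((u t (y t \<xi>))\<^sup>2 + l\<^sup>2 * (r t \<xi> / p t \<xi>)\<^sup>2) = F.e t \<xi>"
        using good by eventually_elim (simp add: F.e_def F.V_def u_y[OF t] power_divide algebra_simps)
    qed (unfold F.e_def F.V_def, measurable)
    also have "\<dots> = (LBINT \<xi>. F.e 0 \<xi>)"
      by (rule F.energy_conserved) (use i0 t in auto)
    also have "\<dots> = (LBINT \<xi>. (v0 \<xi>)\<^sup>2 + l\<^sup>2 * (g \<xi>)\<^sup>2)" by (simp add: F.e_def F.V_def)
    finally show "(LBINT x. (u t x)\<^sup>2 + l\<^sup>2 * (ux t x)\<^sup>2) = (LBINT \<xi>. (v0 \<xi>)\<^sup>2 + l\<^sup>2 * (g \<xi>)\<^sup>2)" .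
  qed
qed

text \<open>Compare along the characteristic that reaches \<open>x\<close> at time \<open>t\<close>:
  its velocity changes by the bound on \<open>Q\<close>, and its displacement costs an integral of
  \<open>\<bar>ux\<bar>\<close> at the fixed time \<open>s\<close> over a window around
  \<open>x\<close>. The constant \<open>Umax + 1\<close> keeps the window nondegenerate.\<close>

lemma abs_u_diff_le:
  assumes T: "T \<ge> 0" obtains c d where "c \<ge> 0" "d > 0"
    "\<And>s t x. s \<in> {0..T} \<Longrightarrow> t \<in> {0..T} \<Longrightarrow>
      \<bar>u t x - u s x\<bar> \<le> c * \<bar>t - s\<bar> + (LBINT z:{x - d * \<bar>t - s\<bar>..x + d * \<bar>t - s\<bar>}. \<bar>ux s z\<bar>)"
proof -
  obtain R D where "flow l g v0 p r m T R D" using flows[OF T] by blast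
  then interpret F: flow l g v0 p r m T R D .
  have "\<bar>u t x - u s x\<bar> \<le> l * F.Pmax * \<bar>t - s\<bar> + (LBINT z:{x - (F.Umax + 1) * \<bar>t - s\<bar>..x + (F.Umax + 1) * \<bar>t - s\<bar>}. \<bar>ux s z\<bar>)"
    if s: "s \<in> {0..T}" and t: "t \<in> {0..T}" for s t x
  proof -
    define \<delta> where "\<delta> = (F.Umax + 1) * \<bar>t - s\<bar>"
    have s0: "s \<ge> 0" and t0: "t \<ge> 0" using s t by auto
    obtain \<xi> where \<xi>: "y t \<xi> = x" using y_surj[OF t0] by blast
    have dU: "\<bar>U t \<xi> - U s \<xi>\<bar> \<le> l * F.Pmax * \<bar>t - s\<bar>" by (rule F.U_Lipschitz[OF s t])
    have z: "\<bar>y s \<xi> - x\<bar> \<le> \<delta>"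
      using F.y_Lipschitz[OF t s, of \<xi>] unfolding \<xi> \<delta>_def by (simp add: abs_minus_commute distrib_right)
    note ac = ac_u[OF s0]
    have i: "set_integrable lborel {a..b} (\<lambda>z. \<bar>ux s z\<bar>)" for a b
      using set_integrable_abs[OF ac_set_integrable[OF ac]] .
    have "\<bar>u s (y s \<xi>) - u s x\<bar> \<le> (LBINT z:{min x (y s \<xi>)..max x (y s \<xi>)}. \<bar>ux s z\<bar>)"
    proof -
      have "\<bar>u s b - u s a\<bar> \<le> (LBINT z:{a..b}. \<bar>ux s z\<bar>)" if "a \<le> b" for a b
        unfolding ac_integral[OF ac that, symmetric] set_lebesgue_integral_def
        by (rule LINT_abs_le) (use i[of a b] in \<open>auto simp: set_integrable_def abs_mult\<close>)
      from this[of x "y s \<xi>"] this[of "y s \<xi>" x] show ?thesis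
        by (cases "x \<le> y s \<xi>") (simp_all add: abs_minus_commute max_def min_def)
    qed
    also have "\<dots> \<le> (LBINT z:{x - \<delta>..x + \<delta>}. \<bar>ux s z\<bar>)"
      unfolding set_lebesgue_integral_def
      by (rule integral_mono) (use i z in \<open>auto simp: set_integrable_def indicator_def abs_le_iff\<close>)
    finally have "\<bar>u s (y s \<xi>) - u s x\<bar> \<le> (LBINT z:{x - \<delta>..x + \<delta>}. \<bar>ux s z\<bar>)" .
    moreover have "u t x = U t \<xi>" "u s (y s \<xi>) = U s \<xi>" using u_y[OF t0] u_y[OF s0] \<xi> by auto
    ultimately show ?thesis using dU unfolding \<delta>_def by linarith
  qed
  then show ?thesis
    using that[of "l * F.Pmax" "F.Umax + 1"] l_pos F.Pmax_nonneg F.Umax_nonneg by simp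
qed

text \<open>With \<open>h = \<bar>t - s\<bar>\<close>, Cauchy-Schwarz on a window of length
  \<open>2 d h\<close> gives one factor \<open>h\<close>, and integrating the window integrals over
  all positions gives a second; the square root of \<open>h^2\<close> is the Lipschitz rate.\<close>

lemma L2_Lipschitz:
  assumes T: "T \<ge> 0" and K: "compact K"
  shows "\<exists>C. \<forall>s\<in>{0..T}. \<forall>t\<in>{0..T}. L2_norm_on K (\<lambda>x. u t x - u s x) \<le> C * \<bar>t - s\<bar>"
proof -
  obtain c d where c: "c \<ge> 0" and d: "d > 0" and
    le: "\<And>s t x. s \<in> {0..T} \<Longrightarrow> t \<in> {0..T} \<Longrightarrow>
      \<bar>u t x - u s x\<bar> \<le> c * \<bar>t - s\<bar> + (LBINT z:{x - d * \<bar>t - s\<bar>..x + d * \<bar>t - s\<bar>}. \<bar>ux s z\<bar>)"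
    using abs_u_diff_le[OF T] by blast
  have Kb [measurable]: "K \<in> sets borel" using K by (rule borel_compact)
  have fin: "emeasure lborel K < \<infinity>" by (rule emeasure_compact_finite[OF K])
  define C where "C = sqrt (2 * c\<^sup>2 * measure lborel K + 8 * d\<^sup>2 * (Ebound T / l\<^sup>2))"
  have "L2_norm_on K (\<lambda>x. u t x - u s x) \<le> C * \<bar>t - s\<bar>" if s: "s \<in> {0..T}" and t: "t \<in> {0..T}" for s t
  proof (cases "s = t")
    case False
    define h where "h = \<bar>t - s\<bar>"
    have h: "h > 0" using False by (simp add: h_def)
    have s0: "s \<ge> 0" using s by simp
    define W where "W x = (LBINT z:{x + (- (d * h))..x + d * h}. (ux s z)\<^sup>2)" for x
    have dh: "- (d * h) < d * h" using d h by simp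
    note W = window_integral[OF ux_square(1)[OF s0] _ less_imp_le[OF dh], folded W_def]
    have W0: "W x \<ge> 0" for x unfolding W_def set_lebesgue_integral_def by (rule integral_nonneg_AE) simp
    have si: "set_integrable lborel {a..b} (\<lambda>z. (ux s z)\<^sup>2)" for a b
      unfolding set_integrable_def
      by (rule Bochner_Integration.integrable_bound[OF ux_square(1)[OF s0]]) (auto simp: indicator_def)
    have pw: "(u t x - u s x)\<^sup>2 \<le> 2 * (c * h)\<^sup>2 + 4 * d * h * W x" for x
    proof -
      define I where "I = (LBINT z:{x + (- (d * h))..x + d * h}. \<bar>ux s z\<bar>)"
      have "I\<^sup>2 \<le> (x + d * h - (x + (- (d * h)))) * W x"
        unfolding I_def W_def by (rule square_integral_le) (use dh si in auto)
      then have I2: "I\<^sup>2 \<le> 2 * d * h * W x" by (simp add: algebra_simps)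
      have "\<bar>u t x - u s x\<bar> \<le> c * h + I" using le[OF s t, of x] by (simp add: h_def I_def)
      then have "\<bar>u t x - u s x\<bar>\<^sup>2 \<le> (c * h + I)\<^sup>2" by (intro power_mono) auto
      also have "\<dots> \<le> 2 * (c * h)\<^sup>2 + 2 * I\<^sup>2"
        using zero_le_power2[of "c * h - I"] by (simp add: power2_sum power2_diff)
      finally show ?thesis using I2 by simp
    qed
    have iK: "integrable lborel (\<lambda>x. 2 * (c * h)\<^sup>2 * indicator K x)"
      using fin by (intro integrable_mult_right integrable_real_indicator) auto
    have iB: "integrable lborel (\<lambda>x. 2 * (c * h)\<^sup>2 * indicator K x + 4 * d * h * W x)"
      by (intro Bochner_Integration.integrable_add iK integrable_mult_right W(1)) simp
    have "(LINT x:K|lebesgue. (u t x - u s x)\<^sup>2) = (LBINT x. indicator K x * (u t x - u s x)\<^sup>2)"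
      unfolding set_lebesgue_integral_def by (subst has_bochner_lebesgue_lborel(1)) auto
    also have "\<dots> \<le> (LBINT x. 2 * (c * h)\<^sup>2 * indicator K x + 4 * d * h * W x)"
    proof (rule integral_mono'[OF iB])
      fix x
      have "0 \<le> 4 * d * h * W x" using d h W0[of x] by simp
      then show "indicator K x * (u t x - u s x)\<^sup>2 \<le> 2 * (c * h)\<^sup>2 * indicator K x + 4 * d * h * W x"
        using pw[of x] by (simp add: indicator_def)
    qed (use d h W0 in auto)
    also have "\<dots> = (LBINT x. 2 * (c * h)\<^sup>2 * indicator K x) + (LBINT x. 4 * d * h * W x)"
      by (rule Bochner_Integration.integral_add[OF iK integrable_mult_right]) (rule W(1), simp)
    also have "(LBINT x. 2 * (c * h)\<^sup>2 * indicator K x) = 2 * (c * h)\<^sup>2 * measure lborel K" by simp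
    also have "(LBINT x. 4 * d * h * W x) = 4 * d * h * ((d * h - (- (d * h))) * (LBINT z. (ux s z)\<^sup>2))"
      using W(2) by simp
    also have "\<dots> = 8 * d\<^sup>2 * (LBINT z. (ux s z)\<^sup>2) * h\<^sup>2" by (simp add: power2_eq_square)
    also have "\<dots> \<le> 8 * d\<^sup>2 * (Ebound T / l\<^sup>2) * h\<^sup>2"
    proof -
      have "(LBINT z. (ux s z)\<^sup>2) \<le> Ebound T / l\<^sup>2"
        using ux_square(2)[OF s0] divide_right_mono[OF Ebound_mono[OF s0, of T], of "l\<^sup>2"] s by simp
      then show ?thesis by (intro mult_right_mono mult_left_mono) auto
    qed
    finally have sq: "(LINT x:K|lebesgue. (u t x - u s x)\<^sup>2) \<le> (2 * c\<^sup>2 * measure lborel K + 8 * d\<^sup>2 * (Ebound T / l\<^sup>2)) * h\<^sup>2"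
      by (simp add: power_mult_distrib algebra_simps)
    then have "L2_norm_on K (\<lambda>x. u t x - u s x) \<le> sqrt ((2 * c\<^sup>2 * measure lborel K + 8 * d\<^sup>2 * (Ebound T / l\<^sup>2)) * h\<^sup>2)"
      unfolding L2_norm_on_def by (rule real_sqrt_le_mono)
    also have "\<dots> = C * \<bar>t - s\<bar>" using h by (simp add: real_sqrt_mult C_def h_def)
    finally show ?thesis .
  qed (simp add: L2_norm_on_def)
  then show ?thesis by blast
qed

lemma u_L2_loc:
  assumes t: "t \<ge> 0"
  shows "u t \<in> L2_loc"
proof -
  have "set_integrable lborel {a..b} (\<lambda>x. (u t x)\<^sup>2)" for a b
    by (rule borel_integrable_atLeastAtMost')
       (intro continuous_intros continuous_on_subset[OF ac_continuous[OF ac_u[OF t]]], simp)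
  then show ?thesis unfolding L2_loc_def by (auto intro!: locally_integrable_onI measurable_completion)
qed

lemma ux_Linf_L2_loc:
  assumes T: "T > 0"
  shows "ux \<in> Linf_L2_loc T"
proof -
  have L2: "ux t \<in> L2_loc" if "t \<ge> 0" for t
  proof -
    have "set_integrable lborel {a..b} (\<lambda>x. (ux t x)\<^sup>2)" for a b
      unfolding set_integrable_def
      by (rule Bochner_Integration.integrable_bound[OF ux_square(1)[OF that]]) (auto simp: indicator_def)
    then show ?thesis unfolding L2_loc_def by (auto intro!: locally_integrable_onI measurable_completion)
  qed
  have bound: "L2_norm_on K (ux t) \<le> sqrt (Ebound T / l\<^sup>2)" if K: "compact K" and t: "t \<in> {0..T}" for K t
  proof -
    have t0: "t \<ge> 0" using t by simp
    have [measurable]: "K \<in> sets borel" using K by (rule borel_compact)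
    have "(LINT x:K|lebesgue. (ux t x)\<^sup>2) = (LBINT x. indicator K x * (ux t x)\<^sup>2)"
      unfolding set_lebesgue_integral_def by (subst has_bochner_lebesgue_lborel(1)) auto
    also have "\<dots> \<le> (LBINT x. (ux t x)\<^sup>2)"
      by (rule integral_mono'[OF ux_square(1)[OF t0]]) (auto simp: indicator_def)
    also have "\<dots> \<le> Ebound T / l\<^sup>2"
      using ux_square(2)[OF t0] divide_right_mono[OF Ebound_mono[OF t0, of T], of "l\<^sup>2"] t by simp
    finally show ?thesis unfolding L2_norm_on_def by (rule real_sqrt_le_mono)
  qed
  have "case_prod ux \<in> borel_measurable lborel" using ux_measurable by (simp add: borel_prod)
  then have m: "case_prod ux \<in> borel_measurable (lebesgue_on ({0..T} \<times> UNIV))"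
    by (intro measurable_restrict_space1 measurable_completion)
  show ?thesis
    unfolding Linf_L2_loc_def
    using m L2 bound by (auto intro!: exI[of _ "sqrt (Ebound T / l\<^sup>2)"])
qed

end

section \<open>Existence of conservative solutions\<close>

lemma locally_integrable_on_diff:
  assumes "f locally_integrable_on S" "h locally_integrable_on S"
  shows "(\<lambda>x. f x - h x) locally_integrable_on S"
  unfolding locally_integrable_on_def
proof (intro allI impI)
  fix K assume "compact K \<and> K \<subseteq> S"
  then have "f absolutely_integrable_on K" "h absolutely_integrable_on K"
    using assms by (auto simp: locally_integrable_on_def)
  then show "(\<lambda>x. f x - h x) absolutely_integrable_on K" by (rule set_integral_diff(1))
qed

lemma has_weak_deriv_diff:
  assumes f: "has_weak_deriv f f'" and h: "has_weak_deriv h h'"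
  shows "has_weak_deriv (\<lambda>x. f x - h x) (\<lambda>x. f' x - h' x)"
proof -
  have l: "f locally_integrable_on UNIV" "f' locally_integrable_on UNIV" "h locally_integrable_on UNIV" "h' locally_integrable_on UNIV"
    using f h by (auto simp: has_weak_deriv_def)
  note lm = l[THEN locally_integrable_on_measurable]
  obtain F F' where F: "ac F F'" "AE x in lebesgue. f x = F x" "AE x in lebesgue. f' x = F' x"
    using has_weak_deriv_imp_ac[OF f] by blast
  obtain H H' where H: "ac H H'" "AE x in lebesgue. h x = H x" "AE x in lebesgue. h' x = H' x"
    using has_weak_deriv_imp_ac[OF h] by blast
  have ac: "ac (\<lambda>x. F x - H x) (\<lambda>x. F' x - H' x)" by (rule ac_diff[OF F(1) H(1)])
  show ?thesis
    unfolding has_weak_deriv_def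
  proof (intro conjI ballI)
    show "(\<lambda>x. f x - h x) locally_integrable_on UNIV" "(\<lambda>x. f' x - h' x) locally_integrable_on UNIV"
      by (intro locally_integrable_on_diff l)+
    fix \<psi> :: "real \<Rightarrow> real" assume \<psi>: "\<psi> \<in> test_functions UNIV"
    note D = test_function_C1[OF \<psi>]
    have m: "\<psi> \<in> borel_measurable borel" "deriv \<psi> \<in> borel_measurable borel"
      using D by (auto intro!: borel_measurable_continuous_onI continuous_at_imp_continuous_on DERIV_isCont)
    have fh: "(\<lambda>x. f x - h x) \<in> borel_measurable lebesgue" "(\<lambda>x. f' x - h' x) \<in> borel_measurable lebesgue"
      using lm by measurable
    have AE: "AE x in lebesgue. f x - h x = F x - H x" "AE x in lebesgue. f' x - h' x = F' x - H' x"
      using F(2) H(2) F(3) H(3) by (eventually_elim; simp)+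
    have "(LINT x|lebesgue. (f x - h x) * deriv \<psi> x) = (LBINT x. (F x - H x) * deriv \<psi> x)"
      by (rule LINT_lebesgue_AE_eq_lborel[OF fh(1) ac_borel[OF ac] m(2) AE(1)])
    also have "\<dots> = (LINT x|lebesgue. (F x - H x) * deriv \<psi> x)"
      using ac_borel[OF ac] m(2) by (intro has_bochner_lebesgue_lborel(1)[symmetric]) simp
    also have "\<dots> = - (LINT x|lebesgue. (F' x - H' x) * \<psi> x)"
      using ac_imp_has_weak_deriv[OF ac] \<psi> by (simp add: has_weak_deriv_def)
    also have "(LINT x|lebesgue. (F' x - H' x) * \<psi> x) = (LBINT x. (F' x - H' x) * \<psi> x)"
      using ac_measurable[OF ac] m(1) by (intro has_bochner_lebesgue_lborel(1)) simp
    also have "\<dots> = (LINT x|lebesgue. (f' x - h' x) * \<psi> x)"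
      by (rule LINT_lebesgue_AE_eq_lborel[OF fh(2) ac_measurable[OF ac] m(1) AE(2), symmetric])
    finally show "(LINT x|lebesgue. (f x - h x) * deriv \<psi> x) = - (LINT x|lebesgue. (f' x - h' x) * \<psi> x)" .
  qed
qed

lemma L2_diff:
  assumes "f \<in> L2" "h \<in> L2"
  shows "(\<lambda>x. f x - h x) \<in> L2"
proof -
  have m [measurable]: "f \<in> borel_measurable lebesgue" "h \<in> borel_measurable lebesgue"
    and i: "integrable lebesgue (\<lambda>x. 2 * (f x)\<^sup>2 + 2 * (h x)\<^sup>2)"
    using assms by (auto simp: L2_def)
  have le: "(f x - h x)\<^sup>2 \<le> 2 * (f x)\<^sup>2 + 2 * (h x)\<^sup>2" for x
    using zero_le_power2[of "f x + h x"] by (simp add: power2_sum power2_diff)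
  have "integrable lebesgue (\<lambda>x. (f x - h x)\<^sup>2)"
    by (rule Bochner_Integration.integrable_bound[OF i]) (use le in auto)
  then show ?thesis by (simp add: L2_def)
qed

lemma L2_AE_cong:
  assumes "f \<in> L2" "h \<in> borel_measurable lebesgue" "AE x in lebesgue. f x = h x"
  shows "h \<in> L2"
proof -
  have [measurable]: "f \<in> borel_measurable lebesgue" using assms(1) by (simp add: L2_def)
  have "integrable lebesgue (\<lambda>x. (h x)\<^sup>2)"
  proof (rule integrable_cong_AE_imp)
    show "integrable lebesgue (\<lambda>x. (f x)\<^sup>2)" using assms(1) by (simp add: L2_def)
    show "AE x in lebesgue. (f x)\<^sup>2 = (h x)\<^sup>2" using assms(3) by eventually_elim simp
  qed (use assms(2) in measurable)
  then show ?thesis using assms(2) by (simp add: L2_def)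
qed

lemma L2_borel_iff: "f \<in> borel_measurable borel \<Longrightarrow> f \<in> L2 \<longleftrightarrow> integrable lborel (\<lambda>x. (f x)\<^sup>2)"
  by (auto simp: L2_def integrable_completion intro: measurable_completion)

lemma H1_dotI:
  assumes "has_weak_deriv f g" "g \<in> L2"
  shows "f \<in> H1_dot"
proof -
  note w = weak_deriv_AE[OF assms(1)]
  have "AE x in lebesgue. g x = weak_deriv f x" using w(1) by eventually_elim simp
  then have "weak_deriv f \<in> L2" by (rule L2_AE_cong[OF assms(2) has_weak_deriv_measurable[OF w(2)]])
  then show ?thesis using assms(1) by (auto simp: H1_dot_def)
qed

lemma LINT_energy_AE_eq:
  fixes f g F G :: "real \<Rightarrow> real"
  assumes m: "f \<in> borel_measurable lebesgue" "g \<in> borel_measurable lebesgue"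
    and b [measurable]: "F \<in> borel_measurable borel" "G \<in> borel_measurable borel"
    and AE: "AE x in lebesgue. f x = F x" "AE x in lebesgue. g x = G x"
  shows "(LINT x|lebesgue. (f x)\<^sup>2 + c * (g x)\<^sup>2) = (LBINT x. (F x)\<^sup>2 + c * (G x)\<^sup>2)"
proof -
  have mb [measurable]: "F \<in> borel_measurable lebesgue" "G \<in> borel_measurable lebesgue"
    using b by (auto intro!: measurable_completion)
  have "(LINT x|lebesgue. (f x)\<^sup>2 + c * (g x)\<^sup>2) = (LINT x|lebesgue. (F x)\<^sup>2 + c * (G x)\<^sup>2)"
  proof (rule integral_cong_AE)
    show "AE x in lebesgue. (f x)\<^sup>2 + c * (g x)\<^sup>2 = (F x)\<^sup>2 + c * (G x)\<^sup>2"
      using AE by eventually_elim simp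
  qed (use m in measurable)
  also have "\<dots> = (LBINT x. (F x)\<^sup>2 + c * (G x)\<^sup>2)"
    by (rule has_bochner_lebesgue_lborel(1)) measurable
  finally show ?thesis .
qed

lemma Lip_L2_loc_AE_cong:
  assumes u: "u \<in> Lip_L2_loc T" and m: "\<And>t. t \<in> {0..T} \<Longrightarrow> v t \<in> borel_measurable lebesgue"
    and AE: "\<And>t. t \<in> {0..T} \<Longrightarrow> AE x in lebesgue. v t x = u t x"
  shows "v \<in> Lip_L2_loc T"
proof -
  have um: "u t \<in> borel_measurable lebesgue" if "t \<in> {0..T}" for t
    using u that by (auto simp: Lip_L2_loc_def L2_loc_def)
  have "v t \<in> L2_loc" if t: "t \<in> {0..T}" for t
  proof -
    have "(\<lambda>x. (v t x)\<^sup>2) absolutely_integrable_on K" if K: "compact K" for K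
    proof -
      have Kb [measurable]: "K \<in> sets lebesgue" using K by (intro sets_completionI_sets) (simp add: borel_compact)
      have "(\<lambda>x. (u t x)\<^sup>2) absolutely_integrable_on K"
        using u t K by (auto simp: Lip_L2_loc_def L2_loc_def locally_integrable_on_def)
      then show ?thesis
        unfolding set_integrable_def
      proof (rule integrable_cong_AE_imp)
        show "(\<lambda>x. indicator K x *\<^sub>R (v t x)\<^sup>2) \<in> borel_measurable lebesgue" using m[OF t] by measurable
        show "AE x in lebesgue. indicator K x *\<^sub>R (u t x)\<^sup>2 = indicator K x *\<^sub>R (v t x)\<^sup>2"
          using AE[OF t] by eventually_elim simp
      qed
    qed
    then show ?thesis using m[OF t] by (simp add: L2_loc_def locally_integrable_on_def)
  qed
  moreover have "L2_norm_on K (\<lambda>x. v t x - v s x) = L2_norm_on K (\<lambda>x. u t x - u s x)"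
    if K: "compact K" and s: "s \<in> {0..T}" and t: "t \<in> {0..T}" for K s t
  proof -
    have Kb [measurable]: "K \<in> sets lebesgue" using K by (intro sets_completionI_sets) (simp add: borel_compact)
    note [measurable] = m[OF s] m[OF t] um[OF s] um[OF t]
    have "(LINT x:K|lebesgue. (v t x - v s x)\<^sup>2) = (LINT x:K|lebesgue. (u t x - u s x)\<^sup>2)"
      unfolding set_lebesgue_integral_def
    proof (rule integral_cong_AE)
      show "AE x in lebesgue. indicator K x *\<^sub>R (v t x - v s x)\<^sup>2 = indicator K x *\<^sub>R (u t x - u s x)\<^sup>2"
        using AE[OF s] AE[OF t] by eventually_elim simp
    qed measurable
    then show ?thesis by (simp add: L2_norm_on_def)
  qed
  ultimately show ?thesis using u by (auto simp: Lip_L2_loc_def)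
qed

lemma weak_balance_law_cong:
  assumes w: "weak_balance_law A B C"
    and eq: "\<And>t. t > 0 \<Longrightarrow> A t = A' t" "\<And>t. t > 0 \<Longrightarrow> B t = B' t" "\<And>t. t > 0 \<Longrightarrow> C t = C' t"
  shows "weak_balance_law A' B' C'"
proof -
  have li: "(\<lambda>(t, x). f' t x) locally_integrable_on ({0<..} \<times> UNIV)"
    if f: "(\<lambda>(t, x). f t x) locally_integrable_on ({0<..} \<times> UNIV)" and eq: "\<And>t. t > 0 \<Longrightarrow> f t = f' t"
    for f f' :: "real \<Rightarrow> real \<Rightarrow> real"
    unfolding locally_integrable_on_def
  proof (intro allI impI)
    fix K :: "(real \<times> real) set" assume K: "compact K \<and> K \<subseteq> {0<..} \<times> UNIV"
    have "(\<lambda>z. indicator K z *\<^sub>R (case z of (t, x) \<Rightarrow> f t x)) = (\<lambda>z. indicator K z *\<^sub>R (case z of (t, x) \<Rightarrow> f' t x))"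
    proof
      fix z
      show "indicator K z *\<^sub>R (case z of (t, x) \<Rightarrow> f t x) = indicator K z *\<^sub>R (case z of (t, x) \<Rightarrow> f' t x)"
        using K eq[of "fst z"] by (cases "z \<in> K"; cases z) auto
    qed
    moreover have "(\<lambda>(t, x). f t x) absolutely_integrable_on K"
      using f K by (simp add: locally_integrable_on_def)
    ultimately show "(\<lambda>(t, x). f' t x) absolutely_integrable_on K"
      by (simp only: set_integrable_def)
  qed
  note w = w[unfolded weak_balance_law_def]
  show ?thesis
    unfolding weak_balance_law_def
  proof (intro conjI ballI)
    show "(\<lambda>(t, x). A' t x) locally_integrable_on ({0<..} \<times> UNIV)" by (rule li[OF _ eq(1)]) (use w in blast)
    show "(\<lambda>(t, x). B' t x) locally_integrable_on ({0<..} \<times> UNIV)" by (rule li[OF _ eq(2)]) (use w in blast)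
    show "(\<lambda>(t, x). C' t x) locally_integrable_on ({0<..} \<times> UNIV)" by (rule li[OF _ eq(3)]) (use w in blast)
    fix \<psi> :: "real \<times> real \<Rightarrow> real" assume \<psi>: "\<psi> \<in> test_functions ({0<..} \<times> UNIV)"
    obtain \<psi>t \<psi>x T X where d: "test_data (\<lambda>t x. \<psi> (t, x)) \<psi>t \<psi>x T X"
      and dt: "\<And>t x. deriv (\<lambda>s. \<psi> (s, x)) t = \<psi>t t x" and dx: "\<And>t x. deriv (\<lambda>z. \<psi> (t, z)) x = \<psi>x t x"
      by (rule test_function_data[OF \<psi>]) (rule that)
    have "A' t x * deriv (\<lambda>s. \<psi> (s, x)) t - B' t x * \<psi> (t, x) + C' t x * deriv (\<lambda>y. \<psi> (t, y)) x
        = A t x * deriv (\<lambda>s. \<psi> (s, x)) t - B t x * \<psi> (t, x) + C t x * deriv (\<lambda>y. \<psi> (t, y)) x" for t x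
    proof (cases "t > 0")
      case False
      then have "\<psi> (t, x) = 0 \<and> \<psi>t t x = 0 \<and> \<psi>x t x = 0" using d unfolding test_data_def by auto
      then show ?thesis by (simp add: dt dx)
    qed (simp add: eq)
    then show "(LINT (t, x)|lebesgue. A' t x * deriv (\<lambda>s. \<psi> (s, x)) t - B' t x * \<psi> (t, x) + C' t x * deriv (\<lambda>y. \<psi> (t, y)) x) = 0"
      using w \<psi> by simp
  qed
qed

text \<open>The moving average of the datum is a \<open>C\<^sup>1\<close> profile with the same behaviour at infinity; it replaces
  the given \<open>\<phi>\<close>, which is only Lipschitz.\<close>

lemma moving_average_profile:
  assumes l: "l > 0" and v0: "ac v0 g" and m: "\<And>x. \<bar>v0 x\<bar> \<le> m" and g2: "integrable lborel (\<lambda>x. (g x)\<^sup>2)"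
  defines "\<phi> \<equiv> \<lambda>x. sint v0 (x + 1) - sint v0 x"
  shows "profile l g v0 m \<phi> (\<lambda>x. v0 (x + 1) - v0 x) (\<lambda>x. LBINT s:{x+0..x+1}. (g s)\<^sup>2) (2 * m) m"
proof -
  \<comment> \<open>By Cauchy-Schwarz on a window of length 1, \<gamma> dominates the squares of
    \<open>v0 - \<phi>\<close> and of the derivative of \<phi>, and its integral is that of
    \<open>g^2\<close>. The constants \<open>2 * m\<close> and \<open>m\<close> bound the derivative
    \<open>v0 (x + 1) - v0 x\<close> and the factor \<phi> of the cross term.\<close>
  define \<gamma> where "\<gamma> x = (LBINT s:{x+0..x+1}. (g s)\<^sup>2)" for x
  have gm [measurable]: "g \<in> borel_measurable borel" by (rule ac_measurable[OF v0])
  have cv: "continuous_on UNIV v0" by (rule ac_continuous[OF v0])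
  have bv [measurable]: "v0 \<in> borel_measurable borel" by (rule ac_borel[OF v0])
  have iv: "set_integrable lborel {a..b} v0" for a b
    by (rule set_integrable_bounded_Icc[OF bv]) (use m in auto)
  have ig: "set_integrable lborel {a..b} (\<lambda>s. (g s)\<^sup>2)" for a b
    unfolding set_integrable_def by (rule Bochner_Integration.integrable_bound[OF g2]) (auto simp: indicator_def)
  have ig1: "set_integrable lborel {a..b} (\<lambda>s. \<bar>g s\<bar>)" for a b
    using set_integrable_abs[OF ac_set_integrable[OF v0]] .
  have ic: "set_integrable lborel {a..b} (\<lambda>s::real. c)" for a b c :: real
    by (rule borel_integrable_atLeastAtMost') simp
  have c1: "(LBINT s:{x..x+1}. c) = c" for x c :: real by (simp add: set_lebesgue_integral_def)
  define I where "I x = (LBINT s:{x..x+1}. \<bar>g s\<bar>)" for x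
  have I2: "(I x)\<^sup>2 \<le> \<gamma> x" for x
    unfolding I_def \<gamma>_def using square_integral_le[of g x "x + 1"] ig by simp
  have dv: "\<bar>v0 s - v0 x\<bar> \<le> I x" if "s \<in> {x..x+1}" for s x
  proof -
    have "\<bar>LBINT z:{x..s}. g z\<bar> \<le> (LBINT z:{x..x+1}. \<bar>g z\<bar>)"
      unfolding set_lebesgue_integral_def
      by (rule LINT_abs_le) (use that ig1[of x "x + 1"] in \<open>auto simp: set_integrable_def indicator_def\<close>)
    then show ?thesis using ac_integral[OF v0, of x s] that by (simp add: I_def)
  qed
  have \<phi>: "\<phi> x = (LBINT s:{x..x+1}. v0 s)" for x
    unfolding \<phi>_def using sint_diff[OF iv, of x "x + 1"] by simp
  have d\<phi>: "(\<phi> has_real_derivative v0 (x + 1) - v0 x) (at x)" for x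
  proof -
    note D = ac_has_real_derivative[OF ac_sint[OF bv iv] cv]
    have "((\<lambda>x. sint v0 (x + 1)) has_real_derivative v0 (x + 1)) (at x)"
      using DERIV_shift[of "sint v0" "v0 (x + 1)" x 1] D[of "x + 1"] by simp
    then show ?thesis unfolding \<phi>_def using D by (auto intro!: derivative_eq_intros)
  qed
  have \<phi>m: "\<bar>\<phi> x\<bar> \<le> m" for x
  proof -
    have "\<bar>\<phi> x\<bar> \<le> (LBINT s:{x..x+1}. m)"
      unfolding \<phi> set_lebesgue_integral_def
      by (rule LINT_abs_le) (use m ic[of x "x + 1" m] in \<open>auto simp: set_integrable_def indicator_def\<close>)
    then show ?thesis by (simp add: c1)
  qed
  have vm: "\<phi> \<in> borel_measurable borel"
    using d\<phi> by (auto intro!: borel_measurable_continuous_onI continuous_at_imp_continuous_on DERIV_isCont)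
  note win = window_integral[OF g2, of 0 1, folded \<gamma>_def]
  have \<gamma>0: "\<gamma> x \<ge> 0" for x using I2[of x] zero_le_power2[of "I x"] by linarith
  have m0: "m \<ge> 0" using m[of 0] by linarith
  have "profile l g v0 m \<phi> (\<lambda>x. v0 (x + 1) - v0 x) \<gamma> (2 * m) m"
  proof (unfold_locales; (rule l gm g2 v0 m d\<phi> \<phi>m m0 \<gamma>0)?)
    show "continuous_on UNIV (\<lambda>x. v0 (x + 1) - v0 x)"
      by (intro continuous_intros continuous_on_compose2[OF cv]) auto
    show "\<bar>v0 (x + 1) - v0 x\<bar> \<le> 2 * m" for x using m[of x] m[of "x + 1"] by linarith
    show "integrable lborel \<gamma>" using win(1) by simp
    then show "\<gamma> \<in> borel_measurable borel" by auto
    show "2 * \<bar>v * \<phi> x * (v0 (x + 1) - v0 x)\<bar> \<le> m * (v\<^sup>2 + \<gamma> x)" for x v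
    proof -
      define q where "q = \<bar>v0 (x + 1) - v0 x\<bar>"
      have "q \<le> I x" using dv[of "x + 1" x] by (simp add: q_def)
      then have "q\<^sup>2 \<le> (I x)\<^sup>2" by (intro power_mono) (auto simp: q_def)
      then have q2: "q\<^sup>2 \<le> \<gamma> x" using I2[of x] by linarith
      have "2 * (\<bar>v\<bar> * q) \<le> v\<^sup>2 + q\<^sup>2" using zero_le_power2[of "\<bar>v\<bar> - q"] by (simp add: power2_diff)
      then have vq: "2 * (\<bar>v\<bar> * q) \<le> v\<^sup>2 + \<gamma> x" using q2 by linarith
      have "2 * \<bar>v * \<phi> x * (v0 (x + 1) - v0 x)\<bar> = \<bar>\<phi> x\<bar> * (2 * (\<bar>v\<bar> * q))" by (simp add: abs_mult q_def)
      also have "\<dots> \<le> m * (v\<^sup>2 + \<gamma> x)"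
        using \<phi>m[of x] vq m0 by (intro mult_mono) (auto simp: q_def)
      finally show ?thesis .
    qed
    have "(v0 x - \<phi> x)\<^sup>2 \<le> \<gamma> x" for x
    proof -
      have "v0 x - \<phi> x = (LBINT s:{x..x+1}. v0 x - v0 s)"
        using set_integral_diff(2)[OF ic[of x "x + 1" "v0 x"] iv[of x "x + 1"]] by (simp add: c1 \<phi>)
      also have "\<bar>\<dots>\<bar> \<le> (LBINT s:{x..x+1}. I x)"
        unfolding set_lebesgue_integral_def
        by (rule LINT_abs_le) (use dv ic[of x "x + 1" "I x"] in \<open>auto simp: set_integrable_def indicator_def abs_minus_commute\<close>)
      finally have "\<bar>v0 x - \<phi> x\<bar>\<^sup>2 \<le> (I x)\<^sup>2" by (intro power_mono) (auto simp: c1)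
      then show ?thesis using I2[of x] by simp
    qed
    then show "integrable lborel (\<lambda>x. (v0 x - \<phi> x)\<^sup>2)"
      using vm by (intro Bochner_Integration.integrable_bound[OF \<open>integrable lborel \<gamma>\<close>]) (auto intro: order_trans[OF _ abs_ge_self])
  qed
  then show ?thesis by (simp add: \<gamma>_def[abs_def])
qed

text \<open>A bound that holds almost everywhere for a continuous function holds on a closed set of
  full measure, hence everywhere.\<close>

lemma Linf_ac_bounded:
  assumes "f \<in> Linf" "ac F g" "AE x in lebesgue. f x = F x"
  obtains m where "\<And>x. \<bar>F x\<bar> \<le> m"
proof -
  have "esssup lebesgue (\<lambda>x. ereal \<bar>f x\<bar>) < \<infinity>" using assms(1) by (simp add: Linf_def)
  then obtain m where m: "esssup lebesgue (\<lambda>x. ereal \<bar>f x\<bar>) \<le> ereal m"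
    by (cases "esssup lebesgue (\<lambda>x. ereal \<bar>f x\<bar>)") auto
  have "AE x in lebesgue. x \<in> {x. \<bar>F x\<bar> \<le> m}"
    using esssup_AE[of "\<lambda>x. ereal \<bar>f x\<bar>" lebesgue] assms(3)
  proof eventually_elim
    case (elim x)
    have "ereal \<bar>f x\<bar> \<le> ereal m" by (rule order_trans[OF elim(1) m])
    then show ?case using elim(2) by simp
  qed
  moreover have "closed {x. \<bar>F x\<bar> \<le> m}"
    by (intro closed_Collect_le continuous_on_rabs ac_continuous[OF assms(2)] continuous_on_const)
  ultimately have "x \<in> {x. \<bar>F x\<bar> \<le> m}" for x
    by (intro mem_closed_if_AE_lebesgue)
  then show ?thesis by (intro that[of m]) simp
qed

theorem theorem4p3:
  fixes l :: real and u0 \<phi> :: "real \<Rightarrow> real"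
  assumes "l > 0"
    and "u0 \<in> H1_dot \<inter> Linf"
    and "\<exists>L. L-lipschitz_on UNIV \<phi>"
    and "integrable lebesgue (weak_deriv \<phi>)"
    and "(\<lambda>x. u0 x - \<phi> x) \<in> H1"
  shows "\<exists>u :: real \<Rightarrow> real \<Rightarrow> real.
    conservative_solution l u0 u \<and>
    (\<forall>t>0. (\<lambda>x. u t x - \<phi> x) \<in> H1) \<and>
    (\<forall>T>0.
       ((\<lambda>t. essinf lebesgue (\<lambda>x. ereal (weak_deriv (u t) x))) \<longlongrightarrow> - \<infinity>) (at_left T) \<longrightarrow>
       ((\<lambda>t. esssup lebesgue (\<lambda>x. ereal (weak_deriv (u t) x))) \<longlongrightarrow> \<infinity>) (at_right T)) \<and>
    (u0 \<in> H1 \<longrightarrow>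
       (AE t in lebesgue. t > 0 \<longrightarrow>
          (LINT x|lebesgue. (u t x)\<^sup>2 + l\<^sup>2 * (weak_deriv (u t) x)\<^sup>2) =
          (LINT x|lebesgue. (u0 x)\<^sup>2 + l\<^sup>2 * (weak_deriv u0 x)\<^sup>2)))"
proof -
  have u0w: "has_weak_deriv u0 (weak_deriv u0)" and u0d: "weak_deriv u0 \<in> L2"
    using assms(2) weak_deriv_AE(2) by (auto simp: H1_dot_def)
  have u0m: "u0 \<in> borel_measurable lebesgue" using assms(2) by (auto simp: Linf_def)
  obtain v0 g where v0: "ac v0 g" and AEv: "AE x in lebesgue. u0 x = v0 x" and AEg: "AE x in lebesgue. weak_deriv u0 x = g x"
    using has_weak_deriv_imp_ac[OF u0w] by blast
  obtain m where m: "\<And>x. \<bar>v0 x\<bar> \<le> m" using Linf_ac_bounded[OF _ v0 AEv] assms(2) by blast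
  have gb: "g \<in> borel_measurable borel" and vb: "v0 \<in> borel_measurable borel"
    using ac_measurable[OF v0] ac_borel[OF v0] by auto
  have "g \<in> L2" by (rule L2_AE_cong[OF u0d measurable_completion AEg]) (use gb in simp)
  then have g2: "integrable lborel (\<lambda>x. (g x)\<^sup>2)" using L2_borel_iff[OF gb] by simp
  define \<phi>0 where "\<phi>0 x = sint v0 (x + 1) - sint v0 x" for x
  interpret profile l g v0 m \<phi>0 "\<lambda>x. v0 (x + 1) - v0 x" "\<lambda>x. LBINT s:{x+0..x+1}. (g s)\<^sup>2" "2 * m" m
    unfolding \<phi>0_def[abs_def] by (rule moving_average_profile[OF assms(1) v0 m g2])
  obtain p r where "\<And>T. T \<ge> 0 \<Longrightarrow> \<exists>R D. flow l g v0 p r m T R D" using global_flow by blast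
  then interpret lagrangian l g v0 m \<phi>0 "\<lambda>x. v0 (x + 1) - v0 x" "\<lambda>x. LBINT s:{x+0..x+1}. (g s)\<^sup>2" "2 * m" m p r
    by unfold_locales
  \<comment> \<open>\<open>u 0\<close> is the continuous representative \<open>v0\<close>, whereas
    \<open>conservative_solution\<close> demands \<open>u0\<close> as a function. The change at time
    0 is on a null set of positions, which the L2 seminorms ignore, and the balance laws live on
    \<open>t > 0\<close>.\<close>
  define v where "v t = (if t = 0 then u0 else u t)" for t
  have v: "v t = u t" if "t > 0" for t using that by (simp add: v_def)
  have u_0: "u 0 x = v0 x" for x
  proof -
    obtain R D where "flow l g v0 p r m 0 R D" using flows[of 0] by auto
    then interpret F: flow l g v0 p r m 0 R D .
    show ?thesis using u_y[of 0 x] by simp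
  qed
  have v_AE: "AE x in lebesgue. v t x = u t x" for t
    using AEv by eventually_elim (simp add: v_def u_0)
  have u_lebesgue: "u t \<in> borel_measurable lebesgue" for t
    by (intro measurable_completion) simp
  have "u \<in> Lip_L2_loc T" if "T > 0" for T
    using u_L2_loc L2_Lipschitz that by (auto simp: Lip_L2_loc_def)
  then have Lip: "v \<in> Lip_L2_loc T" if "T > 0" for T
    by (rule Lip_L2_loc_AE_cong) (use that u0m u_lebesgue v_AE in \<open>auto simp: v_def\<close>)
  have sol: "conservative_solution l u0 v"
    unfolding conservative_solution_def
  proof (intro conjI exI[of _ ux] allI impI)
    show "v 0 = u0" by (simp add: v_def)
    show "AE t in lebesgue. t > 0 \<longrightarrow> has_weak_deriv (v t) (ux t)"
      using weak_deriv_u v by (intro AE_I2) auto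
    show "AE t in lebesgue. t > 0 \<longrightarrow> (\<forall>x. conv_integrable (\<GG> l) (\<lambda>y. 1/2 * (ux t y)\<^sup>2) x)"
      using conv_integrable_ux by (intro AE_I2) auto
    show "weak_balance_law v (\<lambda>t x. v t x * ux t x) (\<lambda>t x. l\<^sup>2 * burgers_P l ux t x)"
      by (rule weak_balance_law_cong[OF momentum_balance]) (simp_all add: v)
    show "weak_balance_law (\<lambda>t x. 1/2 * (v t x)\<^sup>2 + 1/2 * l\<^sup>2 * (ux t x)\<^sup>2) (\<lambda>t x. 0)
        (\<lambda>t x. 1/3 * (v t x)^3 + l\<^sup>2 * v t x * burgers_P l ux t x + 1/2 * l\<^sup>2 * v t x * (ux t x)\<^sup>2)"
      by (rule weak_balance_law_cong[OF energy_balance]) (simp_all add: v)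
  qed (auto intro: Lip ux_Linf_L2_loc)
  have H1: "(\<lambda>x. v t x - \<phi> x) \<in> H1" if t: "t > 0" for t
  proof -
    have d: "has_weak_deriv (\<lambda>x. u0 x - \<phi> x) (weak_deriv (\<lambda>x. u0 x - \<phi> x))" "weak_deriv (\<lambda>x. u0 x - \<phi> x) \<in> L2"
      and L: "(\<lambda>x. u0 x - \<phi> x) \<in> L2"
      using assms(5) weak_deriv_AE(2) by (auto simp: H1_def H1_dot_def)
    have \<phi>0b: "\<phi>0 \<in> borel_measurable borel"
      using \<phi>_derivative by (auto intro!: borel_measurable_continuous_onI continuous_at_imp_continuous_on DERIV_isCont)
    have ub: "u t \<in> borel_measurable borel" "ux t \<in> borel_measurable borel" by measurable
    have "(\<lambda>x. u t x - \<phi>0 x) \<in> L2" "(\<lambda>x. v0 x - \<phi>0 x) \<in> L2" "ux t \<in> L2"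
      using u_minus_\<phi>[of t] v0_\<phi> ux_square(1)[of t] t \<phi>0b ub vb by (auto simp: L2_borel_iff)
    note L2 = this
    have \<phi>m: "\<phi> \<in> borel_measurable lebesgue"
    proof -
      have "(\<lambda>x. u0 x - (u0 x - \<phi> x)) \<in> borel_measurable lebesgue"
        by (rule borel_measurable_diff[OF u0m]) (use L in \<open>simp add: L2_def\<close>)
      then show ?thesis by simp
    qed
    have "(\<lambda>x. \<phi> x - u0 x) \<in> L2" using L \<phi>m u0m by (auto simp: L2_def power2_commute)
    \<comment> \<open>\<open>u t - \<phi>\<close> is
      \<open>(u t - \<phi>0) - (v0 - \<phi>0) - (\<phi> - u0)\<close> almost everywhere, so the
      auxiliary profile disappears from the conclusion.\<close>
    note L2_diff[OF L2_diff[OF L2(1,2)] this]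
    then have "(\<lambda>x. u t x - \<phi> x) \<in> L2"
    proof (rule L2_AE_cong)
      show "(\<lambda>x. u t x - \<phi> x) \<in> borel_measurable lebesgue" using u_lebesgue[of t] \<phi>m by measurable
      show "AE x in lebesgue. (u t x - \<phi>0 x) - (v0 x - \<phi>0 x) - (\<phi> x - u0 x) = u t x - \<phi> x"
        using AEv by eventually_elim simp
    qed
    \<comment> \<open>\<open>\<phi>\<close> is written as \<open>u0 - (u0 - \<phi>)\<close>, a
      difference of two functions with square integrable weak derivatives.\<close>
    moreover have "has_weak_deriv (\<lambda>x. u t x - (u0 x - (u0 x - \<phi> x)))
        (\<lambda>x. ux t x - (weak_deriv u0 x - weak_deriv (\<lambda>x. u0 x - \<phi> x) x))"
      using t by (intro has_weak_deriv_diff weak_deriv_u u0w d) simp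
    then have "(\<lambda>x. u t x - \<phi> x) \<in> H1_dot"
      by (intro H1_dotI[where g="\<lambda>x. ux t x - (weak_deriv u0 x - weak_deriv (\<lambda>x. u0 x - \<phi> x) x)"] L2_diff L2 u0d d) simp
    ultimately show ?thesis using t by (simp add: H1_def v)
  qed
  have break: "((\<lambda>t. esssup lebesgue (\<lambda>x. ereal (weak_deriv (v t) x))) \<longlongrightarrow> \<infinity>) (at_right T)"
    if T: "T > 0" and lim: "((\<lambda>t. essinf lebesgue (\<lambda>x. ereal (weak_deriv (v t) x))) \<longlongrightarrow> - \<infinity>) (at_left T)" for T
  proof -
    have "\<forall>\<^sub>F t in at_left T. v t = u t"
      using eventually_at_left_real[OF T] by eventually_elim (simp add: v)
    then have "((\<lambda>t. essinf lebesgue (\<lambda>x. ereal (weak_deriv (u t) x))) \<longlongrightarrow> - \<infinity>) (at_left T)"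
      by (intro Lim_transform_eventually[OF lim]) (auto elim!: eventually_mono)
    note lim' = breaking[OF T this]
    have "\<forall>\<^sub>F t in at_right T. v t = u t"
      using eventually_at_right_less[of T] by eventually_elim (use T in \<open>simp add: v\<close>)
    then show ?thesis by (intro Lim_transform_eventually[OF lim']) (auto elim!: eventually_mono)
  qed
  have energy: "AE t in lebesgue. t > 0 \<longrightarrow>
      (LINT x|lebesgue. (v t x)\<^sup>2 + l\<^sup>2 * (weak_deriv (v t) x)\<^sup>2) =
      (LINT x|lebesgue. (u0 x)\<^sup>2 + l\<^sup>2 * (weak_deriv u0 x)\<^sup>2)" if "u0 \<in> H1"
  proof -
    have "v0 \<in> L2" using that by (intro L2_AE_cong[OF _ measurable_completion AEv]) (use vb in \<open>auto simp: H1_def\<close>)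
    then have "AE t in lborel. t \<ge> 0 \<longrightarrow> (LBINT x. (u t x)\<^sup>2 + l\<^sup>2 * (ux t x)\<^sup>2) = (LBINT \<xi>. (v0 \<xi>)\<^sup>2 + l\<^sup>2 * (g \<xi>)\<^sup>2)"
      using L2_borel_iff[OF vb] by (intro energy_equality) simp
    then have "AE t in lebesgue. t \<ge> 0 \<longrightarrow> (LBINT x. (u t x)\<^sup>2 + l\<^sup>2 * (ux t x)\<^sup>2) = (LBINT \<xi>. (v0 \<xi>)\<^sup>2 + l\<^sup>2 * (g \<xi>)\<^sup>2)"
      by (rule AE_completion)
    moreover have "(LINT x|lebesgue. (u0 x)\<^sup>2 + l\<^sup>2 * (weak_deriv u0 x)\<^sup>2) = (LBINT \<xi>. (v0 \<xi>)\<^sup>2 + l\<^sup>2 * (g \<xi>)\<^sup>2)"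
      by (rule LINT_energy_AE_eq[OF u0m has_weak_deriv_measurable[OF u0w] vb gb AEv AEg])
    moreover have "(LINT x|lebesgue. (v t x)\<^sup>2 + l\<^sup>2 * (weak_deriv (v t) x)\<^sup>2) = (LBINT x. (u t x)\<^sup>2 + l\<^sup>2 * (ux t x)\<^sup>2)"
      if "t > 0" for t
    proof -
      note w = weak_deriv_AE[OF weak_deriv_u[of t]]
      show ?thesis unfolding v[OF that]
        by (rule LINT_energy_AE_eq) (use that w has_weak_deriv_measurable[OF w(2)] u_lebesgue in auto)
    qed
    ultimately show ?thesis by (auto elim!: eventually_mono)
  qed
  show ?thesis by (intro exI[of _ v] conjI allI impI sol H1 break energy)
qed

end
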